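(* The algebras $(a,b)$ (over any commutative ring $R$ of characteristic $p$, with $a,b\in R$) and $(a,b)_\rho$ (over $R=\mathbb Z[\rho][a,b](1/(1+ab\eta^p))$) are almost cyclic with respect to $R[xy]/R$, and hence are Azumaya over $R$.
   Context: $p$ is a prime, $\rho$ a primitive $p$-th root of one ($\rho=-1$ if $p=2$), $\eta=\rho-1$. The algebra $(a,b)$: for $R$ commutative with $pR=0$ and $a,b\in R$, $(a,b)$ is the $R$-algebra generated by $x,y$ subject to $x^p=a$, $y^p=b$, $xy-yx=1$. The algebra $(a,b)_\rho$: let $R=\mathbb Z[\rho][a,b](1/(1+ab\eta^p))$ be the localized polynomial ring in two variables $a,b$, with fraction field $F$. Let $B/F$ be the symbol algebra generated by $\beta,x$ with $x^p=a$, $\beta^p=1+ab\eta^p$, $x\beta=\rho\beta x$. Put $\alpha=(\beta-1)/\eta$ and $y=x^{-1}\alpha$, so $y^p=b$, $xy=\alpha$ and $xy-\rho yx=1$. Then $(a,b)_\rho\subset B$ is the $R$-submodule spanned by $\{x^iy^j: 0\le i,j\le p-1\}$, which is a subalgebra. In both cases $R[xy]$ is a cyclic Galois extension of $R$ of degree $p$, with generator $\sigma(xy)=xy+1$, respectively $\sigma(xy)=\rho\,xy+1$. Almost cyclic algebras: let $S/R$ be a cyclic Galois extension of commutative rings of degree $n$ with group $G=\langle\sigma\rangle$. Let $J\in\operatorname{Pic}(S)$, identified with an invertible ideal of $S$. Let $S[t,\sigma]$ be the twisted polynomial ring with $ts=\sigma(s)t$ and let $T=S\oplus Jt\oplus(Jt)^2\oplus\cdots\subset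 S[t,\sigma]$, where $(Jt)^m=J\sigma(J)\cdots\sigma^{m-1}(J)t^m$. Assume the norm $(J\otimes\sigma(J)\otimes\cdots\otimes\sigma^{n-1}(J))^G\in\operatorname{Pic}(R)$ is trivial, so that there is a $G$-preserving $S$-module isomorphism $\phi:(Jt)^n\cong S$. Then $\Delta(S/R,\sigma,J,\phi)=T/I$ where $I$ is the ideal generated by all $z-\phi(z)$, $z\in(Jt)^n$. An algebra isomorphic to some $\Delta(S/R,\sigma,J,\phi)$ (compatibly with the inclusion of $S$) is called almost cyclic with respect to $S/R$.
   Formalization: In "almost cyclic", J in Pic(S) is an invertible S-submodule of a commutative overring of S to which the action of σ extends, and T is formed over that overring; J need not be an ideal of S, since for some R of characteristic p the only invertible ideal is S itself and the claim would fail. *)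

theory Defs
  imports
    "HOL-Algebra.QuotRing"
    "HOL-Algebra.Ideal_Product"
    "HOL-Algebra.Generated_Rings"
    "HOL-Algebra.Generated_Groups"
    "HOL-Algebra.Free_Abelian_Groups"
    "HOL-Algebra.Module"
    "HOL-Algebra.Algebraic_Closure_Type"
begin

section \<open>Algebras over a commutative ring\<close>

text \<open>
  A (not necessarily commutative) algebra is given by its structure map
  \<open>\<iota>\<close> from \<open>R\<close> into the centre of \<open>A\<close>. The locale \<open>algebra\<close> of HOL-Algebra is
  restricted to commutative algebras.
\<close>

locale assoc_algebra = R?: cring R + A?: ring A
  for R :: "('r, 'm) ring_scheme" (structure) and \<iota> :: "'r \<Rightarrow> 'a"
    and A :: "('a, 'n) ring_scheme" (structure) +
  assumes struct_hom: "\<iota> \<in> ring_hom R A"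
    and struct_central:
      "\<lbrakk>r \<in> carrier R; z \<in> carrier A\<rbrakk> \<Longrightarrow> \<iota> r \<otimes>\<^bsub>A\<^esub> z = z \<otimes>\<^bsub>A\<^esub> \<iota> r"

definition adjoin :: "('r, 'm) ring_scheme \<Rightarrow> ('r \<Rightarrow> 'a) \<Rightarrow> ('a, 'n) ring_scheme \<Rightarrow> 'a \<Rightarrow> 'a set"
  where "adjoin R \<iota> A u = generate_ring A (insert u (\<iota> ` carrier R))"


section \<open>Algebras given by generators and relations\<close>

text \<open>
  The free \<open>R\<close>-algebra on the type \<open>'g\<close>: finitely supported \<open>R\<close>-valued functions
  on words, with the convolution product.
\<close>

definition free_algebra :: "('r, 'm) ring_scheme \<Rightarrow> ('g list \<Rightarrow> 'r) ring" where
  "free_algebra R =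
    \<lparr>carrier = {f. (\<forall>w. f w \<in> carrier R) \<and> finite {w. f w \<noteq> \<zero>\<^bsub>R\<^esub>}},
     monoid.mult = (\<lambda>f g w. finsum R (\<lambda>k. f (take k w) \<otimes>\<^bsub>R\<^esub> g (drop k w)) {..length w}),
     monoid.one = (\<lambda>w. if w = [] then \<one>\<^bsub>R\<^esub> else \<zero>\<^bsub>R\<^esub>),
     ring.zero = (\<lambda>w. \<zero>\<^bsub>R\<^esub>),
     ring.add = (\<lambda>f g w. f w \<oplus>\<^bsub>R\<^esub> g w)\<rparr>"

definition free_const :: "('r, 'm) ring_scheme \<Rightarrow> 'r \<Rightarrow> 'g list \<Rightarrow> 'r" where
  "free_const R r = (\<lambda>w. if w = [] then r else \<zero>\<^bsub>R\<^esub>)"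

definition free_gen :: "('r, 'm) ring_scheme \<Rightarrow> 'g \<Rightarrow> 'g list \<Rightarrow> 'r" where
  "free_gen R g = (\<lambda>w. if w = [g] then \<one>\<^bsub>R\<^esub> else \<zero>\<^bsub>R\<^esub>)"

text \<open>A set \<open>rels\<close> of elements of the free algebra stands for the relations \<open>f = 0\<close>, \<open>f \<in> rels\<close>.\<close>

definition presented_algebra ::
    "('r, 'm) ring_scheme \<Rightarrow> ('g list \<Rightarrow> 'r) set \<Rightarrow> ('g list \<Rightarrow> 'r) set ring" where
  "presented_algebra R rels = free_algebra R Quot genideal (free_algebra R) rels"

definition presented_class ::
    "('r, 'm) ring_scheme \<Rightarrow> ('g list \<Rightarrow> 'r) set \<Rightarrow> ('g list \<Rightarrow> 'r) \<Rightarrow> ('g list \<Rightarrow> 'r) set" where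
  "presented_class R rels f = genideal (free_algebra R) rels +>\<^bsub>free_algebra R\<^esub> f"

datatype two_gens = Gen1 | Gen2


section \<open>The algebra \<open>(a,b)\<close>\<close>

definition ab_relations ::
    "nat \<Rightarrow> ('r, 'm) ring_scheme \<Rightarrow> 'r \<Rightarrow> 'r \<Rightarrow> (two_gens list \<Rightarrow> 'r) set" where
  "ab_relations p R a b =
    (let P = free_algebra R; x = free_gen R Gen1; y = free_gen R Gen2 in
      {x [^]\<^bsub>P\<^esub> p \<ominus>\<^bsub>P\<^esub> free_const R a,
       y [^]\<^bsub>P\<^esub> p \<ominus>\<^bsub>P\<^esub> free_const R b,
       (x \<otimes>\<^bsub>P\<^esub> y \<ominus>\<^bsub>P\<^esub> y \<otimes>\<^bsub>P\<^esub> x) \<ominus>\<^bsub>P\<^esub> \<one>\<^bsub>P\<^esub>})"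

definition ab_algebra ::
    "nat \<Rightarrow> ('r, 'm) ring_scheme \<Rightarrow> 'r \<Rightarrow> 'r \<Rightarrow> (two_gens list \<Rightarrow> 'r) set ring" where
  "ab_algebra p R a b = presented_algebra R (ab_relations p R a b)"

definition ab_struct where
  "ab_struct p R a b r = presented_class R (ab_relations p R a b) (free_const R r)"

definition ab_x where
  "ab_x p R a b = presented_class R (ab_relations p R a b) (free_gen R Gen1)"

definition ab_y where
  "ab_y p R a b = presented_class R (ab_relations p R a b) (free_gen R Gen2)"


section \<open>The algebra \<open>(a,b)\<^sub>\<rho>\<close>\<close>

definition primitive_root_of_unity :: "nat \<Rightarrow> complex \<Rightarrow> bool" where
  "primitive_root_of_unity n \<rho> \<longleftrightarrow> n > 0 \<and> \<rho> ^ n = 1 \<and> (\<forall>k. 0 < k \<and> k < n \<longrightarrow> \<rho> ^ k \<noteq> 1)"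

text \<open>
  The base ring, its fraction field and all scalars live in the field \<open>\<complex>(a,b)\<close>, the
  fraction field of \<open>\<complex>[a][b]\<close>; the inner polynomial variable is \<open>a\<close>, the outer one \<open>b\<close>.
\<close>

type_synonym cfun2 = "complex poly poly fract"

definition scalar :: "complex \<Rightarrow> cfun2" where "scalar c = to_fract [:[:c:]:]"
definition var_a :: cfun2 where "var_a = to_fract [:[:0, 1:]:]"
definition var_b :: cfun2 where "var_b = to_fract [:0, 1:]"

definition cyclotomic_integers :: "complex \<Rightarrow> complex set" where
  "cyclotomic_integers \<rho> = range (\<lambda>q :: int poly. Polynomial.poly (map_poly of_int q) \<rho>)"

definition rho_polys :: "complex \<Rightarrow> complex poly poly set" where
  "rho_polys \<rho> = {P. \<forall>i j. Polynomial.coeff (Polynomial.coeff P i) j \<in> cyclotomic_integers \<rho>}"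

definition rho_denom :: "nat \<Rightarrow> complex \<Rightarrow> cfun2" where
  "rho_denom p \<rho> = 1 + var_a * var_b * scalar (\<rho> - 1) ^ p"

definition rho_base_set :: "nat \<Rightarrow> complex \<Rightarrow> cfun2 set" where
  "rho_base_set p \<rho> = {to_fract P / rho_denom p \<rho> ^ k | P k. P \<in> rho_polys \<rho>}"

definition rho_base :: "nat \<Rightarrow> complex \<Rightarrow> cfun2 ring" where
  "rho_base p \<rho> = ring_of_type_algebra\<lparr>carrier := rho_base_set p \<rho>\<rparr>"

definition rho_field :: "nat \<Rightarrow> complex \<Rightarrow> cfun2 ring" where
  "rho_field p \<rho> = ring_of_type_algebra\<lparr>carrier :=
      {u / v | u v. u \<in> rho_base_set p \<rho> \<and> v \<in> rho_base_set p \<rho> \<and> v \<noteq> 0}\<rparr>"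

text \<open>The symbol algebra \<open>B\<close>, with generators \<open>x\<close> = \<open>Gen1\<close> and \<open>\<beta>\<close> = \<open>Gen2\<close>.\<close>

definition symbol_relations :: "nat \<Rightarrow> complex \<Rightarrow> (two_gens list \<Rightarrow> cfun2) set" where
  "symbol_relations p \<rho> =
    (let F = rho_field p \<rho>; P = free_algebra F; x = free_gen F Gen1; \<beta> = free_gen F Gen2 in
      {x [^]\<^bsub>P\<^esub> p \<ominus>\<^bsub>P\<^esub> free_const F var_a,
       \<beta> [^]\<^bsub>P\<^esub> p \<ominus>\<^bsub>P\<^esub> free_const F (rho_denom p \<rho>),
       x \<otimes>\<^bsub>P\<^esub> \<beta> \<ominus>\<^bsub>P\<^esub> free_const F (scalar \<rho>) \<otimes>\<^bsub>P\<^esub> \<beta> \<otimes>\<^bsub>P\<^esub> x})"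

definition symbol_algebra :: "nat \<Rightarrow> complex \<Rightarrow> (two_gens list \<Rightarrow> cfun2) set ring" where
  "symbol_algebra p \<rho> = presented_algebra (rho_field p \<rho>) (symbol_relations p \<rho>)"

definition symbol_struct where
  "symbol_struct p \<rho> r =
    presented_class (rho_field p \<rho>) (symbol_relations p \<rho>) (free_const (rho_field p \<rho>) r)"

definition symbol_x where
  "symbol_x p \<rho> =
    presented_class (rho_field p \<rho>) (symbol_relations p \<rho>) (free_gen (rho_field p \<rho>) Gen1)"

definition symbol_beta where
  "symbol_beta p \<rho> =
    presented_class (rho_field p \<rho>) (symbol_relations p \<rho>) (free_gen (rho_field p \<rho>) Gen2)"

definition symbol_alpha where
  "symbol_alpha p \<rho> =
    (let B = symbol_algebra p \<rho> in
      symbol_struct p \<rho> (1 / scalar (\<rho> - 1)) \<otimes>\<^bsub>B\<^esub> (symbol_beta p \<rho> \<ominus>\<^bsub>B\<^esub> \<one>\<^bsub>B\<^esub>))"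

definition symbol_y where
  "symbol_y p \<rho> =
    (let B = symbol_algebra p \<rho> in inv\<^bsub>B\<^esub> (symbol_x p \<rho>) \<otimes>\<^bsub>B\<^esub> symbol_alpha p \<rho>)"

definition ab_rho_algebra :: "nat \<Rightarrow> complex \<Rightarrow> (two_gens list \<Rightarrow> cfun2) set ring" where
  "ab_rho_algebra p \<rho> =
    (let B = symbol_algebra p \<rho> in
      B\<lparr>carrier :=
        {finsum B (\<lambda>(i, j). symbol_struct p \<rho> (c i j) \<otimes>\<^bsub>B\<^esub>
              (symbol_x p \<rho> [^]\<^bsub>B\<^esub> i \<otimes>\<^bsub>B\<^esub> symbol_y p \<rho> [^]\<^bsub>B\<^esub> j))
            ({..<p} \<times> {..<p})
         | c :: nat \<Rightarrow> nat \<Rightarrow> cfun2. \<forall>i j. c i j \<in> rho_base_set p \<rho>}\<rparr>)"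


section \<open>Cyclic Galois extensions\<close>

text \<open>
  The group is the abstract cyclic group \<open>\<langle>\<sigma>\<rangle>\<close> of order \<open>n\<close> acting on \<open>S\<close>; unless \<open>S\<close> is the
  zero ring, \<open>separating\<close> forces the action to be faithful. Together with \<open>fixed_ring\<close>
  it is the usual definition of a Galois extension of commutative rings (Chase, Harrison
  and Rosenberg; DeMeyer and Ingraham).
\<close>

locale cyclic_galois_extension = R?: cring R + S?: cring S
  for R :: "('r, 'm) ring_scheme" (structure) and \<iota> :: "'r \<Rightarrow> 's"
    and S :: "('s, 'k) ring_scheme" (structure) and \<sigma> :: "'s \<Rightarrow> 's" and n :: nat +
  assumes degree_pos: "0 < n"
    and struct_hom: "\<iota> \<in> ring_hom R S"
    and struct_inj: "inj_on \<iota> (carrier R)"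
    and automorphism: "\<sigma> \<in> ring_iso S S"
    and order: "s \<in> carrier S \<Longrightarrow> (\<sigma> ^^ n) s = s"
    and fixed_ring: "{s \<in> carrier S. \<sigma> s = s} = \<iota> ` carrier R"
    and separating:
      "\<lbrakk>0 < i; i < n; maximalideal M S\<rbrakk> \<Longrightarrow> \<exists>s\<in>carrier S. (\<sigma> ^^ i) s \<ominus>\<^bsub>S\<^esub> s \<notin> M"


section \<open>Almost cyclic algebras\<close>

definition skew_poly_ring :: "('e, 'm) ring_scheme \<Rightarrow> ('e \<Rightarrow> 'e) \<Rightarrow> (nat \<Rightarrow> 'e) ring" where
  "skew_poly_ring E \<tau> =
    \<lparr>carrier = {f. (\<forall>m. f m \<in> carrier E) \<and> finite {m. f m \<noteq> \<zero>\<^bsub>E\<^esub>}},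
     monoid.mult = (\<lambda>f g m. finsum E (\<lambda>i. f i \<otimes>\<^bsub>E\<^esub> (\<tau> ^^ i) (g (m - i))) {..m}),
     monoid.one = (\<lambda>m. if m = 0 then \<one>\<^bsub>E\<^esub> else \<zero>\<^bsub>E\<^esub>),
     ring.zero = (\<lambda>m. \<zero>\<^bsub>E\<^esub>),
     ring.add = (\<lambda>f g m. f m \<oplus>\<^bsub>E\<^esub> g m)\<rparr>"

definition skew_monom :: "('e, 'm) ring_scheme \<Rightarrow> nat \<Rightarrow> 'e \<Rightarrow> nat \<Rightarrow> 'e" where
  "skew_monom E n c = (\<lambda>m. if m = n then c else \<zero>\<^bsub>E\<^esub>)"

text \<open>
  \<open>S\<close>-submodules of an overring \<open>E\<close> of \<open>S\<close>. Products of submodules are \<open>ideal_prod\<close>, which is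
  the set of finite sums of products for arbitrary additive subgroups, not only for ideals.
\<close>

definition is_submodule_of_overring :: "('e, 'm) ring_scheme \<Rightarrow> 'e set \<Rightarrow> 'e set \<Rightarrow> bool" where
  "is_submodule_of_overring E S J \<longleftrightarrow>
    additive_subgroup J E \<and> (\<forall>s\<in>S. \<forall>z\<in>J. s \<otimes>\<^bsub>E\<^esub> z \<in> J)"

definition invertible_submodule :: "('e, 'm) ring_scheme \<Rightarrow> 'e set \<Rightarrow> 'e set \<Rightarrow> bool" where
  "invertible_submodule E S J \<longleftrightarrow> is_submodule_of_overring E S J \<and>
    (\<exists>J'. is_submodule_of_overring E S J' \<and> ideal_prod E J J' = S)"

text \<open>The coefficient module \<open>J \<tau>(J) \<dots> \<tau>\<^bsup>m-1\<^esup>(J)\<close> of \<open>(Jt)\<^bsup>m\<^esup>\<close>.\<close>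

primrec twisted_power ::
    "('e, 'm) ring_scheme \<Rightarrow> 'e set \<Rightarrow> ('e \<Rightarrow> 'e) \<Rightarrow> 'e set \<Rightarrow> nat \<Rightarrow> 'e set" where
  "twisted_power E S \<tau> J 0 = S"
| "twisted_power E S \<tau> J (Suc m) =
     ideal_prod E (twisted_power E S \<tau> J m) ((\<tau> ^^ m) ` J)"

text \<open>
  The data \<open>(S, J, \<phi>)\<close>. The class \<open>J \<in> Pic(S)\<close> is represented by an invertible \<open>S\<close>-submodule of a
  commutative overring \<open>E\<close> of \<open>S\<close> to which the group action extends. One cannot always take
  for \<open>E\<close> the total ring of fractions of \<open>S\<close>, that is, for \<open>J\<close> an invertible ideal of \<open>S\<close>
  itself: if all nonzerodivisors of \<open>S\<close> are units, then \<open>S\<close> is the only invertible ideal, although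
  \<open>Pic(S)\<close> may be nontrivial. Allowing arbitrary \<open>E\<close> gives exactly \<open>Pic(S)\<close>: invertible
  submodules are invertible modules, and an invertible module \<open>J\<close> embeds, together with its
  conjugates, in the direct sum of all \<open>J\<^bsup>k\<^esup> \<otimes> \<sigma>(J)\<^bsup>l\<^esup> \<otimes> \<dots>\<close> with integer exponents,
  on which \<open>\<sigma>\<close> acts. The products \<open>J \<tau>(J) \<dots>\<close> in \<open>E\<close> are then isomorphic to the tensor products.
\<close>

locale almost_cyclic_data = E?: cring E
  for E :: "('e, 'm) ring_scheme" (structure) and S :: "'e set" and \<tau> :: "'e \<Rightarrow> 'e" and n :: nat
    and J :: "'e set" and \<phi> :: "'e \<Rightarrow> 'e" +
  assumes subring: "subcring S E"
    and automorphism: "\<tau> \<in> ring_iso E E"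
    and order: "e \<in> carrier E \<Longrightarrow> (\<tau> ^^ n) e = e"
    and stable: "\<tau> ` S = S"
    and invertible: "invertible_submodule E S J"
    and phi_bij: "bij_betw \<phi> (twisted_power E S \<tau> J n) S"
    and phi_add:
      "\<lbrakk>z \<in> twisted_power E S \<tau> J n; z' \<in> twisted_power E S \<tau> J n\<rbrakk>
        \<Longrightarrow> \<phi> (z \<oplus>\<^bsub>E\<^esub> z') = \<phi> z \<oplus>\<^bsub>E\<^esub> \<phi> z'"
    and phi_smult:
      "\<lbrakk>s \<in> S; z \<in> twisted_power E S \<tau> J n\<rbrakk> \<Longrightarrow> \<phi> (s \<otimes>\<^bsub>E\<^esub> z) = s \<otimes>\<^bsub>E\<^esub> \<phi> z"
    and phi_equivariant: "z \<in> twisted_power E S \<tau> J n \<Longrightarrow> \<phi> (\<tau> z) = \<tau> (\<phi> z)"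

definition T_ring ::
    "('e, 'm) ring_scheme \<Rightarrow> 'e set \<Rightarrow> ('e \<Rightarrow> 'e) \<Rightarrow> 'e set \<Rightarrow> (nat \<Rightarrow> 'e) ring" where
  "T_ring E S \<tau> J = (skew_poly_ring E \<tau>)\<lparr>carrier :=
      {f \<in> carrier (skew_poly_ring E \<tau>). \<forall>m. f m \<in> twisted_power E S \<tau> J m}\<rparr>"

text \<open>The map \<open>\<phi>\<close> is written on coefficients: it sends \<open>c t\<^bsup>n\<^esup>\<close> to \<open>\<phi> c\<close>.\<close>

definition Delta_ideal where
  "Delta_ideal E S \<tau> n J \<phi> = genideal (T_ring E S \<tau> J)
    {skew_monom E n c \<ominus>\<^bsub>T_ring E S \<tau> J\<^esub> skew_monom E 0 (\<phi> c) | c.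
      c \<in> twisted_power E S \<tau> J n}"

definition Delta ::
    "('e, 'm) ring_scheme \<Rightarrow> 'e set \<Rightarrow> ('e \<Rightarrow> 'e) \<Rightarrow> nat \<Rightarrow> 'e set \<Rightarrow> ('e \<Rightarrow> 'e)
      \<Rightarrow> (nat \<Rightarrow> 'e) set ring" where
  "Delta E S \<tau> n J \<phi> = T_ring E S \<tau> J Quot Delta_ideal E S \<tau> n J \<phi>"

definition Delta_incl where
  "Delta_incl E S \<tau> n J \<phi> s = Delta_ideal E S \<tau> n J \<phi> +>\<^bsub>T_ring E S \<tau> J\<^esub> skew_monom E 0 s"

text \<open>
  \<open>S\<close> is a subset of \<open>A\<close>, carrying the induced ring structure, and \<open>j\<close> embeds it in the overring.
  Having the elements of \<open>E\<close> in \<open>nat \<Rightarrow> 'a\<close> is no restriction: the overring described above has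
  at most \<open>max(|S|, \<aleph>\<^sub>0)\<close> elements.
\<close>

definition almost_cyclic ::
    "('r, 'm) ring_scheme \<Rightarrow> ('r \<Rightarrow> 'a) \<Rightarrow> 'a ring \<Rightarrow> 'a set \<Rightarrow> ('a \<Rightarrow> 'a) \<Rightarrow> nat \<Rightarrow> bool" where
  "almost_cyclic R \<iota> A S \<sigma> n \<longleftrightarrow>
    assoc_algebra R \<iota> A \<and> subcring S A \<and>
    cyclic_galois_extension R \<iota> (A\<lparr>carrier := S\<rparr>) \<sigma> n \<and>
    (\<exists>(E :: (nat \<Rightarrow> 'a) ring) j \<tau> J \<phi> \<Psi>.
        j \<in> ring_hom (A\<lparr>carrier := S\<rparr>) E \<and> inj_on j S \<and>
        (\<forall>s\<in>S. \<tau> (j s) = j (\<sigma> s)) \<and>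
        almost_cyclic_data E (j ` S) \<tau> n J \<phi> \<and>
        \<Psi> \<in> ring_iso (Delta E (j ` S) \<tau> n J \<phi>) A \<and>
        (\<forall>s\<in>S. \<Psi> (Delta_incl E (j ` S) \<tau> n J \<phi> (j s)) = s))"


section \<open>Azumaya algebras\<close>

definition algebra_module ::
    "('r \<Rightarrow> 'a) \<Rightarrow> ('a, 'n) ring_scheme \<Rightarrow> ('r, 'a) module" where
  "algebra_module \<iota> A =
    \<lparr>carrier = carrier A, monoid.mult = monoid.mult A, monoid.one = \<one>\<^bsub>A\<^esub>, ring.zero = \<zero>\<^bsub>A\<^esub>, ring.add = ring.add A,
     module.smult = (\<lambda>r z. \<iota> r \<otimes>\<^bsub>A\<^esub> z)\<rparr>"

definition free_module :: "('r, 'm) ring_scheme \<Rightarrow> nat \<Rightarrow> ('r, nat \<Rightarrow> 'r) module" where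
  "free_module R n =
    \<lparr>carrier = {..<n} \<rightarrow>\<^sub>E carrier R,
     monoid.mult = (\<lambda>f g. \<lambda>i\<in>{..<n}. f i \<otimes>\<^bsub>R\<^esub> g i), monoid.one = (\<lambda>i\<in>{..<n}. \<one>\<^bsub>R\<^esub>),
     ring.zero = (\<lambda>i\<in>{..<n}. \<zero>\<^bsub>R\<^esub>), ring.add = (\<lambda>f g. \<lambda>i\<in>{..<n}. f i \<oplus>\<^bsub>R\<^esub> g i),
     module.smult = (\<lambda>r f. \<lambda>i\<in>{..<n}. r \<otimes>\<^bsub>R\<^esub> f i)\<rparr>"

definition module_homs ::
    "('r, 'm) ring_scheme \<Rightarrow> ('r, 'a, 'k) module_scheme \<Rightarrow> ('r, 'b, 'l) module_scheme
      \<Rightarrow> ('a \<Rightarrow> 'b) set" where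
  "module_homs R M N =
    {f \<in> carrier M \<rightarrow>\<^sub>E carrier N.
      (\<forall>z\<in>carrier M. \<forall>w\<in>carrier M. f (z \<oplus>\<^bsub>M\<^esub> w) = f z \<oplus>\<^bsub>N\<^esub> f w) \<and>
      (\<forall>r\<in>carrier R. \<forall>z\<in>carrier M. f (r \<odot>\<^bsub>M\<^esub> z) = r \<odot>\<^bsub>N\<^esub> f z)}"

text \<open>Finitely generated projective: a direct summand of some \<open>R\<^bsup>n\<^esup>\<close>.\<close>

definition fg_projective ::
    "('r, 'm) ring_scheme \<Rightarrow> ('r, 'a, 'k) module_scheme \<Rightarrow> bool" where
  "fg_projective R M \<longleftrightarrow> module R M \<and>
    (\<exists>n. \<exists>f\<in>module_homs R M (free_module R n). \<exists>g\<in>module_homs R (free_module R n) M.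
        \<forall>z\<in>carrier M. g (f z) = z)"

definition faithful_module ::
    "('r, 'm) ring_scheme \<Rightarrow> ('r, 'a, 'k) module_scheme \<Rightarrow> bool" where
  "faithful_module R M \<longleftrightarrow>
    (\<forall>r\<in>carrier R. (\<forall>z\<in>carrier M. r \<odot>\<^bsub>M\<^esub> z = \<zero>\<^bsub>M\<^esub>) \<longrightarrow> r = \<zero>\<^bsub>R\<^esub>)"

text \<open>The tensor product over \<open>R\<close>, as an abelian group.\<close>

definition tensor_relations ::
    "('r, 'm) ring_scheme \<Rightarrow> ('r, 'a, 'k) module_scheme \<Rightarrow> ('r, 'b, 'l) module_scheme
      \<Rightarrow> ('a \<times> 'b \<Rightarrow>\<^sub>0 int) set" where
  "tensor_relations R M N =
    {frag_of (u \<oplus>\<^bsub>M\<^esub> u', v) - frag_of (u, v) - frag_of (u', v) | u u' v.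
        u \<in> carrier M \<and> u' \<in> carrier M \<and> v \<in> carrier N} \<union>
    {frag_of (u, v \<oplus>\<^bsub>N\<^esub> v') - frag_of (u, v) - frag_of (u, v') | u v v'.
        u \<in> carrier M \<and> v \<in> carrier N \<and> v' \<in> carrier N} \<union>
    {frag_of (r \<odot>\<^bsub>M\<^esub> u, v) - frag_of (u, r \<odot>\<^bsub>N\<^esub> v) | r u v.
        r \<in> carrier R \<and> u \<in> carrier M \<and> v \<in> carrier N}"

definition tensor_kernel where
  "tensor_kernel R M N =
    generate (free_Abelian_group (carrier M \<times> carrier N)) (tensor_relations R M N)"

definition tensor_product ::
    "('r, 'm) ring_scheme \<Rightarrow> ('r, 'a, 'k) module_scheme \<Rightarrow> ('r, 'b, 'l) module_scheme
      \<Rightarrow> ('a \<times> 'b \<Rightarrow>\<^sub>0 int) set monoid" where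
  "tensor_product R M N =
    free_Abelian_group (carrier M \<times> carrier N) Mod tensor_kernel R M N"

definition pure_tensor where
  "pure_tensor R M N u v =
    tensor_kernel R M N #>\<^bsub>free_Abelian_group (carrier M \<times> carrier N)\<^esub> frag_of (u, v)"

definition endomorphism_group ::
    "('r, 'm) ring_scheme \<Rightarrow> ('r, 'a, 'k) module_scheme \<Rightarrow> ('a \<Rightarrow> 'a) monoid" where
  "endomorphism_group R M =
    \<lparr>carrier = module_homs R M M,
     monoid.mult = (\<lambda>f g. \<lambda>z\<in>carrier M. f z \<oplus>\<^bsub>M\<^esub> g z),
     monoid.one = (\<lambda>z\<in>carrier M. \<zero>\<^bsub>M\<^esub>)\<rparr>"

text \<open>
  The last condition says that the canonical map \<open>A \<otimes> A\<^bsup>op\<^esup> \<rightarrow> End\<^bsub>R\<^esub>(A)\<close> is an isomorphism. It is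
  determined on pure tensors and automatically multiplicative, and \<open>A\<^bsup>op\<^esup>\<close> is the same module
  as \<open>A\<close>, so it suffices to speak of additive groups.
\<close>

definition azumaya ::
    "('r, 'm) ring_scheme \<Rightarrow> ('r \<Rightarrow> 'a) \<Rightarrow> ('a, 'n) ring_scheme \<Rightarrow> bool" where
  "azumaya R \<iota> A \<longleftrightarrow>
    (let M = algebra_module \<iota> A in
      assoc_algebra R \<iota> A \<and> fg_projective R M \<and> faithful_module R M \<and>
      (\<exists>\<Theta> \<in> iso (tensor_product R M M) (endomorphism_group R M).
        \<forall>u\<in>carrier A. \<forall>v\<in>carrier A.
          \<Theta> (pure_tensor R M M u v) = (\<lambda>z\<in>carrier A. u \<otimes>\<^bsub>A\<^esub> z \<otimes>\<^bsub>A\<^esub> v)))"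

end

theory Submission
  imports Defs
begin

text \<open>
  Both algebras are free on the \<open>x\<^bsup>i\<^esup> y\<^bsup>j\<^esup>\<close> with \<open>xy = q yx + 1\<close>, \<open>x\<^bsup>p\<^esup> \<in> R\<close>, \<open>y\<^bsup>p\<^esup> \<in> R\<close>, and
  \<open>1 + q + \<dots> + q\<^bsup>p-1\<^esup> = 0\<close>, where \<open>(1 + (q - 1) xy)\<^bsup>p\<^esup>\<close> is a unit of \<open>R\<close>; here \<open>q = 1\<close> or \<open>q = \<rho>\<close>.
  Commutators with \<open>x\<close> and \<open>y\<close>, twisted by the unit, act on monomials as \<open>q\<close>-derivatives, so the
  coordinates of \<open>z\<close> have the form \<open>\<Sum> u z v\<close>. This gives independence as soon as \<open>R\<close> embeds,
  and the isomorphism \<open>A \<otimes> A\<^bsup>op\<^esup> \<rightarrow> End(A)\<close>.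

  In \<open>S = R[u]\<close>, \<open>u = xy\<close>, the conjugates of \<open>u\<close> differ by units, hence are pairwise comaximal.
  In a suitable ring \<open>E\<close> of periodic sequences over a localization of \<open>S\<close>, with \<open>\<sigma>\<close> extended by the
  shift \<open>\<tau>\<close>, one can write \<open>u = \<xi> \<zeta>\<close> with norms \<open>N \<xi> = a\<close>, \<open>N \<zeta> = b\<close>. Then
  \<open>J = S \<xi> + S \<tau>(\<zeta>) \<dots> \<tau>\<^bsup>p-1\<^esup>(\<zeta>)\<close> is invertible, its norm is \<open>S\<close>, and with \<open>\<phi> = id\<close> the elements
  \<open>\<xi> t\<close> and \<open>\<tau>\<^bsup>p-1\<^esup>(\<zeta>) t\<^bsup>p-1\<^esup>\<close> of \<open>\<Delta>\<close> satisfy the relations of \<open>x\<close> and \<open>y\<close>.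

  That \<open>R\<close> embeds in \<open>(a,b)\<close>, and the field of fractions in the symbol algebra, is seen from the
  action on functions \<open>v\<close> of two indices with \<open>v (m + p) n = a v m n\<close> and \<open>v m (n + p) = b v m n\<close>.
  In the symbol algebra \<open>y\<^bsup>p\<^esup> = (- 1)\<^bsup>p+1\<^esup> b\<close>, which differs from the paper in sign for \<open>p = 2\<close>.
\<close>

section \<open>Algebras with a basis whose coordinates are bimodule operators\<close>

text \<open>The scalars \<open>a\<close> and \<open>b\<close> are arbitrary, possibly zero, so
  \<open>x\<close> and \<open>y\<close> need not be invertible. Hence \<sigma> cannot be conjugation
  by \<open>x\<close>; it is defined by commutation relations, whose solution is unique because an
  element of \<open>S\<close> that kills \<open>x\<close> and \<open>y^(p-1)\<close> by left
  multiplication is zero. The factorization of \<open>u\<close> meets the same obstacle. The norm of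
  \<open>u\<close> is \<open>a b\<close>; once the product \<open>c\<close> of the other conjugates
  is inverted, \<open>u = a (b / c)\<close>. Inverting \<open>c\<close> alone may kill elements of
  \<open>S\<close>, namely those annihilated by powers of \<open>c\<close>. The products of all
  conjugates but one generate the unit ideal, however, so \<open>S\<close> embeds in the product of
  the p localizations at the conjugates of \<open>c\<close>. Periodic sequences realize this
  product: row n of the image of s is the image of \<sigma>^n(s) in a single localization. What
  makes \<open>q = 1\<close> and \<open>q = \<rho>\<close> one case is that the vanishing of the
  p-th quantum integer, with p prime, forces the quantum integers of 1, ..., p - 1 to be units. This
  enters the separation of conjugates, their comaximality, and the division by the scalars that
  iterated q-derivatives produce.\<close>

inductive bimod_op :: "('a, 'n) ring_scheme \<Rightarrow> ('a \<Rightarrow> 'a) \<Rightarrow> bool"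
  for A (structure) where
  sandwich: "\<lbrakk>u \<in> carrier A; v \<in> carrier A\<rbrakk> \<Longrightarrow> bimod_op A (\<lambda>z. u \<otimes> z \<otimes> v)"
| add: "\<lbrakk>bimod_op A g; bimod_op A h\<rbrakk> \<Longrightarrow> bimod_op A (\<lambda>z. g z \<oplus> h z)"
| cong: "\<lbrakk>bimod_op A g; \<And>z. z \<in> carrier A \<Longrightarrow> h z = g z\<rbrakk> \<Longrightarrow> bimod_op A h"

context ring
begin

lemma bimod_op_closed: "bimod_op R g \<Longrightarrow> z \<in> carrier R \<Longrightarrow> g z \<in> carrier R"
  by (induction rule: bimod_op.induct) auto

lemma bimod_op_add:
  assumes "bimod_op R g" "z \<in> carrier R" "w \<in> carrier R"
  shows "g (z \<oplus> w) = g z \<oplus> g w"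
  using assms
proof (induction rule: bimod_op.induct)
  case (sandwich u v)
  then show ?case by (simp add: r_distr l_distr)
next
  case (add g h)
  then have "g z \<in> carrier R" "g w \<in> carrier R" "h z \<in> carrier R" "h w \<in> carrier R"
    by (simp_all add: bimod_op_closed)
  then show ?case using add by (simp add: a_ac)
qed simp

lemma bimod_op_sandwich_comp:
  assumes "bimod_op R g" "u \<in> carrier R" "v \<in> carrier R"
  shows "bimod_op R (\<lambda>z. u \<otimes> g z \<otimes> v)"
  using assms
proof (induction rule: bimod_op.induct)
  case (sandwich u' v')
  then have "bimod_op R (\<lambda>z. (u \<otimes> u') \<otimes> z \<otimes> (v' \<otimes> v))"
    by (auto intro: bimod_op.sandwich)
  then show ?case
    by (rule bimod_op.cong) (use sandwich in \<open>simp add: m_assoc\<close>)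
next
  case (add g h)
  then have "bimod_op R (\<lambda>z. u \<otimes> g z \<otimes> v \<oplus> u \<otimes> h z \<otimes> v)"
    by (intro bimod_op.add) auto
  then show ?case
    by (rule bimod_op.cong) (use add in \<open>simp add: r_distr l_distr bimod_op_closed\<close>)
next
  case (cong g h)
  then have "bimod_op R (\<lambda>z. u \<otimes> g z \<otimes> v)" by simp
  then show ?case by (rule bimod_op.cong) (use cong in simp)
qed

text \<open>The class is the image of \<open>A \<otimes> A^op\<close> in the additive maps of
  \<open>A\<close>, taken up to equality on the carrier. Composition is multiplication in that
  image, which keeps iterated commutators inside.\<close>

lemma bimod_op_comp:
  assumes "bimod_op R g" "bimod_op R h"
  shows "bimod_op R (\<lambda>z. g (h z))"
  using assms
proof (induction rule: bimod_op.induct)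
  case (sandwich u v)
  then show ?case by (intro bimod_op_sandwich_comp)
next
  case (add g g')
  then show ?case by (intro bimod_op.add) auto
next
  case (cong g g')
  then have "bimod_op R (\<lambda>z. g (h z))" by simp
  then show ?case by (rule bimod_op.cong) (use cong in \<open>simp add: bimod_op_closed\<close>)
qed

lemma bimod_op_id: "bimod_op R (\<lambda>z. z)"
proof -
  have "bimod_op R (\<lambda>z. \<one> \<otimes> z \<otimes> \<one>)" by (intro bimod_op.sandwich) auto
  then show ?thesis by (rule bimod_op.cong) simp
qed

lemma bimod_op_funpow: "bimod_op R g \<Longrightarrow> bimod_op R (g ^^ n)"
proof (induction n)
  case 0
  then show ?case using bimod_op_id by (simp add: id_def)
next
  case (Suc n)
  then show ?case using bimod_op_comp[of g "g ^^ n"] by (simp add: o_def)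
qed

text \<open>A central \<open>s\<close> can be moved past the left factor of every sandwich. For
  \<open>s\<close> coming from the base ring this is linearity; the general form serves an arbitrary
  central element in \<open>central_is_scalar\<close>.\<close>

lemma bimod_op_central:
  assumes "bimod_op R g" "s \<in> carrier R" "\<And>z. z \<in> carrier R \<Longrightarrow> s \<otimes> z = z \<otimes> s"
    and "z \<in> carrier R"
  shows "g (s \<otimes> z) = s \<otimes> g z"
  using assms(1)
proof (induction rule: bimod_op.induct)
  case (sandwich u v)
  have "u \<otimes> (s \<otimes> z) = s \<otimes> (u \<otimes> z)"
    using sandwich assms(2,4) assms(3)[OF sandwich(1)] by (simp add: m_assoc[symmetric])
  then show ?case using sandwich assms(2,4) by (simp add: m_assoc)
next
  case (add g h)
  then show ?case using assms(2-4) by (simp add: bimod_op_closed r_distr)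
next
  case (cong g h)
  then show ?case using assms(2-4) by simp
qed

text \<open>Sandwiches and their sums preserve every two-sided ideal, in particular the kernel of
  \<open>h\<close>.\<close>

lemma bimod_op_hom_zero:
  assumes "bimod_op R g" "h \<in> ring_hom R Q" "ring Q" "z \<in> carrier R" "h z = \<zero>\<^bsub>Q\<^esub>"
  shows "h (g z) = \<zero>\<^bsub>Q\<^esub>"
proof -
  interpret Q: ring Q by fact
  interpret h: ring_hom_ring R Q h
    by (rule ring_hom_ringI2[OF ring_axioms assms(3,2)])
  show ?thesis using assms(1)
    by (induction rule: bimod_op.induct) (use assms(4,5) in \<open>simp_all add: bimod_op_closed\<close>)
qed

lemma ring_hom_inj_onI:
  assumes "h \<in> ring_hom R Q" "ring Q" "\<And>z. z \<in> carrier R \<Longrightarrow> h z = \<zero>\<^bsub>Q\<^esub> \<Longrightarrow> z = \<zero>"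
  shows "inj_on h (carrier R)"
proof -
  interpret Q: ring Q by fact
  interpret h: ring_hom_ring R Q h
    by (rule ring_hom_ringI2[OF ring_axioms assms(2,1)])
  show ?thesis
  proof (rule inj_onI)
    fix x y assume xy: "x \<in> carrier R" "y \<in> carrier R" "h x = h y"
    then have "h (x \<ominus> y) = \<zero>\<^bsub>Q\<^esub>"
      by (simp add: minus_eq Q.r_neg)
    then have "x \<ominus> y = \<zero>" by (rule assms(3)[rotated]) (use xy in simp)
    then show "x = y" using xy by simp
  qed
qed

end

locale central_algebra = assoc_algebra R \<iota> A
  for R :: "('r, 'm) ring_scheme" and \<iota> :: "'r \<Rightarrow> 'a" and A :: "('a, 'n) ring_scheme" (structure)
begin

lemma struct_closed: "r \<in> carrier R \<Longrightarrow> \<iota> r \<in> carrier A"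
  using struct_hom by (rule ring_hom_closed)

lemma struct_one: "\<iota> \<one>\<^bsub>R\<^esub> = \<one>" using struct_hom by (rule ring_hom_one)
lemma struct_zero: "\<iota> \<zero>\<^bsub>R\<^esub> = \<zero>"
  using ring_hom_zero[OF struct_hom] R.ring_axioms A.ring_axioms by blast
lemma struct_add: "\<lbrakk>r \<in> carrier R; s \<in> carrier R\<rbrakk> \<Longrightarrow> \<iota> (r \<oplus>\<^bsub>R\<^esub> s) = \<iota> r \<oplus> \<iota> s"
  using struct_hom by (rule ring_hom_add)
lemma struct_mult: "\<lbrakk>r \<in> carrier R; s \<in> carrier R\<rbrakk> \<Longrightarrow> \<iota> (r \<otimes>\<^bsub>R\<^esub> s) = \<iota> r \<otimes> \<iota> s"
  using struct_hom by (rule ring_hom_mult)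

definition scale :: "'r \<Rightarrow> 'a \<Rightarrow> 'a" (infixr "\<bullet>" 72)
  where "r \<bullet> z = \<iota> r \<otimes> z"

lemma scale_closed: "\<lbrakk>r \<in> carrier R; z \<in> carrier A\<rbrakk> \<Longrightarrow> r \<bullet> z \<in> carrier A"
  by (simp add: scale_def struct_closed)

lemma scale_mult_left: "\<lbrakk>r \<in> carrier R; z \<in> carrier A; v \<in> carrier A\<rbrakk> \<Longrightarrow> (r \<bullet> z) \<otimes> v = r \<bullet> (z \<otimes> v)"
  by (simp add: scale_def struct_closed A.m_assoc)

lemma scale_mult_right:
  assumes "r \<in> carrier R" "z \<in> carrier A" "v \<in> carrier A"
  shows "z \<otimes> (r \<bullet> v) = r \<bullet> (z \<otimes> v)"
  using assms struct_central[OF assms(1,2)] by (simp add: scale_def struct_closed A.m_assoc[symmetric])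

lemma scale_scale: "\<lbrakk>r \<in> carrier R; s \<in> carrier R; z \<in> carrier A\<rbrakk> \<Longrightarrow> r \<bullet> (s \<bullet> z) = (r \<otimes>\<^bsub>R\<^esub> s) \<bullet> z"
  by (simp add: scale_def struct_closed struct_mult A.m_assoc)

lemma scale_add_right: "\<lbrakk>r \<in> carrier R; z \<in> carrier A; v \<in> carrier A\<rbrakk> \<Longrightarrow> r \<bullet> (z \<oplus> v) = r \<bullet> z \<oplus> r \<bullet> v"
  by (simp add: scale_def struct_closed A.r_distr)

lemma scale_add_left: "\<lbrakk>r \<in> carrier R; s \<in> carrier R; z \<in> carrier A\<rbrakk> \<Longrightarrow> (r \<oplus>\<^bsub>R\<^esub> s) \<bullet> z = r \<bullet> z \<oplus> s \<bullet> z"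
  by (simp add: scale_def struct_closed struct_add A.l_distr)

lemma scale_one: "z \<in> carrier A \<Longrightarrow> \<one>\<^bsub>R\<^esub> \<bullet> z = z"
  by (simp add: scale_def struct_one)

lemma scale_zero_left: "z \<in> carrier A \<Longrightarrow> \<zero>\<^bsub>R\<^esub> \<bullet> z = \<zero>"
  by (simp add: scale_def struct_zero)

lemma scale_zero_right: "r \<in> carrier R \<Longrightarrow> r \<bullet> \<zero> = \<zero>"
  by (simp add: scale_def struct_closed)

lemma scale_uminus: "\<lbrakk>r \<in> carrier R; z \<in> carrier A\<rbrakk> \<Longrightarrow> r \<bullet> (\<ominus> z) = \<ominus> (r \<bullet> z)"
  by (simp add: scale_def struct_closed A.r_minus)

lemma struct_uminus: "r \<in> carrier R \<Longrightarrow> \<iota> (\<ominus>\<^bsub>R\<^esub> r) = \<ominus> \<iota> r"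
  by (rule A.minus_equality[symmetric])
    (simp_all add: struct_closed struct_add[symmetric] R.l_neg struct_zero)

lemma scale_uminus_left: "\<lbrakk>r \<in> carrier R; z \<in> carrier A\<rbrakk> \<Longrightarrow> (\<ominus>\<^bsub>R\<^esub> r) \<bullet> z = \<ominus> (r \<bullet> z)"
  by (simp add: scale_def struct_closed struct_uminus A.l_minus)

lemma bimod_op_scale:
  "\<lbrakk>bimod_op A g; r \<in> carrier R; z \<in> carrier A\<rbrakk> \<Longrightarrow> g (r \<bullet> z) = r \<bullet> g z"
  unfolding scale_def by (rule bimod_op_central) (auto simp: struct_closed struct_central)

lemmas scale_simps = scale_closed scale_mult_left scale_mult_right scale_scale scale_add_right
  scale_one scale_zero_left scale_zero_right scale_uminus

end

text \<open>A finite dual basis in which \<open>coord_op\<close> is the decisive condition: the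
  projections onto scalars come from \<open>A \<otimes> A^op\<close>. The centre, the kernels of
  homomorphisms and the Azumaya property are all read off from it.\<close>

locale coordinatized_algebra = central_algebra R \<iota> A
  for R :: "('r, 'm) ring_scheme" and \<iota> :: "'r \<Rightarrow> 'a" and A :: "('a, 'n) ring_scheme" (structure) +
  fixes n :: nat and e :: "nat \<Rightarrow> 'a" and c :: "nat \<Rightarrow> 'a \<Rightarrow> 'r"
  assumes struct_inj: "inj_on \<iota> (carrier R)"
    and basis_closed: "k < n \<Longrightarrow> e k \<in> carrier A"
    and coord_closed: "\<lbrakk>k < n; z \<in> carrier A\<rbrakk> \<Longrightarrow> c k z \<in> carrier R"
    and coord_op: "k < n \<Longrightarrow> bimod_op A (\<lambda>z. \<iota> (c k z))"
    and expansion: "z \<in> carrier A \<Longrightarrow> z = (\<Oplus>k\<in>{..<n}. \<iota> (c k z) \<otimes> e k)"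
    and coord_basis: "\<lbrakk>k < n; l < n\<rbrakk> \<Longrightarrow> c k (e l) = (if k = l then \<one>\<^bsub>R\<^esub> else \<zero>\<^bsub>R\<^esub>)"
begin

abbreviation M where "M \<equiv> algebra_module \<iota> A"

lemma M_simps:
  "carrier M = carrier A" "u \<oplus>\<^bsub>M\<^esub> v = u \<oplus> v" "r \<odot>\<^bsub>M\<^esub> u = \<iota> r \<otimes> u" "\<zero>\<^bsub>M\<^esub> = \<zero>"
  by (simp_all add: algebra_module_def)

lemma coord_add:
  assumes "k < n" "z \<in> carrier A" "w \<in> carrier A"
  shows "c k (z \<oplus> w) = c k z \<oplus>\<^bsub>R\<^esub> c k w"
proof -
  have "\<iota> (c k (z \<oplus> w)) = \<iota> (c k z \<oplus>\<^bsub>R\<^esub> c k w)"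
    using bimod_op_add[OF coord_op] assms by (simp add: struct_add coord_closed)
  then show ?thesis
    using assms struct_inj by (simp add: inj_on_eq_iff coord_closed)
qed

lemma coord_smult:
  assumes "k < n" "r \<in> carrier R" "z \<in> carrier A"
  shows "c k (\<iota> r \<otimes> z) = r \<otimes>\<^bsub>R\<^esub> c k z"
proof -
  have "\<iota> (c k (\<iota> r \<otimes> z)) = \<iota> r \<otimes> \<iota> (c k z)"
    by (rule bimod_op_central[OF coord_op])
      (use assms in \<open>auto simp: struct_closed struct_central\<close>)
  then have "\<iota> (c k (\<iota> r \<otimes> z)) = \<iota> (r \<otimes>\<^bsub>R\<^esub> c k z)"
    using assms by (simp add: struct_mult coord_closed)
  then show ?thesis
    using assms struct_inj by (simp add: inj_on_eq_iff coord_closed struct_closed)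
qed

text \<open>The coordinate at \<open>e 0 = \<one>\<close> is linear over the whole centre, so
  applied to \<open>s = s \<otimes> \<one>\<close> it returns \<open>s\<close>, and its values are
  scalars.\<close>

lemma central_is_scalar:
  assumes "s \<in> carrier A" "\<And>z. z \<in> carrier A \<Longrightarrow> s \<otimes> z = z \<otimes> s" "0 < n" "e 0 = \<one>"
  shows "s \<in> \<iota> ` carrier R"
proof -
  have "\<iota> (c 0 (s \<otimes> \<one>)) = s \<otimes> \<iota> (c 0 \<one>)"
    by (rule bimod_op_central[OF coord_op]) (use assms in auto)
  moreover have "c 0 \<one> = \<one>\<^bsub>R\<^esub>" using coord_basis[of 0 0] assms by simp
  ultimately have "\<iota> (c 0 s) = s" using assms(1) by (simp add: struct_one)
  then show ?thesis using coord_closed[OF assms(3,1)] by (metis imageI)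
qed

text \<open>The kernel is stable under the coordinate operators, so the coordinates of a kernel
  element are scalars in the kernel. Injectivity therefore only has to be checked on
  \<open>R\<close>.\<close>

lemma hom_inj:
  assumes "h \<in> ring_hom A Q" "ring Q" "\<And>r. r \<in> carrier R \<Longrightarrow> h (\<iota> r) = \<zero>\<^bsub>Q\<^esub> \<Longrightarrow> r = \<zero>\<^bsub>R\<^esub>"
  shows "inj_on h (carrier A)"
proof -
  have "z = \<zero>" if z: "z \<in> carrier A" "h z = \<zero>\<^bsub>Q\<^esub>" for z
  proof -
    have "c k z = \<zero>\<^bsub>R\<^esub>" if k: "k < n" for k
      by (rule assms(3)[OF coord_closed[OF k z(1)]])
        (rule bimod_op_hom_zero[OF coord_op[OF k] assms(1,2) z])
    then have "(\<Oplus>k\<in>{..<n}. \<iota> (c k z) \<otimes> e k) = (\<Oplus>k\<in>{..<n}. \<zero>)"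
      by (intro A.add.finprod_cong') (auto simp: struct_zero basis_closed)
    then show "z = \<zero>" using expansion[OF z(1), symmetric] by simp
  qed
  then show ?thesis by (rule ring_hom_inj_onI[OF assms(1,2)])
qed

lemma module_M: "module R M"
proof (rule moduleI)
  show "abelian_group M"
  proof (rule abelian_groupI)
    fix x assume "x \<in> carrier M"
    then show "\<exists>y\<in>carrier M. y \<oplus>\<^bsub>M\<^esub> x = \<zero>\<^bsub>M\<^esub>"
      by (intro bexI[of _ "\<ominus> x"]) (auto simp: M_simps A.l_neg)
  qed (auto simp: M_simps A.a_ac)
qed (auto simp: M_simps struct_closed struct_add struct_mult struct_one A.l_distr A.r_distr A.m_assoc
    R.cring_axioms)

lemma coordinate_map: "(\<lambda>z\<in>carrier A. \<lambda>k\<in>{..<n}. c k z) \<in> module_homs R M (free_module R n)"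
  by (auto simp: module_homs_def M_simps free_module_def coord_closed coord_add coord_smult struct_closed
      intro!: restrict_ext)

lemma combination_map:
  "(\<lambda>f\<in>carrier (free_module R n). \<Oplus>k\<in>{..<n}. \<iota> (f k) \<otimes> e k) \<in> module_homs R (free_module R n) M"
proof -
  let ?F = "free_module R n"
  have F: "f k \<in> carrier R" if "f \<in> carrier ?F" "k < n" for f k
    using that by (auto simp: free_module_def)
  have add: "(\<Oplus>k\<in>{..<n}. \<iota> ((f \<oplus>\<^bsub>?F\<^esub> g) k) \<otimes> e k)
      = (\<Oplus>k\<in>{..<n}. \<iota> (f k) \<otimes> e k) \<oplus> (\<Oplus>k\<in>{..<n}. \<iota> (g k) \<otimes> e k)"
    if fg: "f \<in> carrier ?F" "g \<in> carrier ?F" for f g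
  proof -
    have "(\<Oplus>k\<in>{..<n}. \<iota> ((f \<oplus>\<^bsub>?F\<^esub> g) k) \<otimes> e k) = (\<Oplus>k\<in>{..<n}. \<iota> (f k) \<otimes> e k \<oplus> \<iota> (g k) \<otimes> e k)"
      by (rule A.add.finprod_cong')
        (use fg F in \<open>auto simp: struct_closed basis_closed free_module_def struct_add A.l_distr\<close>)
    also have "\<dots> = (\<Oplus>k\<in>{..<n}. \<iota> (f k) \<otimes> e k) \<oplus> (\<Oplus>k\<in>{..<n}. \<iota> (g k) \<otimes> e k)"
      by (rule A.finsum_addf) (use fg F in \<open>auto simp: struct_closed basis_closed\<close>)
    finally show ?thesis .
  qed
  have smult: "(\<Oplus>k\<in>{..<n}. \<iota> ((r \<odot>\<^bsub>?F\<^esub> f) k) \<otimes> e k) = \<iota> r \<otimes> (\<Oplus>k\<in>{..<n}. \<iota> (f k) \<otimes> e k)"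
    if r: "r \<in> carrier R" and f: "f \<in> carrier ?F" for r f
  proof -
    have "\<iota> r \<otimes> (\<Oplus>k\<in>{..<n}. \<iota> (f k) \<otimes> e k) = (\<Oplus>k\<in>{..<n}. \<iota> r \<otimes> (\<iota> (f k) \<otimes> e k))"
      by (rule A.finsum_rdistr) (use r f F in \<open>auto simp: struct_closed basis_closed\<close>)
    also have "\<dots> = (\<Oplus>k\<in>{..<n}. \<iota> ((r \<odot>\<^bsub>?F\<^esub> f) k) \<otimes> e k)"
      by (rule A.add.finprod_cong')
        (use r f F in \<open>auto simp: F struct_closed basis_closed free_module_def struct_mult A.m_assoc\<close>)
    finally show ?thesis by simp
  qed
  have F_closed: "f \<oplus>\<^bsub>?F\<^esub> g \<in> carrier ?F" if "f \<in> carrier ?F" "g \<in> carrier ?F" for f g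
    using that by (auto simp: free_module_def)
  have F_smult: "r \<odot>\<^bsub>?F\<^esub> f \<in> carrier ?F" if "r \<in> carrier R" "f \<in> carrier ?F" for r f
    using that by (auto simp: free_module_def)
  show ?thesis
    unfolding module_homs_def M_simps
  proof (intro CollectI conjI ballI)
    show "(\<lambda>f\<in>carrier ?F. \<Oplus>k\<in>{..<n}. \<iota> (f k) \<otimes> e k) \<in> carrier ?F \<rightarrow>\<^sub>E carrier A"
      using F by (intro restrict_PiE_iff[THEN iffD2] ballI A.finsum_closed) (auto simp: struct_closed basis_closed)
  qed (simp_all only: restrict_apply' F_closed F_smult add smult)
qed

lemma fg_projective_M: "fg_projective R M"
  unfolding fg_projective_def
proof (intro conjI module_M exI bexI ballI)
  show "(\<lambda>z\<in>carrier A. \<lambda>k\<in>{..<n}. c k z) \<in> module_homs R M (free_module R n)"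
    by (rule coordinate_map)
  show "(\<lambda>f\<in>carrier (free_module R n). \<Oplus>k\<in>{..<n}. \<iota> (f k) \<otimes> e k) \<in> module_homs R (free_module R n) M"
    by (rule combination_map)
  fix z assume z: "z \<in> carrier M"
  then have "(\<lambda>k\<in>{..<n}. c k z) \<in> carrier (free_module R n)"
    by (auto simp: free_module_def coord_closed M_simps)
  moreover have "(\<Oplus>k\<in>{..<n}. \<iota> ((\<lambda>k\<in>{..<n}. c k z) k) \<otimes> e k) = z"
    by (subst expansion[of z, OF z[unfolded M_simps]], rule A.add.finprod_cong')
      (use z in \<open>auto simp: M_simps coord_closed struct_closed basis_closed\<close>)
  ultimately show "(\<lambda>f\<in>carrier (free_module R n). \<Oplus>k\<in>{..<n}. \<iota> (f k) \<otimes> e k)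
      ((\<lambda>z\<in>carrier A. \<lambda>k\<in>{..<n}. c k z) z) = z"
    using z by (simp add: M_simps)
qed

lemma faithful_M: "faithful_module R M"
  unfolding faithful_module_def
proof (intro ballI impI)
  fix r assume r: "r \<in> carrier R" "\<forall>z\<in>carrier M. r \<odot>\<^bsub>M\<^esub> z = \<zero>\<^bsub>M\<^esub>"
  then have "\<iota> r \<otimes> \<one> = \<zero>" by (metis M_simps A.one_closed)
  then have "\<iota> r = \<iota> \<zero>\<^bsub>R\<^esub>" using r by (simp add: struct_closed struct_zero)
  then show "r = \<zero>\<^bsub>R\<^esub>" using r struct_inj by (simp add: inj_on_eq_iff)
qed

section \<open>The canonical map from \<open>A \<otimes> A^op\<close> to the endomorphisms of
  \<open>A\<close>\<close>

abbreviation End_M where "End_M \<equiv> endomorphism_group R M"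
abbreviation FG where "FG \<equiv> free_Abelian_group (carrier A \<times> carrier A)"
abbreviation N where "N \<equiv> tensor_kernel R M M"

lemma End_M_D:
  assumes "f \<in> carrier End_M"
  shows "z \<in> carrier A \<Longrightarrow> f z \<in> carrier A" "f \<in> extensional (carrier A)"
    "\<lbrakk>z \<in> carrier A; w \<in> carrier A\<rbrakk> \<Longrightarrow> f (z \<oplus> w) = f z \<oplus> f w"
    "\<lbrakk>r \<in> carrier R; z \<in> carrier A\<rbrakk> \<Longrightarrow> f (\<iota> r \<otimes> z) = \<iota> r \<otimes> f z"
  using assms by (auto simp: endomorphism_group_def module_homs_def M_simps PiE_iff)

lemma End_M_I:
  assumes "\<And>z. z \<in> carrier A \<Longrightarrow> f z \<in> carrier A"
    "\<And>z w. \<lbrakk>z \<in> carrier A; w \<in> carrier A\<rbrakk> \<Longrightarrow> f (z \<oplus> w) = f z \<oplus> f w"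
    "\<And>r z. \<lbrakk>r \<in> carrier R; z \<in> carrier A\<rbrakk> \<Longrightarrow> f (\<iota> r \<otimes> z) = \<iota> r \<otimes> f z"
  shows "(\<lambda>z\<in>carrier A. f z) \<in> carrier End_M"
  using assms by (auto simp: endomorphism_group_def module_homs_def M_simps struct_closed)

lemma End_M_mult: "f \<otimes>\<^bsub>End_M\<^esub> g = (\<lambda>z\<in>carrier A. f z \<oplus> g z)"
  by (simp add: endomorphism_group_def M_simps)

lemma End_M_one: "\<one>\<^bsub>End_M\<^esub> = (\<lambda>z\<in>carrier A. \<zero>)"
  by (simp add: endomorphism_group_def M_simps)

lemma End_M_comm_group: "comm_group End_M"
proof (rule comm_groupI)
  fix f g assume "f \<in> carrier End_M" "g \<in> carrier End_M"
  then show "f \<otimes>\<^bsub>End_M\<^esub> g \<in> carrier End_M"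
    unfolding End_M_mult by (intro End_M_I) (auto simp: End_M_D A.r_distr A.a_ac struct_closed)
next
  show "\<one>\<^bsub>End_M\<^esub> \<in> carrier End_M"
    unfolding End_M_one by (intro End_M_I) (auto simp: struct_closed)
next
  fix f assume f: "f \<in> carrier End_M"
  show "\<one>\<^bsub>End_M\<^esub> \<otimes>\<^bsub>End_M\<^esub> f = f"
    unfolding End_M_mult End_M_one
    by (rule extensionalityI[of _ "carrier A"]) (auto simp: End_M_D[OF f])
  show "\<exists>g\<in>carrier End_M. g \<otimes>\<^bsub>End_M\<^esub> f = \<one>\<^bsub>End_M\<^esub>"
  proof (rule bexI)
    show "(\<lambda>z\<in>carrier A. \<ominus> f z) \<in> carrier End_M"
      by (intro End_M_I) (auto simp: End_M_D[OF f] A.minus_add A.r_minus struct_closed)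
    show "(\<lambda>z\<in>carrier A. \<ominus> f z) \<otimes>\<^bsub>End_M\<^esub> f = \<one>\<^bsub>End_M\<^esub>"
      unfolding End_M_mult End_M_one
      by (rule extensionalityI[of _ "carrier A"]) (auto simp: End_M_D[OF f] A.l_neg)
  qed
qed (auto simp: End_M_mult End_M_D A.a_ac intro!: restrict_ext)

lemma bimod_op_End:
  assumes "bimod_op A g"
  shows "(\<lambda>z\<in>carrier A. g z) \<in> carrier End_M"
proof (rule End_M_I)
  fix r z assume "r \<in> carrier R" "z \<in> carrier A"
  then show "g (\<iota> r \<otimes> z) = \<iota> r \<otimes> g z"
    by (intro bimod_op_central[OF assms] struct_central struct_closed)
qed (use assms in \<open>auto simp: bimod_op_closed bimod_op_add\<close>)

lemma sandwich_End: "u \<in> carrier A \<Longrightarrow> v \<in> carrier A \<Longrightarrow> (\<lambda>z\<in>carrier A. u \<otimes> z \<otimes> v) \<in> carrier End_M"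
  by (intro bimod_op_End bimod_op.sandwich)

lemma tensor_relations_sub: "tensor_relations R M M \<subseteq> carrier FG"
proof -
  have "frag_of x - frag_of y - frag_of z \<in> carrier FG" "frag_of x - frag_of y \<in> carrier FG"
    if "x \<in> carrier A \<times> carrier A" "y \<in> carrier A \<times> carrier A" "z \<in> carrier A \<times> carrier A"
    for x y z :: "'a \<times> 'a"
    using that keys_diff[of "frag_of x - frag_of y" "frag_of z"] keys_diff[of "frag_of x" "frag_of y"]
    by (auto simp: subset_iff split: if_splits)
  then show ?thesis
    unfolding tensor_relations_def M_simps by (auto simp: struct_closed simp del: carrier_free_Abelian_group_iff)
qed

lemma N_subgroup: "subgroup N FG"
  unfolding tensor_kernel_def M_simps
  by (rule group.generate_is_subgroup) (auto intro: tensor_relations_sub[THEN subsetD] simp del: carrier_free_Abelian_group_iff)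

lemma N_rel: "x \<in> tensor_relations R M M \<Longrightarrow> x \<in> N"
  unfolding tensor_kernel_def by (rule generate.incl)

lemma N_zero: "0 \<in> N"
  using subgroup.one_closed[OF N_subgroup] by simp

lemma N_add: "x \<in> N \<Longrightarrow> y \<in> N \<Longrightarrow> x + y \<in> N"
  using subgroup.m_closed[OF N_subgroup] by simp

lemma N_minus: "x \<in> N \<Longrightarrow> - x \<in> N"
  using subgroup.m_inv_closed[OF N_subgroup] subgroup.mem_carrier[OF N_subgroup]
  by (metis carrier_free_Abelian_group_iff inv_free_Abelian_group)

lemma N_diff: "x \<in> N \<Longrightarrow> y \<in> N \<Longrightarrow> x - y \<in> N"
  using N_add[OF _ N_minus] by (metis add_uminus_conv_diff)

lemma N_sum: "(\<And>i. i \<in> I \<Longrightarrow> x i \<in> N) \<Longrightarrow> sum x I \<in> N"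
  by (induction I rule: infinite_finite_induct) (auto intro: N_zero N_add)

lemma N_rel_l:
  "\<lbrakk>u \<in> carrier A; u' \<in> carrier A; v \<in> carrier A\<rbrakk>
    \<Longrightarrow> frag_of (u \<oplus> u', v) - frag_of (u, v) - frag_of (u', v) \<in> N"
  by (rule N_rel, unfold tensor_relations_def M_simps) blast

lemma N_rel_r:
  "\<lbrakk>u \<in> carrier A; v \<in> carrier A; v' \<in> carrier A\<rbrakk>
    \<Longrightarrow> frag_of (u, v \<oplus> v') - frag_of (u, v) - frag_of (u, v') \<in> N"
  by (rule N_rel, unfold tensor_relations_def M_simps) blast

lemma N_rel_s:
  "\<lbrakk>r \<in> carrier R; u \<in> carrier A; v \<in> carrier A\<rbrakk>
    \<Longrightarrow> frag_of (\<iota> r \<otimes> u, v) - frag_of (u, \<iota> r \<otimes> v) \<in> N"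
  by (rule N_rel, unfold tensor_relations_def M_simps) blast

lemma N_zero_l: "v \<in> carrier A \<Longrightarrow> frag_of (\<zero>, v) \<in> N"
  using N_minus[OF N_rel_l[of \<zero> \<zero> v]] by simp

lemma N_zero_r: "v \<in> carrier A \<Longrightarrow> frag_of (v, \<zero>) \<in> N"
  using N_minus[OF N_rel_r[of v \<zero> \<zero>]] by simp

lemma N_expand_r:
  fixes m :: nat
  assumes "u \<in> carrier A" "\<And>k. k < m \<Longrightarrow> f k \<in> carrier A"
  shows "frag_of (u, \<Oplus>k\<in>{..<m}. f k) - (\<Sum>k<m. frag_of (u, f k)) \<in> N"
  using assms(2)
proof (induction m)
  case 0
  then show ?case using assms(1) by (simp add: N_zero_r)
next
  case (Suc m)
  have fs: "(\<Oplus>k\<in>{..<m}. f k) \<in> carrier A" by (intro A.finsum_closed) (auto intro: Suc)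
  have "(\<Oplus>k\<in>{..<Suc m}. f k) = (\<Oplus>k\<in>{..<m}. f k) \<oplus> f m"
    using Suc.prems fs by (simp add: lessThan_Suc A.finsum_insert Pi_iff A.a_comm)
  moreover have "frag_of (u, (\<Oplus>k\<in>{..<m}. f k) \<oplus> f m) - frag_of (u, \<Oplus>k\<in>{..<m}. f k) - frag_of (u, f m) \<in> N"
    by (rule N_rel_r) (use assms(1) fs Suc.prems in auto)
  ultimately show ?case using N_add[OF Suc.IH[OF Suc.prems]] by (fastforce simp: algebra_simps)
qed

text \<open>Expanding the second factor in the basis and moving the scalars across shows that the
  elements \<open>1 \<otimes> e k\<close> generate the tensor product as a left
  \<open>A\<close>-module. Uniqueness of the \<open>u k\<close> comes from
  \<open>sandwich_sum_zero\<close>.\<close>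

lemma tensor_normal_form:
  assumes "x \<in> carrier FG"
  shows "\<exists>u. (\<forall>k<n. u k \<in> carrier A) \<and> x - (\<Sum>k<n. frag_of (u k, e k)) \<in> N"
proof -
  let ?P = "\<lambda>x. \<exists>u. (\<forall>k<n. u k \<in> carrier A) \<and> x - (\<Sum>k<n. frag_of (u k, e k)) \<in> N"
  have "Poly_Mapping.keys x \<subseteq> carrier A \<times> carrier A" using assms by simp
  then show "?P x"
  proof (rule free_Abelian_group_induct[where P = ?P])
    have "0 - (\<Sum>k<n. frag_of (\<zero>, e k)) \<in> N"
      by (intro N_diff N_sum N_zero N_zero_l basis_closed) auto
    then show "?P 0" by (intro exI[of _ "\<lambda>k. \<zero>"]) auto
  next
    fix x y assume "?P x" "?P y"
    then obtain u v where u: "\<And>k. k < n \<Longrightarrow> u k \<in> carrier A" "x - (\<Sum>k<n. frag_of (u k, e k)) \<in> N"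
      and v: "\<And>k. k < n \<Longrightarrow> v k \<in> carrier A" "y - (\<Sum>k<n. frag_of (v k, e k)) \<in> N"
      by blast
    let ?w = "\<lambda>k. u k \<ominus> v k"
    have "frag_of (u k, e k) - frag_of (?w k, e k) - frag_of (v k, e k) \<in> N" if "k < n" for k
    proof -
      have "?w k \<oplus> v k = u k" using u(1) v(1) that by (simp add: A.minus_eq A.a_assoc A.l_neg)
      with N_rel_l[of "?w k" "v k" "e k"] show ?thesis using u(1) v(1) basis_closed that by simp
    qed
    then have "(\<Sum>k<n. frag_of (u k, e k) - frag_of (?w k, e k) - frag_of (v k, e k)) \<in> N"
      by (intro N_sum) auto
    then have "(\<Sum>k<n. frag_of (u k, e k)) - (\<Sum>k<n. frag_of (?w k, e k)) - (\<Sum>k<n. frag_of (v k, e k)) \<in> N"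
      by (simp only: sum_subtractf)
    from N_add[OF N_diff[OF u(2) v(2)] this]
    have "x - y - (\<Sum>k<n. frag_of (?w k, e k)) \<in> N"
      by (simp add: algebra_simps)
    then show "?P (x - y)" using u(1) v(1) by (intro exI[of _ ?w]) auto
  next
    fix a assume "a \<in> carrier A \<times> carrier A"
    then obtain u v where a: "a = (u, v)" and uv: "u \<in> carrier A" "v \<in> carrier A" by auto
    let ?w = "\<lambda>k. \<iota> (c k v) \<otimes> u"
    have "frag_of (u, v) - (\<Sum>k<n. frag_of (u, \<iota> (c k v) \<otimes> e k)) \<in> N"
      using N_expand_r[of u n "\<lambda>k. \<iota> (c k v) \<otimes> e k"] expansion[OF uv(2), symmetric] uv
      by (simp add: struct_closed coord_closed basis_closed)
    moreover have "(\<Sum>k<n. frag_of (?w k, e k) - frag_of (u, \<iota> (c k v) \<otimes> e k)) \<in> N"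
      by (intro N_sum N_rel_s) (use uv in \<open>auto simp: coord_closed basis_closed\<close>)
    then have "(\<Sum>k<n. frag_of (?w k, e k)) - (\<Sum>k<n. frag_of (u, \<iota> (c k v) \<otimes> e k)) \<in> N"
      by (simp only: sum_subtractf)
    ultimately have "frag_of (u, v) - (\<Sum>k<n. frag_of (u, \<iota> (c k v) \<otimes> e k))
       - ((\<Sum>k<n. frag_of (?w k, e k)) - (\<Sum>k<n. frag_of (u, \<iota> (c k v) \<otimes> e k))) \<in> N"
      by (rule N_diff)
    then have "frag_of a - (\<Sum>k<n. frag_of (?w k, e k)) \<in> N"
      by (simp add: algebra_simps a)
    then show "?P (frag_of a)" using uv by (intro exI[of _ ?w]) (auto simp: struct_closed coord_closed)
  qed
qed

text \<open>The hypothesis at \<open>z = a\<close>, multiplied by \<open>b\<close> on the right,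
  says that the sum of the \<open>u k \<otimes> (a \<otimes> e k \<otimes> b)\<close> vanishes; by
  additivity the same holds for the sum of the \<open>u k \<otimes> g (e k)\<close> with any
  bimodule operator \<open>g\<close>. Taking for \<open>g\<close> the coordinate number
  \<open>l\<close> leaves only \<open>u l\<close>.\<close>

lemma sandwich_sum_zero:
  assumes u: "\<And>k. k < n \<Longrightarrow> u k \<in> carrier A"
    and zero: "\<And>z. z \<in> carrier A \<Longrightarrow> (\<Oplus>k\<in>{..<n}. u k \<otimes> z \<otimes> e k) = \<zero>"
    and l: "l < n"
  shows "u l = \<zero>"
proof -
  have *: "(\<Oplus>k\<in>{..<n}. u k \<otimes> g (e k)) = \<zero>" if "bimod_op A g" for g
    using that
  proof (induction rule: bimod_op.induct)
    case (sandwich a b)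
    have "(\<Oplus>k\<in>{..<n}. u k \<otimes> (a \<otimes> e k \<otimes> b)) = (\<Oplus>k\<in>{..<n}. (u k \<otimes> a \<otimes> e k) \<otimes> b)"
      by (rule A.add.finprod_cong') (use u sandwich basis_closed in \<open>auto simp: A.m_assoc\<close>)
    also have "\<dots> = (\<Oplus>k\<in>{..<n}. u k \<otimes> a \<otimes> e k) \<otimes> b"
      by (rule A.finsum_ldistr[symmetric]) (use u sandwich basis_closed in auto)
    also have "\<dots> = \<zero>" using zero sandwich by simp
    finally show ?case .
  next
    case (add g h)
    have "(\<Oplus>k\<in>{..<n}. u k \<otimes> (g (e k) \<oplus> h (e k))) = (\<Oplus>k\<in>{..<n}. u k \<otimes> g (e k) \<oplus> u k \<otimes> h (e k))"
      by (rule A.add.finprod_cong') (use u add basis_closed in \<open>auto simp: A.r_distr bimod_op_closed\<close>)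
    also have "\<dots> = (\<Oplus>k\<in>{..<n}. u k \<otimes> g (e k)) \<oplus> (\<Oplus>k\<in>{..<n}. u k \<otimes> h (e k))"
      by (rule A.finsum_addf) (use u add basis_closed in \<open>auto simp: bimod_op_closed\<close>)
    finally show ?case using add by simp
  next
    case (cong g h)
    have "(\<Oplus>k\<in>{..<n}. u k \<otimes> h (e k)) = (\<Oplus>k\<in>{..<n}. u k \<otimes> g (e k))"
      by (rule A.add.finprod_cong') (use u cong basis_closed in \<open>auto simp: bimod_op_closed\<close>)
    then show ?case using cong by simp
  qed
  have "(\<Oplus>k\<in>{..<n}. u k \<otimes> \<iota> (c l (e k))) = (\<Oplus>k\<in>{..<n}. if l = k then u k else \<zero>)"
    by (rule A.add.finprod_cong') (use u l in \<open>auto simp: coord_basis struct_zero struct_one\<close>)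
  also have "\<dots> = u l"
    by (rule A.finsum_singleton) (use u l in auto)
  finally show ?thesis using *[OF coord_op[OF l]] by simp
qed

text \<open>For injectivity, a tensor in normal form that acts as zero has all its coefficients
  zero. For surjectivity, the coordinate functions are themselves in the image, and an endomorphism
  is assembled from its values on the basis.\<close>

theorem azumaya: "azumaya R \<iota> A"
proof -
  interpret E: comm_group End_M by (rule End_M_comm_group)
  interpret FG: comm_group FG by (rule abelian_free_Abelian_group)
  obtain h where h: "h \<in> hom FG End_M"
    and h_of: "\<And>x. x \<in> carrier A \<times> carrier A \<Longrightarrow> h (frag_of x) = (\<lambda>z\<in>carrier A. fst x \<otimes> z \<otimes> snd x)"
    by (rule E.free_Abelian_group_universal[of "\<lambda>x. \<lambda>z\<in>carrier A. fst x \<otimes> z \<otimes> snd x" "carrier A \<times> carrier A"])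
      (auto intro: sandwich_End)
  interpret h: group_hom FG End_M h
    by unfold_locales (rule h)
  have h_uv: "h (frag_of (u, v)) = (\<lambda>z\<in>carrier A. u \<otimes> z \<otimes> v)" if "u \<in> carrier A" "v \<in> carrier A" for u v
    using h_of[of "(u, v)"] that by simp
  have h_diff: "h (x - y) = h x \<otimes>\<^bsub>End_M\<^esub> inv\<^bsub>End_M\<^esub> h y" if "x \<in> carrier FG" "y \<in> carrier FG" for x y
  proof -
    have "h (x \<otimes>\<^bsub>FG\<^esub> inv\<^bsub>FG\<^esub> y) = h x \<otimes>\<^bsub>End_M\<^esub> inv\<^bsub>End_M\<^esub> h y"
      using that by (simp only: h.hom_mult h.hom_inv FG.inv_closed)
    then show ?thesis using that by simp
  qed
  have diff_one: "h (x - y) = \<one>\<^bsub>End_M\<^esub> \<longleftrightarrow> h x = h y" if "x \<in> carrier FG" "y \<in> carrier FG" for x y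
    unfolding h_diff[OF that]
    using E.inv_solve_right[of "\<one>\<^bsub>End_M\<^esub>" "h x" "h y"] h.hom_closed that by auto
  have diff_FG: "x - y \<in> carrier FG" if "x \<in> carrier FG" "y \<in> carrier FG" for x y
    using that keys_diff[of x y] by auto
  have rel: "h x = \<one>\<^bsub>End_M\<^esub>" if "x \<in> tensor_relations R M M" for x
  proof -
    have *: "h (frag_of (u,v) - frag_of (u',v') - frag_of (u'',v'')) = \<one>\<^bsub>End_M\<^esub>"
      if "u \<in> carrier A" "u' \<in> carrier A" "u'' \<in> carrier A" "v \<in> carrier A" "v' \<in> carrier A" "v'' \<in> carrier A"
        "\<And>z. z \<in> carrier A \<Longrightarrow> u \<otimes> z \<otimes> v = u' \<otimes> z \<otimes> v' \<oplus> u'' \<otimes> z \<otimes> v''" for u u' u'' v v' v''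
    proof -
      have "h (frag_of (u',v') \<otimes>\<^bsub>FG\<^esub> frag_of (u'',v'')) = h (frag_of (u', v')) \<otimes>\<^bsub>End_M\<^esub> h (frag_of (u'', v''))"
        by (rule h.hom_mult) (use that in auto)
      also have "\<dots> = h (frag_of (u, v))"
        using that by (auto simp: h_uv End_M_mult intro!: restrict_ext)
      finally have "h (frag_of (u,v) - (frag_of (u',v') + frag_of (u'',v''))) = \<one>\<^bsub>End_M\<^esub>"
        using that keys_add[of "frag_of (u',v')" "frag_of (u'',v'')"] by (subst diff_one) auto
      then show ?thesis by (simp add: algebra_simps)
    qed
    have **: "h (frag_of (u,v) - frag_of (u',v')) = \<one>\<^bsub>End_M\<^esub>"
      if "u \<in> carrier A" "u' \<in> carrier A" "v \<in> carrier A" "v' \<in> carrier A"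
        "\<And>z. z \<in> carrier A \<Longrightarrow> u \<otimes> z \<otimes> v = u' \<otimes> z \<otimes> v'" for u u' v v'
      using that by (subst diff_one) (auto simp: h_uv intro!: restrict_ext)
    have sc: "\<iota> r \<otimes> u \<otimes> z \<otimes> v = u \<otimes> z \<otimes> (\<iota> r \<otimes> v)"
      if "r \<in> carrier R" "u \<in> carrier A" "v \<in> carrier A" "z \<in> carrier A" for r u v z
    proof -
      have "\<iota> r \<otimes> (u \<otimes> z) \<otimes> v = (u \<otimes> z) \<otimes> \<iota> r \<otimes> v"
        using that by (subst struct_central) auto
      then show ?thesis using that struct_closed by (simp add: A.m_assoc)
    qed
    from that show ?thesis
      unfolding tensor_relations_def M_simps
      by (elim UnE CollectE exE conjE)
        (auto intro!: * ** simp: struct_closed sc A.l_distr A.r_distr)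
  qed
  have N_ker: "N \<subseteq> kernel FG End_M h"
    unfolding tensor_kernel_def M_simps
    by (rule FG.generate_subgroup_incl)
      (use rel tensor_relations_sub h.subgroup_kernel in
        \<open>auto simp: kernel_def simp del: carrier_free_Abelian_group_iff\<close>)
  have N_normal: "N \<lhd> FG" using N_subgroup by (rule FG.subgroup_imp_normal)
  obtain \<Theta> where \<Theta>: "\<Theta> \<in> hom (FG Mod N) End_M" "\<And>x. x \<in> carrier FG \<Longrightarrow> \<Theta> (N #>\<^bsub>FG\<^esub> x) = h x"
    using h.FactGroup_universal_kernel[OF N_normal N_ker] by blast
  have TP: "tensor_product R M M = FG Mod N"
    by (simp add: tensor_product_def M_simps)
  have h_sum: "h (\<Sum>k<m. frag_of (u k, v k)) = (\<lambda>z\<in>carrier A. \<Oplus>k\<in>{..<m}. u k \<otimes> z \<otimes> v k)"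
    if "\<And>k. k < m \<Longrightarrow> u k \<in> carrier A" "\<And>k. k < m \<Longrightarrow> v k \<in> carrier A" for u v and m :: nat
    using that
  proof (induction m)
    case 0
    then show ?case using h.hom_one by (simp add: End_M_one)
  next
    case (Suc m)
    have "h ((\<Sum>k<m. frag_of (u k, v k)) \<otimes>\<^bsub>FG\<^esub> frag_of (u m, v m)) =
       h (\<Sum>k<m. frag_of (u k, v k)) \<otimes>\<^bsub>End_M\<^esub> h (frag_of (u m, v m))"
      by (rule h.hom_mult) (auto intro!: sum_closed_free_Abelian_group Suc simp del: carrier_free_Abelian_group_iff)
    also have "\<dots> = (\<lambda>z\<in>carrier A. \<Oplus>k\<in>{..<Suc m}. u k \<otimes> z \<otimes> v k)"
      using Suc by (auto simp: h_uv End_M_mult lessThan_Suc A.finsum_insert Pi_iff A.a_comm A.finsum_closed intro!: restrict_ext)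
    finally show ?case by simp
  qed
  have inj: "x \<in> N" if x: "x \<in> carrier FG" and hx: "h x = \<one>\<^bsub>End_M\<^esub>" for x
  proof -
    obtain u where u: "\<And>k. k < n \<Longrightarrow> u k \<in> carrier A" "x - (\<Sum>k<n. frag_of (u k, e k)) \<in> N"
      using tensor_normal_form[OF x] by blast
    let ?s = "\<Sum>k<n. frag_of (u k, e k)"
    have s: "?s \<in> carrier FG"
      by (intro sum_closed_free_Abelian_group) (use u basis_closed in auto)
    have "h (x - ?s) = \<one>\<^bsub>End_M\<^esub>" using N_ker u(2) by (auto simp: kernel_def)
    then have "h ?s = \<one>\<^bsub>End_M\<^esub>" using diff_one[OF x s] hx by simp
    then have hs: "(\<lambda>z\<in>carrier A. \<Oplus>k\<in>{..<n}. u k \<otimes> z \<otimes> e k) = (\<lambda>z\<in>carrier A. \<zero>)"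
      using u basis_closed by (simp add: h_sum End_M_one)
    have "(\<Oplus>k\<in>{..<n}. u k \<otimes> z \<otimes> e k) = \<zero>" if "z \<in> carrier A" for z
      using fun_cong[OF hs, of z] that by simp
    then have "u l = \<zero>" if "l < n" for l
      using sandwich_sum_zero[of u l] u(1) that by blast
    then have "?s \<in> N" by (intro N_sum) (auto intro: N_zero_l basis_closed)
    from N_add[OF u(2) this] show ?thesis by simp
  qed
  have surj: "\<exists>x\<in>carrier FG. h x = (\<lambda>z\<in>carrier A. g z)" if "bimod_op A g" for g
    using that
  proof (induction rule: bimod_op.induct)
    case (sandwich u v)
    then show ?case by (intro bexI[of _ "frag_of (u, v)"]) (auto simp: h_uv)
  next
    case (add g g')
    then obtain x y where x: "x \<in> carrier FG" "h x = (\<lambda>z\<in>carrier A. g z)"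
      and y: "y \<in> carrier FG" "h y = (\<lambda>z\<in>carrier A. g' z)" by blast
    have "h (x \<otimes>\<^bsub>FG\<^esub> y) = (\<lambda>z\<in>carrier A. g z \<oplus> g' z)"
      using x y by (auto simp: h.hom_mult End_M_mult intro!: restrict_ext simp del: mult_free_Abelian_group carrier_free_Abelian_group_iff)
    then show ?case using FG.m_closed[OF x(1) y(1)] by blast
  next
    case (cong g g')
    have "(\<lambda>z\<in>carrier A. g' z) = (\<lambda>z\<in>carrier A. g z)" using cong by (intro restrict_ext) auto
    then show ?case using cong by simp
  qed
  have "bij_betw \<Theta> (carrier (FG Mod N)) (carrier End_M)"
  proof (rule bij_betw_imageI)
    show "inj_on \<Theta> (carrier (FG Mod N))"
    proof (rule inj_onI)
      fix K L assume XY: "K \<in> carrier (FG Mod N)" "L \<in> carrier (FG Mod N)" "\<Theta> K = \<Theta> L"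
      then obtain x y where x: "x \<in> carrier FG" "K = N #>\<^bsub>FG\<^esub> x" and y: "y \<in> carrier FG" "L = N #>\<^bsub>FG\<^esub> y"
        unfolding carrier_FactGroup by blast
      then have "h x = h y" using XY \<Theta>(2) by simp
      then have "x - y \<in> N" using inj[OF diff_FG] diff_one x y by blast
      then have "x \<otimes>\<^bsub>FG\<^esub> inv\<^bsub>FG\<^esub> y \<in> N" using y by simp
      then have "x \<in> N #>\<^bsub>FG\<^esub> y"
        using subgroup.rcos_module[OF N_subgroup FG.is_group y(1) x(1)] by blast
      from FG.repr_independence[OF this y(1) N_subgroup] show "K = L"
        using x(2) y(2) by simp
    qed
    show "\<Theta> ` carrier (FG Mod N) = carrier End_M"
    proof
      show "\<Theta> ` carrier (FG Mod N) \<subseteq> carrier End_M" using \<Theta>(1) by (auto simp: hom_def)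
      show "carrier End_M \<subseteq> \<Theta> ` carrier (FG Mod N)"
      proof
        \<comment> \<open>By linearity \<open>f z\<close> is the sum of the
          \<open>\<iota> (c k z) \<otimes> f (e k)\<close>: coordinates followed by right
          multiplications, hence a bimodule operator.\<close>
        fix f assume f: "f \<in> carrier End_M"
        have term_op: "bimod_op A (\<lambda>z. \<iota> (c k z) \<otimes> f (e k))" if "k < n" for k
        proof -
          have "bimod_op A (\<lambda>z. \<one> \<otimes> \<iota> (c k z) \<otimes> f (e k))"
            by (intro bimod_op_sandwich_comp coord_op that) (use f that basis_closed End_M_D in auto)
          then show ?thesis by (rule bimod_op.cong) (use that in \<open>auto simp: struct_closed coord_closed\<close>)
        qed
        have sum_op: "bimod_op A (\<lambda>z. \<Oplus>k\<in>{..<m}. \<iota> (c k z) \<otimes> f (e k))" if "m \<le> n" for m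
          using that
        proof (induction m)
          case 0
          have "bimod_op A (\<lambda>z. \<zero> \<otimes> z \<otimes> \<zero>)" by (intro bimod_op.sandwich) auto
          then show ?case by (rule bimod_op.cong) auto
        next
          case (Suc m)
          then have "bimod_op A (\<lambda>z. \<iota> (c m z) \<otimes> f (e m) \<oplus> (\<Oplus>k\<in>{..<m}. \<iota> (c k z) \<otimes> f (e k)))"
            by (intro bimod_op.add term_op) auto
          then show ?case
            by (rule bimod_op.cong)
              (use Suc.prems in \<open>auto simp: lessThan_Suc A.finsum_insert Pi_iff struct_closed coord_closed basis_closed End_M_D[OF f]\<close>)
        qed
        have f_sum: "f (\<Oplus>k\<in>{..<m}. \<iota> (r k) \<otimes> e k) = (\<Oplus>k\<in>{..<m}. \<iota> (r k) \<otimes> f (e k))"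
          if "m \<le> n" "\<And>k. k < n \<Longrightarrow> r k \<in> carrier R" for m r
          using that(1)
        proof (induction m)
          case 0
          have "f (\<iota> \<zero>\<^bsub>R\<^esub> \<otimes> \<zero>) = \<iota> \<zero>\<^bsub>R\<^esub> \<otimes> f \<zero>" by (rule End_M_D(4)[OF f]) auto
          then show ?case using End_M_D(1)[OF f, of \<zero>] by (simp add: struct_zero)
        next
          case (Suc m)
          then show ?case using that(2)
            by (simp add: lessThan_Suc A.finsum_insert Pi_iff struct_closed basis_closed End_M_D[OF f] A.finsum_closed)
        qed
        have "f = (\<lambda>z\<in>carrier A. \<Oplus>k\<in>{..<n}. \<iota> (c k z) \<otimes> f (e k))"
        proof (rule extensionalityI[of _ "carrier A"])
          fix z assume z: "z \<in> carrier A"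
          have "f z = f (\<Oplus>k\<in>{..<n}. \<iota> (c k z) \<otimes> e k)" by (rule arg_cong[OF expansion[OF z]])
          also have "\<dots> = (\<Oplus>k\<in>{..<n}. \<iota> (c k z) \<otimes> f (e k))"
            by (rule f_sum) (auto simp: coord_closed z)
          finally show "f z = (\<lambda>z\<in>carrier A. \<Oplus>k\<in>{..<n}. \<iota> (c k z) \<otimes> f (e k)) z"
            using z by simp
        qed (auto simp: End_M_D[OF f])
        then obtain x where "x \<in> carrier FG" "h x = f" using surj[OF sum_op[of n]] by auto
        then have "f = \<Theta> (N #>\<^bsub>FG\<^esub> x)" "N #>\<^bsub>FG\<^esub> x \<in> carrier (FG Mod N)"
          using \<Theta>(2) unfolding carrier_FactGroup by auto
        then show "f \<in> \<Theta> ` carrier (FG Mod N)" by (rule image_eqI)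
      qed
    qed
  qed
  then have "\<Theta> \<in> iso (tensor_product R M M) End_M" using \<Theta>(1) by (simp add: TP iso_def)
  moreover have "\<Theta> (pure_tensor R M M u v) = (\<lambda>z\<in>carrier A. u \<otimes> z \<otimes> v)"
    if "u \<in> carrier A" "v \<in> carrier A" for u v
    using that \<Theta>(2)[of "frag_of (u, v)"] h_uv by (simp add: pure_tensor_def M_simps)
  ultimately show ?thesis
    unfolding azumaya_def Let_def
    by (intro conjI assoc_algebra_axioms fg_projective_M faithful_M bexI[of _ \<Theta>] ballI) simp_all
qed

end

section \<open>Quantum integers\<close>

primrec qnum :: "('r, 'm) ring_scheme \<Rightarrow> 'r \<Rightarrow> nat \<Rightarrow> 'r" where
  "qnum R q 0 = \<zero>\<^bsub>R\<^esub>"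
| "qnum R q (Suc k) = qnum R q k \<oplus>\<^bsub>R\<^esub> q [^]\<^bsub>R\<^esub> k"

context cring
begin

lemma qnum_closed [simp]: "q \<in> carrier R \<Longrightarrow> qnum R q k \<in> carrier R"
  by (induction k) auto

lemma qnum_add:
  assumes q: "q \<in> carrier R"
  shows "qnum R q (m + n) = qnum R q m \<oplus> q [^] m \<otimes> qnum R q n"
  by (induction n) (use q in \<open>simp_all add: r_distr a_assoc nat_pow_mult\<close>)

lemma qnum_one [simp]: "q \<in> carrier R \<Longrightarrow> qnum R q (Suc 0) = \<one>" by simp

lemma qnum_Suc': "q \<in> carrier R \<Longrightarrow> qnum R q (Suc k) = \<one> \<oplus> q \<otimes> qnum R q k"
  using qnum_add[of q 1 k] by simp

text \<open>The \<open>m * n\<close> powers of \<open>q\<close> fall into \<open>n\<close> blocks of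
  length \<open>m\<close>, and each block is a power of \<open>q [^] m\<close> times the
  first.\<close>

lemma qnum_mult:
  assumes q: "q \<in> carrier R"
  shows "qnum R q (m * n) = qnum R q m \<otimes> qnum R (q [^] m) n"
proof (induction n)
  case (Suc n)
  have "qnum R q (m * Suc n) = qnum R q (m * n) \<oplus> q [^] (m * n) \<otimes> qnum R q m"
    using qnum_add[OF q, of "m * n" m] by (simp add: add.commute)
  then show ?case using q Suc by (simp add: r_distr nat_pow_pow m_comm)
qed (use q in simp)

lemma pow_eq_qnum:
  assumes q: "q \<in> carrier R"
  shows "q [^] k = \<one> \<oplus> (q \<ominus> \<one>) \<otimes> qnum R q k"
proof (induction k)
  case (Suc k)
  have "q [^] k \<otimes> q = q [^] k \<oplus> (q \<ominus> \<one>) \<otimes> q [^] k"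
  proof -
    have "t \<otimes> q = t \<oplus> (q \<ominus> \<one>) \<otimes> t" if "t \<in> carrier R" for t
      using that q by (simp add: minus_eq l_distr l_minus a_ac r_neg2 r_neg1) (simp add: m_comm)
    then show ?thesis using q by simp
  qed
  also have "\<dots> = \<one> \<oplus> (q \<ominus> \<one>) \<otimes> qnum R q k \<oplus> (q \<ominus> \<one>) \<otimes> q [^] k"
    using Suc by simp
  finally show ?case using q by (simp add: r_distr a_assoc)
qed (use q in simp)

end

text \<open>What \<open>q = 1\<close> in characteristic p and a primitive p-th root of unity in a
  domain have in common.\<close>

locale qnum_vanishing = cring R for R (structure) +
  fixes q :: 'a and p :: nat
  assumes q_closed [simp]: "q \<in> carrier R" and prime: "Factorial_Ring.prime p"
    and qnum_p: "qnum R q p = \<zero>"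
begin

lemma p_pos: "0 < p" using prime by (rule prime_gt_0_nat)
lemma p_gt_1: "1 < p" using prime by (rule prime_gt_1_nat)

lemma q_pow_p: "q [^] p = \<one>" using pow_eq_qnum[of q p] by (simp add: qnum_p)

lemma q_pow_mult_p: "q [^] (p * k) = \<one>"
  by (simp add: nat_pow_pow[symmetric] q_pow_p)

lemma qnum_mult_p: "qnum R q (p * k) = \<zero>"
  by (simp add: qnum_mult qnum_p)

text \<open>With \<open>k * m = p * l + 1\<close> from Bezout, the quantum integer of
  \<open>k\<close> times that of \<open>m\<close> at base \<open>q [^] k\<close> is the quantum
  integer of \<open>p * l + 1\<close>. The latter is 1, because multiples of p give zero and
  \<open>q [^] (p * l)\<close> is 1.\<close>

lemma qnum_unit:
  assumes "0 < k" "k < p"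
  shows "qnum R q k \<in> Units R"
proof -
  have "coprime k p" using assms prime
    by (metis coprime_commute nat_dvd_not_less prime_imp_coprime)
  then obtain m l where ml: "k * m = p * l + 1"
    using assms(1) bezout_nat[of k p] by (metis coprime_iff_gcd_eq_1 not_gr0)
  have "qnum R q k \<otimes> qnum R (q [^] k) m = qnum R q (p * l + 1)"
    by (simp add: qnum_mult[symmetric] ml)
  also have "\<dots> = \<one>" by (simp add: qnum_mult_p q_pow_mult_p)
  finally have "qnum R q k \<otimes> qnum R (q [^] k) m = \<one>" .
  moreover have "qnum R (q [^] k) m \<otimes> qnum R q k = qnum R q k \<otimes> qnum R (q [^] k) m"
    by (simp add: m_comm)
  ultimately show ?thesis unfolding Units_def by auto
qed

text \<open>The falling q-factorial, that is, the scalar produced by \<open>n\<close> q-derivatives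
  of a j-th power. For \<open>n > j\<close> the truncated subtraction makes one factor the quantum
  integer of 0, so the value is zero as it should be.\<close>

primrec qfall :: "nat \<Rightarrow> nat \<Rightarrow> 'a" where
  "qfall j 0 = \<one>"
| "qfall j (Suc n) = qfall j n \<otimes> qnum R q (j - n)"

lemma qfall_closed [simp]: "qfall j n \<in> carrier R"
  by (induction n) auto

lemma qfall_zero: "k < n \<Longrightarrow> qnum R q (j - k) = \<zero> \<Longrightarrow> qfall j n = \<zero>"
  by (induction n) (auto simp: less_Suc_eq)

lemma qfall_unit: "n \<le> j \<Longrightarrow> j < p \<Longrightarrow> qfall j n \<in> Units R"
  by (induction n) (auto intro!: Units_m_closed qnum_unit)

text \<open>The p - 1 consecutive indices from \<open>j\<close> downwards contain a multiple of p
  unless \<open>j\<close> is congruent to -1 modulo p. For \<open>j < p - 1\<close> this multiple is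
  0, for \<open>j \<ge> p\<close> it is p itself.\<close>

lemma qfall_top_zero:
  assumes "j \<noteq> p - 1" "j < 2 * p - 1"
  shows "qfall j (p - 1) = \<zero>"
proof (cases "j < p - 1")
  case True
  then show ?thesis by (intro qfall_zero[of j]) auto
next
  case False
  then show ?thesis using assms by (intro qfall_zero[of "j - p"]) (auto simp: qnum_p)
qed

text \<open>The inverse of \<open>q [^] k\<close> as a natural power, so that no inverse has to be
  chosen.\<close>

lemma q_inverse: "q [^] ((p - 1) * k) \<otimes> q [^] k = \<one>"
proof -
  have "(p - 1) * k + k = p * k" using p_pos by (simp add: algebra_simps diff_mult_distrib)
  then show ?thesis by (simp add: nat_pow_mult q_pow_mult_p)
qed

end

section \<open>Quantum Weyl algebras\<close>

locale weyl_pair = central_algebra R \<iota> A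
  for R :: "('r, 'm) ring_scheme" and \<iota> :: "'r \<Rightarrow> 'a" and A :: "('a, 'n) ring_scheme" (structure) +
  fixes q :: 'r and x y :: 'a
  assumes q_closed [simp]: "q \<in> carrier R" and x_closed [simp]: "x \<in> carrier A"
    and y_closed [simp]: "y \<in> carrier A"
    and weyl: "x \<otimes> y = q \<bullet> (y \<otimes> x) \<oplus> \<one>"
begin

abbreviation (input) qn where "qn \<equiv> qnum R q"

text \<open>The q-Leibniz rule: up to the twist, \<open>x\<close> differentiates powers of
  \<open>y\<close>. At \<open>j = 0\<close> the truncated exponent is harmless, because its
  coefficient is zero.\<close>

lemma x_y_pow: "x \<otimes> y [^] j = (q [^]\<^bsub>R\<^esub> j) \<bullet> (y [^] j \<otimes> x) \<oplus> qn j \<bullet> y [^] (j - 1)"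
proof (induction j)
  case 0
  then show ?case by (simp add: scale_simps)
next
  case (Suc j)
  have yj: "qn j \<bullet> (y [^] (j - Suc 0) \<otimes> y) = qn j \<bullet> y [^] j"
    by (cases j) (simp_all add: scale_simps)
  have "x \<otimes> y [^] Suc j = (x \<otimes> y [^] j) \<otimes> y"
    by (simp add: A.m_assoc)
  also have "\<dots> = (q [^]\<^bsub>R\<^esub> j) \<bullet> (y [^] j \<otimes> (x \<otimes> y)) \<oplus> qn j \<bullet> y [^] j"
    unfolding Suc by (simp add: A.l_distr scale_simps A.m_assoc yj)
  also have "\<dots> = (q [^]\<^bsub>R\<^esub> Suc j) \<bullet> (y [^] Suc j \<otimes> x) \<oplus> qn (Suc j) \<bullet> y [^] j"
    unfolding weyl by (simp add: A.r_distr scale_simps scale_add_left A.m_assoc A.a_ac)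
  finally show ?case by simp
qed

lemma x_Suc: "x [^] Suc i = x \<otimes> x [^] i"
  by (rule A.nat_pow_Suc2) simp

lemma x_comm_pow: "x \<otimes> x [^] (i::nat) = x [^] i \<otimes> x"
  using x_Suc by simp

lemma x_pow_y: "x [^] i \<otimes> y = (q [^]\<^bsub>R\<^esub> i) \<bullet> (y \<otimes> x [^] i) \<oplus> qn i \<bullet> x [^] (i - 1)"
proof (induction i)
  case 0
  then show ?case by (simp add: scale_simps)
next
  case (Suc i)
  have xi: "qn i \<bullet> (x \<otimes> x [^] (i - Suc 0)) = qn i \<bullet> x [^] i"
    by (cases i) (simp_all add: scale_simps x_comm_pow)
  have "x [^] Suc i \<otimes> y = x \<otimes> (x [^] i \<otimes> y)"
    unfolding x_Suc by (simp add: A.m_assoc)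
  also have "\<dots> = (q [^]\<^bsub>R\<^esub> i) \<bullet> ((x \<otimes> y) \<otimes> x [^] i) \<oplus> qn i \<bullet> x [^] i"
    unfolding Suc by (simp add: A.r_distr scale_simps A.m_assoc xi)
  also have "\<dots> = (q [^]\<^bsub>R\<^esub> Suc i) \<bullet> (y \<otimes> (x \<otimes> x [^] i)) \<oplus> qn (Suc i) \<bullet> x [^] i"
    unfolding weyl by (simp add: A.l_distr scale_simps scale_add_left A.m_assoc A.a_ac)
  finally show ?case unfolding x_Suc by simp
qed

text \<open>By \<open>weyl\<close> this is the commutator
  \<open>x \<otimes> y \<ominus> y \<otimes> x\<close>. It is the factor by which commutators with
  powers differ from q-derivatives.\<close>

definition \<gamma> where "\<gamma> = \<one> \<oplus> (q \<ominus>\<^bsub>R\<^esub> \<one>\<^bsub>R\<^esub>) \<bullet> (y \<otimes> x)"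

lemma \<gamma>_closed [simp]: "\<gamma> \<in> carrier A"
  by (simp add: \<gamma>_def scale_closed)

lemma q_pow_qnum: "(q [^]\<^bsub>R\<^esub> j) = \<one>\<^bsub>R\<^esub> \<oplus>\<^bsub>R\<^esub> (q \<ominus>\<^bsub>R\<^esub> \<one>\<^bsub>R\<^esub>) \<otimes>\<^bsub>R\<^esub> qn j"
  by (rule R.pow_eq_qnum) simp

text \<open>Writing \<open>q^j\<close> as 1 plus \<open>q - 1\<close> times the quantum integer of
  \<open>j\<close> makes both remaining terms multiples of that integer; together they contain
  \<open>\<gamma>\<close> as a factor.\<close>

lemma commutator_x: "x \<otimes> y [^] j \<ominus> y [^] j \<otimes> x = qn j \<bullet> (y [^] (j - 1) \<otimes> \<gamma>)"
proof (cases j)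
  case (Suc k)
  let ?Y = "y [^] j \<otimes> x" and ?s = "(q \<ominus>\<^bsub>R\<^esub> \<one>\<^bsub>R\<^esub>) \<otimes>\<^bsub>R\<^esub> qn j"
  have "x \<otimes> y [^] j = ?Y \<oplus> ?s \<bullet> ?Y \<oplus> qn j \<bullet> y [^] (j - 1)"
    unfolding x_y_pow by (subst q_pow_qnum) (simp add: scale_add_left scale_one del: qnum.simps)
  then have "x \<otimes> y [^] j \<ominus> ?Y = ?s \<bullet> ?Y \<oplus> qn j \<bullet> y [^] (j - 1)"
    by (simp add: A.minus_eq A.a_ac A.r_neg scale_closed A.r_neg1 A.r_neg2 del: qnum.simps)
  also have "\<dots> = qn j \<bullet> (y [^] (j - 1) \<otimes> \<gamma>)"
    unfolding \<gamma>_def using Suc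
    by (simp add: A.r_distr scale_simps A.m_assoc R.m_comm A.a_ac del: qnum.simps)
  finally show ?thesis .
qed (simp add: A.minus_eq A.r_neg scale_simps)

lemma commutator_y: "x [^] i \<otimes> y \<ominus> y \<otimes> x [^] i = qn i \<bullet> (\<gamma> \<otimes> x [^] (i - 1))"
proof (cases i)
  case (Suc k)
  let ?X = "y \<otimes> x [^] i" and ?s = "(q \<ominus>\<^bsub>R\<^esub> \<one>\<^bsub>R\<^esub>) \<otimes>\<^bsub>R\<^esub> qn i"
  have "x [^] i \<otimes> y = ?X \<oplus> ?s \<bullet> ?X \<oplus> qn i \<bullet> x [^] (i - 1)"
    unfolding x_pow_y by (subst q_pow_qnum) (simp add: scale_add_left scale_one del: qnum.simps)
  then have "x [^] i \<otimes> y \<ominus> ?X = ?s \<bullet> ?X \<oplus> qn i \<bullet> x [^] (i - 1)"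
    by (simp add: A.minus_eq A.a_ac A.r_neg scale_closed A.r_neg1 A.r_neg2 del: qnum.simps)
  also have "\<dots> = qn i \<bullet> (\<gamma> \<otimes> x [^] (i - 1))"
    unfolding \<gamma>_def using Suc
    by (simp add: A.l_distr scale_simps A.m_assoc R.m_comm A.a_ac x_comm_pow del: qnum.simps)
  finally show ?thesis .
qed (simp add: A.minus_eq A.r_neg scale_simps)

text \<open>Meant for \<open>w\<close> inverse to \<open>\<gamma>\<close>. The commutator with
  \<open>x\<close> leaves \<open>\<gamma>\<close> at the right end of a monomial and the one with
  \<open>y\<close> at the left end, so \<open>w\<close> is multiplied on different sides. Both
  operators then act as exact q-derivatives on \<open>x^i y^j\<close>.\<close>

definition ad_x where "ad_x w z = (x \<otimes> z \<ominus> z \<otimes> x) \<otimes> w"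
definition ad_y where "ad_y w z = w \<otimes> (z \<otimes> y \<ominus> y \<otimes> z)"

lemma bimod_op_ad_x:
  assumes [simp]: "w \<in> carrier A"
  shows "bimod_op A (ad_x w)"
proof -
  have "bimod_op A (\<lambda>z. x \<otimes> z \<otimes> w \<oplus> \<one> \<otimes> z \<otimes> (\<ominus> (x \<otimes> w)))"
    by (intro bimod_op.intros) auto
  then show ?thesis
    by (rule bimod_op.cong) (simp add: ad_x_def A.minus_eq A.l_distr A.l_minus A.r_minus A.m_assoc)
qed

lemma bimod_op_ad_y:
  assumes [simp]: "w \<in> carrier A"
  shows "bimod_op A (ad_y w)"
proof -
  have "bimod_op A (\<lambda>z. w \<otimes> z \<otimes> y \<oplus> (\<ominus> (w \<otimes> y)) \<otimes> z \<otimes> \<one>)"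
    by (intro bimod_op.intros) auto
  then show ?thesis
    by (rule bimod_op.cong) (simp add: ad_y_def A.minus_eq A.r_distr A.l_minus A.r_minus A.m_assoc)
qed

lemma y_comm_pow: "y \<otimes> y [^] (i::nat) = y [^] i \<otimes> y"
  using A.nat_pow_Suc2[OF y_closed] by simp

lemma ad_x_monomial:
  fixes i j :: nat
  assumes [simp]: "w \<in> carrier A" and w: "\<gamma> \<otimes> w = \<one>"
  shows "ad_x w (x [^] i \<otimes> y [^] j) = qn j \<bullet> (x [^] i \<otimes> y [^] (j - 1))"
proof -
  have "x \<otimes> (x [^] i \<otimes> y [^] j) \<ominus> x [^] i \<otimes> y [^] j \<otimes> x = x [^] i \<otimes> (x \<otimes> y [^] j \<ominus> y [^] j \<otimes> x)"
    by (simp add: A.minus_eq A.r_distr A.r_minus A.m_assoc[symmetric] x_comm_pow)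
  also have "\<dots> = qn j \<bullet> (x [^] i \<otimes> (y [^] (j - 1) \<otimes> \<gamma>))"
    unfolding commutator_x by (simp add: scale_mult_right)
  finally show ?thesis
    unfolding ad_x_def by (simp add: scale_simps A.m_assoc w)
qed

lemma ad_y_monomial:
  fixes i j :: nat
  assumes [simp]: "w \<in> carrier A" and w: "w \<otimes> \<gamma> = \<one>"
  shows "ad_y w (x [^] i \<otimes> y [^] j) = qn i \<bullet> (x [^] (i - 1) \<otimes> y [^] j)"
proof -
  have "x [^] i \<otimes> y [^] j \<otimes> y \<ominus> y \<otimes> (x [^] i \<otimes> y [^] j) = (x [^] i \<otimes> y \<ominus> y \<otimes> x [^] i) \<otimes> y [^] j"
    by (simp add: A.minus_eq A.l_distr A.l_minus A.m_assoc y_comm_pow)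
  also have "\<dots> = qn i \<bullet> (\<gamma> \<otimes> (x [^] (i - 1) \<otimes> y [^] j))"
    unfolding commutator_y by (simp add: scale_mult_left A.m_assoc)
  finally show ?thesis
    unfolding ad_y_def by (simp add: scale_simps A.m_assoc[symmetric] w)
qed

end

section \<open>Reduction to monomials with exponents below p\<close>

locale weyl_relations = weyl_pair R \<iota> A q x y + qnum_vanishing R q p
  for R :: "('r, 'm) ring_scheme" and \<iota> :: "'r \<Rightarrow> 'a" and A :: "('a, 'n) ring_scheme" (structure)
    and q x y p +
  fixes a b :: 'r
  assumes a_closed [simp]: "a \<in> carrier R" and b_closed [simp]: "b \<in> carrier R"
    and x_pow_p: "x [^] p = \<iota> a" and y_pow_p: "y [^] p = \<iota> b"
begin

inductive_set monomial_span :: "'a set" where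
  monomial: "\<lbrakk>r \<in> carrier R; i < p; j < p\<rbrakk> \<Longrightarrow> r \<bullet> (x [^] i \<otimes> y [^] j) \<in> monomial_span"
| add: "\<lbrakk>u \<in> monomial_span; v \<in> monomial_span\<rbrakk> \<Longrightarrow> u \<oplus> v \<in> monomial_span"

lemma monomial_span_closed: "z \<in> monomial_span \<Longrightarrow> z \<in> carrier A"
  by (induction rule: monomial_span.induct) (auto simp: scale_closed)

lemma monomial_span_scale: "z \<in> monomial_span \<Longrightarrow> r \<in> carrier R \<Longrightarrow> r \<bullet> z \<in> monomial_span"
  by (induction rule: monomial_span.induct)
    (auto simp: scale_simps monomial_span_closed intro: monomial_span.intros)

text \<open>The right-hand side mentions only monomials with reduced exponents and scalars from
  \<open>R\<close>, so the same formula holds in every algebra with these relations.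
  \<open>weyl_hom\<close> compares two such algebras through it and through
  \<open>y_mult_monomial\<close>.\<close>

lemma x_mult_monomial:
  fixes i j :: nat
  assumes "r \<in> carrier R"
  shows "x \<otimes> (r \<bullet> (x [^] i \<otimes> y [^] j)) =
    (if Suc i = p then (r \<otimes>\<^bsub>R\<^esub> a) \<bullet> (x [^] (0::nat) \<otimes> y [^] j) else r \<bullet> (x [^] Suc i \<otimes> y [^] j))"
proof -
  have *: "x \<otimes> (r \<bullet> (x [^] i \<otimes> y [^] j)) = r \<bullet> (x [^] Suc i \<otimes> y [^] j)"
    unfolding x_Suc using assms by (simp add: scale_mult_right A.m_assoc)
  show ?thesis
  proof (cases "Suc i = p")
    case True
    have "r \<bullet> (x [^] p \<otimes> y [^] j) = (r \<otimes>\<^bsub>R\<^esub> a) \<bullet> (x [^] (0::nat) \<otimes> y [^] j)"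
      using assms by (simp add: x_pow_p scale_def struct_closed struct_mult A.m_assoc)
    then show ?thesis unfolding * using True by simp
  qed (simp add: * del: A.nat_pow_Suc)
qed

lemma y_mult_monomial:
  fixes i j :: nat
  assumes "r \<in> carrier R"
  shows "y \<otimes> (r \<bullet> (x [^] i \<otimes> y [^] j)) =
    (if Suc j = p then (q [^]\<^bsub>R\<^esub> ((p - 1) * i) \<otimes>\<^bsub>R\<^esub> r \<otimes>\<^bsub>R\<^esub> b) \<bullet> (x [^] i \<otimes> y [^] (0::nat))
      else (q [^]\<^bsub>R\<^esub> ((p - 1) * i) \<otimes>\<^bsub>R\<^esub> r) \<bullet> (x [^] i \<otimes> y [^] Suc j))
    \<oplus> (\<ominus>\<^bsub>R\<^esub> (q [^]\<^bsub>R\<^esub> ((p - 1) * i) \<otimes>\<^bsub>R\<^esub> r \<otimes>\<^bsub>R\<^esub> qn i)) \<bullet> (x [^] (i - 1) \<otimes> y [^] j)"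
proof -
  let ?s = "q [^]\<^bsub>R\<^esub> ((p - 1) * i)"
  \<comment> \<open>Multiplying \<open>x_pow_y\<close> by \<open>?s\<close>, the inverse of
    \<open>q^i\<close>, solves it for \<open>y \<otimes> x [^] i\<close>.\<close>
  have "?s \<bullet> (x [^] i \<otimes> y) = y \<otimes> x [^] i \<oplus> (?s \<otimes>\<^bsub>R\<^esub> qn i) \<bullet> x [^] (i - 1)"
    unfolding x_pow_y using q_inverse[of i] by (simp add: scale_simps del: qnum.simps)
  then have yx: "y \<otimes> x [^] i = ?s \<bullet> (x [^] i \<otimes> y) \<oplus> (\<ominus>\<^bsub>R\<^esub> (?s \<otimes>\<^bsub>R\<^esub> qn i)) \<bullet> x [^] (i - 1)"
    by (simp add: scale_uminus_left scale_simps A.a_assoc A.r_neg)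
  have "y \<otimes> (r \<bullet> (x [^] i \<otimes> y [^] j)) = r \<bullet> ((y \<otimes> x [^] i) \<otimes> y [^] j)"
    using assms by (simp add: scale_mult_right A.m_assoc)
  also have "\<dots> = (?s \<otimes>\<^bsub>R\<^esub> r) \<bullet> (x [^] i \<otimes> (y \<otimes> y [^] j))
      \<oplus> (\<ominus>\<^bsub>R\<^esub> (?s \<otimes>\<^bsub>R\<^esub> r \<otimes>\<^bsub>R\<^esub> qn i)) \<bullet> (x [^] (i - 1) \<otimes> y [^] j)"
    unfolding yx using assms
    by (simp add: A.l_distr A.l_minus scale_simps A.m_assoc scale_uminus_left R.m_ac)
  finally have *: "y \<otimes> (r \<bullet> (x [^] i \<otimes> y [^] j)) = (?s \<otimes>\<^bsub>R\<^esub> r) \<bullet> (x [^] i \<otimes> y [^] Suc j)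
      \<oplus> (\<ominus>\<^bsub>R\<^esub> (?s \<otimes>\<^bsub>R\<^esub> r \<otimes>\<^bsub>R\<^esub> qn i)) \<bullet> (x [^] (i - 1) \<otimes> y [^] j)"
    by (simp add: y_comm_pow)
  have "(?s \<otimes>\<^bsub>R\<^esub> r) \<bullet> (x [^] i \<otimes> y [^] p) = (?s \<otimes>\<^bsub>R\<^esub> r \<otimes>\<^bsub>R\<^esub> b) \<bullet> (x [^] i \<otimes> y [^] (0::nat))"
    using assms struct_central[OF b_closed, of "x [^] i"]
    by (simp add: y_pow_p scale_def struct_closed struct_mult A.m_assoc)
  then show ?thesis unfolding * by (auto simp del: A.nat_pow_Suc)
qed

lemma x_mult_span: "z \<in> monomial_span \<Longrightarrow> x \<otimes> z \<in> monomial_span"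
proof (induction rule: monomial_span.induct)
  case (monomial r i j)
  show ?case unfolding x_mult_monomial[OF monomial(1)]
    by (simp only: split: if_split, intro conjI impI monomial_span.monomial) (use monomial p_pos in auto)
next
  case (add u v)
  then show ?case by (simp add: A.r_distr monomial_span_closed monomial_span.add)
qed

lemma y_mult_span: "z \<in> monomial_span \<Longrightarrow> y \<otimes> z \<in> monomial_span"
proof (induction rule: monomial_span.induct)
  case (monomial r i j)
  show ?case unfolding y_mult_monomial[OF monomial(1)]
    by (rule monomial_span.add; (simp only: split: if_split)?; intro conjI impI monomial_span.monomial)
      (use monomial p_pos in auto)
next
  case (add u v)
  then show ?case by (simp add: A.r_distr monomial_span_closed monomial_span.add)
qed

lemma one_in_span: "\<one> \<in> monomial_span"
  using monomial_span.monomial[of "\<one>\<^bsub>R\<^esub>" 0 0] p_pos by (simp add: scale_one)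

lemma struct_in_span: "r \<in> carrier R \<Longrightarrow> \<iota> r \<in> monomial_span"
  using monomial_span_scale[OF one_in_span, of r] by (simp add: scale_def struct_closed)

lemma x_in_span: "x \<in> monomial_span" using x_mult_span[OF one_in_span] by simp
lemma y_in_span: "y \<in> monomial_span" using y_mult_span[OF one_in_span] by simp

lemma pow_mult_span:
  assumes "u \<in> carrier A" "\<And>z. z \<in> monomial_span \<Longrightarrow> u \<otimes> z \<in> monomial_span" "z \<in> monomial_span"
  shows "u [^] (i::nat) \<otimes> z \<in> monomial_span"
  using assms(3)
proof (induction i arbitrary: z)
  case (Suc i)
  then show ?case using assms(1) Suc.IH[OF assms(2)[OF Suc.prems]] by (simp add: A.m_assoc monomial_span_closed)
qed (simp add: monomial_span_closed)

lemma monomial_span_mult: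
  assumes "u \<in> monomial_span" "z \<in> monomial_span"
  shows "u \<otimes> z \<in> monomial_span"
  using assms(1)
proof (induction rule: monomial_span.induct)
  case (monomial r i j)
  have "x [^] i \<otimes> (y [^] j \<otimes> z) \<in> monomial_span"
    by (intro pow_mult_span x_mult_span y_mult_span assms(2)) auto
  from monomial_span_scale[OF this monomial(1)] show ?case
    using monomial assms(2) by (simp add: scale_simps A.m_assoc monomial_span_closed)
next
  case (add u v)
  then show ?case using assms(2) by (simp add: A.l_distr monomial_span_closed monomial_span.add)
qed

lemma monomial_span_subring: "subring monomial_span A"
proof (rule A.subringI)
  fix z assume z: "z \<in> monomial_span"
  then have "(\<ominus>\<^bsub>R\<^esub> \<one>\<^bsub>R\<^esub>) \<bullet> z \<in> monomial_span" by (intro monomial_span_scale) auto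
  then show "\<ominus> z \<in> monomial_span"
    using z by (simp add: scale_uminus_left scale_one monomial_span_closed)
qed (auto intro: monomial_span_closed one_in_span monomial_span_mult monomial_span.add)

end

section \<open>Coordinates by iterated q-derivatives\<close>

locale weyl_unit = weyl_relations R \<iota> A q x y p a b
  for R :: "('r, 'm) ring_scheme" and \<iota> :: "'r \<Rightarrow> 'a" and A :: "('a, 'n) ring_scheme" (structure)
    and q x y p a b +
  fixes d :: 'r
  assumes d_unit: "d \<in> Units R"
    and d_pow: "(\<one> \<oplus> (q \<ominus>\<^bsub>R\<^esub> \<one>\<^bsub>R\<^esub>) \<bullet> (x \<otimes> y)) [^] p = \<iota> d"
begin

text \<open>For \<open>q = 1\<close> this is 1; in the symbol algebra it is the given generator that
  q-commutes with \<open>x\<close>.\<close>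

definition \<beta> where "\<beta> = \<one> \<oplus> (q \<ominus>\<^bsub>R\<^esub> \<one>\<^bsub>R\<^esub>) \<bullet> (x \<otimes> y)"
definition \<beta>_inv where "\<beta>_inv = inv\<^bsub>R\<^esub> d \<bullet> \<beta> [^] (p - 1)"

lemma \<beta>_closed [simp]: "\<beta> \<in> carrier A"
  by (simp add: \<beta>_def scale_closed)

lemma d_closed [simp]: "d \<in> carrier R" using d_unit by auto
lemma inv_d_closed [simp]: "inv\<^bsub>R\<^esub> d \<in> carrier R" using d_unit by auto
lemma inv_d [simp]: "inv\<^bsub>R\<^esub> d \<otimes>\<^bsub>R\<^esub> d = \<one>\<^bsub>R\<^esub>" using d_unit by auto

lemma \<beta>_inv_closed [simp]: "\<beta>_inv \<in> carrier A"
  by (simp add: \<beta>_inv_def scale_closed)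

lemma \<beta>_pow_p: "\<beta> [^] p = \<iota> d" using d_pow by (simp add: \<beta>_def)

lemma \<beta>_inv: "\<beta> \<otimes> \<beta>_inv = \<one>" "\<beta>_inv \<otimes> \<beta> = \<one>"
proof -
  have "\<beta> [^] p = \<beta> [^] (p - 1) \<otimes> \<beta>" "\<beta> [^] p = \<beta> \<otimes> \<beta> [^] (p - 1)"
    using A.nat_pow_Suc[of \<beta> "p - 1"] A.nat_pow_Suc2[of \<beta> "p - 1"] p_pos by simp_all
  moreover have "inv\<^bsub>R\<^esub> d \<bullet> \<iota> d = \<one>"
    by (simp add: scale_def struct_mult[symmetric] struct_one)
  ultimately show "\<beta> \<otimes> \<beta>_inv = \<one>" "\<beta>_inv \<otimes> \<beta> = \<one>"
    by (simp_all add: \<beta>_inv_def scale_mult_left scale_mult_right \<beta>_pow_p)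
qed

text \<open>Substituting \<open>weyl\<close> for \<open>x \<otimes> y\<close> lets \<open>q\<close>
  be factored out. So \<open>\<gamma>\<close> inherits an inverse from \<open>\<beta>\<close>, whose
  p-th power is the unit \<open>d\<close>.\<close>

lemma \<beta>_\<gamma>: "\<beta> = q \<bullet> \<gamma>"
proof -
  have *: "(q \<ominus>\<^bsub>R\<^esub> \<one>\<^bsub>R\<^esub>) \<otimes>\<^bsub>R\<^esub> q = q \<otimes>\<^bsub>R\<^esub> (q \<ominus>\<^bsub>R\<^esub> \<one>\<^bsub>R\<^esub>)" by (simp add: R.m_comm)
  have "\<beta> = (\<one>\<^bsub>R\<^esub> \<oplus>\<^bsub>R\<^esub> (q \<ominus>\<^bsub>R\<^esub> \<one>\<^bsub>R\<^esub>)) \<bullet> \<one> \<oplus> (q \<otimes>\<^bsub>R\<^esub> (q \<ominus>\<^bsub>R\<^esub> \<one>\<^bsub>R\<^esub>)) \<bullet> (y \<otimes> x)"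
    unfolding \<beta>_def weyl by (simp add: scale_simps scale_add_left A.a_ac *)
  also have "\<one>\<^bsub>R\<^esub> \<oplus>\<^bsub>R\<^esub> (q \<ominus>\<^bsub>R\<^esub> \<one>\<^bsub>R\<^esub>) = q"
    by (simp add: R.minus_eq R.a_ac R.r_neg)
  finally show ?thesis unfolding \<gamma>_def by (simp add: scale_simps)
qed

definition \<gamma>_inv where "\<gamma>_inv = q \<bullet> \<beta>_inv"

lemma \<gamma>_inv_closed [simp]: "\<gamma>_inv \<in> carrier A"
  by (simp add: \<gamma>_inv_def scale_closed)

lemma \<gamma>_inv: "\<gamma> \<otimes> \<gamma>_inv = \<one>" "\<gamma>_inv \<otimes> \<gamma> = \<one>"
  using \<beta>_inv unfolding \<beta>_\<gamma> \<gamma>_inv_def by (simp_all add: scale_simps)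

lemma ad_x_pow_monomial:
  fixes i j :: nat
  shows "(ad_x \<gamma>_inv ^^ n) (x [^] i \<otimes> y [^] j) = qfall j n \<bullet> (x [^] i \<otimes> y [^] (j - n))"
proof (induction n)
  case (Suc n)
  then show ?case
    by (simp add: bimod_op_scale bimod_op_ad_x ad_x_monomial \<gamma>_inv scale_scale del: qnum.simps)
qed (simp add: scale_one)

lemma ad_y_pow_monomial:
  fixes i j :: nat
  shows "(ad_y \<gamma>_inv ^^ n) (x [^] i \<otimes> y [^] j) = qfall i n \<bullet> (x [^] (i - n) \<otimes> y [^] j)"
proof (induction n)
  case (Suc n)
  then show ?case
    by (simp add: bimod_op_scale bimod_op_ad_y ad_y_monomial \<gamma>_inv scale_scale del: qnum.simps)
qed (simp add: scale_one)

definition corner :: "'a \<Rightarrow> 'a" where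
  "corner z = (ad_x \<gamma>_inv ^^ (p - 1)) ((ad_y \<gamma>_inv ^^ (p - 1)) z)"

definition corner_scalar where
  "corner_scalar = qfall (p - 1) (p - 1) \<otimes>\<^bsub>R\<^esub> qfall (p - 1) (p - 1)"

lemma corner_scalar_unit: "corner_scalar \<in> Units R"
  unfolding corner_scalar_def using p_pos by (intro R.Units_m_closed qfall_unit) auto

text \<open>The range \<open>2 * p - 1\<close> covers the sums \<open>(p - 1 - k) + i\<close> with
  \<open>i, k < p\<close>. Only the exponent p - 1 survives on each side: below it the derivatives
  run past the constant, above it they meet the quantum integer of p.\<close>

lemma corner_monomial:
  fixes i j :: nat
  assumes "i < 2 * p - 1" "j < 2 * p - 1"
  shows "corner (x [^] i \<otimes> y [^] j) = (if i = p - 1 \<and> j = p - 1 then \<iota> corner_scalar else \<zero>)"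
proof -
  have "corner (x [^] i \<otimes> y [^] j) =
      (qfall i (p - 1) \<otimes>\<^bsub>R\<^esub> qfall j (p - 1)) \<bullet> (x [^] (i - (p - 1)) \<otimes> y [^] (j - (p - 1)))"
    unfolding corner_def ad_y_pow_monomial
    by (simp add: bimod_op_scale[OF bimod_op_funpow[OF bimod_op_ad_x]] ad_x_pow_monomial scale_scale)
  then show ?thesis
    using qfall_top_zero[OF _ assms(1)] qfall_top_zero[OF _ assms(2)]
    by (auto simp: scale_zero_left scale_def corner_scalar_def struct_closed struct_zero)
qed

text \<open>
  Multiplying by \<open>x\<^bsup>p-1-i\<^esup>\<close> and \<open>y\<^bsup>p-1-j\<^esup>\<close> moves the monomial \<open>x\<^bsup>i\<^esup>y\<^bsup>j\<^esup>\<close> to the corner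
  \<open>x\<^bsup>p-1\<^esup>y\<^bsup>p-1\<^esup>\<close>, the only one that survives \<open>p-1\<close> applications of both inner derivations.
\<close>

definition monomial_coordinate :: "nat \<Rightarrow> nat \<Rightarrow> 'a \<Rightarrow> 'a" where
  "monomial_coordinate i j z =
    inv\<^bsub>R\<^esub> corner_scalar \<bullet> corner (x [^] (p - 1 - i) \<otimes> z \<otimes> y [^] (p - 1 - j))"

lemma bimod_op_corner: "bimod_op A corner"
  unfolding corner_def[abs_def]
  by (intro bimod_op_comp[OF bimod_op_funpow bimod_op_funpow] bimod_op_ad_x bimod_op_ad_y) simp_all

lemma bimod_op_monomial_coordinate: "bimod_op A (monomial_coordinate i j)"
proof -
  have "bimod_op A (\<lambda>z. \<iota> (inv\<^bsub>R\<^esub> corner_scalar) \<otimes> corner (x [^] (p - 1 - i) \<otimes> z \<otimes> y [^] (p - 1 - j)) \<otimes> \<one>)"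
    using corner_scalar_unit
    by (intro bimod_op_sandwich_comp bimod_op_comp[OF bimod_op_corner] bimod_op.sandwich)
      (auto intro: struct_closed)
  then show ?thesis
    by (rule bimod_op.cong)
      (use corner_scalar_unit in
        \<open>simp add: monomial_coordinate_def scale_def struct_closed bimod_op_closed[OF bimod_op_corner]\<close>)
qed

lemma monomial_coordinate_monomial:
  fixes i j k l :: nat
  assumes "i < p" "j < p" "k < p" "l < p" "r \<in> carrier R"
  shows "monomial_coordinate k l (r \<bullet> (x [^] i \<otimes> y [^] j)) = (if i = k \<and> j = l then \<iota> r else \<zero>)"
proof -
  have m: "x [^] (p - 1 - k) \<otimes> (x [^] i \<otimes> y [^] j) \<otimes> y [^] (p - 1 - l)
      = x [^] (p - 1 - k + i) \<otimes> y [^] (j + (p - 1 - l))"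
    by (simp add: A.nat_pow_mult[symmetric] A.m_assoc)
  have "monomial_coordinate k l (x [^] i \<otimes> y [^] j) = (if i = k \<and> j = l then \<one> else \<zero>)"
    unfolding monomial_coordinate_def m using assms corner_scalar_unit R.Units_l_inv[OF corner_scalar_unit]
    by (subst corner_monomial)
      (auto simp: scale_def struct_closed struct_mult[symmetric] struct_one R.Units_closed)
  then show ?thesis
    using assms by (simp add: bimod_op_scale[OF bimod_op_monomial_coordinate])
      (simp add: scale_def struct_closed)
qed

end

locale weyl_algebra = weyl_unit R \<iota> A q x y p a b d
  for R :: "('r, 'm) ring_scheme" and \<iota> :: "'r \<Rightarrow> 'a" and A :: "('a, 'n) ring_scheme" (structure)
    and q x y p a b d +
  assumes struct_inj: "inj_on \<iota> (carrier R)"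
    and spanning: "carrier A \<subseteq> monomial_span"
begin

definition basis :: "nat \<Rightarrow> 'a" where
  "basis k = x [^] (k div p) \<otimes> y [^] (k mod p)"

definition coordinate :: "nat \<Rightarrow> 'a \<Rightarrow> 'r" where
  "coordinate k z = inv_into (carrier R) \<iota> (monomial_coordinate (k div p) (k mod p) z)"

lemma basis_closed: "basis k \<in> carrier A" by (simp add: basis_def)

lemma index_bounds: "k < p * p \<Longrightarrow> k div p < p" "k mod p < p"
  using p_pos by (auto simp: less_mult_imp_div_less)

lemma index_eq: "i < p \<Longrightarrow> j < p \<Longrightarrow> (k div p = i \<and> k mod p = j) \<longleftrightarrow> k = i * p + j"
  by auto

lemma index_less: "i < p \<Longrightarrow> j < p \<Longrightarrow> i * p + j < p * p"
  by (metis index_eq less_mult_imp_div_less div_less_iff_less_mult p_pos)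

text \<open>This is where spanning enters: on monomials the operator gives a scalar or zero, so all
  its values lie in the image of \<open>R\<close> and \<open>\<iota>\<close> can be inverted on
  them.\<close>

lemma monomial_coordinate_scalar:
  assumes "k < p" "l < p" "z \<in> carrier A"
  shows "monomial_coordinate k l z \<in> \<iota> ` carrier R"
proof -
  have "z \<in> monomial_span" using assms spanning by auto
  then show ?thesis
  proof (induction rule: monomial_span.induct)
    case (monomial r i j)
    then show ?case using assms
      by (auto simp: monomial_coordinate_monomial struct_zero[symmetric])
  next
    case (add u v)
    then have "monomial_coordinate k l (u \<oplus> v) = monomial_coordinate k l u \<oplus> monomial_coordinate k l v"
      by (intro bimod_op_add[OF bimod_op_monomial_coordinate] monomial_span_closed)
    then show ?case using add by (auto simp: struct_add[symmetric])
  qed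
qed

lemma coordinate_closed: "k < p * p \<Longrightarrow> z \<in> carrier A \<Longrightarrow> coordinate k z \<in> carrier R"
  unfolding coordinate_def by (intro inv_into_into monomial_coordinate_scalar index_bounds)

lemma struct_coordinate:
  "k < p * p \<Longrightarrow> z \<in> carrier A \<Longrightarrow> \<iota> (coordinate k z) = monomial_coordinate (k div p) (k mod p) z"
  unfolding coordinate_def by (intro f_inv_into_f monomial_coordinate_scalar index_bounds)

lemma coordinate_monomial:
  assumes "k < p * p" "i < p" "j < p" "r \<in> carrier R"
  shows "coordinate k (r \<bullet> (x [^] i \<otimes> y [^] j)) = (if k = i * p + j then r else \<zero>\<^bsub>R\<^esub>)"
proof -
  have "\<iota> (coordinate k (r \<bullet> (x [^] i \<otimes> y [^] j))) = \<iota> (if k = i * p + j then r else \<zero>\<^bsub>R\<^esub>)"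
    using assms index_eq[OF assms(2,3), of k] index_bounds(1)[OF assms(1)] index_bounds(2)[of k]
    by (subst struct_coordinate) (auto simp: scale_closed monomial_coordinate_monomial struct_zero)
  then show ?thesis
    by (rule inj_onD[OF struct_inj]) (use assms in \<open>auto intro!: coordinate_closed simp: scale_closed\<close>)
qed

sublocale coordinatized_algebra R \<iota> A "p * p" basis coordinate
proof unfold_locales
  show "inj_on \<iota> (carrier R)" by (rule struct_inj)
next
  fix k assume k: "k < p * p"
  show "basis k \<in> carrier A" by (rule basis_closed)
  show "bimod_op A (\<lambda>z. \<iota> (coordinate k z))"
    by (rule bimod_op.cong[OF bimod_op_monomial_coordinate]) (rule struct_coordinate[OF k])
  fix z assume "z \<in> carrier A"
  with k show "coordinate k z \<in> carrier R" by (rule coordinate_closed)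
next
  fix k l assume k: "k < p * p" and l: "l < p * p"
  have "coordinate k (basis l) = coordinate k (\<one>\<^bsub>R\<^esub> \<bullet> (x [^] (l div p) \<otimes> y [^] (l mod p)))"
    by (simp add: basis_def scale_one)
  then show "coordinate k (basis l) = (if k = l then \<one>\<^bsub>R\<^esub> else \<zero>\<^bsub>R\<^esub>)"
    using k l index_bounds by (simp add: coordinate_monomial)
next
  fix z assume "z \<in> carrier A"
  then have "z \<in> monomial_span" using spanning by auto
  then show "z = (\<Oplus>k\<in>{..<p * p}. \<iota> (coordinate k z) \<otimes> basis k)"
  proof (induction rule: monomial_span.induct)
    case (monomial r i j)
    let ?l = "i * p + j"
    have "(\<Oplus>k\<in>{..<p * p}. \<iota> (coordinate k (r \<bullet> (x [^] i \<otimes> y [^] j))) \<otimes> basis k)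
        = (\<Oplus>k\<in>{..<p * p}. if ?l = k then \<iota> r \<otimes> basis k else \<zero>)"
      using monomial
      by (intro A.add.finprod_cong') (auto simp: coordinate_monomial struct_zero struct_closed basis_closed)
    also have "\<dots> = \<iota> r \<otimes> basis ?l"
      using monomial index_less by (intro A.finsum_singleton) (auto simp: basis_closed struct_closed)
    also have "\<dots> = r \<bullet> (x [^] i \<otimes> y [^] j)"
      using monomial by (simp add: scale_def basis_def)
    finally show ?case by simp
  next
    case (add u v)
    have uv: "u \<in> carrier A" "v \<in> carrier A" using add monomial_span_closed by auto
    have c: "\<iota> (coordinate k (u \<oplus> v)) = \<iota> (coordinate k u) \<oplus> \<iota> (coordinate k v)" if "k < p * p" for k
      using that uv by (simp add: struct_coordinate bimod_op_add[OF bimod_op_monomial_coordinate])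
    have "(\<Oplus>k\<in>{..<p * p}. \<iota> (coordinate k (u \<oplus> v)) \<otimes> basis k)
       = (\<Oplus>k\<in>{..<p * p}. \<iota> (coordinate k u) \<otimes> basis k \<oplus> \<iota> (coordinate k v) \<otimes> basis k)"
      using uv by (intro A.add.finprod_cong') (auto simp: c A.l_distr coordinate_closed struct_closed basis_closed)
    also have "\<dots> = (\<Oplus>k\<in>{..<p * p}. \<iota> (coordinate k u) \<otimes> basis k)
        \<oplus> (\<Oplus>k\<in>{..<p * p}. \<iota> (coordinate k v) \<otimes> basis k)"
      using uv by (intro A.finsum_addf) (auto simp: coordinate_closed struct_closed basis_closed)
    also have "\<dots> = u \<oplus> v" by (simp only: add(3,4)[symmetric])
    finally show ?case by (rule sym)
  qed
qed

lemma basis_zero: "basis 0 = \<one>" by (simp add: basis_def)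

text \<open>Commuting with \<open>x\<close> and \<open>y\<close> means commuting with all monomials,
  so \<open>central_is_scalar\<close> applies. It identifies the fixed ring of
  \<open>\<sigma>\<close>.\<close>

lemma central_scalar:
  assumes s: "s \<in> carrier A" and sx: "s \<otimes> x = x \<otimes> s" and sy: "s \<otimes> y = y \<otimes> s"
  shows "s \<in> \<iota> ` carrier R"
proof (rule central_is_scalar[OF s _ _ basis_zero])
  have pow: "s \<otimes> u [^] (k::nat) = u [^] k \<otimes> s" if "u \<in> carrier A" "s \<otimes> u = u \<otimes> s" for u k
    by (induction k) (use that s in \<open>simp_all add: A.m_assoc[symmetric], simp add: A.m_assoc\<close>)
  show "s \<otimes> z = z \<otimes> s" if "z \<in> carrier A" for z
  proof -
    have "z \<in> monomial_span" using that spanning by auto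
    then show ?thesis
    proof (induction rule: monomial_span.induct)
      case (monomial r i j)
      have "s \<otimes> (x [^] i \<otimes> y [^] j) = (x [^] i \<otimes> y [^] j) \<otimes> s"
        using s pow[OF x_closed sx, of i] pow[OF y_closed sy, of j] by (metis A.m_assoc A.nat_pow_closed x_closed y_closed)
      then show ?case using s monomial(1) by (simp add: scale_mult_left scale_mult_right)
    next
      case (add u v)
      then show ?case using s by (simp add: A.l_distr A.r_distr monomial_span_closed)
    qed
  qed
qed (use p_pos in simp)

text \<open>\<open>A\<close> has the universal property of the algebra defined by the relations,
  also when it was built as an order and not by a presentation. The map is defined through
  coordinates. Left multiplication by \<open>x\<close> and by \<open>y\<close> follows the same
  formulas on monomials on both sides, and multiplicativity reduces to these two because the span
  consists of sums of scaled products of \<open>x\<close> and \<open>y\<close>.\<close>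

lemma weyl_hom:
  assumes "weyl_relations R \<kappa> Q q x' y' p a b"
  shows "\<exists>h \<in> ring_hom A Q. (\<forall>r\<in>carrier R. h (\<iota> r) = \<kappa> r) \<and> h x = x' \<and> h y = y'"
proof -
  interpret Q: weyl_relations R \<kappa> Q q x' y' p a b by fact
  define m where "m k = x' [^]\<^bsub>Q\<^esub> (k div p) \<otimes>\<^bsub>Q\<^esub> y' [^]\<^bsub>Q\<^esub> (k mod p)" for k
  have m_closed: "m k \<in> carrier Q" for k by (simp add: m_def)
  define h where "h z = finsum Q (\<lambda>k. \<kappa> (coordinate k z) \<otimes>\<^bsub>Q\<^esub> m k) {..<p * p}" for z
  have h_closed: "h z \<in> carrier Q" if "z \<in> carrier A" for z
    unfolding h_def using that by (intro Q.A.finsum_closed) (auto simp: coordinate_closed Q.struct_closed m_closed)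
  have h_add: "h (u \<oplus> v) = h u \<oplus>\<^bsub>Q\<^esub> h v" if uv: "u \<in> carrier A" "v \<in> carrier A" for u v
  proof -
    have "h (u \<oplus> v) = finsum Q (\<lambda>k. \<kappa> (coordinate k u) \<otimes>\<^bsub>Q\<^esub> m k \<oplus>\<^bsub>Q\<^esub> \<kappa> (coordinate k v) \<otimes>\<^bsub>Q\<^esub> m k) {..<p * p}"
      unfolding h_def using uv
      by (intro Q.A.add.finprod_cong')
        (auto simp: coord_add Q.struct_add Q.A.l_distr coordinate_closed Q.struct_closed m_closed)
    also have "\<dots> = h u \<oplus>\<^bsub>Q\<^esub> h v"
      unfolding h_def using uv
      by (intro Q.A.finsum_addf) (auto simp: coordinate_closed Q.struct_closed m_closed)
    finally show ?thesis .
  qed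
  have h_monomial: "h (r \<bullet> (x [^] i \<otimes> y [^] j)) = Q.scale r (x' [^]\<^bsub>Q\<^esub> i \<otimes>\<^bsub>Q\<^esub> y' [^]\<^bsub>Q\<^esub> j)"
    if "r \<in> carrier R" "i < p" "j < p" for r and i j :: nat
  proof -
    have "h (r \<bullet> (x [^] i \<otimes> y [^] j)) =
        finsum Q (\<lambda>k. if i * p + j = k then \<kappa> r \<otimes>\<^bsub>Q\<^esub> m k else \<zero>\<^bsub>Q\<^esub>) {..<p * p}"
      unfolding h_def using that
      by (intro Q.A.add.finprod_cong')
        (auto simp: coordinate_monomial Q.struct_zero Q.struct_closed m_closed)
    also have "\<dots> = \<kappa> r \<otimes>\<^bsub>Q\<^esub> m (i * p + j)"
      using that index_less by (intro Q.A.finsum_singleton) (auto simp: m_closed Q.struct_closed)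
    finally show ?thesis using that by (simp add: Q.scale_def m_def)
  qed
  \<comment> \<open>Lets \<open>h\<close> pass through the case distinctions in the two
    multiplication formulas.\<close>
  have h_if: "h (if c then r \<bullet> (x [^] i \<otimes> y [^] j) else s \<bullet> (x [^] k \<otimes> y [^] l)) =
      (if c then Q.scale r (x' [^]\<^bsub>Q\<^esub> i \<otimes>\<^bsub>Q\<^esub> y' [^]\<^bsub>Q\<^esub> j) else Q.scale s (x' [^]\<^bsub>Q\<^esub> k \<otimes>\<^bsub>Q\<^esub> y' [^]\<^bsub>Q\<^esub> l))"
    if "r \<in> carrier R" "s \<in> carrier R" "c \<Longrightarrow> i < p \<and> j < p" "\<not> c \<Longrightarrow> k < p \<and> l < p"
    for c r s and i j k l :: nat
    using that by (cases c) (simp_all add: h_monomial)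
  have h_x: "h (x \<otimes> z) = x' \<otimes>\<^bsub>Q\<^esub> h z" if "z \<in> monomial_span" for z
    using that
  proof (induction rule: monomial_span.induct)
    case (monomial r i j)
    have "h (x \<otimes> (r \<bullet> (x [^] i \<otimes> y [^] j))) = x' \<otimes>\<^bsub>Q\<^esub> Q.scale r (x' [^]\<^bsub>Q\<^esub> i \<otimes>\<^bsub>Q\<^esub> y' [^]\<^bsub>Q\<^esub> j)"
      unfolding x_mult_monomial[OF monomial(1)] Q.x_mult_monomial[OF monomial(1)]
      by (rule h_if) (use monomial p_pos in auto)
    then show ?case using monomial by (simp add: h_monomial)
  next
    case (add u v)
    then show ?case
      by (simp add: A.r_distr monomial_span_closed h_add Q.A.r_distr h_closed)
  qed
  have h_y: "h (y \<otimes> z) = y' \<otimes>\<^bsub>Q\<^esub> h z" if "z \<in> monomial_span" for z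
    using that
  proof (induction rule: monomial_span.induct)
    case (monomial r i j)
    have *: "i - 1 < p" using monomial by simp
    have "h (y \<otimes> (r \<bullet> (x [^] i \<otimes> y [^] j))) = y' \<otimes>\<^bsub>Q\<^esub> Q.scale r (x' [^]\<^bsub>Q\<^esub> i \<otimes>\<^bsub>Q\<^esub> y' [^]\<^bsub>Q\<^esub> j)"
      unfolding y_mult_monomial[OF monomial(1)] Q.y_mult_monomial[OF monomial(1)]
      by (subst h_add, (use monomial in \<open>auto simp: scale_closed\<close>)[2], subst h_monomial, (use monomial * in auto)[3],
          subst h_if) (use monomial p_pos in auto)
    then show ?case using monomial by (simp add: h_monomial)
  next
    case (add u v)
    then show ?case
      by (simp add: A.r_distr monomial_span_closed h_add Q.A.r_distr h_closed)
  qed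
  have h_scale: "h (r \<bullet> z) = Q.scale r (h z)" if "r \<in> carrier R" "z \<in> monomial_span" for r z
    using that(2)
  proof (induction rule: monomial_span.induct)
    case (monomial s i j)
    then show ?case using that(1)
      by (simp add: scale_scale h_monomial Q.scale_scale)
  next
    case (add u v)
    then show ?case using that(1)
      by (simp add: scale_add_right monomial_span_closed h_add scale_closed Q.scale_add_right h_closed)
  qed
  have h_pow: "h (u [^] n \<otimes> z) = v [^]\<^bsub>Q\<^esub> n \<otimes>\<^bsub>Q\<^esub> h z"
    if "u \<in> monomial_span" "v \<in> carrier Q" "\<And>z. z \<in> monomial_span \<Longrightarrow> h (u \<otimes> z) = v \<otimes>\<^bsub>Q\<^esub> h z"
      "z \<in> monomial_span" for u v z and n :: nat
    using that(4)
  proof (induction n arbitrary: z)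
    case 0
    then show ?case by (simp add: monomial_span_closed h_closed)
  next
    case (Suc n)
    then show ?case using that(1-3) Suc.IH[OF monomial_span_mult[OF that(1) Suc.prems]]
      by (simp add: A.m_assoc Q.A.m_assoc monomial_span_closed h_closed)
  qed
  have h_mult: "h (u \<otimes> z) = h u \<otimes>\<^bsub>Q\<^esub> h z" if "u \<in> monomial_span" "z \<in> monomial_span" for u z
    using that(1)
  proof (induction rule: monomial_span.induct)
    case (monomial r i j)
    have yz: "y [^] j \<otimes> z \<in> monomial_span"
      by (rule pow_mult_span[OF y_closed _ that(2)]) (rule y_mult_span)
    have xyz: "x [^] i \<otimes> (y [^] j \<otimes> z) \<in> monomial_span"
      by (rule pow_mult_span[OF x_closed _ yz]) (rule x_mult_span)
    have "h ((r \<bullet> (x [^] i \<otimes> y [^] j)) \<otimes> z) = h (r \<bullet> (x [^] i \<otimes> (y [^] j \<otimes> z)))"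
      using monomial that by (simp add: scale_simps A.m_assoc monomial_span_closed)
    also have "\<dots> = Q.scale r (x' [^]\<^bsub>Q\<^esub> i \<otimes>\<^bsub>Q\<^esub> (y' [^]\<^bsub>Q\<^esub> j \<otimes>\<^bsub>Q\<^esub> h z))"
      by (simp only: h_scale[OF monomial(1) xyz] h_pow[OF x_in_span Q.x_closed h_x yz]
          h_pow[OF y_in_span Q.y_closed h_y that(2)])
    also have "\<dots> = h (r \<bullet> (x [^] i \<otimes> y [^] j)) \<otimes>\<^bsub>Q\<^esub> h z"
      using monomial that h_closed[OF monomial_span_closed[OF that(2)]]
      by (simp add: h_monomial Q.scale_mult_left Q.A.m_assoc)
    finally show ?case .
  next
    case (add u v)
    then show ?case using that(2)
      by (simp add: A.l_distr monomial_span_closed h_add Q.A.l_distr h_closed)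
  qed
  have h_one: "h \<one> = \<one>\<^bsub>Q\<^esub>"
    using h_monomial[of "\<one>\<^bsub>R\<^esub>" 0 0] p_pos by (simp add: scale_one Q.scale_one)
  have "h \<in> ring_hom A Q"
    by (rule ring_hom_memI) (use spanning in \<open>auto intro: h_closed h_mult h_add h_one\<close>)
  moreover have "h (\<iota> r) = \<kappa> r" if "r \<in> carrier R" for r
    using h_scale[OF that one_in_span] that
    by (simp add: h_one scale_def Q.scale_def struct_closed Q.struct_closed)
  moreover have "h x = x'" "h y = y'"
    using h_x[OF one_in_span] h_y[OF one_in_span] by (simp_all add: h_one)
  ultimately show ?thesis by blast
qed

end

section \<open>The cyclic Galois extension generated by \<open>xy\<close>\<close>

context weyl_algebra
begin

definition u where "u = x \<otimes> y"
definition S where "S = adjoin R \<iota> A u"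

lemma u_closed [simp]: "u \<in> carrier A" by (simp add: u_def)

lemma generators_closed: "insert u (\<iota> ` carrier R) \<subseteq> carrier A"
  by (auto intro: struct_closed)

lemma S_sub: "S \<subseteq> carrier A"
  unfolding S_def adjoin_def by (rule A.generate_ring_incl[OF generators_closed])

lemma S_closed: "s \<in> S \<Longrightarrow> s \<in> carrier A" using S_sub by auto

lemma S_subring: "subring S A"
  unfolding S_def adjoin_def by (rule A.generate_ring_is_subring[OF generators_closed])

lemma S_ops:
  "\<one> \<in> S" "\<zero> \<in> S" "s \<in> S \<Longrightarrow> \<ominus> s \<in> S"
  "\<lbrakk>s \<in> S; t \<in> S\<rbrakk> \<Longrightarrow> s \<oplus> t \<in> S" "\<lbrakk>s \<in> S; t \<in> S\<rbrakk> \<Longrightarrow> s \<otimes> t \<in> S"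
  using subringE[OF S_subring] by auto

lemma u_in_S: "u \<in> S"
  unfolding S_def adjoin_def by (rule generate_ring.incl) simp

lemma struct_in_S: "r \<in> carrier R \<Longrightarrow> \<iota> r \<in> S"
  unfolding S_def adjoin_def by (rule generate_ring.incl) simp

lemma scale_in_S: "r \<in> carrier R \<Longrightarrow> s \<in> S \<Longrightarrow> r \<bullet> s \<in> S"
  by (simp add: scale_def struct_in_S S_ops)

lemma pow_in_S: "s \<in> S \<Longrightarrow> s [^] (k::nat) \<in> S"
  by (induction k) (simp_all add: S_ops)

lemma S_induct [consumes 1, case_names struct u uminus add mult]:
  assumes "s \<in> S" "\<And>r. r \<in> carrier R \<Longrightarrow> P (\<iota> r)" "P u"
    "\<And>s. s \<in> S \<Longrightarrow> P s \<Longrightarrow> P (\<ominus> s)"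
    "\<And>s t. s \<in> S \<Longrightarrow> t \<in> S \<Longrightarrow> P s \<Longrightarrow> P t \<Longrightarrow> P (s \<oplus> t)"
    "\<And>s t. s \<in> S \<Longrightarrow> t \<in> S \<Longrightarrow> P s \<Longrightarrow> P t \<Longrightarrow> P (s \<otimes> t)"
  shows "P s"
  using assms(1) unfolding S_def adjoin_def
proof (induction rule: generate_ring.induct)
  case one
  then show ?case using assms(2)[of "\<one>\<^bsub>R\<^esub>"] by (simp add: struct_one)
qed (use assms(2-) in \<open>auto simp: S_def adjoin_def\<close>)

lemma S_commute:
  assumes "s \<in> S" "t \<in> S"
  shows "s \<otimes> t = t \<otimes> s"
proof -
  \<comment> \<open>Commuting with \<open>u\<close> suffices for commuting with all of
    \<open>S\<close>; this is applied to \<open>z = u\<close> and then to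
    \<open>z = s\<close>.\<close>
  have step: "\<And>t. t \<in> S \<Longrightarrow> z \<otimes> t = t \<otimes> z" if z: "z \<in> carrier A" "z \<otimes> u = u \<otimes> z" for z
  proof -
    fix t assume "t \<in> S"
    then show "z \<otimes> t = t \<otimes> z"
    proof (induction rule: S_induct)
      case (struct r)
      then show ?case using z by (simp add: struct_central)
    next
      case (uminus s)
      then show ?case using z by (simp add: A.l_minus A.r_minus S_closed)
    next
      case (add s t)
      then show ?case using z by (simp add: A.l_distr A.r_distr S_closed)
    next
      case (mult s t)
      have "z \<otimes> (s \<otimes> t) = (z \<otimes> s) \<otimes> t"
        using mult(1,2) z by (simp add: A.m_assoc S_closed)
      also have "\<dots> = s \<otimes> (z \<otimes> t)"
        using mult(1,2) z unfolding mult(3) by (simp add: A.m_assoc S_closed)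
      also have "\<dots> = (s \<otimes> t) \<otimes> z"
        using mult(1,2) z unfolding mult(4) by (simp add: A.m_assoc S_closed)
      finally show ?case .
    qed (use z in simp)
  qed
  have "s \<otimes> u = u \<otimes> s" using step[of u s] assms by simp
  then show ?thesis using step[of s t] assms S_closed by simp
qed

lemma S_subcring: "subcring S A"
  by (rule A.subcringI[OF S_subring]) (rule S_commute)

abbreviation S_ring where "S_ring \<equiv> A\<lparr>carrier := S\<rparr>"

lemma S_cring: "cring S_ring"
  using S_subcring A.subcring_iff[OF S_sub] by simp

text \<open>\<open>t\<close> stands for the conjugate \<open>x s x^-1 = y^-1 s y\<close>, expressed
  without inverses. The first and third clauses both have \<open>t\<close> as a left factor, which
  is what \<open>annihilator_zero\<close> needs for uniqueness; the first and second make a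
  self-conjugate \<open>s\<close> commute with both generators.\<close>

definition conj where
  "conj s t \<longleftrightarrow> x \<otimes> s = t \<otimes> x \<and> s \<otimes> y = y \<otimes> t \<and> y [^] (p - 1) \<otimes> s = t \<otimes> y [^] (p - 1)"

text \<open>The k-th conjugate of \<open>u\<close>, as \<open>\<sigma>_pow_u\<close> confirms:
  iterating \<open>z \<mapsto> q z + 1\<close> adds up a quantum integer.\<close>

definition shifted_u where "shifted_u k = q [^]\<^bsub>R\<^esub> k \<bullet> u \<oplus> \<iota> (qn k)"

lemma shifted_u_closed [simp]: "shifted_u k \<in> carrier A"
  by (simp add: shifted_u_def scale_closed struct_closed)

lemma shifted_u_in_S: "shifted_u k \<in> S"
  by (simp add: shifted_u_def scale_in_S struct_in_S S_ops u_in_S)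

lemma shifted_u_Suc: "q \<bullet> shifted_u k \<oplus> \<one> = shifted_u (Suc k)"
  by (simp add: shifted_u_def scale_simps struct_closed R.qnum_Suc' struct_add struct_mult struct_one
      R.m_comm A.a_assoc del: qnum.simps)
    (simp add: scale_def A.a_comm struct_closed)

lemma shifted_u_0: "shifted_u 0 = u"
  by (simp add: shifted_u_def scale_simps struct_zero)

lemma shifted_u_p: "shifted_u p = u"
  by (simp add: shifted_u_def scale_simps struct_zero q_pow_p qnum_p)

lemma u_y: "u \<otimes> y = y \<otimes> shifted_u 1"
  unfolding u_def shifted_u_def
  by (subst (1) weyl) (simp add: A.l_distr A.r_distr scale_simps A.m_assoc struct_one)

lemma x_u: "x \<otimes> u = shifted_u 1 \<otimes> x"
  unfolding u_def shifted_u_def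
  by (subst (1) weyl) (simp add: A.l_distr A.r_distr scale_simps A.m_assoc struct_one)

lemma shifted_u_y: "shifted_u k \<otimes> y = y \<otimes> shifted_u (Suc k)"
proof -
  have "shifted_u k \<otimes> y = q [^]\<^bsub>R\<^esub> k \<bullet> (y \<otimes> shifted_u 1) \<oplus> y \<otimes> \<iota> (qn k)"
    unfolding u_y[symmetric] unfolding shifted_u_def
    by (simp add: A.l_distr scale_simps struct_closed struct_central del: qnum.simps)
  also have "\<dots> = y \<otimes> (q [^]\<^bsub>R\<^esub> k \<bullet> (q \<bullet> u \<oplus> \<one>) \<oplus> \<iota> (qn k))"
    by (simp add: A.r_distr scale_simps struct_closed struct_one shifted_u_def del: qnum.simps)
  also have "q [^]\<^bsub>R\<^esub> k \<bullet> (q \<bullet> u \<oplus> \<one>) \<oplus> \<iota> (qn k) = shifted_u (Suc k)"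
    by (simp add: scale_simps shifted_u_def struct_add A.a_ac struct_closed)
      (simp add: scale_def struct_closed A.a_ac)
  finally show ?thesis .
qed

lemma u_y_pow: "u \<otimes> y [^] (k::nat) = y [^] k \<otimes> shifted_u k"
proof (induction k)
  case (Suc k)
  then show ?case by (simp add: A.m_assoc[symmetric]) (simp add: A.m_assoc shifted_u_y)
qed (simp add: shifted_u_0)

text \<open>In the third clause, moving \<open>u\<close> across \<open>y [^] (p - 1)\<close> shifts
  it p - 1 times and the map \<open>z \<mapsto> q z + 1\<close> shifts it once more; p shifts are
  the identity.\<close>

lemma conj_u: "conj u (shifted_u 1)"
proof -
  have su: "shifted_u 1 = q \<bullet> u \<oplus> \<one>"
    using shifted_u_Suc[of 0] by (simp add: shifted_u_0)
  have "shifted_u 1 \<otimes> y [^] (p - 1) = q \<bullet> (u \<otimes> y [^] (p - 1)) \<oplus> y [^] (p - 1)"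
    unfolding su by (simp add: A.l_distr scale_simps)
  also have "\<dots> = y [^] (p - 1) \<otimes> (q \<bullet> shifted_u (p - 1) \<oplus> \<one>)"
    unfolding u_y_pow by (simp add: A.r_distr scale_simps)
  also have "\<dots> = y [^] (p - 1) \<otimes> u"
    unfolding shifted_u_Suc using p_pos by (simp add: shifted_u_p)
  finally show ?thesis by (simp add: conj_def x_u u_y del: One_nat_def)
qed

lemma conj_struct: "r \<in> carrier R \<Longrightarrow> conj (\<iota> r) (\<iota> r)"
  by (simp add: conj_def struct_central)

lemma conj_uminus: "\<lbrakk>conj s t; s \<in> S; t \<in> S\<rbrakk> \<Longrightarrow> conj (\<ominus> s) (\<ominus> t)"
  by (simp add: conj_def A.l_minus A.r_minus S_closed)

lemma conj_add: "\<lbrakk>conj s t; conj s' t'; s \<in> S; t \<in> S; s' \<in> S; t' \<in> S\<rbrakk> \<Longrightarrow> conj (s \<oplus> s') (t \<oplus> t')"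
  by (simp add: conj_def A.l_distr A.r_distr S_closed)

lemma conj_mult:
  assumes c: "conj s t" "conj s' t'" and [simp]: "s \<in> S" "t \<in> S" "s' \<in> S" "t' \<in> S"
  shows "conj (s \<otimes> s') (t \<otimes> t')"
proof -
  note [simp] = S_closed
  have *: "z \<otimes> (s \<otimes> s') = t \<otimes> t' \<otimes> z"
    if "z \<in> carrier A" "z \<otimes> s = t \<otimes> z" "z \<otimes> s' = t' \<otimes> z" for z
    using that by (simp add: A.m_assoc[symmetric]) (simp add: A.m_assoc)
  have "s \<otimes> s' \<otimes> y = y \<otimes> (t \<otimes> t')"
    using c by (simp add: conj_def A.m_assoc) (simp add: A.m_assoc[symmetric])
  then show ?thesis using * c by (simp add: conj_def)
qed

lemma conj_ex: "s \<in> S \<Longrightarrow> \<exists>t\<in>S. conj s t"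
proof (induction rule: S_induct)
  case (struct r)
  then show ?case using conj_struct struct_in_S by blast
next
  case u
  then show ?case using conj_u shifted_u_in_S by blast
next
  case (uminus s)
  then show ?case using conj_uminus S_ops by blast
next
  case (add s t)
  then show ?case using conj_add S_ops by metis
next
  case (mult s t)
  then show ?case using conj_mult S_ops by metis
qed

text \<open>Moving the first factor across \<open>y [^] k\<close> turns it into
  \<open>q^k (u - 1)\<close>, and \<open>u - 1 = q y x\<close> contributes the next \<open>y\<close>
  and \<open>x\<close>. It drives the descent in \<open>annihilator_zero\<close>.\<close>

lemma y_x_pow_Suc:
  "(u \<ominus> \<iota> (qn (Suc k))) \<otimes> (y [^] k \<otimes> x [^] k) = q [^]\<^bsub>R\<^esub> Suc k \<bullet> (y [^] Suc k \<otimes> x [^] Suc k)"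
proof -
  have "(u \<ominus> \<iota> (qn (Suc k))) \<otimes> y [^] k = y [^] k \<otimes> (shifted_u k \<ominus> \<iota> (qn (Suc k)))"
    by (simp add: A.minus_eq A.l_distr A.r_distr A.l_minus A.r_minus u_y_pow struct_closed struct_central
        del: qnum.simps)
  also have "shifted_u k \<ominus> \<iota> (qn (Suc k)) = q [^]\<^bsub>R\<^esub> k \<bullet> (u \<ominus> \<one>)"
  proof -
    have "shifted_u k \<ominus> \<iota> (qn (Suc k)) = q [^]\<^bsub>R\<^esub> k \<bullet> u \<oplus> (\<iota> (qn k) \<ominus> (\<iota> (qn k) \<oplus> \<iota> (q [^]\<^bsub>R\<^esub> k)))"
      by (simp add: shifted_u_def A.minus_eq A.a_assoc scale_closed struct_closed struct_add)
    also have "\<iota> (qn k) \<ominus> (\<iota> (qn k) \<oplus> \<iota> (q [^]\<^bsub>R\<^esub> k)) = \<ominus> (q [^]\<^bsub>R\<^esub> k \<bullet> \<one>)"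
      by (simp add: A.minus_eq A.minus_add A.r_neg2 struct_closed scale_def)
    finally show ?thesis by (simp add: A.minus_eq scale_simps)
  qed
  also have "u \<ominus> \<one> = q \<bullet> (y \<otimes> x)"
    unfolding u_def weyl by (simp add: A.minus_eq A.a_assoc A.r_neg scale_closed)
  finally have "(u \<ominus> \<iota> (qn (Suc k))) \<otimes> y [^] k = q [^]\<^bsub>R\<^esub> Suc k \<bullet> (y [^] Suc k \<otimes> x)"
    by (simp add: scale_simps A.m_assoc)
  then have "(u \<ominus> \<iota> (qn (Suc k))) \<otimes> y [^] k \<otimes> x [^] k = q [^]\<^bsub>R\<^esub> Suc k \<bullet> (y [^] Suc k \<otimes> x) \<otimes> x [^] k"
    by simp
  then show ?thesis
    unfolding x_Suc
    by (simp add: A.m_assoc struct_closed scale_mult_left del: qnum.simps A.nat_pow_Suc R.nat_pow_Suc)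
qed

text \<open>From \<open>t x = 0\<close> follows \<open>t u = 0\<close>. Starting with
  \<open>t y^(p-1) x^(p-1) = 0\<close>, the exponents are lowered by \<open>y_x_pow_Suc\<close>:
  multiplied by \<open>t\<close>, its left side becomes minus the quantum integer of
  \<open>l + 1\<close> times \<open>t y^l x^l\<close>, and that integer is a unit because
  \<open>0 < l + 1 < p\<close>. At exponent 0 nothing but \<open>t\<close> is left.\<close>

lemma annihilator_zero:
  assumes t: "t \<in> S" "t \<otimes> x = \<zero>" "t \<otimes> y [^] (p - 1) = \<zero>"
  shows "t = \<zero>"
proof -
  note [simp] = S_closed[OF t(1)]
  have tu: "t \<otimes> u = \<zero>" unfolding u_def using t(2) by (simp add: A.m_assoc[symmetric])
  have "t \<otimes> (y [^] (p - 1 - k) \<otimes> x [^] (p - 1 - k)) = \<zero>" if "k \<le> p - 1" for k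
    using that
  proof (induction k)
    case 0
    then show ?case using t(3) by (simp add: A.m_assoc[symmetric])
  next
    case (Suc k)
    define l where "l = p - 1 - Suc k"
    have l: "p - 1 - k = Suc l" "Suc l < p" using Suc.prems by (auto simp: l_def)
    let ?z = "y [^] l \<otimes> x [^] l"
    have "t \<otimes> ((u \<ominus> \<iota> (qn (Suc l))) \<otimes> ?z) = \<zero>"
      unfolding y_x_pow_Suc using Suc l
      by (simp add: scale_mult_right scale_zero_right del: R.nat_pow_Suc A.nat_pow_Suc)
    moreover have "t \<otimes> ((u \<ominus> \<iota> (qn (Suc l))) \<otimes> ?z) = (t \<otimes> (u \<ominus> \<iota> (qn (Suc l)))) \<otimes> ?z"
      by (simp add: A.m_assoc struct_closed del: qnum.simps)
    moreover have "t \<otimes> (u \<ominus> \<iota> (qn (Suc l))) = \<ominus> (qn (Suc l) \<bullet> t)"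
      by (simp add: A.minus_eq A.r_distr A.r_minus tu struct_closed struct_central scale_def del: qnum.simps)
    ultimately have "\<ominus> (qn (Suc l) \<bullet> (t \<otimes> ?z)) = \<zero>"
      by (simp add: A.l_minus scale_simps del: qnum.simps)
    then have "qn (Suc l) \<bullet> (t \<otimes> ?z) = \<zero>"
      by (metis A.minus_minus A.minus_zero scale_closed A.m_closed A.nat_pow_closed R.qnum_closed
          q_closed \<open>t \<in> carrier A\<close> x_closed y_closed)
    moreover have un: "qn (Suc l) \<in> Units R" by (rule qnum_unit) (use l in auto)
    ultimately have "inv\<^bsub>R\<^esub> qn (Suc l) \<bullet> (qn (Suc l) \<bullet> (t \<otimes> ?z)) = \<zero>"
      by (simp add: scale_zero_right del: qnum.simps)
    then have "t \<otimes> ?z = \<zero>"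
      using un by (simp add: scale_simps R.Units_l_inv del: qnum.simps)
    then show ?case by (simp add: l_def)
  qed
  from this[of "p - 1"] show ?thesis by simp
qed

lemma conj_unique:
  assumes "conj s t" "conj s t'" "s \<in> S" "t \<in> S" "t' \<in> S"
  shows "t = t'"
proof -
  have "t \<ominus> t' = \<zero>"
    by (rule annihilator_zero)
      (use assms in \<open>auto simp: conj_def A.minus_eq A.l_distr A.l_minus S_ops S_closed A.r_neg\<close>)
  then show ?thesis using assms by (simp add: S_closed)
qed

section \<open>The automorphism \<sigma> and the Galois property\<close>

definition \<sigma> where "\<sigma> s = (THE t. t \<in> S \<and> conj s t)"

lemma \<sigma>_props:
  assumes "s \<in> S"
  shows "\<sigma> s \<in> S" "conj s (\<sigma> s)"
proof -
  have "\<exists>!t. t \<in> S \<and> conj s t" using conj_ex[OF assms] conj_unique assms by blast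
  from theI'[OF this] show "\<sigma> s \<in> S" "conj s (\<sigma> s)" unfolding \<sigma>_def by auto
qed

lemma \<sigma>_eq: "\<lbrakk>s \<in> S; t \<in> S; conj s t\<rbrakk> \<Longrightarrow> \<sigma> s = t"
  using \<sigma>_props conj_unique by blast

lemma \<sigma>_u: "\<sigma> u = shifted_u 1"
  by (rule \<sigma>_eq) (auto simp: u_in_S shifted_u_in_S conj_u simp del: One_nat_def)

lemma \<sigma>_struct: "r \<in> carrier R \<Longrightarrow> \<sigma> (\<iota> r) = \<iota> r"
  by (rule \<sigma>_eq) (auto simp: struct_in_S conj_struct)

lemma \<sigma>_add: "\<lbrakk>s \<in> S; t \<in> S\<rbrakk> \<Longrightarrow> \<sigma> (s \<oplus> t) = \<sigma> s \<oplus> \<sigma> t"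
  by (rule \<sigma>_eq) (auto simp: S_ops \<sigma>_props conj_add)

lemma \<sigma>_mult: "\<lbrakk>s \<in> S; t \<in> S\<rbrakk> \<Longrightarrow> \<sigma> (s \<otimes> t) = \<sigma> s \<otimes> \<sigma> t"
  by (rule \<sigma>_eq) (auto simp: S_ops \<sigma>_props conj_mult)

lemma \<sigma>_uminus: "s \<in> S \<Longrightarrow> \<sigma> (\<ominus> s) = \<ominus> \<sigma> s"
  by (rule \<sigma>_eq) (auto simp: S_ops \<sigma>_props conj_uminus)

lemma \<sigma>_one: "\<sigma> \<one> = \<one>"
  using \<sigma>_struct[of "\<one>\<^bsub>R\<^esub>"] by (simp add: struct_one)

lemma \<sigma>_pow_in_S: "s \<in> S \<Longrightarrow> (\<sigma> ^^ k) s \<in> S"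
  by (induction k) (auto simp: \<sigma>_props)

lemma \<sigma>_pow_struct: "r \<in> carrier R \<Longrightarrow> (\<sigma> ^^ k) (\<iota> r) = \<iota> r"
  by (induction k) (auto simp: \<sigma>_struct)

lemma \<sigma>_pow_add: "\<lbrakk>s \<in> S; t \<in> S\<rbrakk> \<Longrightarrow> (\<sigma> ^^ k) (s \<oplus> t) = (\<sigma> ^^ k) s \<oplus> (\<sigma> ^^ k) t"
  by (induction k) (auto simp: \<sigma>_add \<sigma>_pow_in_S)

lemma \<sigma>_pow_mult: "\<lbrakk>s \<in> S; t \<in> S\<rbrakk> \<Longrightarrow> (\<sigma> ^^ k) (s \<otimes> t) = (\<sigma> ^^ k) s \<otimes> (\<sigma> ^^ k) t"
  by (induction k) (auto simp: \<sigma>_mult \<sigma>_pow_in_S)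

lemma \<sigma>_pow_uminus: "s \<in> S \<Longrightarrow> (\<sigma> ^^ k) (\<ominus> s) = \<ominus> (\<sigma> ^^ k) s"
  by (induction k) (auto simp: \<sigma>_uminus \<sigma>_pow_in_S)

lemma \<sigma>_pow_one: "(\<sigma> ^^ k) \<one> = \<one>"
  by (induction k) (auto simp: \<sigma>_one)

lemma \<sigma>_scale: "\<lbrakk>r \<in> carrier R; s \<in> S\<rbrakk> \<Longrightarrow> \<sigma> (r \<bullet> s) = r \<bullet> \<sigma> s"
  by (simp add: scale_def \<sigma>_mult struct_in_S \<sigma>_struct)

lemma \<sigma>_pow_u: "(\<sigma> ^^ k) u = shifted_u k"
proof (induction k)
  case (Suc k)
  have "\<sigma> (shifted_u k) = q [^]\<^bsub>R\<^esub> k \<bullet> shifted_u 1 \<oplus> \<iota> (qn k)"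
    unfolding shifted_u_def[of k]
    by (simp add: \<sigma>_add \<sigma>_scale scale_in_S u_in_S struct_in_S \<sigma>_struct \<sigma>_u del: One_nat_def)
  also have "\<dots> = shifted_u (Suc k)"
    by (simp add: shifted_u_def scale_simps struct_closed struct_add struct_one A.a_ac)
      (simp add: scale_def struct_closed A.a_ac)
  finally show ?case using Suc by simp
qed (simp add: shifted_u_0)

lemma \<sigma>_order: "s \<in> S \<Longrightarrow> (\<sigma> ^^ p) s = s"
  by (induction rule: S_induct)
    (simp_all add: \<sigma>_pow_struct \<sigma>_pow_add \<sigma>_pow_mult \<sigma>_pow_uminus \<sigma>_pow_u shifted_u_p)

lemma \<sigma>_bij: "bij_betw \<sigma> S S"
proof -
  obtain m where m: "p = Suc m" using p_pos by (cases p) auto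
  show ?thesis
  proof (rule bij_betw_byWitness[where f' = "\<sigma> ^^ m"])
    show "\<forall>s\<in>S. (\<sigma> ^^ m) (\<sigma> s) = s"
      using \<sigma>_order unfolding m by (simp add: funpow_swap1)
    show "\<forall>s\<in>S. \<sigma> ((\<sigma> ^^ m) s) = s"
      using \<sigma>_order unfolding m by simp
  qed (auto simp: \<sigma>_props \<sigma>_pow_in_S)
qed

lemma \<sigma>_iso: "\<sigma> \<in> ring_iso S_ring S_ring"
  unfolding ring_iso_def using \<sigma>_bij
  by (auto intro!: ring_hom_memI simp: \<sigma>_props \<sigma>_add \<sigma>_mult \<sigma>_one)

text \<open>A fixed element is its own conjugate, hence commutes with \<open>x\<close> and
  \<open>y\<close> and is a scalar by \<open>central_scalar\<close>.\<close>

lemma \<sigma>_fixed: "{s \<in> S. \<sigma> s = s} = \<iota> ` carrier R"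
proof
  show "{s \<in> S. \<sigma> s = s} \<subseteq> \<iota> ` carrier R"
  proof
    fix s assume "s \<in> {s \<in> S. \<sigma> s = s}"
    then have s: "s \<in> S" "\<sigma> s = s" by auto
    then have "conj s s" using \<sigma>_props(2)[of s] by simp
    then show "s \<in> \<iota> ` carrier R"
      using s by (intro central_scalar) (auto simp: conj_def S_closed)
  qed
qed (auto simp: struct_in_S \<sigma>_struct)

lemma \<beta>_in_S: "\<beta> \<in> S" "\<beta>_inv \<in> S"
  unfolding \<beta>_inv_def \<beta>_def u_def[symmetric]
  by (simp_all add: S_ops scale_in_S u_in_S pow_in_S)

text \<open>For \<open>0 < k < p\<close> this exhibits the difference from \<open>u\<close> as a
  product of two units, so no maximal ideal contains it; that is what \<open>separating\<close> asks
  for.\<close>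

lemma shifted_u_diff: "shifted_u k = qn k \<bullet> \<beta> \<oplus> u"
proof -
  have "shifted_u k = (\<one>\<^bsub>R\<^esub> \<oplus>\<^bsub>R\<^esub> (q \<ominus>\<^bsub>R\<^esub> \<one>\<^bsub>R\<^esub>) \<otimes>\<^bsub>R\<^esub> qn k) \<bullet> u \<oplus> qn k \<bullet> \<one>"
    unfolding shifted_u_def q_pow_qnum[of k] by (simp add: scale_def struct_closed)
  then show ?thesis
    unfolding \<beta>_def u_def[symmetric]
    by (simp add: scale_simps scale_add_left A.a_ac R.m_comm)
qed

theorem galois: "cyclic_galois_extension R \<iota> S_ring \<sigma> p"
proof (intro cyclic_galois_extension.intro cyclic_galois_extension_axioms.intro)
  interpret S: cring S_ring by (rule S_cring)
  show "\<iota> \<in> ring_hom R S_ring"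
    by (rule ring_hom_memI) (auto simp: struct_in_S struct_add struct_mult struct_one)
  show "{s \<in> carrier S_ring. \<sigma> s = s} = \<iota> ` carrier R" using \<sigma>_fixed by simp
  fix i M assume i: "0 < i" "i < p" and M: "maximalideal M S_ring"
  interpret M: maximalideal M S_ring by fact
  have un: "qn i \<in> Units R" by (rule qnum_unit) (use i in auto)
  have "(\<sigma> ^^ i) u \<ominus>\<^bsub>S_ring\<^esub> u \<notin> M"
  proof
    assume in_M: "(\<sigma> ^^ i) u \<ominus>\<^bsub>S_ring\<^esub> u \<in> M"
    define t where "t = (\<sigma> ^^ i) u \<ominus>\<^bsub>S_ring\<^esub> u"
    have t: "t \<in> S" using S.minus_closed[of "(\<sigma> ^^ i) u" u] by (simp add: t_def \<sigma>_pow_in_S u_in_S)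
    have "t \<oplus>\<^bsub>S_ring\<^esub> u = (\<sigma> ^^ i) u"
      unfolding t_def by (simp only: S.minus_eq) 
        (use S.l_neg[of u] S.a_assoc[of "(\<sigma> ^^ i) u" "\<ominus>\<^bsub>S_ring\<^esub> u" u] S.r_zero[of "(\<sigma> ^^ i) u"] S.a_inv_closed[of u]
          in \<open>simp add: \<sigma>_pow_in_S u_in_S\<close>)
    then have "t \<oplus> u = qn i \<bullet> \<beta> \<oplus> u" by (simp add: \<sigma>_pow_u shifted_u_diff)
    then have t_eq: "t = qn i \<bullet> \<beta>" using t by (simp add: S_closed scale_closed)
    have "(inv\<^bsub>R\<^esub> qn i \<bullet> \<beta>_inv) \<otimes>\<^bsub>S_ring\<^esub> t \<in> M"
      using M.I_l_closed[OF in_M] un by (simp add: t_def scale_in_S \<beta>_in_S)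
    moreover have "(inv\<^bsub>R\<^esub> qn i \<bullet> \<beta>_inv) \<otimes>\<^bsub>S_ring\<^esub> t = \<one>"
      using un by (simp add: t_eq scale_simps \<beta>_inv R.Units_l_inv R.Units_r_inv)
    ultimately have "M = carrier S_ring" using M.one_imp_carrier by simp
    then show False using M.I_notcarr by simp
  qed
  then show "\<exists>s\<in>carrier S_ring. (\<sigma> ^^ i) s \<ominus>\<^bsub>S_ring\<^esub> s \<notin> M" using u_in_S by auto
qed (auto simp: p_pos struct_inj \<sigma>_iso \<sigma>_order R.cring_axioms S_cring)

end

section \<open>Skew polynomial rings\<close>

text \<open>Both sums run over the triangle \<open>i + j \<le> m\<close>, one by diagonals, the
  other by rows. Associativity of skew polynomials and of the convolution on words both come from
  it.\<close>

lemma (in abelian_monoid) finsum_triangle: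
  fixes F :: "nat \<Rightarrow> nat \<Rightarrow> 'a"
  assumes "\<And>i j. i + j \<le> m \<Longrightarrow> F i j \<in> carrier G"
  shows "(\<Oplus>l\<in>{..m}. \<Oplus>i\<in>{..l}. F i (l - i)) = (\<Oplus>i\<in>{..m}. \<Oplus>j\<in>{..m - i}. F i j)"
  using assms
proof (induction m)
  case (Suc m)
  have IH: "(\<Oplus>l\<in>{..m}. \<Oplus>i\<in>{..l}. F i (l - i)) = (\<Oplus>i\<in>{..m}. \<Oplus>j\<in>{..m - i}. F i j)"
    by (rule Suc.IH) (rule Suc.prems, simp)
  have "(\<Oplus>i\<in>{..Suc m}. \<Oplus>j\<in>{..Suc m - i}. F i j)
      = (\<Oplus>j\<in>{..0}. F (Suc m) j) \<oplus> (\<Oplus>i\<in>{..m}. \<Oplus>j\<in>{..Suc m - i}. F i j)"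
    by (subst finsum_Suc) (auto intro!: finsum_closed Suc.prems)
  also have "(\<Oplus>i\<in>{..m}. \<Oplus>j\<in>{..Suc m - i}. F i j)
      = (\<Oplus>i\<in>{..m}. F i (Suc m - i) \<oplus> (\<Oplus>j\<in>{..m - i}. F i j))"
  proof (rule add.finprod_cong')
    fix i assume "i \<in> {..m}"
    then have i: "Suc m - i = Suc (m - i)" "i \<le> m" by auto
    show "(\<Oplus>j\<in>{..Suc m - i}. F i j) = F i (Suc m - i) \<oplus> (\<Oplus>j\<in>{..m - i}. F i j)"
      unfolding i(1) by (rule finsum_Suc) (use i in \<open>auto intro!: Suc.prems\<close>)
  qed (auto intro!: finsum_closed Suc.prems)
  also have "\<dots> = (\<Oplus>i\<in>{..m}. F i (Suc m - i)) \<oplus> (\<Oplus>i\<in>{..m}. \<Oplus>j\<in>{..m - i}. F i j)"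
    by (rule finsum_addf) (auto intro!: finsum_closed Suc.prems)
  finally have "(\<Oplus>i\<in>{..Suc m}. \<Oplus>j\<in>{..Suc m - i}. F i j)
      = (F (Suc m) 0 \<oplus> (\<Oplus>i\<in>{..m}. F i (Suc m - i))) \<oplus> (\<Oplus>i\<in>{..m}. \<Oplus>j\<in>{..m - i}. F i j)"
    using Suc.prems by (simp add: a_assoc finsum_closed Pi_iff)
  also have "F (Suc m) 0 \<oplus> (\<Oplus>i\<in>{..m}. F i (Suc m - i)) = (\<Oplus>i\<in>{..Suc m}. F i (Suc m - i))"
    by (subst finsum_Suc) (use Suc.prems in auto)
  also have "(\<Oplus>i\<in>{..Suc m}. F i (Suc m - i)) \<oplus> (\<Oplus>i\<in>{..m}. \<Oplus>j\<in>{..m - i}. F i j)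
      = (\<Oplus>l\<in>{..Suc m}. \<Oplus>i\<in>{..l}. F i (l - i))"
    unfolding IH[symmetric] by (subst (2) finsum_Suc) (auto intro!: finsum_closed Suc.prems)
  finally show ?case by (rule sym)
qed (simp add: assms)

text \<open>Negation in the restricted record is chosen inside the smaller carrier, so it has to be
  identified with the ambient one.\<close>

lemma (in ring) subring_minus:
  assumes "subring H R" "v \<in> H" "w \<in> H"
  shows "v \<ominus>\<^bsub>R\<lparr>carrier := H\<rparr>\<^esub> w = v \<ominus> w"
proof -
  interpret H: ring "R\<lparr>carrier := H\<rparr>" by (rule subring_is_ring[OF assms(1)])
  note sub = subringE(1)[OF assms(1)]
  have "w \<oplus> \<ominus>\<^bsub>R\<lparr>carrier := H\<rparr>\<^esub> w = \<zero>" using H.r_neg[of w] assms by simp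
  moreover have "\<ominus>\<^bsub>R\<lparr>carrier := H\<rparr>\<^esub> w \<in> carrier R" using H.a_inv_closed[of w] assms sub by auto
  ultimately have "\<ominus>\<^bsub>R\<lparr>carrier := H\<rparr>\<^esub> w = \<ominus> w"
    using assms sub minus_equality[of "\<ominus>\<^bsub>R\<lparr>carrier := H\<rparr>\<^esub> w" w] a_comm by auto
  then show ?thesis by (simp add: a_minus_def)
qed

locale skew_polynomials = cring E for E (structure) +
  fixes \<tau> :: "'a \<Rightarrow> 'a"
  assumes tau_hom: "\<tau> \<in> ring_hom E E"
begin

lemma tau_pow_hom: "\<tau> ^^ k \<in> ring_hom E E"
proof (induction k)
  case 0
  show ?case by (rule ring_hom_memI) auto
next
  case (Suc k)
  then show ?case using ring_hom_trans[OF Suc tau_hom] by (simp add: o_def)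
qed

lemma tau_closed [simp]: "e \<in> carrier E \<Longrightarrow> (\<tau> ^^ k) e \<in> carrier E"
  using tau_pow_hom by (rule ring_hom_closed)
lemma tau_one [simp]: "(\<tau> ^^ k) \<one> = \<one>"
  using tau_pow_hom by (rule ring_hom_one)
lemma tau_zero [simp]: "(\<tau> ^^ k) \<zero> = \<zero>"
  using tau_pow_hom ring_axioms ring_hom_zero by blast
lemma tau_mult: "\<lbrakk>c \<in> carrier E; e \<in> carrier E\<rbrakk> \<Longrightarrow> (\<tau> ^^ k) (c \<otimes> e) = (\<tau> ^^ k) c \<otimes> (\<tau> ^^ k) e"
  using tau_pow_hom by (rule ring_hom_mult)
lemma tau_add: "\<lbrakk>c \<in> carrier E; e \<in> carrier E\<rbrakk> \<Longrightarrow> (\<tau> ^^ k) (c \<oplus> e) = (\<tau> ^^ k) c \<oplus> (\<tau> ^^ k) e"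
  using tau_pow_hom by (rule ring_hom_add)
lemma tau_finsum: "f \<in> I \<rightarrow> carrier E \<Longrightarrow> (\<tau> ^^ k) (finsum E f I) = (\<Oplus>i\<in>I. (\<tau> ^^ k) (f i))"
proof -
  interpret h: ring_hom_ring E E "\<tau> ^^ k"
    by (rule ring_hom_ringI2[OF ring_axioms ring_axioms tau_pow_hom])
  show "f \<in> I \<rightarrow> carrier E \<Longrightarrow> (\<tau> ^^ k) (finsum E f I) = (\<Oplus>i\<in>I. (\<tau> ^^ k) (f i))"
    using h.hom_finsum[of f I] by (simp add: o_def)
qed
lemma tau_tau: "(\<tau> ^^ k) ((\<tau> ^^ l) e) = (\<tau> ^^ (k + l)) e"
  by (simp add: funpow_add)

abbreviation P where "P \<equiv> skew_poly_ring E \<tau>"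

lemma finite_support_iff: "finite {m. f m \<noteq> \<zero>} \<longleftrightarrow> (\<exists>N. \<forall>m::nat>N. f m = \<zero>)"
proof
  assume "finite {m. f m \<noteq> \<zero>}"
  then obtain N where "\<forall>m\<in>{m. f m \<noteq> \<zero>}. m \<le> N" using finite_nat_set_iff_bounded_le by auto
  then show "\<exists>N. \<forall>m>N. f m = \<zero>" by (intro exI[of _ N]) force
next
  assume "\<exists>N. \<forall>m>N. f m = \<zero>"
  then obtain N where "\<forall>m>N. f m = \<zero>" by blast
  then have "m \<le> N" if "f m \<noteq> \<zero>" for m using that by (meson not_le)
  then have "{m. f m \<noteq> \<zero>} \<subseteq> {..N}" by auto
  then show "finite {m. f m \<noteq> \<zero>}" by (rule finite_subset) simp
qed

lemma P_carrier: "f \<in> carrier P \<longleftrightarrow> (\<forall>m. f m \<in> carrier E) \<and> (\<exists>N. \<forall>m>N. f m = \<zero>)"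
  by (simp add: skew_poly_ring_def finite_support_iff)

lemma P_coeff: "f \<in> carrier P \<Longrightarrow> f m \<in> carrier E" by (simp add: P_carrier)

lemma P_add: "(f \<oplus>\<^bsub>P\<^esub> g) = (\<lambda>m. f m \<oplus> g m)"
  by (simp add: skew_poly_ring_def)
lemma P_zero: "\<zero>\<^bsub>P\<^esub> = (\<lambda>m. \<zero>)"
  by (simp add: skew_poly_ring_def)
lemma P_one: "\<one>\<^bsub>P\<^esub> = skew_monom E 0 \<one>"
  by (simp add: skew_poly_ring_def skew_monom_def)
lemma P_mult: "(f \<otimes>\<^bsub>P\<^esub> g) = (\<lambda>m. \<Oplus>i\<in>{..m}. f i \<otimes> (\<tau> ^^ i) (g (m - i)))"
  by (simp add: skew_poly_ring_def)

lemma monom_closed [simp]: "c \<in> carrier E \<Longrightarrow> skew_monom E n c \<in> carrier P"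
  unfolding P_carrier by (auto simp: skew_monom_def intro!: exI[of _ n])

lemma P_mult_closed:
  assumes f: "f \<in> carrier P" and g: "g \<in> carrier P"
  shows "f \<otimes>\<^bsub>P\<^esub> g \<in> carrier P"
proof -
  note [simp] = P_coeff[OF f] P_coeff[OF g]
  obtain N M where N: "\<And>m. m > N \<Longrightarrow> f m = \<zero>" and M: "\<And>m. m > M \<Longrightarrow> g m = \<zero>"
    using f g unfolding P_carrier by blast
  have "(f \<otimes>\<^bsub>P\<^esub> g) m = \<zero>" if "m > N + M" for m
  proof -
    have "f i \<otimes> (\<tau> ^^ i) (g (m - i)) = \<zero>" for i
    proof (cases "i > N")
      case False
      then have "m - i > M" using that by simp
      then show ?thesis using f by (simp add: M)
    qed (use g N in simp)
    then show ?thesis by (simp add: P_mult)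
  qed
  moreover have "(f \<otimes>\<^bsub>P\<^esub> g) m \<in> carrier E" for m
    using f g by (auto simp: P_mult intro!: finsum_closed)
  ultimately show ?thesis unfolding P_carrier by blast
qed

lemma monom_mult:
  assumes "c \<in> carrier E" "f \<in> carrier P"
  shows "skew_monom E n c \<otimes>\<^bsub>P\<^esub> f = (\<lambda>m. if n \<le> m then c \<otimes> (\<tau> ^^ n) (f (m - n)) else \<zero>)"
proof
  fix m
  note [simp] = P_coeff[OF assms(2)]
  have "(skew_monom E n c \<otimes>\<^bsub>P\<^esub> f) m = (\<Oplus>i\<in>{..m}. if n = i then c \<otimes> (\<tau> ^^ i) (f (m - i)) else \<zero>)"
    unfolding P_mult using assms by (intro add.finprod_cong') (auto simp: skew_monom_def)
  also have "\<dots> = (if n \<le> m then c \<otimes> (\<tau> ^^ n) (f (m - n)) else \<zero>)"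
  proof (cases "n \<le> m")
    case True
    then show ?thesis using assms by (subst finsum_singleton) auto
  next
    case False
    then have "(\<Oplus>i\<in>{..m}. if n = i then c \<otimes> (\<tau> ^^ i) (f (m - i)) else \<zero>) = (\<Oplus>i\<in>{..m}. \<zero>)"
      by (intro add.finprod_cong') auto
    then show ?thesis using False by simp
  qed
  finally show "(skew_monom E n c \<otimes>\<^bsub>P\<^esub> f) m = (if n \<le> m then c \<otimes> (\<tau> ^^ n) (f (m - n)) else \<zero>)" .
qed

lemma mult_monom:
  assumes "c \<in> carrier E" "f \<in> carrier P"
  shows "f \<otimes>\<^bsub>P\<^esub> skew_monom E n c = (\<lambda>m. if n \<le> m then f (m - n) \<otimes> (\<tau> ^^ (m - n)) c else \<zero>)"
proof
  fix m
  note [simp] = P_coeff[OF assms(2)]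
  show "(f \<otimes>\<^bsub>P\<^esub> skew_monom E n c) m = (if n \<le> m then f (m - n) \<otimes> (\<tau> ^^ (m - n)) c else \<zero>)"
  proof (cases "n \<le> m")
    case True
    have "(f \<otimes>\<^bsub>P\<^esub> skew_monom E n c) m = (\<Oplus>i\<in>{..m}. if m - n = i then f i \<otimes> (\<tau> ^^ i) c else \<zero>)"
      unfolding P_mult using assms True by (intro add.finprod_cong') (auto simp: skew_monom_def)
    also have "\<dots> = f (m - n) \<otimes> (\<tau> ^^ (m - n)) c"
      using assms by (subst finsum_singleton) auto
    finally show ?thesis using True by simp
  next
    case False
    then have "(f \<otimes>\<^bsub>P\<^esub> skew_monom E n c) m = (\<Oplus>i\<in>{..m}. \<zero>)"
      unfolding P_mult using assms by (intro add.finprod_cong') (auto simp: skew_monom_def)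
    then show ?thesis using False by simp
  qed
qed

lemma P_abelian_group: "abelian_group P"
proof (rule abelian_groupI)
  fix f g assume "f \<in> carrier P" "g \<in> carrier P"
  then obtain N M where N: "\<And>m. m > N \<Longrightarrow> f m = \<zero>" and M: "\<And>m. m > M \<Longrightarrow> g m = \<zero>"
    and c: "\<And>m. f m \<in> carrier E" "\<And>m. g m \<in> carrier E"
    unfolding P_carrier by blast
  then show "f \<oplus>\<^bsub>P\<^esub> g \<in> carrier P"
    unfolding P_carrier P_add by (auto intro!: exI[of _ "max N M"])
next
  fix f assume f: "f \<in> carrier P"
  note [simp] = P_coeff[OF f]
  from f obtain N where N: "\<And>m. m > N \<Longrightarrow> f m = \<zero>" unfolding P_carrier by blast
  show "\<exists>g\<in>carrier P. g \<oplus>\<^bsub>P\<^esub> f = \<zero>\<^bsub>P\<^esub>"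
  proof (rule bexI)
    show "(\<lambda>m. \<ominus> f m) \<in> carrier P"
      unfolding P_carrier using f N by auto
    show "(\<lambda>m. \<ominus> f m) \<oplus>\<^bsub>P\<^esub> f = \<zero>\<^bsub>P\<^esub>"
      using f by (simp add: P_add P_zero l_neg)
  qed
next
  show "\<zero>\<^bsub>P\<^esub> \<in> carrier P" by (simp add: P_carrier P_zero)
qed (simp_all add: P_add P_zero P_carrier a_ac)

lemma P_assoc:
  assumes f: "f \<in> carrier P" and g: "g \<in> carrier P" and h: "h \<in> carrier P"
  shows "(f \<otimes>\<^bsub>P\<^esub> g) \<otimes>\<^bsub>P\<^esub> h = f \<otimes>\<^bsub>P\<^esub> (g \<otimes>\<^bsub>P\<^esub> h)"
proof
  note [simp] = P_coeff[OF f] P_coeff[OF g] P_coeff[OF h]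
  fix m
  define F where "F i j = f i \<otimes> ((\<tau> ^^ i) (g j) \<otimes> (\<tau> ^^ (i + j)) (h (m - i - j)))" for i j
  have F: "F i j \<in> carrier E" for i j using f g h by (simp add: F_def)
  have "((f \<otimes>\<^bsub>P\<^esub> g) \<otimes>\<^bsub>P\<^esub> h) m = (\<Oplus>l\<in>{..m}. \<Oplus>i\<in>{..l}. F i (l - i))"
    unfolding P_mult
  proof (rule add.finprod_cong')
    fix l assume "l \<in> {..m}"
    have "(\<Oplus>i\<in>{..l}. f i \<otimes> (\<tau> ^^ i) (g (l - i))) \<otimes> (\<tau> ^^ l) (h (m - l))
        = (\<Oplus>i\<in>{..l}. f i \<otimes> (\<tau> ^^ i) (g (l - i)) \<otimes> (\<tau> ^^ l) (h (m - l)))"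
      using f g h by (intro finsum_ldistr) auto
    also have "\<dots> = (\<Oplus>i\<in>{..l}. F i (l - i))"
      using f g h by (intro add.finprod_cong') (auto simp: F_def m_assoc)
    finally show "(\<Oplus>i\<in>{..l}. f i \<otimes> (\<tau> ^^ i) (g (l - i))) \<otimes> (\<tau> ^^ l) (h (m - l)) = (\<Oplus>i\<in>{..l}. F i (l - i))" .
  qed (auto intro!: finsum_closed F)
  also have "\<dots> = (\<Oplus>i\<in>{..m}. \<Oplus>j\<in>{..m - i}. F i j)"
    by (rule finsum_triangle) (rule F)
  also have "\<dots> = (f \<otimes>\<^bsub>P\<^esub> (g \<otimes>\<^bsub>P\<^esub> h)) m"
    unfolding P_mult
  proof (rule add.finprod_cong'[symmetric])
    fix i assume "i \<in> {..m}"
    have "(\<tau> ^^ i) (\<Oplus>j\<in>{..m - i}. g j \<otimes> (\<tau> ^^ j) (h (m - i - j)))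
        = (\<Oplus>j\<in>{..m - i}. (\<tau> ^^ i) (g j \<otimes> (\<tau> ^^ j) (h (m - i - j))))"
      using g h by (intro tau_finsum) auto
    then have "f i \<otimes> (\<tau> ^^ i) (\<Oplus>j\<in>{..m - i}. g j \<otimes> (\<tau> ^^ j) (h (m - i - j)))
        = (\<Oplus>j\<in>{..m - i}. f i \<otimes> (\<tau> ^^ i) (g j \<otimes> (\<tau> ^^ j) (h (m - i - j))))"
      using f g h by (simp add: finsum_rdistr Pi_iff)
    also have "\<dots> = (\<Oplus>j\<in>{..m - i}. F i j)"
      using f g h by (intro add.finprod_cong') (auto simp: F_def tau_mult tau_tau)
    finally show "f i \<otimes> (\<tau> ^^ i) (\<Oplus>j\<in>{..m - i}. g j \<otimes> (\<tau> ^^ j) (h (m - i - j))) = (\<Oplus>j\<in>{..m - i}. F i j)" .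
  qed (auto intro!: finsum_closed F)
  finally show "((f \<otimes>\<^bsub>P\<^esub> g) \<otimes>\<^bsub>P\<^esub> h) m = (f \<otimes>\<^bsub>P\<^esub> (g \<otimes>\<^bsub>P\<^esub> h)) m" .
qed

lemma P_ring: "ring P"
proof (rule ringI[OF P_abelian_group])
  show "monoid P"
  proof (rule monoidI)
    fix f assume f: "f \<in> carrier P"
    note [simp] = P_coeff[OF f]
    show "\<one>\<^bsub>P\<^esub> \<otimes>\<^bsub>P\<^esub> f = f" "f \<otimes>\<^bsub>P\<^esub> \<one>\<^bsub>P\<^esub> = f"
      unfolding P_one using f by (auto simp: monom_mult mult_monom)
  qed (auto simp: P_mult_closed P_assoc P_one)
  fix f g h assume c: "f \<in> carrier P" "g \<in> carrier P" "h \<in> carrier P"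
  note [simp] = c[THEN P_coeff]
  show "(f \<oplus>\<^bsub>P\<^esub> g) \<otimes>\<^bsub>P\<^esub> h = f \<otimes>\<^bsub>P\<^esub> h \<oplus>\<^bsub>P\<^esub> g \<otimes>\<^bsub>P\<^esub> h"
  proof
    fix m
    have "((f \<oplus>\<^bsub>P\<^esub> g) \<otimes>\<^bsub>P\<^esub> h) m
        = (\<Oplus>i\<in>{..m}. f i \<otimes> (\<tau> ^^ i) (h (m - i)) \<oplus> g i \<otimes> (\<tau> ^^ i) (h (m - i)))"
      unfolding P_mult P_add using c by (intro add.finprod_cong') (auto simp: l_distr)
    then show "((f \<oplus>\<^bsub>P\<^esub> g) \<otimes>\<^bsub>P\<^esub> h) m = (f \<otimes>\<^bsub>P\<^esub> h \<oplus>\<^bsub>P\<^esub> g \<otimes>\<^bsub>P\<^esub> h) m"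
      unfolding P_mult P_add using c by (simp add: finsum_addf Pi_iff)
  qed
  show "h \<otimes>\<^bsub>P\<^esub> (f \<oplus>\<^bsub>P\<^esub> g) = h \<otimes>\<^bsub>P\<^esub> f \<oplus>\<^bsub>P\<^esub> h \<otimes>\<^bsub>P\<^esub> g"
  proof
    fix m
    have "(h \<otimes>\<^bsub>P\<^esub> (f \<oplus>\<^bsub>P\<^esub> g)) m
        = (\<Oplus>i\<in>{..m}. h i \<otimes> (\<tau> ^^ i) (f (m - i)) \<oplus> h i \<otimes> (\<tau> ^^ i) (g (m - i)))"
      unfolding P_mult P_add using c by (intro add.finprod_cong') (auto simp: r_distr tau_add)
    then show "(h \<otimes>\<^bsub>P\<^esub> (f \<oplus>\<^bsub>P\<^esub> g)) m = (h \<otimes>\<^bsub>P\<^esub> f \<oplus>\<^bsub>P\<^esub> h \<otimes>\<^bsub>P\<^esub> g) m"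
      unfolding P_mult P_add using c by (simp add: finsum_addf Pi_iff)
  qed
qed

lemma monom_monom:
  assumes "c \<in> carrier E" "e \<in> carrier E"
  shows "skew_monom E n c \<otimes>\<^bsub>P\<^esub> skew_monom E k e = skew_monom E (n + k) (c \<otimes> (\<tau> ^^ n) e)"
  using assms by (auto simp: monom_mult) (auto simp: skew_monom_def fun_eq_iff)

lemma monom_add:
  "\<lbrakk>c \<in> carrier E; e \<in> carrier E\<rbrakk> \<Longrightarrow> skew_monom E n c \<oplus>\<^bsub>P\<^esub> skew_monom E n e = skew_monom E n (c \<oplus> e)"
  by (auto simp: P_add skew_monom_def fun_eq_iff)

lemma P_uminus: "f \<in> carrier P \<Longrightarrow> \<ominus>\<^bsub>P\<^esub> f = (\<lambda>m. \<ominus> f m)"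
proof -
  assume f: "f \<in> carrier P"
  note [simp] = P_coeff[OF f]
  interpret P: ring P by (rule P_ring)
  have "(\<lambda>m. \<ominus> f m) \<in> carrier P" using f unfolding P_carrier by fastforce
  moreover have "(\<lambda>m. \<ominus> f m) \<oplus>\<^bsub>P\<^esub> f = \<zero>\<^bsub>P\<^esub>"
    using f by (simp add: P_add P_zero l_neg)
  ultimately show ?thesis using f by (intro P.minus_equality)
qed

text \<open>For \<open>\<phi> = id\<close> the ideal defining \<open>\<Delta>\<close> lies in the multiples of the central element \<open>t\<^bsup>n\<^esup> - 1\<close>.\<close>

lemma power_minus_one_mult:
  assumes n: "0 < n" and order: "\<And>e. e \<in> carrier E \<Longrightarrow> (\<tau> ^^ n) e = e" and h: "h \<in> carrier P"
  defines "w \<equiv> skew_monom E n \<one> \<ominus>\<^bsub>P\<^esub> skew_monom E 0 \<one>"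
  shows "h \<otimes>\<^bsub>P\<^esub> w = (\<lambda>m. (if n \<le> m then h (m - n) else \<zero>) \<ominus> h m)"
    and "w \<otimes>\<^bsub>P\<^esub> h = h \<otimes>\<^bsub>P\<^esub> w"
proof -
  note [simp] = P_coeff[OF h]
  interpret P: ring P by (rule P_ring)
  have one: "h \<otimes>\<^bsub>P\<^esub> skew_monom E 0 \<one> = h" "skew_monom E 0 \<one> \<otimes>\<^bsub>P\<^esub> h = h"
    using P.r_one[OF h] P.l_one[OF h] unfolding P_one by auto
  have "h \<otimes>\<^bsub>P\<^esub> w = h \<otimes>\<^bsub>P\<^esub> skew_monom E n \<one> \<ominus>\<^bsub>P\<^esub> h"
    unfolding w_def using h one by (simp add: P.minus_eq P.r_distr P.r_minus)
  then show 1: "h \<otimes>\<^bsub>P\<^esub> w = (\<lambda>m. (if n \<le> m then h (m - n) else \<zero>) \<ominus> h m)"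
    using h by (auto simp: P.minus_eq P_add P_uminus mult_monom minus_eq)
  have "w \<otimes>\<^bsub>P\<^esub> h = skew_monom E n \<one> \<otimes>\<^bsub>P\<^esub> h \<ominus>\<^bsub>P\<^esub> h"
    unfolding w_def using h one by (simp add: P.minus_eq P.l_distr P.l_minus)
  then have "w \<otimes>\<^bsub>P\<^esub> h = (\<lambda>m. (if n \<le> m then h (m - n) else \<zero>) \<ominus> h m)"
    using h by (auto simp: P.minus_eq P_add P_uminus monom_mult minus_eq order)
  then show "w \<otimes>\<^bsub>P\<^esub> h = h \<otimes>\<^bsub>P\<^esub> w" using 1 by simp
qed

text \<open>Comparing coefficients at \<open>m + n\<close> makes \<open>h\<close> periodic with
  period \<open>n\<close>, and finite support then forces \<open>h = 0\<close>. So no nonzero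
  constant is a multiple of \<open>t^n - 1\<close>.\<close>

lemma power_minus_one_const:
  assumes n: "0 < n" and order: "\<And>e. e \<in> carrier E \<Longrightarrow> (\<tau> ^^ n) e = e" and h: "h \<in> carrier P"
    and eq: "skew_monom E 0 c = h \<otimes>\<^bsub>P\<^esub> (skew_monom E n \<one> \<ominus>\<^bsub>P\<^esub> skew_monom E 0 \<one>)"
  shows "c = \<zero>"
proof -
  note [simp] = P_coeff[OF h]
  obtain N where N: "\<And>m. m > N \<Longrightarrow> h m = \<zero>" using h unfolding P_carrier by blast
  have "skew_monom E 0 c = (\<lambda>m. (if n \<le> m then h (m - n) else \<zero>) \<ominus> h m)"
    using eq power_minus_one_mult(1)[OF n order h] by simp
  note coeff = fun_cong[OF this]
  have step: "h (m + n) = h m" for m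
  proof -
    have "h m \<ominus> h (m + n) = \<zero>" using coeff[of "m + n"] n by (simp add: skew_monom_def)
    then show ?thesis using h by simp
  qed
  have "h (m + k * n) = h m" for m k
  proof (induction k)
    case (Suc k)
    then show ?case using step[of "m + k * n"] by (simp add: ac_simps)
  qed simp
  note shift = this
  have "h m = \<zero>" for m
  proof -
    have "Suc N * 1 \<le> Suc N * n" by (rule mult_le_mono2) (use n in simp)
    then have "N < m + Suc N * n" by simp
    with N[of "m + Suc N * n"] shift[of m "Suc N"] show ?thesis by simp
  qed
  then show ?thesis using coeff[of 0] n by (simp add: skew_monom_def minus_eq)
qed

end

section \<open>Almost cyclic algebras from a factorization of a generator\<close>

definition comax :: "('a, 'm) ring_scheme \<Rightarrow> 'a \<Rightarrow> 'a \<Rightarrow> bool" where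
  "comax R v w \<longleftrightarrow> (\<exists>g\<in>carrier R. \<exists>h\<in>carrier R. g \<otimes>\<^bsub>R\<^esub> v \<oplus>\<^bsub>R\<^esub> h \<otimes>\<^bsub>R\<^esub> w = \<one>\<^bsub>R\<^esub>)"

context cring
begin

lemma comax_sym: "\<lbrakk>comax R v w; v \<in> carrier R; w \<in> carrier R\<rbrakk> \<Longrightarrow> comax R w v"
  unfolding comax_def by (metis m_closed a_comm)

lemma comax_one: "v \<in> carrier R \<Longrightarrow> comax R v \<one>"
  unfolding comax_def by (rule bexI[of _ \<zero>], rule bexI[of _ \<one>]) auto

lemma comax_mult:
  assumes "comax R v w" "comax R v w'" "v \<in> carrier R" "w \<in> carrier R" "w' \<in> carrier R"
  shows "comax R v (w \<otimes> w')"
proof -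
  from assms obtain g h g' h' where gh: "g \<in> carrier R" "h \<in> carrier R" "g' \<in> carrier R" "h' \<in> carrier R"
    "g \<otimes> v \<oplus> h \<otimes> w = \<one>" "g' \<otimes> v \<oplus> h' \<otimes> w' = \<one>" unfolding comax_def by blast
  have "(g \<otimes> v \<oplus> h \<otimes> w) \<otimes> (g' \<otimes> v \<oplus> h' \<otimes> w') = \<one>" by (simp add: gh)
  moreover have "(g \<otimes> v \<oplus> h \<otimes> w) \<otimes> (g' \<otimes> v \<oplus> h' \<otimes> w')
      = (g \<otimes> (g' \<otimes> v \<oplus> h' \<otimes> w') \<oplus> h \<otimes> w \<otimes> g') \<otimes> v \<oplus> (h \<otimes> h') \<otimes> (w \<otimes> w')"
    using gh(1-4) assms(3-5) by (simp add: l_distr r_distr m_ac a_ac)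
  moreover have "g \<otimes> (g' \<otimes> v \<oplus> h' \<otimes> w') \<oplus> h \<otimes> w \<otimes> g' \<in> carrier R" "h \<otimes> h' \<in> carrier R"
    using gh(1-4) assms(3-5) by auto
  ultimately show ?thesis unfolding comax_def by metis
qed

lemma comax_pow: "\<lbrakk>comax R v w; v \<in> carrier R; w \<in> carrier R\<rbrakk> \<Longrightarrow> comax R v (w [^] (n::nat))"
  by (induction n) (auto intro: comax_one comax_mult)

text \<open>Powers of comaximal elements are again comaximal, so \<open>z\<close> is killed by
  1.\<close>

lemma comax_torsion:
  assumes "comax R v w" "v \<in> carrier R" "w \<in> carrier R" "z \<in> carrier R"
    and "v [^] (m::nat) \<otimes> z = \<zero>" "w [^] (n::nat) \<otimes> z = \<zero>"
  shows "z = \<zero>"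
proof -
  have "comax R (v [^] m) (w [^] n)"
    using assms(1-3) by (intro comax_pow comax_sym[of "w [^] n" v] comax_sym[OF comax_pow] comax_pow) (auto intro: comax_sym comax_pow)
  then obtain g h where gh: "g \<in> carrier R" "h \<in> carrier R" "g \<otimes> v [^] m \<oplus> h \<otimes> w [^] n = \<one>"
    unfolding comax_def by blast
  have "z = (g \<otimes> v [^] m \<oplus> h \<otimes> w [^] n) \<otimes> z" using gh assms by simp
  also have "\<dots> = g \<otimes> (v [^] m \<otimes> z) \<oplus> h \<otimes> (w [^] n \<otimes> z)"
    using gh(1,2) assms(2-4) by (simp add: l_distr m_assoc)
  finally show ?thesis using gh(1,2) assms(5,6) by simp
qed

end

locale stable_subring = skew_polynomials E \<tau> for E (structure) and \<tau> +
  fixes S :: "'a set"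
  assumes S_subring: "subcring S E" and S_stable: "\<tau> ` S = S"
begin

lemma S_closed: "s \<in> S \<Longrightarrow> s \<in> carrier E"
  using subcring.axioms(1)[OF S_subring] subringE(1) by blast

lemma S_ops:
  "\<one> \<in> S" "\<zero> \<in> S" "s \<in> S \<Longrightarrow> \<ominus> s \<in> S"
  "\<lbrakk>s \<in> S; t \<in> S\<rbrakk> \<Longrightarrow> s \<oplus> t \<in> S" "\<lbrakk>s \<in> S; t \<in> S\<rbrakk> \<Longrightarrow> s \<otimes> t \<in> S"
  using subringE[OF subcring.axioms(1)[OF S_subring]] by auto

lemma tau_S: "s \<in> S \<Longrightarrow> (\<tau> ^^ k) s \<in> S"
  by (induction k) (use S_stable in auto)

lemma tau_S1: "s \<in> S \<Longrightarrow> \<tau> s \<in> S"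
  using tau_S[of s 1] by simp

lemma submoduleD:
  assumes "is_submodule_of_overring E S K"
  shows "z \<in> K \<Longrightarrow> z \<in> carrier E" "\<zero> \<in> K" "\<lbrakk>z \<in> K; z' \<in> K\<rbrakk> \<Longrightarrow> z \<oplus> z' \<in> K"
    "\<lbrakk>s \<in> S; z \<in> K\<rbrakk> \<Longrightarrow> s \<otimes> z \<in> K" "z \<in> K \<Longrightarrow> \<ominus> z \<in> K"
proof -
  interpret additive_subgroup K E using assms by (simp add: is_submodule_of_overring_def)
  show "z \<in> K \<Longrightarrow> z \<in> carrier E" "\<zero> \<in> K" "\<lbrakk>z \<in> K; z' \<in> K\<rbrakk> \<Longrightarrow> z \<oplus> z' \<in> K" by auto
  show "\<lbrakk>s \<in> S; z \<in> K\<rbrakk> \<Longrightarrow> s \<otimes> z \<in> K" using assms by (simp add: is_submodule_of_overring_def)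
  show "z \<in> K \<Longrightarrow> \<ominus> z \<in> K" by auto
qed

lemma submoduleI:
  assumes "\<And>z. z \<in> K \<Longrightarrow> z \<in> carrier E" "\<zero> \<in> K" "\<And>z z'. \<lbrakk>z \<in> K; z' \<in> K\<rbrakk> \<Longrightarrow> z \<oplus> z' \<in> K"
    "\<And>s z. \<lbrakk>s \<in> S; z \<in> K\<rbrakk> \<Longrightarrow> s \<otimes> z \<in> K"
  shows "is_submodule_of_overring E S K"
proof -
  have "\<ominus> z \<in> K" if "z \<in> K" for z
    using assms(4)[of "\<ominus> \<one>" z] assms(1) that by (simp add: S_ops l_minus)
  then have "additive_subgroup K E"
    by (intro additive_subgroupI add.subgroupI) (use assms in \<open>auto simp: a_inv_def\<close>)
  then show ?thesis unfolding is_submodule_of_overring_def using assms(4) by blast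
qed

lemma ideal_prod_submodule:
  assumes K: "is_submodule_of_overring E S K" and L: "L \<subseteq> carrier E" "\<zero> \<in> L"
  shows "is_submodule_of_overring E S (ideal_prod E K L)"
proof (rule submoduleI)
  note KD = submoduleD[OF K]
  show cl: "z \<in> carrier E" if "z \<in> ideal_prod E K L" for z
    using that by (induction rule: ideal_prod.induct) (use KD L in auto)
  have "\<zero> \<otimes> \<zero> \<in> ideal_prod E K L" using KD(2) L(2) by (rule ideal_prod.prod)
  then show "\<zero> \<in> ideal_prod E K L" by simp
  fix s z assume s: "s \<in> S" and z: "z \<in> ideal_prod E K L"
  show "s \<otimes> z \<in> ideal_prod E K L"
    using z
  proof (induction rule: ideal_prod.induct)
    case (prod i l)
    then have "(s \<otimes> i) \<otimes> l \<in> ideal_prod E K L" using s KD by (intro ideal_prod.prod)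
    moreover have "(s \<otimes> i) \<otimes> l = s \<otimes> (i \<otimes> l)"
      using prod s KD(1) L(1) by (intro m_assoc) (auto simp: S_closed)
    ultimately show ?case by simp
  next
    case (sum z z')
    then show ?case using s cl by (simp add: r_distr S_closed ideal_prod.sum)
  qed
qed (rule ideal_prod.sum)

lemma S_submodule: "is_submodule_of_overring E S S"
  by (rule submoduleI) (auto simp: S_closed S_ops)

end

locale twisted_submodule = stable_subring E \<tau> S for E (structure) and \<tau> S +
  fixes J :: "'a set"
  assumes J_submodule: "is_submodule_of_overring E S J"
begin

abbreviation Jp where "Jp m \<equiv> twisted_power E S \<tau> J m"

lemma tau_J: "(\<tau> ^^ m) ` J \<subseteq> carrier E" "\<zero> \<in> (\<tau> ^^ m) ` J"
  using submoduleD(1,2)[OF J_submodule] by (auto intro!: image_eqI[of _ _ \<zero>])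

lemma Jp_submodule: "is_submodule_of_overring E S (Jp m)"
  by (induction m) (simp_all add: S_submodule ideal_prod_submodule tau_J)

lemmas Jp_D = submoduleD[OF Jp_submodule]

text \<open>The product of \<open>c t^i\<close> and \<open>e t^j\<close> has the coefficient
  \<open>c \<tau>^i(e)\<close>; so the twisted powers form a grading, and \<open>T\<close> is closed
  under multiplication.\<close>

lemma Jp_mult:
  assumes "c \<in> Jp i" "e \<in> Jp j"
  shows "c \<otimes> (\<tau> ^^ i) e \<in> Jp (i + j)"
  using assms(2)
proof (induction j arbitrary: e)
  case 0
  then have "(\<tau> ^^ i) e \<otimes> c \<in> Jp i" using assms(1) by (intro Jp_D(4)) (auto simp: tau_S)
  then show ?case using 0 Jp_D(1)[OF assms(1)] by (simp add: m_comm S_closed tau_S)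
next
  case (Suc j)
  from Suc.prems have "e \<in> ideal_prod E (Jp j) ((\<tau> ^^ j) ` J)" by simp
  then show ?case
  proof (induction rule: ideal_prod.induct)
    case (prod e' l)
    then obtain z where z: "z \<in> J" "l = (\<tau> ^^ j) z" by auto
    have "(c \<otimes> (\<tau> ^^ i) e') \<otimes> (\<tau> ^^ (i + j)) z \<in> Jp (i + Suc j)"
      using Suc.IH[OF prod(1)] z by (auto intro: ideal_prod.prod)
    then show ?case
      using prod z assms(1) Jp_D(1) submoduleD(1)[OF J_submodule]
      by (simp add: tau_mult tau_tau m_assoc)
  next
    case (sum e e')
    have "e \<in> carrier E" "e' \<in> carrier E"
      using sum(1,2) Jp_D(1)[of _ "Suc j"] by auto
    moreover have "c \<otimes> (\<tau> ^^ i) e \<oplus> c \<otimes> (\<tau> ^^ i) e' \<in> Jp (i + Suc j)"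
      by (rule Jp_D(3)[OF sum(3,4)])
    ultimately show ?case using Jp_D(1)[OF assms(1)]
      by (simp only: tau_add r_distr tau_closed)
  qed
qed

abbreviation T where "T \<equiv> T_ring E S \<tau> J"

lemma T_carrier: "carrier T = {f \<in> carrier P. \<forall>m. f m \<in> Jp m}"
  by (simp add: T_ring_def)

lemma T_subring: "subring (carrier T) P"
proof -
  interpret P: ring P by (rule P_ring)
  show ?thesis
  proof (rule P.subringI)
    show "\<one>\<^bsub>P\<^esub> \<in> carrier T"
      using monom_closed[OF one_closed, of 0] unfolding T_carrier P_one
      by (simp add: S_ops Jp_D(2)) (simp add: skew_monom_def S_ops Jp_D(2))
  next
    fix f assume f: "f \<in> carrier T"
    then show "\<ominus>\<^bsub>P\<^esub> f \<in> carrier T"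
      using P.a_inv_closed unfolding T_carrier by (simp add: P_uminus Jp_D(5))
  next
    fix f g assume fg: "f \<in> carrier T" "g \<in> carrier T"
    then show "f \<oplus>\<^bsub>P\<^esub> g \<in> carrier T"
      using P.a_closed unfolding T_carrier by (simp add: P_add Jp_D(3))
    have sum: "(\<Oplus>i\<in>I. z i) \<in> Jp m" if "finite I" "\<And>i. i \<in> I \<Longrightarrow> z i \<in> Jp m" for I :: "nat set" and z m
      using that
    proof (induction I rule: finite_induct)
      case (insert i I)
      then have "z \<in> I \<rightarrow> carrier E" "z i \<in> carrier E" using Jp_D(1) by auto
      then show ?case using insert by (simp add: finsum_insert Jp_D(3))
    qed (simp add: Jp_D(2))
    have "f i \<otimes> (\<tau> ^^ i) (g (m - i)) \<in> Jp m" if "i \<le> m" for i m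
      using Jp_mult[of "f i" i "g (m - i)" "m - i"] fg that by (simp add: T_carrier)
    then show "f \<otimes>\<^bsub>P\<^esub> g \<in> carrier T"
      using fg P_mult_closed unfolding T_carrier by (auto simp: P_mult intro!: sum)
  qed (simp add: T_carrier)
qed

lemma T_eq: "T = P\<lparr>carrier := carrier T\<rparr>"
  by (simp add: T_ring_def)

lemma T_ring: "ring T"
proof -
  interpret P: ring P by (rule P_ring)
  show ?thesis using P.subring_is_ring[OF T_subring] by (simp flip: T_eq)
qed

lemma T_simps: "f \<otimes>\<^bsub>T\<^esub> g = f \<otimes>\<^bsub>P\<^esub> g" "f \<oplus>\<^bsub>T\<^esub> g = f \<oplus>\<^bsub>P\<^esub> g" "\<one>\<^bsub>T\<^esub> = \<one>\<^bsub>P\<^esub>" "\<zero>\<^bsub>T\<^esub> = \<zero>\<^bsub>P\<^esub>"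
  by (simp_all add: T_ring_def)

lemma T_minus: "\<lbrakk>f \<in> carrier T; g \<in> carrier T\<rbrakk> \<Longrightarrow> f \<ominus>\<^bsub>T\<^esub> g = f \<ominus>\<^bsub>P\<^esub> g"
  using ring.subring_minus[OF P_ring T_subring] by (simp flip: T_eq)

lemma monom_in_T: "c \<in> Jp m \<Longrightarrow> skew_monom E m c \<in> carrier T"
  unfolding T_carrier using Jp_D(1)[of c m] Jp_D(2) by (auto simp: skew_monom_def intro!: monom_closed[unfolded skew_monom_def])

lemma T_induct:
  assumes "f \<in> carrier T" "\<And>m c. c \<in> Jp m \<Longrightarrow> skew_monom E m c \<in> H"
    "\<And>f g. \<lbrakk>f \<in> H; g \<in> H; f \<in> carrier T; g \<in> carrier T\<rbrakk> \<Longrightarrow> f \<oplus>\<^bsub>T\<^esub> g \<in> H"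
  shows "f \<in> H"
proof -
  have "f \<in> H" if "f \<in> carrier T" "\<forall>m\<ge>N. f m = \<zero>" for f N
    using that
  proof (induction N arbitrary: f)
    case 0
    then have "f = skew_monom E 0 \<zero>" by (auto simp: skew_monom_def fun_eq_iff)
    then show ?case using assms(2)[of \<zero> 0] by (simp add: S_ops)
  next
    case (Suc N)
    let ?g = "f(N := \<zero>)"
    have fN: "f N \<in> Jp N" "\<And>m. f m \<in> carrier E" using Suc.prems(1) by (auto simp: T_carrier P_carrier)
    have g: "?g \<in> carrier T" using Suc.prems unfolding T_carrier P_carrier by (auto simp: Jp_D(2))
    have "\<forall>m\<ge>N. ?g m = \<zero>" using Suc.prems(2) by (auto simp: Suc_le_eq)
    then have "?g \<in> H" using Suc.IH g by blast
    then have "?g \<oplus>\<^bsub>T\<^esub> skew_monom E N (f N) \<in> H"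
      using assms(2,3) fN g monom_in_T by blast
    moreover have "?g \<oplus>\<^bsub>T\<^esub> skew_monom E N (f N) = f"
      using fN by (auto simp: T_simps P_add skew_monom_def fun_eq_iff)
    ultimately show ?case by simp
  qed
  moreover obtain N where "\<forall>m>N. f m = \<zero>" using assms(1) unfolding T_carrier P_carrier by blast
  then have "\<forall>m\<ge>Suc N. f m = \<zero>" by auto
  ultimately show ?thesis using assms(1) by blast
qed

end

section \<open>Norms, the invertible submodule J and its twisted powers\<close>

context skew_polynomials
begin

text \<open>The coefficient of \<open>(c t)^m\<close>; when m is the order of the group it is the
  norm of \<open>c\<close>.\<close>

primrec partial_norm :: "'a \<Rightarrow> nat \<Rightarrow> 'a" where
  "partial_norm c 0 = \<one>"
| "partial_norm c (Suc m) = partial_norm c m \<otimes> (\<tau> ^^ m) c"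

lemma partial_norm_closed [simp]: "c \<in> carrier E \<Longrightarrow> partial_norm c m \<in> carrier E"
  by (induction m) auto

lemma partial_norm_add:
  "c \<in> carrier E \<Longrightarrow> partial_norm c (m + k) = partial_norm c m \<otimes> (\<tau> ^^ m) (partial_norm c k)"
  by (induction k) (auto simp: tau_mult tau_tau m_assoc)

lemma partial_norm_Suc':
  "c \<in> carrier E \<Longrightarrow> partial_norm c (Suc m) = c \<otimes> \<tau> (partial_norm c m)"
  using partial_norm_add[of c 1 m] by simp

lemma partial_norm_mult:
  "\<lbrakk>c \<in> carrier E; e \<in> carrier E\<rbrakk> \<Longrightarrow> partial_norm (c \<otimes> e) m = partial_norm c m \<otimes> partial_norm e m"
  by (induction m) (auto simp: tau_mult m_ac)

end

locale factored_extension = stable_subring E \<tau> S for E (structure) and \<tau> S +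
  fixes p :: nat and \<xi> \<zeta> :: 'a
  assumes p_gt_1: "1 < p" and order: "e \<in> carrier E \<Longrightarrow> (\<tau> ^^ p) e = e"
    and X_closed [simp]: "\<xi> \<in> carrier E" and Y_closed [simp]: "\<zeta> \<in> carrier E"
    and XY_in_S: "\<xi> \<otimes> \<zeta> \<in> S"
    and norm_X: "partial_norm \<xi> p \<in> S" and norm_Y: "partial_norm \<zeta> p \<in> S"
    and comaximal: "\<lbrakk>0 < k; k < p\<rbrakk> \<Longrightarrow>
      comax (E\<lparr>carrier := S\<rparr>) (\<xi> \<otimes> \<zeta>) ((\<tau> ^^ k) (\<xi> \<otimes> \<zeta>))"
begin

definition span2 where "span2 v w = {s \<otimes> v \<oplus> t \<otimes> w | s t. s \<in> S \<and> t \<in> S}"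

text \<open>The product of the conjugates of \<open>\<zeta>\<close> numbered m to p - 1. In the
  quotient it is the coefficient of \<open>yh^(p - m)\<close> in degree m, so \<open>J\<close>
  collects the coefficients of \<open>S x + S y^(p-1)\<close>.\<close>

definition Z where "Z m = (\<tau> ^^ m) (partial_norm \<zeta> (p - m))"

definition J where "J = span2 \<xi> (Z 1)"

lemma Z_closed [simp]: "Z m \<in> carrier E" by (simp add: Z_def)

lemma span2_I: "\<lbrakk>s \<in> S; t \<in> S\<rbrakk> \<Longrightarrow> s \<otimes> v \<oplus> t \<otimes> w \<in> span2 v w"
  by (auto simp: span2_def)

lemma span2_closed: "\<lbrakk>v \<in> carrier E; w \<in> carrier E; z \<in> span2 v w\<rbrakk> \<Longrightarrow> z \<in> carrier E"
  by (auto simp: span2_def S_closed)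

lemma span2_left: "\<lbrakk>v \<in> carrier E; w \<in> carrier E; s \<in> S\<rbrakk> \<Longrightarrow> s \<otimes> v \<in> span2 v w"
  using span2_I[of s \<zero> v w] by (simp add: S_ops S_closed)

lemma span2_right: "\<lbrakk>v \<in> carrier E; w \<in> carrier E; s \<in> S\<rbrakk> \<Longrightarrow> s \<otimes> w \<in> span2 v w"
  using span2_I[of \<zero> s v w] by (simp add: S_ops S_closed)

lemma span2_add:
  assumes "v \<in> carrier E" "w \<in> carrier E" "z \<in> span2 v w" "z' \<in> span2 v w"
  shows "z \<oplus> z' \<in> span2 v w"
proof -
  from assms obtain s t s' t' where st: "s \<in> S" "t \<in> S" "s' \<in> S" "t' \<in> S"
    "z = s \<otimes> v \<oplus> t \<otimes> w" "z' = s' \<otimes> v \<oplus> t' \<otimes> w" by (auto simp: span2_def)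
  then have "z \<oplus> z' = (s \<oplus> s') \<otimes> v \<oplus> (t \<oplus> t') \<otimes> w"
    using assms(1,2) by (simp add: S_closed l_distr a_ac)
  then show ?thesis using st by (auto intro: span2_I simp: S_ops)
qed

lemma span2_smult:
  assumes "v \<in> carrier E" "w \<in> carrier E" "z \<in> span2 v w" "s \<in> S"
  shows "s \<otimes> z \<in> span2 v w"
proof -
  from assms obtain s' t' where st: "s' \<in> S" "t' \<in> S" "z = s' \<otimes> v \<oplus> t' \<otimes> w" by (auto simp: span2_def)
  then have "s \<otimes> z = (s \<otimes> s') \<otimes> v \<oplus> (s \<otimes> t') \<otimes> w"
    using assms by (simp add: S_closed r_distr m_assoc)
  then show ?thesis using st assms by (auto intro: span2_I simp: S_ops)
qed

lemma span2_submodule: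
  assumes "v \<in> carrier E" "w \<in> carrier E"
  shows "is_submodule_of_overring E S (span2 v w)"
proof (rule submoduleI)
  show "\<zero> \<in> span2 v w" using span2_left[OF assms, of \<zero>] assms by (simp add: S_ops)
qed (use assms in \<open>auto intro: span2_closed span2_add span2_smult\<close>)

sublocale twisted_submodule E \<tau> S J
  by (intro twisted_submodule.intro stable_subring_axioms twisted_submodule_axioms.intro)
    (simp add: J_def span2_submodule)

definition u where "u = \<xi> \<otimes> \<zeta>"

lemma u_in_S: "u \<in> S" using XY_in_S by (simp add: u_def)
lemma u_closed [simp]: "u \<in> carrier E" by (simp add: u_def)

lemma tau_p: "e \<in> carrier E \<Longrightarrow> (\<tau> ^^ (p + m)) e = (\<tau> ^^ m) e"
  using order[of "(\<tau> ^^ m) e"] by (simp add: funpow_add)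

lemma partial_norm_in_S: "s \<in> S \<Longrightarrow> partial_norm s m \<in> S"
  by (induction m) (auto simp: S_ops tau_S)

lemma Z_rec: "m < p \<Longrightarrow> Z m = (\<tau> ^^ m) \<zeta> \<otimes> Z (Suc m)"
proof -
  assume "m < p"
  then have "p - m = Suc (p - Suc m)" by simp
  then have "Z m = (\<tau> ^^ m) (\<zeta> \<otimes> \<tau> (partial_norm \<zeta> (p - Suc m)))"
    unfolding Z_def by (simp add: partial_norm_Suc' del: partial_norm.simps)
  also have "\<dots> = (\<tau> ^^ m) \<zeta> \<otimes> Z (Suc m)"
    using tau_closed[of _ 1] by (simp add: tau_mult Z_def funpow_swap1)
  finally show ?thesis .
qed

lemma Z_0: "Z 0 = partial_norm \<zeta> p" by (simp add: Z_def)
lemma Z_p: "Z p = \<one>" by (simp add: Z_def)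

text \<open>Of the p - 1 conjugates of \<open>\<zeta>\<close> on the left, those numbered m + 1 to p
  - 1 form \<open>Z (Suc m)\<close>; the others wrap around modulo p to the numbers 0 to m -
  1.\<close>

lemma tau_Z1: 
  assumes "m < p"
  shows "(\<tau> ^^ m) (Z 1) = Z (Suc m) \<otimes> partial_norm \<zeta> m"
proof -
  have "p - 1 = (p - Suc m) + m" using assms by simp
  then have "partial_norm \<zeta> (p - 1) = partial_norm \<zeta> (p - Suc m) \<otimes> (\<tau> ^^ (p - Suc m)) (partial_norm \<zeta> m)"
    using partial_norm_add[of \<zeta> "p - Suc m" m] by simp
  moreover have "(\<tau> ^^ m) (Z 1) = (\<tau> ^^ Suc m) (partial_norm \<zeta> (p - 1))"
    by (simp add: Z_def funpow_swap1)
  ultimately have "(\<tau> ^^ m) (Z 1) = Z (Suc m) \<otimes> (\<tau> ^^ (Suc m + (p - Suc m))) (partial_norm \<zeta> m)"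
    by (simp add: Z_def tau_tau tau_mult del: funpow.simps)
  also have "Suc m + (p - Suc m) = p" using assms by simp
  finally show ?thesis by (simp add: order)
qed

abbreviation comax_S where "comax_S \<equiv> comax (E\<lparr>carrier := S\<rparr>)"

lemma S_cring: "cring (E\<lparr>carrier := S\<rparr>)"
  using S_subring subcring_iff S_closed by blast

lemmas comax_S_sym = cring.comax_sym[OF S_cring, simplified]
lemmas comax_S_one = cring.comax_one[OF S_cring, simplified]
lemmas comax_S_mult = cring.comax_mult[OF S_cring, simplified]

lemma comax_tau:
  assumes "comax_S v w" "v \<in> S" "w \<in> S"
  shows "comax_S ((\<tau> ^^ k) v) ((\<tau> ^^ k) w)"
proof -
  from assms obtain g h where gh: "g \<in> S" "h \<in> S" "g \<otimes> v \<oplus> h \<otimes> w = \<one>" unfolding comax_def by auto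
  then have "(\<tau> ^^ k) g \<otimes> (\<tau> ^^ k) v \<oplus> (\<tau> ^^ k) h \<otimes> (\<tau> ^^ k) w = \<one>"
    using assms by (metis S_closed m_closed tau_add tau_mult tau_one)
  then show ?thesis unfolding comax_def using gh tau_S by auto
qed

lemma comax_u: "\<lbrakk>0 < k; k < p\<rbrakk> \<Longrightarrow> comax_S u ((\<tau> ^^ k) u)"
  using comaximal[of k] by (simp add: u_def)

lemma comax_norm: "m < p \<Longrightarrow> comax_S ((\<tau> ^^ m) u) (partial_norm u m)"
proof -
  assume m: "m < p"
  have "comax_S ((\<tau> ^^ m) u) (partial_norm u l)" if "l \<le> m" for l
    using that
  proof (induction l)
    case 0
    then show ?case by (simp add: comax_S_one tau_S u_in_S)
  next
    case (Suc l)
    have "comax_S ((\<tau> ^^ l) u) ((\<tau> ^^ l) ((\<tau> ^^ (m - l)) u))"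
      by (intro comax_tau comax_u) (use Suc m in \<open>auto simp: u_in_S tau_S\<close>)
    then have "comax_S ((\<tau> ^^ l) u) ((\<tau> ^^ m) u)" using Suc by (simp add: tau_tau)
    then have "comax_S ((\<tau> ^^ m) u) ((\<tau> ^^ l) u)" by (rule comax_S_sym) (auto simp: tau_S u_in_S)
    then show ?case using Suc by (auto intro!: comax_S_mult simp: tau_S u_in_S partial_norm_in_S)
  qed
  then show ?thesis by simp
qed

lemma comax_u_norm: "l < p \<Longrightarrow> comax_S u (\<tau> (partial_norm u l))"
  proof (induction l)
    case 0
    then show ?case using tau_one[of 1] by (simp add: comax_S_one u_in_S)
  next
    case (Suc l)
    have "\<tau> (partial_norm u (Suc l)) = \<tau> (partial_norm u l) \<otimes> (\<tau> ^^ Suc l) u"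
      using tau_mult[of "partial_norm u l" "(\<tau> ^^ l) u" 1] by simp
    then show ?case using Suc tau_S[of _ 1] tau_S[of u "Suc l"]
      by (auto intro!: comax_S_mult comax_u simp: u_in_S partial_norm_in_S tau_S1 simp del: funpow.simps)
  qed

lemma norm_XY: "partial_norm \<xi> m \<otimes> partial_norm \<zeta> m = partial_norm u m"
  by (simp add: u_def partial_norm_mult)

lemma ideal_prod_span2:
  assumes c: "v \<in> carrier E" "w \<in> carrier E" "v' \<in> carrier E" "w' \<in> carrier E"
    and K: "is_submodule_of_overring E S K"
    and prods: "v \<otimes> v' \<in> K" "v \<otimes> w' \<in> K" "w \<otimes> v' \<in> K" "w \<otimes> w' \<in> K"
  shows "ideal_prod E (span2 v w) (span2 v' w') \<subseteq> K"
proof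
  note KD = submoduleD[OF K]
  fix z assume "z \<in> ideal_prod E (span2 v w) (span2 v' w')"
  then show "z \<in> K"
  proof (induction rule: ideal_prod.induct)
    case (prod i l)
    then obtain s t s' t' where st: "s \<in> S" "t \<in> S" "s' \<in> S" "t' \<in> S"
      "i = s \<otimes> v \<oplus> t \<otimes> w" "l = s' \<otimes> v' \<oplus> t' \<otimes> w'" by (auto simp: span2_def)
    have "i \<otimes> l = ((s \<otimes> s') \<otimes> (v \<otimes> v') \<oplus> (s \<otimes> t') \<otimes> (v \<otimes> w'))
        \<oplus> ((t \<otimes> s') \<otimes> (w \<otimes> v') \<oplus> (t \<otimes> t') \<otimes> (w \<otimes> w'))"
      using st c by (simp add: S_closed l_distr r_distr m_ac a_ac)
    then show ?case using st prods by (simp add: KD S_ops)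
  next
    case (sum z z')
    then show ?case by (simp add: KD)
  qed
qed

lemma tau_span2:
  assumes "v \<in> carrier E" "w \<in> carrier E"
  shows "(\<tau> ^^ m) ` span2 v w = span2 ((\<tau> ^^ m) v) ((\<tau> ^^ m) w)"
proof -
  have surj: "(\<tau> ^^ m) ` S = S"
  proof (induction m)
    case (Suc m)
    have "(\<tau> ^^ Suc m) ` S = \<tau> ` ((\<tau> ^^ m) ` S)" by (simp add: image_image)
    then show ?case using Suc S_stable by simp
  qed simp
  show ?thesis
  proof (intro equalityI subsetI)
    fix z assume "z \<in> (\<tau> ^^ m) ` span2 v w"
    then obtain s t where "s \<in> S" "t \<in> S" "z = (\<tau> ^^ m) (s \<otimes> v \<oplus> t \<otimes> w)" by (auto simp: span2_def)
    then show "z \<in> span2 ((\<tau> ^^ m) v) ((\<tau> ^^ m) w)"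
      using assms by (auto simp: tau_add tau_mult S_closed tau_S intro!: span2_I)
  next
    fix z assume "z \<in> span2 ((\<tau> ^^ m) v) ((\<tau> ^^ m) w)"
    then obtain s' t' where z: "s' \<in> S" "t' \<in> S" "z = s' \<otimes> (\<tau> ^^ m) v \<oplus> t' \<otimes> (\<tau> ^^ m) w"
      by (auto simp: span2_def)
    then obtain s t where st: "s \<in> S" "t \<in> S" "s' = (\<tau> ^^ m) s" "t' = (\<tau> ^^ m) t"
      using surj by (metis imageE)
    have "z = (\<tau> ^^ m) (s \<otimes> v \<oplus> t \<otimes> w)" using st z assms by (simp add: tau_add tau_mult S_closed)
    then show "z \<in> (\<tau> ^^ m) ` span2 v w" using span2_I[OF st(1,2)] by auto
  qed
qed

text \<open>In the step from m to m + 1 there are four products of generators. One is the next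
  partial norm of \<open>\<xi>\<close>; the others are multiples of \<open>Z (Suc m)\<close>, by the
  m-th partial norm of \<open>u\<close>, by the m-th conjugate of \<open>u\<close>, and by a
  conjugate of the norm of \<open>\<zeta>\<close>. The first two of these factors are comaximal, so
  \<open>Z (Suc m)\<close> itself lies in the product.\<close>

lemma Jp_eq: "m \<le> p \<Longrightarrow> Jp m = span2 (partial_norm \<xi> m) (Z m)"
proof (induction m)
  case 0
  have "S \<subseteq> span2 \<one> (partial_norm \<zeta> p)" using span2_left[of \<one> "partial_norm \<zeta> p"] S_closed by fastforce
  moreover have "span2 \<one> (partial_norm \<zeta> p) \<subseteq> S"
    using norm_Y by (auto simp: span2_def S_ops)
  ultimately show ?case by (auto simp: Z_0)
next
  case (Suc m)
  let ?N = "partial_norm \<xi>" and ?K = "span2 (partial_norm \<xi> (Suc m)) (Z (Suc m))"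
  let ?X = "(\<tau> ^^ m) \<xi>" and ?Y = "(\<tau> ^^ m) \<zeta>" and ?Z = "(\<tau> ^^ m) (Z 1)"
  have m: "m < p" using Suc by simp
  have Jp: "Jp (Suc m) = ideal_prod E (span2 (?N m) (Z m)) (span2 ?X ?Z)"
    using Suc by (simp add: J_def tau_span2 flip: One_nat_def)
  have p1: "?N m \<otimes> ?X = ?N (Suc m)" by simp
  have p2: "?N m \<otimes> ?Z = partial_norm u m \<otimes> Z (Suc m)"
    unfolding tau_Z1[OF m] norm_XY[symmetric] by (simp add: m_ac)
  have p3: "Z m \<otimes> ?X = (\<tau> ^^ m) u \<otimes> Z (Suc m)"
    unfolding Z_rec[OF m] u_def by (simp add: tau_mult m_ac)
  have "\<zeta> \<otimes> Z 1 = partial_norm \<zeta> p" using Z_rec[of 0] p_gt_1 by (simp add: Z_0)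
  then have "?Y \<otimes> ?Z = (\<tau> ^^ m) (partial_norm \<zeta> p)" by (simp flip: tau_mult)
  moreover have "Z m \<otimes> ?Z = (?Y \<otimes> ?Z) \<otimes> Z (Suc m)"
    unfolding Z_rec[OF m] by (simp add: m_ac)
  ultimately have p4: "Z m \<otimes> ?Z = (\<tau> ^^ m) (partial_norm \<zeta> p) \<otimes> Z (Suc m)"
    by simp
  have in_K: "s \<otimes> Z (Suc m) \<in> ?K" if "s \<in> S" for s
    by (rule span2_right) (use that in auto)
  have N_in_K: "?N (Suc m) \<in> ?K" using span2_left[of "?N (Suc m)" "Z (Suc m)" \<one>] by (simp add: S_ops)
  have "Jp (Suc m) \<subseteq> ?K"
    unfolding Jp
  proof (rule ideal_prod_span2)
    show "?N m \<otimes> ?X \<in> ?K" unfolding p1 by (rule N_in_K)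
    show "?N m \<otimes> ?Z \<in> ?K" unfolding p2 by (rule in_K) (simp add: partial_norm_in_S u_in_S)
    show "Z m \<otimes> ?X \<in> ?K" unfolding p3 by (rule in_K) (simp add: tau_S u_in_S)
    show "Z m \<otimes> ?Z \<in> ?K" unfolding p4 by (rule in_K) (simp add: tau_S norm_Y)
  qed (simp_all add: span2_submodule)
  moreover have "?K \<subseteq> Jp (Suc m)"
  proof -
    have gen: "?N m \<in> span2 (?N m) (Z m)" "Z m \<in> span2 (?N m) (Z m)" "?X \<in> span2 ?X ?Z" "?Z \<in> span2 ?X ?Z"
      using span2_left[of "?N m" "Z m" \<one>] span2_right[of "?N m" "Z m" \<one>] span2_left[of ?X ?Z \<one>]
        span2_right[of ?X ?Z \<one>] by (simp_all add: S_ops)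
    have X_in: "?N (Suc m) \<in> Jp (Suc m)"
      unfolding Jp p1[symmetric] by (intro ideal_prod.prod gen)
    obtain g h where gh: "g \<in> S" "h \<in> S" "g \<otimes> (\<tau> ^^ m) u \<oplus> h \<otimes> partial_norm u m = \<one>"
      using comax_norm[OF m] by (auto simp: comax_def)
    have ZX: "Z m \<otimes> ?X \<in> Jp (Suc m)" and NZ: "?N m \<otimes> ?Z \<in> Jp (Suc m)"
      unfolding Jp by (intro ideal_prod.prod gen)+
    have "g \<otimes> (Z m \<otimes> ?X) \<oplus> h \<otimes> (?N m \<otimes> ?Z) \<in> Jp (Suc m)"
      by (rule Jp_D(3)[OF Jp_D(4)[OF gh(1) ZX] Jp_D(4)[OF gh(2) NZ]])
    moreover have "g \<otimes> (Z m \<otimes> ?X) \<oplus> h \<otimes> (?N m \<otimes> ?Z)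
        = (g \<otimes> (\<tau> ^^ m) u \<oplus> h \<otimes> partial_norm u m) \<otimes> Z (Suc m)"
      unfolding p2 p3 using gh(1,2) by (simp add: S_closed l_distr m_assoc)
    ultimately have Z_in: "Z (Suc m) \<in> Jp (Suc m)" by (simp add: gh)
    show ?thesis
      unfolding span2_def by (auto intro!: Jp_D(3) Jp_D(4) X_in Z_in simp del: twisted_power.simps partial_norm.simps)
  qed
  ultimately show ?case by blast
qed

text \<open>Here \<open>Z p = \<one>\<close> and the norm of \<open>\<xi>\<close> lies in
  \<open>S\<close>. The norm of \<open>J\<close> is thus equal to \<open>S\<close>, not just
  isomorphic to it, and the identity can serve as \<open>\<phi>\<close>.\<close>

lemma Jp_p: "Jp p = S"
proof -
  have "Jp p = span2 (partial_norm \<xi> p) \<one>" by (simp add: Jp_eq Z_p)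
  also have "\<dots> = S"
    using norm_X span2_right[of "partial_norm \<xi> p" \<one>] S_closed by (fastforce simp: span2_def S_ops)
  finally show ?thesis .
qed

text \<open>The inverse exchanges the two factors: it is spanned by \<open>\<zeta>\<close> and the
  product of the conjugates of \<open>\<xi>\<close> numbered 1 to p - 1. The products of generators
  are \<open>u\<close>, the product of the conjugates of \<open>u\<close> numbered 1 to p - 1, and
  the two norms; the first two are comaximal.\<close>

lemma J_invertible: "invertible_submodule E S J"
proof -
  obtain n where n: "p = Suc n" using p_gt_1 by (cases p) auto
  let ?W = "\<tau> (partial_norm \<xi> n)" and ?V = "\<tau> (partial_norm \<zeta> n)"
  have c [simp]: "?W \<in> carrier E" "?V \<in> carrier E"
    using tau_closed[of "partial_norm \<xi> n" 1] tau_closed[of "partial_norm \<zeta> n" 1] by simp_all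
  have Z1: "Z 1 = ?V"
  proof -
    have "p - Suc 0 = n" using n by simp
    then show ?thesis by (simp add: Z_def)
  qed
  have W: "\<xi> \<otimes> ?W = partial_norm \<xi> p" and V: "?V \<otimes> \<zeta> = partial_norm \<zeta> p"
    using partial_norm_Suc'[of \<xi> n] partial_norm_Suc'[of \<zeta> n] n m_comm[of ?V \<zeta>] c
    by simp_all
  have VW: "?V \<otimes> ?W = \<tau> (partial_norm u n)"
    unfolding norm_XY[symmetric] using tau_mult[of "partial_norm \<xi> n" "partial_norm \<zeta> n" 1]
      m_comm[of ?V ?W] c by simp
  have "ideal_prod E J (span2 \<zeta> ?W) \<subseteq> S"
    unfolding J_def Z1
    by (rule ideal_prod_span2)
      (use tau_S[of "partial_norm u n" 1] in
        \<open>simp_all add: W V VW S_submodule norm_X norm_Y u_in_S partial_norm_in_S flip: u_def\<close>)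
  moreover have "S \<subseteq> ideal_prod E J (span2 \<zeta> ?W)"
  proof -
    have gen: "\<xi> \<in> J" "?V \<in> J" "\<zeta> \<in> span2 \<zeta> ?W" "?W \<in> span2 \<zeta> ?W"
      unfolding J_def Z1
      using span2_left[of \<xi> ?V \<one>] span2_right[of \<xi> ?V \<one>] span2_left[of \<zeta> ?W \<one>] span2_right[of \<zeta> ?W \<one>]
      by (simp_all add: S_ops)
    have sub: "is_submodule_of_overring E S (ideal_prod E J (span2 \<zeta> ?W))"
      by (rule ideal_prod_submodule[OF J_submodule])
        (use submoduleD(1,2)[OF span2_submodule[of \<zeta> ?W]] in auto)
    obtain g h where gh: "g \<in> S" "h \<in> S" "g \<otimes> u \<oplus> h \<otimes> \<tau> (partial_norm u n) = \<one>"
      using comax_u_norm[of n] n by (auto simp: comax_def)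
    have "g \<otimes> (\<xi> \<otimes> \<zeta>) \<oplus> h \<otimes> (?V \<otimes> ?W) \<in> ideal_prod E J (span2 \<zeta> ?W)"
      by (intro submoduleD[OF sub] ideal_prod.prod gen gh)
    then have one: "\<one> \<in> ideal_prod E J (span2 \<zeta> ?W)" using gh by (simp add: VW u_def)
    show ?thesis
    proof
      fix s assume "s \<in> S"
      then show "s \<in> ideal_prod E J (span2 \<zeta> ?W)" using submoduleD(4)[OF sub, of s \<one>] one by (simp add: S_closed)
    qed
  qed
  ultimately show ?thesis
    unfolding invertible_submodule_def using J_submodule span2_submodule[of \<zeta> ?W] by auto
qed

lemma data:
  assumes "\<tau> \<in> ring_iso E E"
  shows "almost_cyclic_data E S \<tau> p J (\<lambda>z. z)"
  by (intro almost_cyclic_data.intro almost_cyclic_data_axioms.intro cring_axioms)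
    (auto simp: S_subring assms order S_stable J_invertible Jp_p bij_betw_def inj_on_def)

section \<open>The quotient ring and its generators\<close>

abbreviation I where "I \<equiv> Delta_ideal E S \<tau> p J (\<lambda>z. z)"
abbreviation D where "D \<equiv> Delta E S \<tau> p J (\<lambda>z. z)"
definition cl where "cl f = I +>\<^bsub>T\<^esub> f"

lemma Delta_gens_closed:
  "{skew_monom E p c \<ominus>\<^bsub>T\<^esub> skew_monom E 0 c | c. c \<in> Jp p} \<subseteq> carrier T"
proof -
  interpret T: ring T by (rule T_ring)
  show ?thesis using monom_in_T[of _ p] monom_in_T[of _ 0] Jp_p by auto
qed

lemma I_ideal: "ideal I T"
  unfolding Delta_ideal_def by (rule ring.genideal_ideal[OF T_ring Delta_gens_closed])

lemma D_ring: "ring D"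
  unfolding Delta_def by (rule ideal.quotient_is_ring[OF I_ideal])

lemma cl_hom: "cl \<in> ring_hom T D"
  unfolding cl_def[abs_def] Delta_def by (rule ideal.rcos_ring_hom[OF I_ideal])

lemma cl_surj: "carrier D = cl ` carrier T"
  by (auto simp: Delta_def FactRing_def A_RCOSETS_def' cl_def)

lemma cl_eqI:
  assumes "f \<in> carrier T" "g \<in> carrier T" "f \<ominus>\<^bsub>T\<^esub> g \<in> I"
  shows "cl f = cl g"
  using ring.quotient_eq_iff_same_a_r_cos[OF T_ring I_ideal assms(1,2)] assms(3) by (simp add: cl_def)

text \<open>The defining relation for the coefficient 1, available because the p-th twisted power is
  \<open>S\<close>, says \<open>t^p = 1\<close>.\<close>

lemma cl_reduce:
  assumes c: "c \<in> Jp m"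
  shows "cl (skew_monom E (p + m) c) = cl (skew_monom E m c)"
proof -
  interpret T: ring T by (rule T_ring)
  have *: "cl (skew_monom E p \<one>) = cl (skew_monom E 0 \<one>)"
  proof (rule cl_eqI)
    show "skew_monom E p \<one> \<ominus>\<^bsub>T\<^esub> skew_monom E 0 \<one> \<in> I"
      unfolding Delta_ideal_def
      by (rule subsetD[OF T.genideal_self[OF Delta_gens_closed]]) (auto simp: Jp_p S_ops)
  qed (auto intro!: monom_in_T simp: Jp_p S_ops simp del: twisted_power.simps, auto simp: S_ops)
  have cE: "c \<in> carrier E" using Jp_D(1) c by blast
  have "skew_monom E (p + m) c = skew_monom E m c \<otimes>\<^bsub>T\<^esub> skew_monom E p \<one>"
    using cE by (simp add: T_simps monom_monom add.commute)
  moreover have "skew_monom E m c = skew_monom E m c \<otimes>\<^bsub>T\<^esub> skew_monom E 0 \<one>"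
    using cE by (simp add: T_simps monom_monom)
  ultimately show ?thesis
    using ring_hom_mult[OF cl_hom monom_in_T[OF c], of "skew_monom E p \<one>"]
      ring_hom_mult[OF cl_hom monom_in_T[OF c], of "skew_monom E 0 \<one>"] *
      monom_in_T[of \<one> p] monom_in_T[of \<one> 0] by (simp add: Jp_p S_ops)
qed

text \<open>The cofactors range over the whole skew polynomial ring, where \<open>t^p - 1\<close> is
  central; this makes the right-hand set an ideal of \<open>T\<close>. It contains the generators
  because \<open>c t^p - c = c (t^p - 1)\<close>.\<close>

lemma I_multiples:
  "I \<subseteq> {f \<in> carrier T. \<exists>h\<in>carrier P. f = h \<otimes>\<^bsub>P\<^esub> (skew_monom E p \<one> \<ominus>\<^bsub>P\<^esub> skew_monom E 0 \<one>)}"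
  (is "_ \<subseteq> ?K")
proof -
  interpret P: ring P by (rule P_ring)
  interpret T: ring T by (rule T_ring)
  let ?w = "skew_monom E p \<one> \<ominus>\<^bsub>P\<^esub> skew_monom E 0 \<one>"
  have w: "?w \<in> carrier P" by simp
  have TP: "f \<in> carrier P" if "f \<in> carrier T" for f using that by (simp add: T_carrier)
  have comm: "?w \<otimes>\<^bsub>P\<^esub> h = h \<otimes>\<^bsub>P\<^esub> ?w" if "h \<in> carrier P" for h
    using power_minus_one_mult(2)[OF _ order that] p_gt_1 by simp
  have "ideal ?K T"
  proof (rule idealI[OF T_ring])
    show "subgroup ?K (add_monoid T)"
    proof (rule T.add.subgroupI)
      have "\<zero>\<^bsub>T\<^esub> = \<zero>\<^bsub>P\<^esub> \<otimes>\<^bsub>P\<^esub> ?w" by (simp add: T_simps)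
      then show "?K \<noteq> {}" using T.zero_closed P.zero_closed by blast
    next
      fix f assume "f \<in> ?K"
      then obtain h where h: "f \<in> carrier T" "h \<in> carrier P" "f = h \<otimes>\<^bsub>P\<^esub> ?w" by blast
      have "\<ominus>\<^bsub>T\<^esub> f = \<zero>\<^bsub>T\<^esub> \<ominus>\<^bsub>T\<^esub> f" using h(1) by (simp add: T.minus_eq)
      also have "\<dots> = \<zero>\<^bsub>P\<^esub> \<ominus>\<^bsub>P\<^esub> f" using T_minus[OF T.zero_closed h(1)] by (simp add: T_simps)
      also have "\<dots> = (\<ominus>\<^bsub>P\<^esub> h) \<otimes>\<^bsub>P\<^esub> ?w" using h by (simp add: P.minus_eq P.l_minus)
      finally have "\<ominus>\<^bsub>T\<^esub> f = (\<ominus>\<^bsub>P\<^esub> h) \<otimes>\<^bsub>P\<^esub> ?w" .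
      then show "\<ominus>\<^bsub>T\<^esub> f \<in> ?K"
        using T.a_inv_closed[OF h(1)] P.a_inv_closed[OF h(2)] by blast
    next
      fix f g assume "f \<in> ?K" "g \<in> ?K"
      then obtain h k where h: "f \<in> carrier T" "g \<in> carrier T" "h \<in> carrier P" "k \<in> carrier P"
        "f = h \<otimes>\<^bsub>P\<^esub> ?w" "g = k \<otimes>\<^bsub>P\<^esub> ?w" by blast
      then have "f \<oplus>\<^bsub>T\<^esub> g = (h \<oplus>\<^bsub>P\<^esub> k) \<otimes>\<^bsub>P\<^esub> ?w" using w by (simp add: T_simps P.l_distr)
      then show "f \<oplus>\<^bsub>T\<^esub> g \<in> ?K" using h T.a_closed by blast
    qed auto
  next
    fix f g assume "f \<in> ?K" "g \<in> carrier T"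
    then obtain h where h: "f \<in> carrier T" "g \<in> carrier T" "h \<in> carrier P" "f = h \<otimes>\<^bsub>P\<^esub> ?w" by blast
    have "g \<otimes>\<^bsub>T\<^esub> f = (g \<otimes>\<^bsub>P\<^esub> h) \<otimes>\<^bsub>P\<^esub> ?w" using h w TP by (simp add: T_simps P.m_assoc)
    then show "g \<otimes>\<^bsub>T\<^esub> f \<in> ?K" using h TP T.m_closed P.m_closed by blast
    have "f \<otimes>\<^bsub>T\<^esub> g = (h \<otimes>\<^bsub>P\<^esub> g) \<otimes>\<^bsub>P\<^esub> ?w" using h w TP comm[of g] by (simp add: T_simps P.m_assoc)
    then show "f \<otimes>\<^bsub>T\<^esub> g \<in> ?K" using h TP T.m_closed P.m_closed by blast
  qed
  moreover have "{skew_monom E p c \<ominus>\<^bsub>T\<^esub> skew_monom E 0 c | c. c \<in> Jp p} \<subseteq> ?K"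
  proof
    fix f assume "f \<in> {skew_monom E p c \<ominus>\<^bsub>T\<^esub> skew_monom E 0 c | c. c \<in> Jp p}"
    then obtain c where c: "c \<in> Jp p" "f = skew_monom E p c \<ominus>\<^bsub>T\<^esub> skew_monom E 0 c" by blast
    have cS: "c \<in> S" "c \<in> carrier E" using c S_closed by (auto simp: Jp_p)
    have "f = skew_monom E p c \<ominus>\<^bsub>P\<^esub> skew_monom E 0 c"
      using c cS monom_in_T[of c p] monom_in_T[of c 0] by (simp add: T_minus)
    also have "\<dots> = skew_monom E 0 c \<otimes>\<^bsub>P\<^esub> ?w"
      using cS by (simp add: P.minus_eq P.r_distr P.r_minus monom_monom)
    finally have fw: "f = skew_monom E 0 c \<otimes>\<^bsub>P\<^esub> ?w" .
    have "f \<in> carrier T" using c(1) monom_in_T[of c p] monom_in_T[of c 0] cS(1) unfolding c(2) by simp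
    with fw show "f \<in> ?K" by (intro CollectI conjI bexI[of _ "skew_monom E 0 c"] monom_closed cS)
  qed
  ultimately show ?thesis unfolding Delta_ideal_def by (rule T.genideal_minimal)
qed

abbreviation incl where "incl \<equiv> Delta_incl E S \<tau> p J (\<lambda>z. z)"

lemma incl_eq: "incl s = cl (skew_monom E 0 s)"
  by (simp add: Delta_incl_def cl_def)

lemma S_monom_in_T: "s \<in> S \<Longrightarrow> skew_monom E 0 s \<in> carrier T"
  using monom_in_T[of s 0] by simp

lemma incl_hom: "incl \<in> ring_hom (E\<lparr>carrier := S\<rparr>) D"
proof (rule ring_hom_memI)
  show "incl \<one>\<^bsub>E\<lparr>carrier := S\<rparr>\<^esub> = \<one>\<^bsub>D\<^esub>"
    using ring_hom_one[OF cl_hom] by (simp add: incl_eq T_simps P_one)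
  fix s t assume st: "s \<in> carrier (E\<lparr>carrier := S\<rparr>)" "t \<in> carrier (E\<lparr>carrier := S\<rparr>)"
  show "incl s \<in> carrier D" using st by (simp add: incl_eq cl_surj S_monom_in_T)
  show "incl (s \<otimes>\<^bsub>E\<lparr>carrier := S\<rparr>\<^esub> t) = incl s \<otimes>\<^bsub>D\<^esub> incl t"
    using ring_hom_mult[OF cl_hom, of "skew_monom E 0 s" "skew_monom E 0 t"] st
    by (simp add: incl_eq T_simps monom_monom S_closed S_monom_in_T)
  show "incl (s \<oplus>\<^bsub>E\<lparr>carrier := S\<rparr>\<^esub> t) = incl s \<oplus>\<^bsub>D\<^esub> incl t"
    using ring_hom_add[OF cl_hom, of "skew_monom E 0 s" "skew_monom E 0 t"] st
    by (simp add: incl_eq T_simps monom_add S_closed S_monom_in_T)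
qed

lemma incl_zero:
  assumes "s \<in> S" "incl s = \<zero>\<^bsub>D\<^esub>"
  shows "s = \<zero>"
proof -
  interpret T: ring T by (rule T_ring)
  have "skew_monom E 0 s \<in> I"
    using assms T.a_rcos_zero[OF I_ideal] ideal.rcos_const_imp_mem[OF I_ideal, of "skew_monom E 0 s"] S_monom_in_T
    by (simp add: incl_eq cl_def Delta_def FactRing_def)
  then obtain h where "h \<in> carrier P"
    "skew_monom E 0 s = h \<otimes>\<^bsub>P\<^esub> (skew_monom E p \<one> \<ominus>\<^bsub>P\<^esub> skew_monom E 0 \<one>)"
    using I_multiples by blast
  then show ?thesis using power_minus_one_const[OF _ order] p_gt_1 by simp
qed

text \<open>Since \<open>t^p = 1\<close>, the two elements are \<open>\<xi> t\<close> and
  \<open>t^-1 \<zeta>\<close>. Hence their product is \<open>\<xi> \<zeta> = u\<close>, and their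
  p-th powers are norms.\<close>

definition xh where "xh = cl (skew_monom E 1 \<xi>)"
definition yh where "yh = cl (skew_monom E (p - 1) ((\<tau> ^^ (p - 1)) \<zeta>))"

lemma X_in: "partial_norm \<xi> m \<in> Jp m" if "m \<le> p"
  using span2_left[of "partial_norm \<xi> m" "Z m" \<one>] that by (simp add: Jp_eq S_ops)

lemma Z_in: "Z m \<in> Jp m" if "m \<le> p"
  using span2_right[of "partial_norm \<xi> m" "Z m" \<one>] that by (simp add: Jp_eq S_ops)

lemma Z_pred: "Z (p - 1) = (\<tau> ^^ (p - 1)) \<zeta>"
  using Z_rec[of "p - 1"] p_gt_1 by (simp add: Z_p)

lemma xh_rep: "skew_monom E 1 \<xi> \<in> carrier T"
  using monom_in_T[OF X_in[of 1]] p_gt_1 by simp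

lemma yh_rep: "skew_monom E (p - 1) ((\<tau> ^^ (p - 1)) \<zeta>) \<in> carrier T"
  using monom_in_T[OF Z_in[of "p - 1"]] unfolding Z_pred by simp

lemma hat_closed: "xh \<in> carrier D" "yh \<in> carrier D"
  using xh_rep yh_rep unfolding xh_def yh_def cl_surj by blast+

lemma xh_pow:
  assumes "m \<le> p"
  shows "xh [^]\<^bsub>D\<^esub> m = cl (skew_monom E m (partial_norm \<xi> m))"
  using assms
proof (induction m)
  case 0
  then show ?case using ring_hom_one[OF cl_hom] by (simp add: T_simps P_one)
next
  case (Suc m)
  then show ?case
    using ring_hom_mult[OF cl_hom monom_in_T[OF X_in[of m]] xh_rep]
    by (simp add: xh_def T_simps monom_monom)
qed

lemma yh_pow:
  assumes "m \<le> p"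
  shows "yh [^]\<^bsub>D\<^esub> m = cl (skew_monom E (p - m) (Z (p - m)))"
  using assms
proof (induction m)
  case 0
  then show ?case using cl_reduce[of \<one> 0] ring_hom_one[OF cl_hom] by (simp add: Z_p T_simps P_one S_ops)
next
  case (Suc m)
  let ?k = "p - Suc m"
  have k: "p - m = Suc ?k" "?k < p" using Suc.prems by auto
  \<comment> \<open>A factor \<open>yh\<close> raises the degree by p - 1, which after reduction by
    \<open>t^p = 1\<close> means lowering it by one.\<close>
  have deg: "(p - m) + (p - 1) = p + ?k" using k p_gt_1 by linarith
  have "yh [^]\<^bsub>D\<^esub> Suc m = cl (skew_monom E (p - m) (Z (p - m)) \<otimes>\<^bsub>T\<^esub> skew_monom E (p - 1) ((\<tau> ^^ (p - 1)) \<zeta>))"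
    using Suc ring_hom_mult[OF cl_hom monom_in_T[OF Z_in[of "p - m"]] yh_rep] by (simp add: yh_def)
  also have "\<dots> = cl (skew_monom E (p + ?k) (Z (p - m) \<otimes> (\<tau> ^^ (p + ?k)) \<zeta>))"
    unfolding T_simps by (subst monom_monom) (simp_all only: Z_closed tau_closed Y_closed tau_tau deg)
  also have "Z (p - m) \<otimes> (\<tau> ^^ (p + ?k)) \<zeta> = Z ?k"
    using Z_rec[OF k(2)] by (simp add: tau_p k(1) m_comm del: funpow.simps)
  also have "cl (skew_monom E (p + ?k) (Z ?k)) = cl (skew_monom E ?k (Z ?k))"
    by (rule cl_reduce) (rule Z_in, simp)
  finally show ?case .
qed

lemma xh_pow_p: "xh [^]\<^bsub>D\<^esub> p = incl (partial_norm \<xi> p)"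
  using cl_reduce[of "partial_norm \<xi> p" 0] norm_X by (simp add: xh_pow incl_eq)

lemma yh_pow_p: "yh [^]\<^bsub>D\<^esub> p = incl (partial_norm \<zeta> p)"
  by (simp add: yh_pow incl_eq Z_0)

lemma xh_yh: "xh \<otimes>\<^bsub>D\<^esub> yh = incl u"
proof -
  have "xh \<otimes>\<^bsub>D\<^esub> yh = cl (skew_monom E (1 + (p - 1)) (\<xi> \<otimes> (\<tau> ^^ (1 + (p - 1))) \<zeta>))"
    unfolding xh_def yh_def ring_hom_mult[OF cl_hom xh_rep yh_rep, symmetric]
    unfolding T_simps by (subst monom_monom) (simp_all only: tau_tau X_closed Y_closed tau_closed)
  also have "1 + (p - 1) = p + 0" using p_gt_1 by simp
  also have "\<xi> \<otimes> (\<tau> ^^ (p + 0)) \<zeta> = u" by (simp add: order u_def)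
  also have "cl (skew_monom E (p + 0) u) = incl u"
    unfolding incl_eq by (rule cl_reduce) (simp add: u_in_S)
  finally show ?thesis .
qed

lemma yh_xh: "yh \<otimes>\<^bsub>D\<^esub> xh = incl ((\<tau> ^^ (p - 1)) u)"
proof -
  have "yh \<otimes>\<^bsub>D\<^esub> xh = cl (skew_monom E (p - 1 + 1) ((\<tau> ^^ (p - 1)) \<zeta> \<otimes> (\<tau> ^^ (p - 1)) \<xi>))"
    unfolding xh_def yh_def ring_hom_mult[OF cl_hom yh_rep xh_rep, symmetric]
    unfolding T_simps by (subst monom_monom) simp_all
  also have "p - 1 + 1 = p + 0" using p_gt_1 by simp
  also have "(\<tau> ^^ (p - 1)) \<zeta> \<otimes> (\<tau> ^^ (p - 1)) \<xi> = (\<tau> ^^ (p - 1)) u"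
    by (simp add: u_def tau_mult m_comm)
  also have "cl (skew_monom E (p + 0) ((\<tau> ^^ (p - 1)) u)) = incl ((\<tau> ^^ (p - 1)) u)"
    unfolding incl_eq by (rule cl_reduce) (simp add: u_in_S tau_S)
  finally show ?thesis .
qed

lemma incl_central:
  assumes s: "s \<in> S" "\<tau> s = s" and z: "z \<in> carrier D"
  shows "incl s \<otimes>\<^bsub>D\<^esub> z = z \<otimes>\<^bsub>D\<^esub> incl s"
proof -
  obtain f where f: "f \<in> carrier T" "z = cl f" using z cl_surj by auto
  have fP: "f \<in> carrier P" using f(1) by (simp add: T_carrier)
  have sm: "(\<tau> ^^ m) s = s" for m by (induction m) (use s in auto)
  have "skew_monom E 0 s \<otimes>\<^bsub>T\<^esub> f = f \<otimes>\<^bsub>T\<^esub> skew_monom E 0 s"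
    using s S_closed fP P_coeff[OF fP] by (simp add: T_simps monom_mult mult_monom sm m_comm)
  then show ?thesis
    using ring_hom_mult[OF cl_hom f(1) S_monom_in_T[OF s(1)]] ring_hom_mult[OF cl_hom S_monom_in_T[OF s(1)] f(1)]
    by (simp add: incl_eq f(2))
qed

text \<open>In degree one the classes are \<open>s xh + t yh^(p-1)\<close> with \<open>s\<close> and
  \<open>t\<close> from \<open>S\<close>, by the choice of \<open>J\<close>; the higher degrees are
  generated by degree one.\<close>

lemma D_generated:
  assumes H: "subring H D" and "incl ` S \<subseteq> H" "xh \<in> H" "yh \<in> H"
  shows "H = carrier D"
proof -
  interpret D: ring D by (rule D_ring)
  interpret T: ring T by (rule T_ring)
  note HD = subringE[OF H]
  have pow: "h [^]\<^bsub>D\<^esub> (n::nat) \<in> H" if "h \<in> H" for h n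
    by (induction n) (use that HD in auto)
  have monom1: "cl (skew_monom E 1 z) \<in> H" if zJ: "z \<in> J" for z
  proof -
    have "z \<in> span2 \<xi> (Z 1)" using zJ by (simp only: J_def)
    then obtain s t where st: "s \<in> S" "t \<in> S" "z = s \<otimes> \<xi> \<oplus> t \<otimes> Z 1"
      unfolding span2_def mem_Collect_eq by (elim exE conjE)
    have Z1: "skew_monom E 1 (Z 1) \<in> carrier T" using monom_in_T[OF Z_in[of 1]] p_gt_1 by simp
    let ?a = "skew_monom E 0 s \<otimes>\<^bsub>T\<^esub> skew_monom E 1 \<xi>" and ?b = "skew_monom E 0 t \<otimes>\<^bsub>T\<^esub> skew_monom E 1 (Z 1)"
    have z_eq: "skew_monom E 1 z = ?a \<oplus>\<^bsub>T\<^esub> ?b"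
      using st(1,2) unfolding st(3) by (simp add: T_simps monom_monom monom_add S_closed)
    have cl_add: "cl (?a \<oplus>\<^bsub>T\<^esub> ?b) = cl ?a \<oplus>\<^bsub>D\<^esub> cl ?b"
      by (rule ring_hom_add[OF cl_hom T.m_closed[OF S_monom_in_T[OF st(1)] xh_rep] T.m_closed[OF S_monom_in_T[OF st(2)] Z1]])
    have cl_a: "cl ?a = incl s \<otimes>\<^bsub>D\<^esub> xh"
      unfolding incl_eq xh_def by (rule ring_hom_mult[OF cl_hom S_monom_in_T[OF st(1)] xh_rep])
    have cl_b: "cl ?b = incl t \<otimes>\<^bsub>D\<^esub> cl (skew_monom E 1 (Z 1))"
      unfolding incl_eq by (rule ring_hom_mult[OF cl_hom S_monom_in_T[OF st(2)] Z1])
    have cl_Z: "cl (skew_monom E 1 (Z 1)) = yh [^]\<^bsub>D\<^esub> (p - 1)"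
      using yh_pow[of "p - 1"] p_gt_1 by simp
    have "cl (skew_monom E 1 z) = incl s \<otimes>\<^bsub>D\<^esub> xh \<oplus>\<^bsub>D\<^esub> incl t \<otimes>\<^bsub>D\<^esub> yh [^]\<^bsub>D\<^esub> (p - 1)"
      by (simp only: z_eq cl_add cl_a cl_b cl_Z)
    moreover have "incl s \<in> H" "incl t \<in> H" using st assms(2) by auto
    ultimately show ?thesis using HD(6,7) assms(3) pow[OF assms(4)] by metis
  qed
  have monom: "cl (skew_monom E m c) \<in> H" if "c \<in> Jp m" for m c
    using that
  proof (induction m arbitrary: c)
    case 0
    then show ?case using assms(2) by (auto simp: incl_eq)
  next
    case (Suc m)
    from Suc.prems have c: "c \<in> ideal_prod E (Jp m) ((\<tau> ^^ m) ` J)" by simp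
    then show ?case
    proof (induction rule: ideal_prod.induct)
      case (prod e l)
      then obtain z where z: "z \<in> J" "l = (\<tau> ^^ m) z" by auto
      have z1: "skew_monom E 1 z \<in> carrier T"
        using monom_in_T[of z 1] z Jp_eq[of 1] p_gt_1 by (simp add: J_def del: twisted_power.simps)
      have "skew_monom E (Suc m) (e \<otimes> l) = skew_monom E m e \<otimes>\<^bsub>T\<^esub> skew_monom E 1 z"
        using prod z Jp_D(1) submoduleD(1)[OF J_submodule] by (simp add: T_simps monom_monom)
      then have "cl (skew_monom E (Suc m) (e \<otimes> l)) = cl (skew_monom E m e) \<otimes>\<^bsub>D\<^esub> cl (skew_monom E 1 z)"
        using ring_hom_mult[OF cl_hom monom_in_T[OF prod(1)] z1] by simp
      then show ?case using Suc.IH[OF prod(1)] monom1[OF z(1)] HD by simp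
    next
      case (sum e e')
      have ee: "e \<in> Jp (Suc m)" "e' \<in> Jp (Suc m)" using sum by simp_all
      then have "cl (skew_monom E (Suc m) (e \<oplus> e')) = cl (skew_monom E (Suc m) e) \<oplus>\<^bsub>D\<^esub> cl (skew_monom E (Suc m) e')"
        using ring_hom_add[OF cl_hom monom_in_T[OF ee(1)] monom_in_T[OF ee(2)]] Jp_D(1)
        by (simp add: T_simps monom_add del: twisted_power.simps)
      then show ?case using sum HD by simp
    qed
  qed
  have "f \<in> {f \<in> carrier T. cl f \<in> H}" if "f \<in> carrier T" for f
    using that
  proof (rule T_induct)
    fix m c assume "c \<in> Jp m"
    then show "skew_monom E m c \<in> {f \<in> carrier T. cl f \<in> H}" using monom monom_in_T by blast
  next
    fix f g assume "f \<in> {f \<in> carrier T. cl f \<in> H}" "g \<in> {f \<in> carrier T. cl f \<in> H}"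
    then show "f \<oplus>\<^bsub>T\<^esub> g \<in> {f \<in> carrier T. cl f \<in> H}"
      using ring_hom_add[OF cl_hom, of f g] HD ring.ring_simprules(1)[OF T_ring] by simp
  qed
  then show ?thesis using HD(1) cl_surj by auto
qed

end

section \<open>Localization at an element\<close>

lemma (in ring) coset_representative:
  assumes I: "ideal I R" and h: "h \<in> carrier R"
  shows "h \<in> I +> h" "z \<in> I +> h \<Longrightarrow> I +> z = I +> h"
proof -
  interpret I: ideal I R by fact
  show "h \<in> I +> h" unfolding a_r_coset_def' using h I.zero_closed by force
  assume "z \<in> I +> h"
  then obtain k where k: "k \<in> I" "z = k \<oplus> h" unfolding a_r_coset_def' by auto
  then have "z \<in> carrier R" "z \<ominus> h \<in> I"
    using h I.Icarr by (auto simp: minus_eq a_assoc r_neg)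
  then show "I +> z = I +> h" using quotient_eq_iff_same_a_r_cos[OF I _ h] by blast
qed

context cring
begin

text \<open>The localization at \<open>c\<close> is \<open>R[z]/(c z - 1)\<close>; cosets are replaced by chosen representatives to lower the type.\<close>

lemma localization_exists:
  assumes c: "c \<in> carrier R"
  shows "\<exists>(L :: (nat \<Rightarrow> 'a) ring) f. cring L \<and> f \<in> ring_hom R L \<and> f c \<in> Units L \<and>
    (\<forall>s\<in>carrier R. f s = \<zero>\<^bsub>L\<^esub> \<longrightarrow> (\<exists>n::nat. c [^] n \<otimes> s = \<zero>))"
proof -
  define P where "P = UP R"
  have U: "UP_cring R" by unfold_locales
  interpret P: cring P unfolding P_def by (rule UP_cring.UP_cring[OF U])
  interpret U: UP_cring R P by (rule U) (simp add: P_def)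
  let ?m = "up_ring.monom P"
  define w where "w = ?m c 1 \<ominus>\<^bsub>P\<^esub> ?m \<one> 0"
  have w: "w \<in> carrier P" using c by (simp add: w_def)
  define I where "I = PIdl\<^bsub>P\<^esub> w"
  have I: "ideal I P" unfolding I_def by (rule P.cgenideal_ideal[OF w])
  define Q where "Q = P Quot I"
  have Q: "cring Q" unfolding Q_def by (rule ideal.quotient_is_cring[OF I P.cring_axioms])
  define g where "g K = (SOME k. k \<in> K)" for K :: "(nat \<Rightarrow> 'a) set"
  have g_in: "g (I +>\<^bsub>P\<^esub> h) \<in> I +>\<^bsub>P\<^esub> h" if "h \<in> carrier P" for h
    unfolding g_def by (rule someI[where P = "\<lambda>k. k \<in> I +>\<^bsub>P\<^esub> h", OF P.coset_representative(1)[OF I that]])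
  have inj: "inj_on g (carrier Q)"
  proof (rule inj_onI)
    fix K L assume KL: "K \<in> carrier Q" "L \<in> carrier Q" "g K = g L"
    then obtain h k where hk: "h \<in> carrier P" "K = I +>\<^bsub>P\<^esub> h" "k \<in> carrier P" "L = I +>\<^bsub>P\<^esub> k"
      unfolding Q_def FactRing_def A_RCOSETS_def' by auto
    have "I +>\<^bsub>P\<^esub> g K = K" "I +>\<^bsub>P\<^esub> g L = L"
      using P.coset_representative(2)[OF I _ g_in] hk by simp_all
    then show "K = L" using KL(3) by metis
  qed
  define L where "L = image_ring g Q"
  have iso: "g \<in> ring_iso Q L" unfolding L_def by (rule inj_imp_image_ring_iso[OF inj])
  have L: "cring L"
    using cring.ring_iso_imp_img_cring[OF Q iso] by (simp add: L_def image_ring_def image_group_def monoid.defs)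
  define f where "f s = g (I +>\<^bsub>P\<^esub> ?m s 0)" for s
  have const_hom: "(\<lambda>s. ?m s 0) \<in> ring_hom R P"
    by (rule ring_hom_memI) (use U.monom_mult[of _ _ 0 0] in \<open>auto simp: U.monom_one\<close>)
  have cl_hom: "(\<lambda>h. g (I +>\<^bsub>P\<^esub> h)) \<in> ring_hom P L"
    using ring_hom_trans[OF ideal.rcos_ring_hom[OF I], of g L] iso
    by (simp add: o_def Q_def ring_iso_def)
  have f_hom: "f \<in> ring_hom R L"
    using ring_hom_trans[OF const_hom cl_hom] by (simp add: o_def f_def[abs_def])
  have "f c \<otimes>\<^bsub>L\<^esub> g (I +>\<^bsub>P\<^esub> ?m \<one> 1) = \<one>\<^bsub>L\<^esub>"
  proof -
    have "w \<in> I" unfolding I_def by (rule P.cgenideal_self[OF w])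
    then have "I +>\<^bsub>P\<^esub> ?m c 1 = I +>\<^bsub>P\<^esub> ?m \<one> 0"
      using P.quotient_eq_iff_same_a_r_cos[OF I, of "?m c 1" "?m \<one> 0"] c by (simp add: w_def)
    moreover have "?m c 0 \<otimes>\<^bsub>P\<^esub> ?m \<one> 1 = ?m c 1"
      using c U.monom_mult[of c \<one> 0 1] by simp
    ultimately show ?thesis
      using ring_hom_mult[OF cl_hom, of "?m c 0" "?m \<one> 1"] ring_hom_one[OF cl_hom] c
      by (simp add: f_def U.monom_one)
  qed
  moreover have cl: "f c \<in> carrier L" "g (I +>\<^bsub>P\<^esub> ?m \<one> 1) \<in> carrier L"
    using ring_hom_closed[OF f_hom c] ring_hom_closed[OF cl_hom, of "?m \<one> 1"] by auto
  ultimately have unit: "f c \<in> Units L"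
    using comm_monoid.m_comm[OF cring.axioms(2)[OF L] cl] unfolding Units_def by auto
  \<comment> \<open>Comparing coefficients in \<open>s = h (c z - 1)\<close> shows that the n-th
    coefficient of \<open>h\<close> is \<open>- c^n s\<close>. As \<open>h\<close> is a polynomial,
    these vanish for large n.\<close>
  have kernel: "\<exists>n::nat. c [^] n \<otimes> s = \<zero>" if s: "s \<in> carrier R" "f s = \<zero>\<^bsub>L\<^esub>" for s
  proof -
    have "\<zero>\<^bsub>L\<^esub> = g (I +>\<^bsub>P\<^esub> \<zero>\<^bsub>P\<^esub>)"
      using ring_hom_zero[OF cl_hom P.ring_axioms cring.axioms(1)[OF L]] by simp
    then have "I +>\<^bsub>P\<^esub> ?m s 0 = I +>\<^bsub>P\<^esub> \<zero>\<^bsub>P\<^esub>"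
      using s by (intro inj_onD[OF inj]) (auto simp: f_def Q_def FactRing_def A_RCOSETS_def')
    then have "?m s 0 \<in> I"
      using P.quotient_eq_iff_same_a_r_cos[OF I, of "?m s 0" "\<zero>\<^bsub>P\<^esub>"] s by (simp add: P.minus_eq)
    then obtain h where h: "h \<in> carrier P" "?m s 0 = h \<otimes>\<^bsub>P\<^esub> w"
      unfolding I_def cgenideal_def by auto
    let ?h = "up_ring.coeff P h"
    have hw: "h \<otimes>\<^bsub>P\<^esub> w = h \<otimes>\<^bsub>P\<^esub> ?m c 1 \<ominus>\<^bsub>P\<^esub> h"
      using h(1) c P.r_one[OF h(1)] by (simp add: w_def P.minus_eq P.r_distr P.r_minus U.monom_one)
    have shift: "up_ring.coeff P (h \<otimes>\<^bsub>P\<^esub> ?m c 1) n = (if n = 0 then \<zero> else ?h (n - 1) \<otimes> c)" for n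
    proof (cases n)
      case (Suc k)
      have "up_ring.coeff P (h \<otimes>\<^bsub>P\<^esub> ?m c 1) n = (\<Oplus>i\<in>{..n}. ?h i \<otimes> up_ring.coeff P (?m c 1) (n - i))"
        by (rule U.coeff_mult) (use h(1) c in auto)
      also have "\<dots> = (\<Oplus>i\<in>{..n}. if k = i then ?h i \<otimes> c else \<zero>)"
      proof (rule add.finprod_cong')
        fix i assume "i \<in> {..n}"
        then have "(1 = n - i) = (k = i)" using Suc by auto
        then show "?h i \<otimes> up_ring.coeff P (?m c 1) (n - i) = (if k = i then ?h i \<otimes> c else \<zero>)"
          using h(1) c by (simp add: U.coeff_monom)
      qed (use h(1) c in auto)
      also have "\<dots> = ?h k \<otimes> c"
        using h(1) c Suc by (intro finsum_singleton) auto
      finally show ?thesis using Suc by simp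
    qed (use h(1) c in simp)
    have eq: "(if n = 0 then s else \<zero>) = (if n = 0 then \<zero> else ?h (n - 1) \<otimes> c) \<ominus> ?h n" for n
    proof -
      have "up_ring.coeff P (?m s 0) n = up_ring.coeff P (h \<otimes>\<^bsub>P\<^esub> ?m c 1) n \<ominus> ?h n"
        unfolding h(2) hw using h(1) c by (subst U.coeff_minus) auto
      then show ?thesis unfolding shift using s(1) by (auto split: if_splits)
    qed
    have coeffs: "?h n = \<ominus> (c [^] n \<otimes> s)" for n
    proof (induction n)
      case 0
      have "s = \<ominus> ?h 0" using eq[of 0] h(1) by (simp add: minus_eq)
      then show ?case using s h(1) by simp
    next
      case (Suc n)
      have "?h n \<otimes> c \<ominus> ?h (Suc n) = \<zero>" using eq[of "Suc n"] by simp
      then have "?h (Suc n) = ?h n \<otimes> c" using h(1) c by (simp add: r_right_minus_eq)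
      then show ?case using Suc s c by (simp add: l_minus r_minus m_ac)
    qed
    obtain N where "bound \<zero> N ?h" using h(1) unfolding P_def UP_def up_def by auto
    then have "?h (Suc N) = \<zero>" by auto
    then have "\<ominus> (c [^] Suc N \<otimes> s) = \<zero>" unfolding coeffs .
    then have "c [^] Suc N \<otimes> s = \<zero>"
      using s c minus_minus[of "c [^] Suc N \<otimes> s"] by (simp del: nat_pow_Suc)
    then show ?thesis by blast
  qed
  show ?thesis using L f_hom unit kernel by blast
qed

end

section \<open>Periodic sequences\<close>

text \<open>Sequences over a ring on \<open>nat \<Rightarrow> 'a\<close> are flattened by pairing of
  indices, because \<open>almost_cyclic\<close> asks for an overring of that same type.\<close>

definition row :: "nat \<Rightarrow> (nat \<Rightarrow> 'a) \<Rightarrow> nat \<Rightarrow> 'a" where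
  "row n e = (\<lambda>k. e (prod_encode (n, k)))"

definition of_rows :: "(nat \<Rightarrow> nat \<Rightarrow> 'a) \<Rightarrow> nat \<Rightarrow> 'a" where
  "of_rows g = (\<lambda>m. case prod_decode m of (n, k) \<Rightarrow> g n k)"

lemma row_of_rows [simp]: "row n (of_rows g) = g n"
  by (simp add: row_def of_rows_def)

lemma rows_eqI: "(\<And>n. row n e = row n e') \<Longrightarrow> e = e'"
proof
  fix m assume rows: "\<And>n. row n e = row n e'"
  obtain n k where "m = prod_encode (n, k)" by (metis prod_decode_inverse surj_pair)
  then show "e m = e' m" using fun_cong[OF rows[of n], of k] by (simp add: row_def)
qed

text \<open>Sequences of period \<open>p\<close> in a ring of sequences, coded as sequences by pairing of indices.\<close>

definition periodic_ring :: "(nat \<Rightarrow> 'a) ring \<Rightarrow> nat \<Rightarrow> (nat \<Rightarrow> 'a) ring" where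
  "periodic_ring L p =
    \<lparr>carrier = {e. \<forall>n. row n e \<in> carrier L \<and> row (n + p) e = row n e},
     monoid.mult = (\<lambda>e e'. of_rows (\<lambda>n. row n e \<otimes>\<^bsub>L\<^esub> row n e')),
     monoid.one = of_rows (\<lambda>n. \<one>\<^bsub>L\<^esub>),
     ring.zero = of_rows (\<lambda>n. \<zero>\<^bsub>L\<^esub>),
     ring.add = (\<lambda>e e'. of_rows (\<lambda>n. row n e \<oplus>\<^bsub>L\<^esub> row n e'))\<rparr>"

definition shift :: "(nat \<Rightarrow> 'a) \<Rightarrow> nat \<Rightarrow> 'a" where
  "shift e = of_rows (\<lambda>n. row (Suc n) e)"

lemma row_shift_pow [simp]: "row n ((shift ^^ m) e) = row (m + n) e"
  by (induction m arbitrary: n) (auto simp: shift_def)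

lemma row_shift [simp]: "row n (shift e) = row (Suc n) e"
  by (simp add: shift_def)

lemma periodic_carrier:
  "e \<in> carrier (periodic_ring L p) \<longleftrightarrow> (\<forall>n. row n e \<in> carrier L \<and> row (n + p) e = row n e)"
  by (simp add: periodic_ring_def)

lemma periodic_rows [simp]:
  "row n (e \<otimes>\<^bsub>periodic_ring L p\<^esub> e') = row n e \<otimes>\<^bsub>L\<^esub> row n e'"
  "row n (e \<oplus>\<^bsub>periodic_ring L p\<^esub> e') = row n e \<oplus>\<^bsub>L\<^esub> row n e'"
  "row n \<one>\<^bsub>periodic_ring L p\<^esub> = \<one>\<^bsub>L\<^esub>" "row n \<zero>\<^bsub>periodic_ring L p\<^esub> = \<zero>\<^bsub>L\<^esub>"
  by (simp_all add: periodic_ring_def)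

lemma periodic_ring_cring:
  assumes "cring L"
  shows "cring (periodic_ring L p)" (is "cring ?E")
proof -
  interpret L: cring L by fact
  note [simp] = periodic_carrier
  have closed: "e \<oplus>\<^bsub>?E\<^esub> e' \<in> carrier ?E" "e \<otimes>\<^bsub>?E\<^esub> e' \<in> carrier ?E"
    if "e \<in> carrier ?E" "e' \<in> carrier ?E" for e e'
    using that by simp_all
  have const_closed: "\<one>\<^bsub>?E\<^esub> \<in> carrier ?E" "\<zero>\<^bsub>?E\<^esub> \<in> carrier ?E" by simp_all
  show ?thesis
  proof (rule cringI)
    show "abelian_group ?E"
    proof (rule abelian_groupI)
      fix e assume e: "e \<in> carrier ?E"
      show "\<exists>e'\<in>carrier ?E. e' \<oplus>\<^bsub>?E\<^esub> e = \<zero>\<^bsub>?E\<^esub>"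
      proof (rule bexI)
        show "of_rows (\<lambda>n. \<ominus>\<^bsub>L\<^esub> row n e) \<oplus>\<^bsub>?E\<^esub> e = \<zero>\<^bsub>?E\<^esub>"
          by (rule rows_eqI) (use e in \<open>simp add: L.l_neg\<close>)
      qed (use e in simp)
      show "\<zero>\<^bsub>?E\<^esub> \<oplus>\<^bsub>?E\<^esub> e = e" by (rule rows_eqI) (use e in simp)
    next
      fix e e' e'' assume e: "e \<in> carrier ?E" "e' \<in> carrier ?E" "e'' \<in> carrier ?E"
      show "e \<oplus>\<^bsub>?E\<^esub> e' \<oplus>\<^bsub>?E\<^esub> e'' = e \<oplus>\<^bsub>?E\<^esub> (e' \<oplus>\<^bsub>?E\<^esub> e'')"
        by (rule rows_eqI) (use e in \<open>simp add: L.a_assoc\<close>)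
    next
      fix e e' assume e: "e \<in> carrier ?E" "e' \<in> carrier ?E"
      show "e \<oplus>\<^bsub>?E\<^esub> e' = e' \<oplus>\<^bsub>?E\<^esub> e"
        by (rule rows_eqI) (use e in \<open>simp add: L.a_comm\<close>)
    qed (fact closed const_closed)+
    show "comm_monoid ?E"
    proof (rule comm_monoidI)
      fix e e' e'' assume e: "e \<in> carrier ?E" "e' \<in> carrier ?E" "e'' \<in> carrier ?E"
      show "e \<otimes>\<^bsub>?E\<^esub> e' \<otimes>\<^bsub>?E\<^esub> e'' = e \<otimes>\<^bsub>?E\<^esub> (e' \<otimes>\<^bsub>?E\<^esub> e'')"
        by (rule rows_eqI) (use e in \<open>simp add: L.m_assoc\<close>)
    next
      fix e e' assume e: "e \<in> carrier ?E" "e' \<in> carrier ?E"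
      show "e \<otimes>\<^bsub>?E\<^esub> e' = e' \<otimes>\<^bsub>?E\<^esub> e"
        by (rule rows_eqI) (use e in \<open>simp add: L.m_comm\<close>)
    next
      fix e assume e: "e \<in> carrier ?E"
      show "\<one>\<^bsub>?E\<^esub> \<otimes>\<^bsub>?E\<^esub> e = e" by (rule rows_eqI) (use e in simp)
    qed (fact closed const_closed)+
    fix e e' e'' assume e: "e \<in> carrier ?E" "e' \<in> carrier ?E" "e'' \<in> carrier ?E"
    show "(e \<oplus>\<^bsub>?E\<^esub> e') \<otimes>\<^bsub>?E\<^esub> e'' = e \<otimes>\<^bsub>?E\<^esub> e'' \<oplus>\<^bsub>?E\<^esub> e' \<otimes>\<^bsub>?E\<^esub> e''"
      by (rule rows_eqI) (use e in \<open>simp add: L.l_distr\<close>)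
  qed
qed

lemma shift_hom: "shift \<in> ring_hom (periodic_ring L p) (periodic_ring L p)"
proof (rule ring_hom_memI)
  fix e assume "e \<in> carrier (periodic_ring L p)"
  then show "shift e \<in> carrier (periodic_ring L p)"
    unfolding periodic_carrier by (metis row_shift add_Suc)
qed (rule rows_eqI, simp)+

lemma shift_order: "e \<in> carrier (periodic_ring L p) \<Longrightarrow> (shift ^^ p) e = e"
  by (rule rows_eqI) (simp add: periodic_carrier add.commute)

lemma shift_iso:
  assumes "0 < p"
  shows "shift \<in> ring_iso (periodic_ring L p) (periodic_ring L p)"
proof -
  obtain m where m: "p = Suc m" using assms by (cases p) auto
  have pow: "(shift ^^ k) e \<in> carrier (periodic_ring L p)" if "e \<in> carrier (periodic_ring L p)" for k e
    by (induction k) (use that ring_hom_closed[OF shift_hom] in auto)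
  have "bij_betw shift (carrier (periodic_ring L p)) (carrier (periodic_ring L p))"
  proof (rule bij_betw_byWitness[where f' = "shift ^^ m"])
    show "\<forall>e\<in>carrier (periodic_ring L p). (shift ^^ m) (shift e) = e"
      using shift_order[of _ L p] by (simp add: m funpow_swap1)
    show "\<forall>e\<in>carrier (periodic_ring L p). shift ((shift ^^ m) e) = e"
      using shift_order[of _ L p] by (simp add: m)
  qed (use pow[of _ 1] pow in auto)
  then show ?thesis using shift_hom by (simp add: ring_iso_def)
qed

section \<open>Quantum Weyl algebras are almost cyclic\<close>

context weyl_algebra
begin

text \<open>The relations hold in the quotient, so \<open>weyl_hom\<close> maps \<open>A\<close>
  there. Injectivity only concerns \<open>R\<close>, which embeds through \<open>S\<close>, and
  surjectivity is \<open>D_generated\<close>. The required \<open>\<Psi>\<close> is the inverse of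
  this map.\<close>

lemma almost_cyclic_from_factorization:
  fixes E :: "'e ring" and j :: "'a \<Rightarrow> 'e" and \<tau> \<xi> \<zeta>
  assumes fe: "factored_extension E \<tau> (j ` S) p \<xi> \<zeta>"
    and iso: "\<tau> \<in> ring_iso E E" and j: "j \<in> ring_hom S_ring E" "inj_on j S"
    and tau_j: "\<And>s. s \<in> S \<Longrightarrow> \<tau> (j s) = j (\<sigma> s)"
    and prod: "\<xi> \<otimes>\<^bsub>E\<^esub> \<zeta> = j u"
    and norm_xi: "skew_polynomials.partial_norm E \<tau> \<xi> p = j (\<iota> a)"
    and norm_zeta: "skew_polynomials.partial_norm E \<tau> \<zeta> p = j (\<iota> b)"
  shows "\<exists>J \<phi> \<Psi>. almost_cyclic_data E (j ` S) \<tau> p J \<phi> \<and>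
    \<Psi> \<in> ring_iso (Delta E (j ` S) \<tau> p J \<phi>) A \<and>
    (\<forall>s\<in>S. \<Psi> (Delta_incl E (j ` S) \<tau> p J \<phi> (j s)) = s)"
proof -
  interpret E: factored_extension E \<tau> "j ` S" p \<xi> \<zeta> by fact
  interpret D: ring E.D by (rule E.D_ring)
  interpret S: cring S_ring by (rule S_cring)
  define \<kappa> where "\<kappa> r = E.incl (j (\<iota> r))" for r
  have incl_hom: "E.incl \<in> ring_hom (E\<lparr>carrier := j ` S\<rparr>) E.D" by (rule E.incl_hom)
  have ij_hom: "(\<lambda>s. E.incl (j s)) \<in> ring_hom S_ring E.D"
  proof -
    have "j \<in> ring_hom S_ring (E\<lparr>carrier := j ` S\<rparr>)"
      using j(1) by (auto simp: ring_hom_def)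
    from ring_hom_trans[OF this incl_hom] show ?thesis by (simp add: o_def)
  qed
  note ij_closed = ring_hom_closed[OF ij_hom, simplified]
  note ij_add = ring_hom_add[OF ij_hom, simplified]
  note ij_mult = ring_hom_mult[OF ij_hom, simplified]
  note ij_one = ring_hom_one[OF ij_hom, simplified]
  have ij_uminus: "E.incl (j (\<ominus> s)) = \<ominus>\<^bsub>E.D\<^esub> E.incl (j s)" if "s \<in> S" for s
  proof -
    have "E.incl (j \<zero>) = \<zero>\<^bsub>E.D\<^esub>"
      using ring_hom_zero[OF ij_hom S.ring_axioms D.ring_axioms] by simp
    then have "E.incl (j (\<ominus> s)) \<oplus>\<^bsub>E.D\<^esub> E.incl (j s) = \<zero>\<^bsub>E.D\<^esub>"
      using that by (simp add: ij_add[symmetric] S_ops S_closed A.l_neg)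
    then show ?thesis using that by (intro D.minus_equality[symmetric]) (auto simp: ij_closed S_ops)
  qed
  have tau_pow_j: "(\<tau> ^^ k) (j s) = j ((\<sigma> ^^ k) s)" if "s \<in> S" for k s
    by (induction k) (use that tau_j \<sigma>_pow_in_S in auto)
  have \<kappa>_hom: "\<kappa> \<in> ring_hom R E.D"
    by (rule ring_hom_memI)
      (auto simp: \<kappa>_def struct_in_S ij_closed struct_add struct_mult struct_one ij_add ij_mult ij_one)
  have \<kappa>_central: "\<kappa> r \<otimes>\<^bsub>E.D\<^esub> z = z \<otimes>\<^bsub>E.D\<^esub> \<kappa> r" if "r \<in> carrier R" "z \<in> carrier E.D" for r z
    unfolding \<kappa>_def using that
    by (intro E.incl_central) (auto simp: struct_in_S tau_j \<sigma>_struct)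
  have u_eq: "E.u = j u" by (simp add: E.u_def prod)
  \<comment> \<open>\<open>yh xh\<close> is the conjugate of \<open>u\<close> numbered p - 1, so the
    relation reads \<open>u = q \<sigma>^(p-1)(u) + 1\<close>: the last of p shifts leads back to
    \<open>u\<close>.\<close>
  have rel: "E.xh \<otimes>\<^bsub>E.D\<^esub> E.yh = \<kappa> q \<otimes>\<^bsub>E.D\<^esub> (E.yh \<otimes>\<^bsub>E.D\<^esub> E.xh) \<oplus>\<^bsub>E.D\<^esub> \<one>\<^bsub>E.D\<^esub>"
  proof -
    have "shifted_u p = \<iota> q \<otimes> shifted_u (p - 1) \<oplus> \<one>"
      using shifted_u_Suc[of "p - 1"] p_pos by (simp add: scale_def)
    then have "E.incl (j u) = E.incl (j (\<iota> q \<otimes> shifted_u (p - 1) \<oplus> \<one>))"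
      by (simp add: shifted_u_p)
    also have "\<dots> = \<kappa> q \<otimes>\<^bsub>E.D\<^esub> E.incl (j (shifted_u (p - 1))) \<oplus>\<^bsub>E.D\<^esub> \<one>\<^bsub>E.D\<^esub>"
      by (simp add: \<kappa>_def ij_add ij_mult ij_one S_ops struct_in_S shifted_u_in_S)
    finally show ?thesis
      by (simp add: E.xh_yh E.yh_xh u_eq tau_pow_j u_in_S \<sigma>_pow_u)
  qed
  have alg: "central_algebra R \<kappa> E.D"
    by (intro central_algebra.intro assoc_algebra.intro assoc_algebra_axioms.intro R.cring_axioms
        D.ring_axioms \<kappa>_hom \<kappa>_central)
  have "weyl_relations R \<kappa> E.D q E.xh E.yh p a b"
  proof (intro weyl_relations.intro weyl_pair.intro weyl_pair_axioms.intro weyl_relations_axioms.intro)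
    show "E.xh \<otimes>\<^bsub>E.D\<^esub> E.yh = central_algebra.scale \<kappa> E.D q (E.yh \<otimes>\<^bsub>E.D\<^esub> E.xh) \<oplus>\<^bsub>E.D\<^esub> \<one>\<^bsub>E.D\<^esub>"
      using rel by (simp add: central_algebra.scale_def[OF alg])
    show "E.xh [^]\<^bsub>E.D\<^esub> p = \<kappa> a" "E.yh [^]\<^bsub>E.D\<^esub> p = \<kappa> b"
      by (simp_all add: E.xh_pow_p E.yh_pow_p norm_xi norm_zeta \<kappa>_def)
  qed (auto simp: alg E.hat_closed qnum_vanishing_axioms)
  from weyl_hom[OF this] obtain h where h: "h \<in> ring_hom A E.D"
    and h_struct: "\<And>r. r \<in> carrier R \<Longrightarrow> h (\<iota> r) = \<kappa> r" and hx: "h x = E.xh" and hy: "h y = E.yh"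
    by blast
  have h_S: "h s = E.incl (j s)" if "s \<in> S" for s
    using that
  proof (induction rule: S_induct)
    case (struct r)
    then show ?case by (simp add: h_struct \<kappa>_def)
  next
    case u
    show ?case using ring_hom_mult[OF h x_closed y_closed] by (simp add: hx hy E.xh_yh u_eq flip: u_def)
  next
    case (uminus s)
    interpret h: ring_hom_ring A E.D h by (rule ring_hom_ringI2[OF A.ring_axioms D.ring_axioms h])
    show ?case using uminus by (simp add: S_closed ij_uminus)
  next
    case (add s t)
    then show ?case using ring_hom_add[OF h] by (simp add: S_closed ij_add)
  next
    case (mult s t)
    then show ?case using ring_hom_mult[OF h] by (simp add: S_closed ij_mult)
  qed
  have h_inj: "inj_on h (carrier A)"
  proof (rule hom_inj[OF h D.ring_axioms])
    fix r assume r: "r \<in> carrier R" "h (\<iota> r) = \<zero>\<^bsub>E.D\<^esub>"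
    have "j (\<iota> r) = \<zero>\<^bsub>E\<^esub>"
      by (rule E.incl_zero) (use r in \<open>auto simp: h_struct \<kappa>_def struct_in_S\<close>)
    moreover have "j \<zero> = \<zero>\<^bsub>E\<^esub>"
      using ring_hom_zero[OF j(1) S.ring_axioms E.ring_axioms] by simp
    ultimately have "\<iota> r = \<iota> \<zero>\<^bsub>R\<^esub>"
      using inj_onD[OF j(2), of "\<iota> r" \<zero>] r(1) by (simp add: struct_in_S S_ops struct_zero)
    then show "r = \<zero>\<^bsub>R\<^esub>" using inj_onD[OF struct_inj] r(1) by blast
  qed
  have h_surj: "h ` carrier A = carrier E.D"
  proof (rule E.D_generated)
    interpret h: ring_hom_ring A E.D h by (rule ring_hom_ringI2[OF A.ring_axioms D.ring_axioms h])
    show "subring (h ` carrier A) E.D" by (rule h.img_is_subring[OF A.carrier_is_subring])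
    show "E.incl ` j ` S \<subseteq> h ` carrier A"
    proof
      fix z assume "z \<in> E.incl ` j ` S"
      then obtain s where "s \<in> S" "z = E.incl (j s)" by auto
      then show "z \<in> h ` carrier A" using h_S[of s] S_closed[of s] by (metis imageI)
    qed
    show "E.xh \<in> h ` carrier A" "E.yh \<in> h ` carrier A" using hx hy x_closed y_closed by (metis imageI)+
  qed
  have h_iso: "h \<in> ring_iso A E.D" using h h_inj h_surj by (simp add: ring_iso_def bij_betw_def)
  have inv: "inv_into (carrier A) h (E.incl (j s)) = s" if "s \<in> S" for s
    using h_inj h_S[OF that] S_closed[OF that] by (metis inv_into_f_f)
  show ?thesis
    using E.data[OF iso] ring_iso_set_sym[OF A.ring_axioms h_iso] inv by blast
qed

end

text \<open>Applying \<open>\<tau>\<close> permutes the \<open>n\<close> factors cyclically.\<close>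

lemma (in skew_polynomials) partial_norm_invariant:
  assumes "e \<in> carrier E" "(\<tau> ^^ n) e = e" "0 < n"
  shows "\<tau> (partial_norm e n) = partial_norm e n"
proof -
  obtain m where m: "n = Suc m" using assms(3) by (cases n) auto
  have "\<tau> (partial_norm e (Suc m)) = \<tau> (partial_norm e m) \<otimes> (\<tau> ^^ n) e"
    using tau_mult[of "partial_norm e m" "(\<tau> ^^ m) e" 1] assms(1) by (simp add: m)
  also have "\<dots> = e \<otimes> \<tau> (partial_norm e m)"
    using assms tau_closed[of "partial_norm e m" 1] by (simp add: m_comm)
  also have "\<dots> = partial_norm e n" using assms(1) unfolding m by (rule partial_norm_Suc'[symmetric])
  finally show ?thesis by (simp add: m)
qed

section \<open>Products of conjugates of u and the overring of periodic sequences\<close>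

context weyl_algebra
begin

text \<open>The product of the conjugates of \<open>u\<close> numbered \<open>i\<close> to
  \<open>i + l - 1\<close>, where the numbers count modulo p.\<close>

primrec segment :: "nat \<Rightarrow> nat \<Rightarrow> 'a" where
  "segment i 0 = \<one>"
| "segment i (Suc l) = segment i l \<otimes> shifted_u (i + l)"

lemma segment_in_S: "segment i l \<in> S"
  by (induction l) (auto simp: S_ops shifted_u_in_S)

lemma \<sigma>_pow_shifted_u: "(\<sigma> ^^ n) (shifted_u k) = shifted_u (n + k)"
  unfolding \<sigma>_pow_u[symmetric] by (simp add: funpow_add)

lemma shifted_u_add_p: "shifted_u (k + p) = shifted_u k"
  using \<sigma>_pow_shifted_u[of k p] by (simp add: shifted_u_p \<sigma>_pow_u)

lemma shifted_u_mult_p: "p dvd n \<Longrightarrow> shifted_u n = u"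
proof -
  have "shifted_u (p * m) = u" for m
  proof (induction m)
    case (Suc m)
    then show ?case using shifted_u_add_p[of "p * m"] by (simp add: add.commute)
  qed (simp add: shifted_u_0)
  then show "p dvd n \<Longrightarrow> shifted_u n = u" by (auto elim: dvdE)
qed

lemma \<sigma>_pow_segment: "(\<sigma> ^^ n) (segment i l) = segment (n + i) l"
  by (induction l) (simp_all add: \<sigma>_pow_one \<sigma>_pow_mult segment_in_S shifted_u_in_S \<sigma>_pow_shifted_u add.assoc)

lemma segment_add: "segment i (l + m) = segment i l \<otimes> segment (i + l) m"
  by (induction m) (simp_all add: segment_in_S S_closed A.m_assoc add.assoc)

lemma segment_add_p: "segment (i + p) l = segment i l"
proof (induction l)
  case (Suc l)
  have "i + p + l = i + l + p" by simp
  then show ?case by (simp only: segment.simps Suc shifted_u_add_p)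
qed simp

lemma x_pow_u: "x [^] (m::nat) \<otimes> u = shifted_u m \<otimes> x [^] m"
proof (induction m)
  case (Suc m)
  have c: "x \<otimes> shifted_u m = shifted_u (Suc m) \<otimes> x"
    using \<sigma>_props(2)[OF shifted_u_in_S[of m]] \<sigma>_pow_shifted_u[of 1 m] by (simp add: conj_def)
  have "x [^] Suc m \<otimes> u = x \<otimes> (x [^] m \<otimes> u)" unfolding x_Suc by (simp add: A.m_assoc)
  also have "\<dots> = (x \<otimes> shifted_u m) \<otimes> x [^] m" unfolding Suc by (simp add: A.m_assoc)
  also have "\<dots> = shifted_u (Suc m) \<otimes> x [^] Suc m" unfolding c x_Suc by (simp add: A.m_assoc)
  finally show ?case .
qed (simp add: shifted_u_0)

text \<open>The innermost \<open>x \<otimes> y\<close> is \<open>u\<close>, and moving it left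
  across \<open>x [^] m\<close> shifts it \<open>m\<close> times. At \<open>m = p\<close> this makes
  \<open>a b\<close> the norm of \<open>u\<close>.\<close>

lemma x_pow_y_pow: "x [^] (m::nat) \<otimes> y [^] m = segment 0 m"
proof (induction m)
  case (Suc m)
  have "x [^] Suc m \<otimes> y [^] Suc m = (x [^] m \<otimes> u) \<otimes> y [^] m"
    unfolding u_def by (simp add: A.m_assoc y_comm_pow)
  also have "\<dots> = shifted_u m \<otimes> segment 0 m"
    unfolding x_pow_u Suc[symmetric] by (simp add: A.m_assoc)
  finally show ?case using S_commute[OF shifted_u_in_S[of m] segment_in_S[of 0 m]] by simp
qed simp

lemma segment_norm: "u \<otimes> segment 1 (p - 1) = \<iota> a \<otimes> \<iota> b"
proof -
  have "segment 0 (1 + (p - 1)) = \<iota> a \<otimes> \<iota> b"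
    using x_pow_y_pow[of p] p_pos by (simp add: x_pow_p y_pow_p)
  then show ?thesis unfolding segment_add by (simp add: shifted_u_0)
qed

text \<open>The k-th conjugate is \<open>q^k u\<close> plus a quantum integer, and that integer is a
  unit.\<close>

lemma comax_shifted:
  assumes "0 < k" "k < p"
  shows "comax S_ring u (shifted_u k)"
proof -
  have un: "qn k \<in> Units R" by (rule qnum_unit) (use assms in auto)
  define r where "r = inv\<^bsub>R\<^esub> qn k"
  have r: "r \<in> carrier R" "r \<otimes>\<^bsub>R\<^esub> qn k = \<one>\<^bsub>R\<^esub>" using un by (simp_all add: r_def)
  let ?g = "\<ominus> \<iota> (r \<otimes>\<^bsub>R\<^esub> q [^]\<^bsub>R\<^esub> k)"
  have "\<iota> r \<otimes> shifted_u k = \<iota> (r \<otimes>\<^bsub>R\<^esub> q [^]\<^bsub>R\<^esub> k) \<otimes> u \<oplus> \<one>"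
    unfolding shifted_u_def using r
    by (simp add: scale_def A.r_distr struct_closed struct_mult A.m_assoc del: struct_mult)
      (simp add: struct_mult[symmetric] A.m_assoc[symmetric] struct_closed struct_one)
  then have eq: "?g \<otimes> u \<oplus> \<iota> r \<otimes> shifted_u k = \<one>"
    using r by (simp add: A.l_minus struct_closed A.r_neg1)
  show ?thesis
    unfolding comax_def
  proof (rule bexI, rule bexI)
    show "?g \<otimes>\<^bsub>S_ring\<^esub> u \<oplus>\<^bsub>S_ring\<^esub> \<iota> r \<otimes>\<^bsub>S_ring\<^esub> shifted_u k = \<one>\<^bsub>S_ring\<^esub>" using eq by simp
  qed (use r in \<open>simp_all add: S_ops struct_in_S\<close>)
qed

lemma comax_\<sigma>:
  assumes "comax S_ring v w" "v \<in> S" "w \<in> S"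
  shows "comax S_ring ((\<sigma> ^^ n) v) ((\<sigma> ^^ n) w)"
proof -
  from assms obtain g h where gh: "g \<in> S" "h \<in> S" "g \<otimes> v \<oplus> h \<otimes> w = \<one>"
    unfolding comax_def by auto
  have "(\<sigma> ^^ n) (g \<otimes> v \<oplus> h \<otimes> w) = \<one>" by (simp add: gh \<sigma>_pow_one)
  then have "(\<sigma> ^^ n) g \<otimes> (\<sigma> ^^ n) v \<oplus> (\<sigma> ^^ n) h \<otimes> (\<sigma> ^^ n) w = \<one>"
    using gh(1,2) assms(2,3) by (simp add: \<sigma>_pow_add \<sigma>_pow_mult S_ops)
  then show ?thesis unfolding comax_def using gh(1,2) \<sigma>_pow_in_S by auto
qed

lemma comax_segment: "m < p \<Longrightarrow> l \<le> m \<Longrightarrow> comax S_ring (shifted_u m) (segment 0 l)"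
proof (induction l)
  case 0
  then show ?case using cring.comax_one[OF S_cring] by (simp add: shifted_u_in_S)
next
  case (Suc l)
  have "comax S_ring ((\<sigma> ^^ l) u) ((\<sigma> ^^ l) (shifted_u (m - l)))"
    by (intro comax_\<sigma> comax_shifted) (use Suc in \<open>auto simp: u_in_S shifted_u_in_S\<close>)
  then have "comax S_ring (shifted_u l) (shifted_u m)"
    using Suc by (simp add: \<sigma>_pow_u \<sigma>_pow_shifted_u)
  then have "comax S_ring (shifted_u m) (shifted_u l)"
    using cring.comax_sym[OF S_cring] by (simp add: shifted_u_in_S)
  then show ?case
    using Suc cring.comax_mult[OF S_cring, of "shifted_u m" "segment 0 l" "shifted_u l"]
    by (simp add: shifted_u_in_S segment_in_S)
qed

text \<open>The products of all conjugates of \<open>u\<close> but one generate the unit ideal. The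
  proof shortens the product: after m + 1 of the hypotheses, \<open>z\<close> is killed by a power
  of the product of the conjugates numbered m + 1 to p - 1. For m = p - 1 that product is
  empty.\<close>

lemma torsion_zero:
  assumes z: "z \<in> S"
    and torsion: "\<And>m. m < p \<Longrightarrow> \<exists>n::nat. segment (Suc m) (p - 1) [^]\<^bsub>S_ring\<^esub> n \<otimes> z = \<zero>"
  shows "z = \<zero>"
proof -
  interpret S: cring S_ring by (rule S_cring)
  have seg [simp]: "segment i l \<in> carrier S_ring" for i l by (simp add: segment_in_S)
  have su [simp]: "shifted_u i \<in> carrier S_ring" for i by (simp add: shifted_u_in_S)
  have zc [simp]: "z \<in> carrier S_ring" using z by simp
  let ?pow = "\<lambda>v (n::nat). v [^]\<^bsub>S_ring\<^esub> n" and ?m = "\<lambda>v w. v \<otimes>\<^bsub>S_ring\<^esub> w"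
  have zero: "\<zero>\<^bsub>S_ring\<^esub> = \<zero>" by simp
  have torsion': "\<exists>n. ?m (?pow (segment (Suc m) (p - 1)) n) z = \<zero>\<^bsub>S_ring\<^esub>" if "m < p" for m
    using torsion[OF that] by simp
  have "\<exists>n. ?m (?pow (segment (Suc m) (p - Suc m)) n) z = \<zero>\<^bsub>S_ring\<^esub>" if "Suc m \<le> p" for m
    using that
  proof (induction m)
    case 0
    then show ?case using torsion'[of 0] by simp
  next
    case (Suc m)
    let ?w = "segment (Suc (Suc m)) (p - Suc (Suc m))" and ?l = "segment 0 (Suc m)" and ?u = "shifted_u (Suc m)"
    have s1: "segment (Suc m) (p - Suc m) = ?m ?u ?w"
      using segment_add[of "Suc m" 1 "p - Suc (Suc m)"] Suc.prems by (simp add: Suc_diff_Suc)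
    have deg: "p - 1 = (p - Suc (Suc m)) + Suc m" "Suc (Suc m) + (p - Suc (Suc m)) = 0 + p"
      using Suc.prems by simp_all
    have s2: "segment (Suc (Suc m)) (p - 1) = ?m ?w ?l"
      unfolding deg(1) segment_add deg(2) segment_add_p by simp
    obtain n where n: "?m (?pow (?m ?u ?w) n) z = \<zero>\<^bsub>S_ring\<^esub>" using Suc s1 by auto
    obtain k where k: "?m (?pow (?m ?w ?l) k) z = \<zero>\<^bsub>S_ring\<^esub>" using torsion'[of "Suc m"] Suc.prems s2 by auto
    \<comment> \<open>\<open>?w\<close> is the common part of the two products. The exponent
      \<open>n + k\<close> makes both relations applicable to \<open>z'\<close>, which is then
      killed by powers of the comaximal \<open>?u\<close> and \<open>?l\<close>.\<close>
    define z' where "z' = ?m (?pow ?w (n + k)) z"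
    have z': "z' \<in> carrier S_ring" unfolding z'_def by (intro S.m_closed S.nat_pow_closed seg zc)
    have pc: "?pow ?w i \<in> carrier S_ring" "?pow ?u i \<in> carrier S_ring" "?pow ?l i \<in> carrier S_ring" for i
      by (rule S.nat_pow_closed, simp only: seg su)+
    have "?m (?pow ?u n) z' = ?m (?pow ?w k) (?m (?pow (?m ?u ?w) n) z)"
      unfolding z'_def using pc zc
      by (simp only: S.nat_pow_distrib[OF su seg] S.nat_pow_mult[OF seg, symmetric] S.m_ac S.m_closed)
    then have 1: "?m (?pow ?u n) z' = \<zero>\<^bsub>S_ring\<^esub>" unfolding n using pc by (simp only: S.r_null)
    have "?m (?pow ?l k) z' = ?m (?pow ?w n) (?m (?pow (?m ?w ?l) k) z)"
      unfolding z'_def using pc zc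
      by (simp only: S.nat_pow_distrib[OF seg seg] S.nat_pow_mult[OF seg, symmetric] S.m_ac S.m_closed)
    then have 2: "?m (?pow ?l k) z' = \<zero>\<^bsub>S_ring\<^esub>" unfolding k using pc by (simp only: S.r_null)
    have "z' = \<zero>\<^bsub>S_ring\<^esub>"
      by (rule S.comax_torsion[OF comax_segment[of "Suc m" "Suc m"] su seg z' 1 2]) (use Suc.prems in auto)
    then show ?case unfolding z'_def by blast
  qed
  from this[of "p - 1"] p_pos obtain n where "?m (?pow (segment p 0) n) z = \<zero>\<^bsub>S_ring\<^esub>" by auto
  moreover have "segment p 0 = \<one>\<^bsub>S_ring\<^esub>" by simp
  ultimately have "z = \<zero>\<^bsub>S_ring\<^esub>" by (simp only: S.nat_pow_one S.l_one zc)
  then show ?thesis by simp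
qed

theorem factorization_exists:
  "\<exists>(E :: (nat \<Rightarrow> 'a) ring) j \<tau> J \<phi> \<Psi>.
    j \<in> ring_hom S_ring E \<and> inj_on j S \<and> (\<forall>s\<in>S. \<tau> (j s) = j (\<sigma> s)) \<and>
    almost_cyclic_data E (j ` S) \<tau> p J \<phi> \<and>
    \<Psi> \<in> ring_iso (Delta E (j ` S) \<tau> p J \<phi>) A \<and>
    (\<forall>s\<in>S. \<Psi> (Delta_incl E (j ` S) \<tau> p J \<phi> (j s)) = s)"
proof -
  interpret S: cring S_ring by (rule S_cring)
  \<comment> \<open>As \<open>u c = a b\<close>, inverting \<open>c\<close> yields
    \<open>u = a (b / c)\<close>, a factorization that follows the factors of the norm.\<close>
  define c where "c = segment 1 (p - 1)"
  have c: "c \<in> carrier S_ring" by (simp add: c_def segment_in_S)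
  obtain L :: "(nat \<Rightarrow> 'a) ring" and f where L: "cring L" and f: "f \<in> ring_hom S_ring L"
    and fc: "f c \<in> Units L"
    and ker: "\<And>s. s \<in> carrier S_ring \<Longrightarrow> f s = \<zero>\<^bsub>L\<^esub> \<Longrightarrow> \<exists>n::nat. c [^]\<^bsub>S_ring\<^esub> n \<otimes>\<^bsub>S_ring\<^esub> s = \<zero>\<^bsub>S_ring\<^esub>"
    using S.localization_exists[OF c] by blast
  interpret L: cring L by (rule L)
  note f_closed [simp] = ring_hom_closed[OF f, simplified]
  note f_mult = ring_hom_mult[OF f, simplified]
  note f_add = ring_hom_add[OF f, simplified]
  note f_one = ring_hom_one[OF f, simplified]
  have f_zero: "f \<zero> = \<zero>\<^bsub>L\<^esub>" using ring_hom_zero[OF f S.ring_axioms L.ring_axioms] by simp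
  have fc_closed [simp]: "inv\<^bsub>L\<^esub> f c \<in> carrier L" "f c \<in> carrier L" using fc by auto
  define E where "E = periodic_ring L p"
  interpret E: cring E unfolding E_def by (rule periodic_ring_cring[OF L])
  have E_carrier: "e \<in> carrier E \<longleftrightarrow> (\<forall>n. row n e \<in> carrier L \<and> row (n + p) e = row n e)" for e
    by (simp add: E_def periodic_carrier)
  have E_rows: "row n (e \<otimes>\<^bsub>E\<^esub> e') = row n e \<otimes>\<^bsub>L\<^esub> row n e'" "row n (e \<oplus>\<^bsub>E\<^esub> e') = row n e \<oplus>\<^bsub>L\<^esub> row n e'"
    "row n \<one>\<^bsub>E\<^esub> = \<one>\<^bsub>L\<^esub>" "row n \<zero>\<^bsub>E\<^esub> = \<zero>\<^bsub>L\<^esub>" for n e e'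
    by (simp_all add: E_def)
  interpret E: skew_polynomials E shift
    by unfold_locales (simp add: E_def shift_hom)
  define j where "j s = of_rows (\<lambda>n. f ((\<sigma> ^^ n) s))" for s
  have row_j: "row n (j s) = f ((\<sigma> ^^ n) s)" for n s by (simp add: j_def)
  have j_closed: "j s \<in> carrier E" if "s \<in> S" for s
    using that unfolding E_carrier row_j by (simp add: \<sigma>_pow_in_S funpow_add \<sigma>_order)
  have j: "j \<in> ring_hom S_ring E"
  proof (rule ring_hom_memI)
    fix s t assume st: "s \<in> carrier S_ring" "t \<in> carrier S_ring"
    show "j (s \<otimes>\<^bsub>S_ring\<^esub> t) = j s \<otimes>\<^bsub>E\<^esub> j t"
      by (rule rows_eqI) (use st in \<open>simp add: E_rows row_j \<sigma>_pow_mult f_mult \<sigma>_pow_in_S\<close>)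
    show "j (s \<oplus>\<^bsub>S_ring\<^esub> t) = j s \<oplus>\<^bsub>E\<^esub> j t"
      by (rule rows_eqI) (use st in \<open>simp add: E_rows row_j \<sigma>_pow_add f_add \<sigma>_pow_in_S\<close>)
  next
    show "j \<one>\<^bsub>S_ring\<^esub> = \<one>\<^bsub>E\<^esub>"
      by (rule rows_eqI) (simp add: E_rows row_j \<sigma>_pow_one f_one)
  qed (simp add: j_closed)
  have j_inj: "inj_on j S"
  proof -
    \<comment> \<open>A zero row means that a power of a conjugate of \<open>c\<close> kills
      \<open>z\<close>. The rows together provide every conjugate of \<open>c\<close>, so
      \<open>torsion_zero\<close> applies.\<close>
    have "inj_on j (carrier S_ring)"
    proof (rule S.ring_hom_inj_onI[OF j E.ring_axioms])
      fix z assume z: "z \<in> carrier S_ring" "j z = \<zero>\<^bsub>E\<^esub>"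
      have zS: "z \<in> S" using z by simp
      have "z = \<zero>"
      proof (rule torsion_zero[OF zS])
        fix m assume m: "m < p"
        \<comment> \<open>The m-th hypothesis comes from row \<open>p - m\<close>: applying
          \<open>\<sigma>^m\<close> brings its argument back to \<open>z\<close> and turns
          \<open>c\<close> into the segment that starts at \<open>Suc m\<close>.\<close>
        have pm: "(\<sigma> ^^ m) ((\<sigma> ^^ (p - m)) z) = z"
          using \<sigma>_order[OF zS] m by (simp flip: funpow_add[THEN fun_cong, unfolded o_apply])
        have "f ((\<sigma> ^^ (p - m)) z) = \<zero>\<^bsub>L\<^esub>" using z(2) row_j[of "p - m" z] by (simp add: E_rows)
        then obtain n :: nat where n: "c [^]\<^bsub>S_ring\<^esub> n \<otimes> (\<sigma> ^^ (p - m)) z = \<zero>"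
          using ker[of "(\<sigma> ^^ (p - m)) z"] zS by (auto simp: \<sigma>_pow_in_S)
        have pow: "c [^]\<^bsub>S_ring\<^esub> k \<in> S \<and> (\<sigma> ^^ m) (c [^]\<^bsub>S_ring\<^esub> k) = segment (Suc m) (p - 1) [^]\<^bsub>S_ring\<^esub> k" for k :: nat
          by (induction k) (use c in \<open>simp_all add: S_ops \<sigma>_pow_one \<sigma>_pow_mult c_def \<sigma>_pow_segment\<close>)
        have "(\<sigma> ^^ m) (c [^]\<^bsub>S_ring\<^esub> n \<otimes> (\<sigma> ^^ (p - m)) z) = segment (Suc m) (p - 1) [^]\<^bsub>S_ring\<^esub> n \<otimes> z"
          using pow[of n] zS pm by (simp add: \<sigma>_pow_mult \<sigma>_pow_in_S)
        moreover have "(\<sigma> ^^ m) \<zero> = \<zero>"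
          using \<sigma>_pow_struct[of "\<zero>\<^bsub>R\<^esub>" m] by (simp add: struct_zero)
        ultimately have "segment (Suc m) (p - 1) [^]\<^bsub>S_ring\<^esub> n \<otimes> z = \<zero>" by (simp add: n)
        then show "\<exists>n::nat. segment (Suc m) (p - 1) [^]\<^bsub>S_ring\<^esub> n \<otimes> z = \<zero>" by blast
      qed
      then show "z = \<zero>\<^bsub>S_ring\<^esub>" by simp
    qed
    then show ?thesis by simp
  qed
  have shift_j: "shift (j s) = j (\<sigma> s)" for s
    by (rule rows_eqI) (simp add: row_j funpow_swap1)
  \<comment> \<open>\<open>\<xi>\<close> carries all of \<open>a\<close> in the rows divisible by p
    and is 1 elsewhere, so its norm is \<open>a\<close>. The rows of \<open>\<zeta>\<close> are
    chosen to give \<open>\<xi> \<zeta> = u\<close>, with \<open>u = a (b / c)\<close> in the rows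
    divisible by p; its norm is \<open>(b / c) c = b\<close>.\<close>
  define \<xi> where "\<xi> = of_rows (\<lambda>n. if p dvd n then f (\<iota> a) else \<one>\<^bsub>L\<^esub>)"
  define \<zeta> where "\<zeta> = of_rows (\<lambda>n. if p dvd n then f (\<iota> b) \<otimes>\<^bsub>L\<^esub> inv\<^bsub>L\<^esub> f c else f (shifted_u n))"
  have row_\<xi>: "row n \<xi> = (if p dvd n then f (\<iota> a) else \<one>\<^bsub>L\<^esub>)" for n by (simp add: \<xi>_def)
  have row_\<zeta>: "row n \<zeta> = (if p dvd n then f (\<iota> b) \<otimes>\<^bsub>L\<^esub> inv\<^bsub>L\<^esub> f c else f (shifted_u n))" for n
    by (simp add: \<zeta>_def)
  have cl: "\<xi> \<in> carrier E" "\<zeta> \<in> carrier E"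
    unfolding E_carrier row_\<xi> row_\<zeta> by (auto simp: struct_in_S shifted_u_in_S shifted_u_add_p)
  have ab: "f (\<iota> a) \<otimes>\<^bsub>L\<^esub> (f (\<iota> b) \<otimes>\<^bsub>L\<^esub> inv\<^bsub>L\<^esub> f c) = f u"
  proof -
    have "f (\<iota> a) \<otimes>\<^bsub>L\<^esub> f (\<iota> b) = f u \<otimes>\<^bsub>L\<^esub> f c"
      using segment_norm by (simp add: f_mult[symmetric] struct_in_S u_in_S c_def segment_in_S)
    then show ?thesis
      using fc by (simp add: L.m_assoc[symmetric] struct_in_S u_in_S) (simp add: L.m_assoc u_in_S)
  qed
  have prod: "\<xi> \<otimes>\<^bsub>E\<^esub> \<zeta> = j u"
    by (rule rows_eqI) (simp add: E_rows row_\<xi> row_\<zeta> row_j \<sigma>_pow_u ab shifted_u_mult_p shifted_u_in_S)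
  \<comment> \<open>A norm is fixed by the shift, so all its rows agree and row 0 is enough.\<close>
  have invariant: "row n (E.partial_norm e p) = row 0 (E.partial_norm e p)" if "e \<in> carrier E" for e n
  proof (induction n)
    case (Suc n)
    have "shift (E.partial_norm e p) = E.partial_norm e p"
      by (rule E.partial_norm_invariant) (use that p_pos shift_order[of e L p] in \<open>auto simp: E_def\<close>)
    then show ?case using row_shift[of n "E.partial_norm e p"] Suc by simp
  qed simp
  have "row 0 (E.partial_norm \<xi> (Suc m)) = f (\<iota> a)" if "m < p" for m
    using that
  proof (induction m)
    case (Suc m)
    then have "\<not> p dvd Suc m" by (simp add: nat_dvd_not_less)
    then have "row (Suc m) \<xi> = \<one>\<^bsub>L\<^esub>" by (simp add: row_\<xi>)
    then show ?case using Suc unfolding E.partial_norm.simps(2)[of \<xi> "Suc m"] E_rows row_shift_pow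
      by (simp add: struct_in_S del: E.partial_norm.simps)
  qed (simp add: E_rows row_\<xi> struct_in_S)
  from this[of "p - 1"] p_pos have nx0: "row 0 (E.partial_norm \<xi> p) = f (\<iota> a)" by simp
  have norm_\<xi>: "E.partial_norm \<xi> p = j (\<iota> a)"
    by (rule rows_eqI, subst invariant[OF cl(1)]) (simp only: nx0 row_j \<sigma>_pow_struct a_closed)
  have "row 0 (E.partial_norm \<zeta> (Suc m)) = f (\<iota> b) \<otimes>\<^bsub>L\<^esub> inv\<^bsub>L\<^esub> f c \<otimes>\<^bsub>L\<^esub> f (segment 1 m)" if "m < p" for m
    using that
  proof (induction m)
    case (Suc m)
    then have "\<not> p dvd Suc m" by (simp add: nat_dvd_not_less)
    then have "row (Suc m) \<zeta> = f (shifted_u (Suc m))" by (simp add: row_\<zeta>)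
    then show ?case using Suc unfolding E.partial_norm.simps(2)[of \<zeta> "Suc m"] E_rows row_shift_pow
      by (simp add: struct_in_S f_mult segment_in_S shifted_u_in_S L.m_assoc del: E.partial_norm.simps)
  qed (simp add: E_rows row_\<zeta> struct_in_S f_one)
  from this[of "p - 1"] p_pos
  have "row 0 (E.partial_norm \<zeta> p) = f (\<iota> b) \<otimes>\<^bsub>L\<^esub> inv\<^bsub>L\<^esub> f c \<otimes>\<^bsub>L\<^esub> f c" by (simp add: c_def)
  then have nz0: "row 0 (E.partial_norm \<zeta> p) = f (\<iota> b)"
    using fc by (simp add: L.m_assoc struct_in_S)
  have norm_\<zeta>: "E.partial_norm \<zeta> p = j (\<iota> b)"
    by (rule rows_eqI, subst invariant[OF cl(2)]) (simp only: nz0 row_j \<sigma>_pow_struct b_closed)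
  have shift_pow_j: "(shift ^^ k) (j s) = j ((\<sigma> ^^ k) s)" for k s
    by (induction k) (simp_all add: shift_j)
  have comax_E: "comax (E\<lparr>carrier := j ` S\<rparr>) (j u) ((shift ^^ k) (j u))" if k: "0 < k" "k < p" for k
  proof -
    obtain g h where gh: "g \<in> S" "h \<in> S" "g \<otimes> u \<oplus> h \<otimes> shifted_u k = \<one>"
      using comax_shifted[OF k] unfolding comax_def by auto
    have "j (g \<otimes> u \<oplus> h \<otimes> shifted_u k) = \<one>\<^bsub>E\<^esub>" using ring_hom_one[OF j] by (simp add: gh)
    then have "j g \<otimes>\<^bsub>E\<^esub> j u \<oplus>\<^bsub>E\<^esub> j h \<otimes>\<^bsub>E\<^esub> j (shifted_u k) = \<one>\<^bsub>E\<^esub>"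
      using gh(1,2) ring_hom_add[OF j] ring_hom_mult[OF j] by (simp add: S_ops u_in_S shifted_u_in_S)
    then show ?thesis unfolding comax_def shift_pow_j \<sigma>_pow_u using gh(1,2) by auto
  qed
  have "factored_extension E shift (j ` S) p \<xi> \<zeta>"
  proof (intro factored_extension.intro stable_subring.intro stable_subring_axioms.intro
      factored_extension_axioms.intro E.skew_polynomials_axioms)
    interpret jh: ring_hom_ring S_ring E j by (rule ring_hom_ringI2[OF S.ring_axioms E.ring_axioms j])
    show "subcring (j ` S) E"
      using E.subcringI'[OF jh.img_is_subring[OF S.carrier_is_subring]] by simp
    show "shift ` j ` S = j ` S"
      using \<sigma>_bij unfolding bij_betw_def image_image shift_j by (metis image_image)
    show "(shift ^^ p) e = e" if "e \<in> carrier E" for e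
      using that shift_order[of e L p] by (simp add: E_def)
  qed (use p_gt_1 in \<open>auto simp: cl prod norm_\<xi> norm_\<zeta> comax_E u_in_S struct_in_S\<close>)
  from almost_cyclic_from_factorization[OF this _ j j_inj _ prod norm_\<xi> norm_\<zeta>]
  show ?thesis
    using j j_inj shift_j shift_iso[OF p_pos, of L] unfolding E_def by blast
qed

end

lemma weyl_algebra_almost_cyclic:
  fixes A :: "'a ring"
  assumes "weyl_algebra R \<iota> A q x y p a b d"
  shows "\<exists>\<sigma>. \<sigma> (x \<otimes>\<^bsub>A\<^esub> y) = \<iota> q \<otimes>\<^bsub>A\<^esub> (x \<otimes>\<^bsub>A\<^esub> y) \<oplus>\<^bsub>A\<^esub> \<one>\<^bsub>A\<^esub> \<and>
    almost_cyclic R \<iota> A (adjoin R \<iota> A (x \<otimes>\<^bsub>A\<^esub> y)) \<sigma> p"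
proof -
  interpret weyl_algebra R \<iota> A q x y p a b d by fact
  have "\<sigma> u = \<iota> q \<otimes>\<^bsub>A\<^esub> u \<oplus>\<^bsub>A\<^esub> \<one>\<^bsub>A\<^esub>"
    using shifted_u_Suc[of 0] by (simp add: \<sigma>_u shifted_u_0 scale_def)
  moreover have "almost_cyclic R \<iota> A S \<sigma> p"
    unfolding almost_cyclic_def
    using assoc_algebra_axioms S_subcring galois factorization_exists by blast
  ultimately show ?thesis unfolding S_def u_def by blast
qed

section \<open>Free algebras\<close>

lemma ring_hom_kernel_ideal:
  assumes "ring R" "ring S" "h \<in> ring_hom R S"
  shows "ideal (a_kernel R S h) R"
  by (rule ring_hom_ring.kernel_is_ideal[OF ring_hom_ringI2[OF assms]])

lemma ring_hom_minus:
  assumes "ring R" "ring S" "h \<in> ring_hom R S" and xy: "x \<in> carrier R" "y \<in> carrier R"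
  shows "h (x \<ominus>\<^bsub>R\<^esub> y) = h x \<ominus>\<^bsub>S\<^esub> h y"
proof -
  interpret h: ring_hom_ring R S h by (rule ring_hom_ringI2[OF assms(1-3)])
  show ?thesis using xy by (simp add: a_minus_def)
qed

context cring
begin

abbreviation FA :: "('g list \<Rightarrow> 'a) ring" where "FA \<equiv> free_algebra R"

definition free_monom :: "'g list \<Rightarrow> 'a \<Rightarrow> 'g list \<Rightarrow> 'a" where
  "free_monom w r = (\<lambda>v. if v = w then r else \<zero>)"

lemma free_const_eq: "free_const R r = free_monom [] r"
  by (simp add: free_const_def free_monom_def)

lemma free_gen_eq: "free_gen R g = free_monom [g] \<one>"
  by (simp add: free_gen_def free_monom_def)

lemma FA_carrier: "f \<in> carrier FA \<longleftrightarrow> (\<forall>w. f w \<in> carrier R) \<and> finite {w. f w \<noteq> \<zero>}"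
  by (simp add: free_algebra_def)

lemma FA_coeff: "f \<in> carrier FA \<Longrightarrow> f w \<in> carrier R"
  by (simp add: FA_carrier)

lemma FA_add: "f \<oplus>\<^bsub>FA\<^esub> g = (\<lambda>w. f w \<oplus> g w)"
  by (simp add: free_algebra_def)

lemma FA_zero: "\<zero>\<^bsub>FA\<^esub> = (\<lambda>w. \<zero>)"
  by (simp add: free_algebra_def)

lemma FA_one: "\<one>\<^bsub>FA\<^esub> = free_monom [] \<one>"
  by (simp add: free_algebra_def free_monom_def)

lemma FA_mult: "f \<otimes>\<^bsub>FA\<^esub> g = (\<lambda>w. \<Oplus>k\<in>{..length w}. f (take k w) \<otimes> g (drop k w))"
  by (simp add: free_algebra_def)

lemma free_monom_closed [simp]: "r \<in> carrier R \<Longrightarrow> free_monom w r \<in> carrier FA"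
  unfolding FA_carrier by (auto simp: free_monom_def intro: finite_subset[of _ "{w}"])

lemma FA_mult_closed:
  assumes f: "f \<in> carrier FA" and g: "g \<in> carrier FA"
  shows "f \<otimes>\<^bsub>FA\<^esub> g \<in> carrier FA"
proof -
  note [simp] = FA_coeff[OF f] FA_coeff[OF g]
  have "{w. (f \<otimes>\<^bsub>FA\<^esub> g) w \<noteq> \<zero>} \<subseteq> (\<lambda>(v, v'). v @ v') ` ({w. f w \<noteq> \<zero>} \<times> {w. g w \<noteq> \<zero>})"
  proof
    fix w assume "w \<in> {w. (f \<otimes>\<^bsub>FA\<^esub> g) w \<noteq> \<zero>}"
    then have nz: "(\<Oplus>k\<in>{..length w}. f (take k w) \<otimes> g (drop k w)) \<noteq> \<zero>" by (simp add: FA_mult)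
    have "\<exists>k. f (take k w) \<otimes> g (drop k w) \<noteq> \<zero>"
    proof (rule ccontr)
      assume "\<not> ?thesis"
      then have "(\<Oplus>k\<in>{..length w}. f (take k w) \<otimes> g (drop k w)) = \<zero>" by simp
      with nz show False by simp
    qed
    then obtain k where k: "f (take k w) \<otimes> g (drop k w) \<noteq> \<zero>" by blast
    then have "f (take k w) \<noteq> \<zero>" "g (drop k w) \<noteq> \<zero>" by auto
    then show "w \<in> (\<lambda>(v, v'). v @ v') ` ({w. f w \<noteq> \<zero>} \<times> {w. g w \<noteq> \<zero>})"
      by (intro image_eqI[of _ _ "(take k w, drop k w)"]) auto
  qed
  moreover have "finite ({w. f w \<noteq> \<zero>} \<times> {w. g w \<noteq> \<zero>})"
    using f g by (simp add: FA_carrier)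
  ultimately have "finite {w. (f \<otimes>\<^bsub>FA\<^esub> g) w \<noteq> \<zero>}" by (meson finite_imageI finite_subset)
  then show ?thesis unfolding FA_carrier by (auto simp: FA_mult intro!: finsum_closed)
qed

lemma FA_add_closed:
  assumes "f \<in> carrier FA" "g \<in> carrier FA"
  shows "f \<oplus>\<^bsub>FA\<^esub> g \<in> carrier FA"
proof -
  have "{w. f w \<oplus> g w \<noteq> \<zero>} \<subseteq> {w. f w \<noteq> \<zero>} \<union> {w. g w \<noteq> \<zero>}" by auto
  moreover have "finite ({w. f w \<noteq> \<zero>} \<union> {w. g w \<noteq> \<zero>})" using assms by (simp add: FA_carrier)
  ultimately have "finite {w. f w \<oplus> g w \<noteq> \<zero>}" by (rule finite_subset)
  then show ?thesis unfolding FA_carrier FA_add using assms by (simp add: FA_coeff)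
qed

lemma FA_abelian_group: "abelian_group (FA :: ('g list \<Rightarrow> 'a) ring)"
proof (rule abelian_groupI)
  fix f :: "'g list \<Rightarrow> 'a" assume f: "f \<in> carrier FA"
  note [simp] = FA_coeff[OF f]
  show "\<exists>g\<in>carrier FA. g \<oplus>\<^bsub>FA\<^esub> f = \<zero>\<^bsub>FA\<^esub>"
  proof (rule bexI)
    have "{w. \<ominus> f w \<noteq> \<zero>} \<subseteq> {w. f w \<noteq> \<zero>}" by auto
    moreover have "finite {w. f w \<noteq> \<zero>}" using f by (simp add: FA_carrier)
    ultimately have "finite {w. \<ominus> f w \<noteq> \<zero>}" by (rule finite_subset)
    then show "(\<lambda>w. \<ominus> f w) \<in> carrier FA" unfolding FA_carrier by simp
    show "(\<lambda>w. \<ominus> f w) \<oplus>\<^bsub>FA\<^esub> f = \<zero>\<^bsub>FA\<^esub>" by (simp add: FA_add FA_zero l_neg)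
  qed
next
  show "\<zero>\<^bsub>FA\<^esub> \<in> carrier FA" by (simp add: FA_carrier FA_zero)
next
  fix f g h :: "'g list \<Rightarrow> 'a" assume c: "f \<in> carrier FA" "g \<in> carrier FA" "h \<in> carrier FA"
  note [simp] = c[THEN FA_coeff]
  show "f \<oplus>\<^bsub>FA\<^esub> g \<oplus>\<^bsub>FA\<^esub> h = f \<oplus>\<^bsub>FA\<^esub> (g \<oplus>\<^bsub>FA\<^esub> h)" by (simp add: FA_add a_assoc)
next
  fix f g :: "'g list \<Rightarrow> 'a" assume c: "f \<in> carrier FA" "g \<in> carrier FA"
  note [simp] = c[THEN FA_coeff]
  show "f \<oplus>\<^bsub>FA\<^esub> g = g \<oplus>\<^bsub>FA\<^esub> f" by (simp add: FA_add a_comm)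
next
  fix f :: "'g list \<Rightarrow> 'a" assume c: "f \<in> carrier FA"
  show "\<zero>\<^bsub>FA\<^esub> \<oplus>\<^bsub>FA\<^esub> f = f" using FA_coeff[OF c] by (simp add: FA_add FA_zero)
qed (rule FA_add_closed)

lemma FA_assoc:
  assumes f: "f \<in> carrier FA" and g: "g \<in> carrier FA" and h: "h \<in> carrier FA"
  shows "(f \<otimes>\<^bsub>FA\<^esub> g) \<otimes>\<^bsub>FA\<^esub> h = f \<otimes>\<^bsub>FA\<^esub> (g \<otimes>\<^bsub>FA\<^esub> h)"
proof
  note [simp] = FA_coeff[OF f] FA_coeff[OF g] FA_coeff[OF h]
  fix w
  \<comment> \<open>\<open>F i j\<close> cuts the word after \<open>i\<close> and after
    \<open>i + j\<close> letters, so that \<open>finsum_triangle\<close> compares the two ways of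
    cutting it in three.\<close>
  define F where "F i j = f (take i w) \<otimes> (g (take j (drop i w)) \<otimes> h (drop (i + j) w))" for i j
  have F: "F i j \<in> carrier R" for i j by (simp add: F_def)
  have "((f \<otimes>\<^bsub>FA\<^esub> g) \<otimes>\<^bsub>FA\<^esub> h) w = (\<Oplus>l\<in>{..length w}. \<Oplus>i\<in>{..l}. F i (l - i))"
    unfolding FA_mult
  proof (rule add.finprod_cong')
    fix l assume "l \<in> {..length w}"
    then have l: "length (take l w) = l" by simp
    have "(\<Oplus>i\<in>{..l}. f (take i (take l w)) \<otimes> g (drop i (take l w))) \<otimes> h (drop l w)
        = (\<Oplus>i\<in>{..l}. f (take i (take l w)) \<otimes> g (drop i (take l w)) \<otimes> h (drop l w))"
      by (intro finsum_ldistr) auto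
    also have "\<dots> = (\<Oplus>i\<in>{..l}. F i (l - i))"
      by (intro add.finprod_cong') (auto simp: F_def m_assoc drop_take min_absorb1)
    finally show "(\<Oplus>i\<in>{..length (take l w)}. f (take i (take l w)) \<otimes> g (drop i (take l w))) \<otimes> h (drop l w)
        = (\<Oplus>i\<in>{..l}. F i (l - i))" unfolding l .
  qed (auto intro!: finsum_closed F)
  also have "\<dots> = (\<Oplus>i\<in>{..length w}. \<Oplus>j\<in>{..length w - i}. F i j)"
    by (rule finsum_triangle) (rule F)
  also have "\<dots> = (f \<otimes>\<^bsub>FA\<^esub> (g \<otimes>\<^bsub>FA\<^esub> h)) w"
    unfolding FA_mult
    by (rule add.finprod_cong')
      (auto simp: F_def finsum_rdistr Pi_iff add.commute intro!: finsum_closed)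
  finally show "((f \<otimes>\<^bsub>FA\<^esub> g) \<otimes>\<^bsub>FA\<^esub> h) w = (f \<otimes>\<^bsub>FA\<^esub> (g \<otimes>\<^bsub>FA\<^esub> h)) w" .
qed

lemma free_monom_mult_apply:
  assumes r: "r \<in> carrier R" and f: "f \<in> carrier FA"
  shows "(free_monom w r \<otimes>\<^bsub>FA\<^esub> f) v = (if take (length w) v = w then r \<otimes> f (drop (length w) v) else \<zero>)"
proof -
  note [simp] = FA_coeff[OF f]
  show ?thesis
  proof (cases "take (length w) v = w")
    case True
    then have len: "length w \<le> length v" by (metis length_take min.cobounded1)
    have "(free_monom w r \<otimes>\<^bsub>FA\<^esub> f) v = (\<Oplus>k\<in>{..length v}. if length w = k then r \<otimes> f (drop k v) else \<zero>)"
      unfolding FA_mult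
    proof (rule add.finprod_cong')
      fix k assume "k \<in> {..length v}"
      then have "take k v = w \<longleftrightarrow> length w = k" using True by auto
      then show "free_monom w r (take k v) \<otimes> f (drop k v) = (if length w = k then r \<otimes> f (drop k v) else \<zero>)"
        by (simp add: free_monom_def)
    qed (use r in auto)
    also have "\<dots> = r \<otimes> f (drop (length w) v)"
      using r len by (subst finsum_singleton) auto
    finally show ?thesis using True by simp
  next
    case False
    have "free_monom w r (take k v) \<otimes> f (drop k v) = \<zero>" if "k \<le> length v" for k
    proof -
      have "take k v \<noteq> w" using False that by auto
      then show ?thesis by (simp add: free_monom_def)
    qed
    then have "(\<Oplus>k\<in>{..length v}. free_monom w r (take k v) \<otimes> f (drop k v)) = (\<Oplus>k\<in>{..length v}. \<zero>)"
      by (intro add.finprod_cong') auto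
    then show ?thesis using False by (simp add: FA_mult)
  qed
qed

lemma free_monom_mult:
  assumes "r \<in> carrier R" "s \<in> carrier R"
  shows "free_monom w r \<otimes>\<^bsub>FA\<^esub> free_monom v s = free_monom (w @ v) (r \<otimes> s)"
proof
  fix z
  have "(take (length w) z = w \<and> drop (length w) z = v) = (z = w @ v)"
    by (metis append_eq_conv_conj append_take_drop_id)
  then show "(free_monom w r \<otimes>\<^bsub>FA\<^esub> free_monom v s) z = free_monom (w @ v) (r \<otimes> s) z"
    using assms by (auto simp: free_monom_mult_apply) (auto simp: free_monom_def)
qed

lemma FA_induct:
  assumes "f \<in> carrier FA" "\<And>w r. r \<in> carrier R \<Longrightarrow> free_monom w r \<in> H"
    "\<And>f g. \<lbrakk>f \<in> H; g \<in> H; f \<in> carrier FA; g \<in> carrier FA\<rbrakk> \<Longrightarrow> f \<oplus>\<^bsub>FA\<^esub> g \<in> H"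
  shows "f \<in> H"
proof -
  have "finite W \<Longrightarrow> f \<in> carrier FA \<Longrightarrow> {w. f w \<noteq> \<zero>} \<subseteq> W \<Longrightarrow> f \<in> H" for W
  proof (induction W arbitrary: f rule: finite_induct)
    case empty
    then have "f = free_monom [] \<zero>" by (auto simp: free_monom_def fun_eq_iff)
    then show ?case using assms(2)[of \<zero> "[]"] by simp
  next
    case (insert w W)
    let ?g = "f(w := \<zero>)"
    have fw: "\<And>v. f v \<in> carrier R" using insert.prems(1) by (rule FA_coeff)
    have "finite {v. ?g v \<noteq> \<zero>}"
      by (rule finite_subset[of _ "{v. f v \<noteq> \<zero>}"]) (use insert.prems(1) in \<open>auto simp: FA_carrier\<close>)
    then have g: "?g \<in> carrier FA" unfolding FA_carrier using fw by auto
    have "?g \<in> H" by (rule insert.IH[OF g]) (use insert.prems(2) in auto)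
    then have "?g \<oplus>\<^bsub>FA\<^esub> free_monom w (f w) \<in> H"
      using assms(2,3) fw g by simp
    moreover have "?g \<oplus>\<^bsub>FA\<^esub> free_monom w (f w) = f"
      using fw by (auto simp: FA_add free_monom_def fun_eq_iff)
    ultimately show ?case by simp
  qed
  then show ?thesis using assms(1) unfolding FA_carrier by blast
qed

lemma FA_distr:
  assumes "f \<in> carrier FA" "g \<in> carrier FA" "h \<in> carrier FA"
  shows "(f \<oplus>\<^bsub>FA\<^esub> g) \<otimes>\<^bsub>FA\<^esub> h = f \<otimes>\<^bsub>FA\<^esub> h \<oplus>\<^bsub>FA\<^esub> g \<otimes>\<^bsub>FA\<^esub> h"
    and "h \<otimes>\<^bsub>FA\<^esub> (f \<oplus>\<^bsub>FA\<^esub> g) = h \<otimes>\<^bsub>FA\<^esub> f \<oplus>\<^bsub>FA\<^esub> h \<otimes>\<^bsub>FA\<^esub> g"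
  using assms[THEN FA_coeff]
  by (auto simp: FA_mult FA_add fun_eq_iff l_distr r_distr finsum_addf Pi_iff)

lemma FA_ring: "ring (FA :: ('g list \<Rightarrow> 'a) ring)"
proof (rule ringI[OF FA_abelian_group _ FA_distr])
  show "monoid (FA :: ('g list \<Rightarrow> 'a) ring)"
  proof (rule monoidI)
    fix f :: "'g list \<Rightarrow> 'a" assume f: "f \<in> carrier FA"
    show "\<one>\<^bsub>FA\<^esub> \<otimes>\<^bsub>FA\<^esub> f = f"
      unfolding FA_one using f by (auto simp: free_monom_mult_apply FA_coeff)
    show "f \<otimes>\<^bsub>FA\<^esub> \<one>\<^bsub>FA\<^esub> = f"
    proof -
      have "f \<in> {f \<in> carrier FA. f \<otimes>\<^bsub>FA\<^esub> free_monom [] \<one> = f}"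
      proof (rule FA_induct[OF f])
        fix f g :: "'g list \<Rightarrow> 'a" assume "f \<in> {f \<in> carrier FA. f \<otimes>\<^bsub>FA\<^esub> free_monom [] \<one> = f}"
          "g \<in> {f \<in> carrier FA. f \<otimes>\<^bsub>FA\<^esub> free_monom [] \<one> = f}"
        then show "f \<oplus>\<^bsub>FA\<^esub> g \<in> {f \<in> carrier FA. f \<otimes>\<^bsub>FA\<^esub> free_monom [] \<one> = f}"
          by (simp add: FA_distr FA_add_closed)
      qed (simp add: free_monom_mult)
      then show ?thesis by (simp add: FA_one)
    qed
  qed (simp_all add: FA_mult_closed FA_assoc FA_one)
qed

lemma free_const_central:
  fixes f :: "'g list \<Rightarrow> 'a"
  assumes r: "r \<in> carrier R" and f: "f \<in> carrier FA"
  shows "free_const R r \<otimes>\<^bsub>FA\<^esub> f = f \<otimes>\<^bsub>FA\<^esub> free_const R r"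
proof -
  have "f \<in> {f \<in> carrier FA. free_const R r \<otimes>\<^bsub>FA\<^esub> f = f \<otimes>\<^bsub>FA\<^esub> free_const R r}"
  proof (rule FA_induct[OF f])
    fix f g :: "'g list \<Rightarrow> 'a" assume "f \<in> {f \<in> carrier FA. free_const R r \<otimes>\<^bsub>FA\<^esub> f = f \<otimes>\<^bsub>FA\<^esub> free_const R r}"
      "g \<in> {f \<in> carrier FA. free_const R r \<otimes>\<^bsub>FA\<^esub> f = f \<otimes>\<^bsub>FA\<^esub> free_const R r}"
    then show "f \<oplus>\<^bsub>FA\<^esub> g \<in> {f \<in> carrier FA. free_const R r \<otimes>\<^bsub>FA\<^esub> f = f \<otimes>\<^bsub>FA\<^esub> free_const R r}"
      using r by (simp add: FA_distr FA_add_closed free_const_eq)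
  qed (use r in \<open>simp add: free_monom_mult free_const_eq m_comm\<close>)
  then show ?thesis by simp
qed

lemma free_const_hom: "free_const R \<in> ring_hom R FA"
  by (rule ring_hom_memI)
    (auto simp: free_const_eq free_monom_mult FA_one FA_add, auto simp: free_monom_def)

end

section \<open>Algebras given by a presentation\<close>

locale presentation = cring R for R :: "('r, 'm) ring_scheme" (structure) +
  fixes rels :: "('g list \<Rightarrow> 'r) set"
  assumes rels_closed: "rels \<subseteq> carrier (free_algebra R)"
begin

abbreviation I where "I \<equiv> genideal (free_algebra R) rels"
abbreviation PA where "PA \<equiv> presented_algebra R rels"
abbreviation cls where "cls \<equiv> presented_class R rels"
abbreviation struct where "struct r \<equiv> presented_class R rels (free_const R r)"

lemma I_ideal: "ideal I (free_algebra R)"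
  by (rule ring.genideal_ideal[OF FA_ring rels_closed])

lemma PA_ring: "ring PA"
  unfolding presented_algebra_def by (rule ideal.quotient_is_ring[OF I_ideal])

lemma class_hom: "cls \<in> ring_hom (free_algebra R) PA"
  unfolding presented_algebra_def using ideal.rcos_ring_hom[OF I_ideal]
  by (simp add: presented_class_def[abs_def])

lemma class_surj: "carrier PA = cls ` carrier (free_algebra R)"
  by (auto simp: presented_algebra_def FactRing_def A_RCOSETS_def' presented_class_def)

lemma class_rel:
  assumes "f \<in> carrier (free_algebra R)" "g \<in> carrier (free_algebra R)"
    and "f \<ominus>\<^bsub>free_algebra R\<^esub> g \<in> rels"
  shows "cls f = cls g"
proof -
  have "f \<ominus>\<^bsub>free_algebra R\<^esub> g \<in> I"
    using ring.genideal_self[OF FA_ring rels_closed] assms(3) by blast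
  then show ?thesis
    using ring.quotient_eq_iff_same_a_r_cos[OF FA_ring I_ideal assms(1,2)]
    by (simp add: presented_class_def)
qed

lemma struct_hom: "(\<lambda>r. struct r) \<in> ring_hom R PA"
  using ring_hom_trans[OF free_const_hom class_hom] by (simp add: o_def)

lemma central: "central_algebra R (\<lambda>r. struct r) PA"
proof (intro central_algebra.intro assoc_algebra.intro assoc_algebra_axioms.intro cring_axioms PA_ring struct_hom)
  fix r z assume r: "r \<in> carrier R" and "z \<in> carrier PA"
  then obtain f where f: "f \<in> carrier (free_algebra R)" "z = cls f" using class_surj by auto
  have c: "free_const R r \<in> carrier (free_algebra R)" using r by (simp add: free_const_eq)
  show "struct r \<otimes>\<^bsub>PA\<^esub> z = z \<otimes>\<^bsub>PA\<^esub> struct r"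
    using ring_hom_mult[OF class_hom c f(1)] ring_hom_mult[OF class_hom f(1) c] free_const_central[OF r f(1)]
    by (simp add: f(2))
qed

lemma PA_generated:
  assumes H: "subring H PA" and "\<And>r. r \<in> carrier R \<Longrightarrow> struct r \<in> H" "\<And>g. cls (free_gen R g) \<in> H"
  shows "carrier PA \<subseteq> H"
proof -
  note HD = subringE[OF H]
  have word: "cls (free_monom w \<one>) \<in> H" for w
  proof (induction w)
    case Nil
    then show ?case using assms(2)[of \<one>] by (simp add: free_const_eq)
  next
    case (Cons g w)
    have "free_monom (g # w) \<one> = free_gen R g \<otimes>\<^bsub>free_algebra R\<^esub> free_monom w \<one>"
      by (simp add: free_gen_eq free_monom_mult)
    then show ?case
      using ring_hom_mult[OF class_hom, of "free_gen R g" "free_monom w \<one>"] Cons assms(3) HD(6)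
      by (simp add: free_gen_eq)
  qed
  have "f \<in> {f \<in> carrier (free_algebra R). cls f \<in> H}" if "f \<in> carrier (free_algebra R)" for f
  proof (rule FA_induct[OF that])
    fix w :: "'g list" and r assume r: "r \<in> carrier R"
    have "free_monom w r = free_const R r \<otimes>\<^bsub>free_algebra R\<^esub> free_monom w \<one>"
      using r by (simp add: free_const_eq free_monom_mult)
    then have "cls (free_monom w r) = struct r \<otimes>\<^bsub>PA\<^esub> cls (free_monom w \<one>)"
      using ring_hom_mult[OF class_hom, of "free_const R r" "free_monom w \<one>"] r by (simp add: free_const_eq)
    then show "free_monom w r \<in> {f \<in> carrier (free_algebra R). cls f \<in> H}"
      using r word assms(2) HD(6) by simp
  next
    fix f g :: "'g list \<Rightarrow> 'r" assume "f \<in> {f \<in> carrier (free_algebra R). cls f \<in> H}" "g \<in> {f \<in> carrier (free_algebra R). cls f \<in> H}"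
    then show "f \<oplus>\<^bsub>free_algebra R\<^esub> g \<in> {f \<in> carrier (free_algebra R). cls f \<in> H}"
      using ring_hom_add[OF class_hom, of f g] HD(7) by (simp add: FA_add_closed)
  qed
  then show ?thesis unfolding class_surj by auto
qed

end

locale evaluation = central_algebra R \<kappa> Q
  for R :: "('r, 'm) ring_scheme" and \<kappa> :: "'r \<Rightarrow> 'q" and Q :: "('q, 'n) ring_scheme" (structure) +
  fixes G :: "'g \<Rightarrow> 'q"
  assumes G_closed [simp]: "G g \<in> carrier Q"
begin

abbreviation FR where "FR \<equiv> free_algebra R"

primrec word :: "'g list \<Rightarrow> 'q" where
  "word [] = \<one>"
| "word (g # w) = G g \<otimes> word w"

lemma word_closed [simp]: "word w \<in> carrier Q" by (induction w) auto

lemma word_append: "word (v @ w) = word v \<otimes> word w"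
  by (induction v) (auto simp: A.m_assoc)

definition eval_free :: "('g list \<Rightarrow> 'r) \<Rightarrow> 'q" where
  "eval_free f = (\<Oplus>w\<in>{w. f w \<noteq> \<zero>\<^bsub>R\<^esub>}. \<kappa> (f w) \<otimes> word w)"

lemma eval_free_superset:
  assumes f: "f \<in> carrier FR" and W: "finite W" "{w. f w \<noteq> \<zero>\<^bsub>R\<^esub>} \<subseteq> W"
  shows "eval_free f = (\<Oplus>w\<in>W. \<kappa> (f w) \<otimes> word w)"
  unfolding eval_free_def
  by (rule A.add.finprod_mono_neutral_cong_left)
    (use W R.FA_coeff[OF f] in \<open>auto simp: struct_zero struct_closed\<close>)

lemma eval_free_closed: "f \<in> carrier FR \<Longrightarrow> eval_free f \<in> carrier Q"
  unfolding eval_free_def by (intro A.finsum_closed) (auto simp: struct_closed R.FA_coeff)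

lemma eval_free_add:
  assumes f: "f \<in> carrier FR" and g: "g \<in> carrier FR"
  shows "eval_free (f \<oplus>\<^bsub>FR\<^esub> g) = eval_free f \<oplus> eval_free g"
proof -
  note [simp] = R.FA_coeff[OF f] R.FA_coeff[OF g]
  let ?W = "{w. f w \<noteq> \<zero>\<^bsub>R\<^esub>} \<union> {w. g w \<noteq> \<zero>\<^bsub>R\<^esub>}"
  have W: "finite ?W" using f g by (simp add: R.FA_carrier)
  have "eval_free (f \<oplus>\<^bsub>FR\<^esub> g) = (\<Oplus>w\<in>?W. \<kappa> (f w \<oplus>\<^bsub>R\<^esub> g w) \<otimes> word w)"
    by (subst eval_free_superset[OF R.FA_add_closed[OF f g] W]) (auto simp: R.FA_add)
  also have "\<dots> = (\<Oplus>w\<in>?W. \<kappa> (f w) \<otimes> word w \<oplus> \<kappa> (g w) \<otimes> word w)"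
    by (intro A.add.finprod_cong') (auto simp: struct_add struct_closed A.l_distr)
  also have "\<dots> = (\<Oplus>w\<in>?W. \<kappa> (f w) \<otimes> word w) \<oplus> (\<Oplus>w\<in>?W. \<kappa> (g w) \<otimes> word w)"
    by (intro A.finsum_addf) (auto simp: struct_closed)
  finally show ?thesis
    using eval_free_superset[OF f W] eval_free_superset[OF g W] by simp
qed

lemma eval_free_monom:
  assumes r: "r \<in> carrier R"
  shows "eval_free (R.free_monom w r) = \<kappa> r \<otimes> word w"
proof -
  have "eval_free (R.free_monom w r) = (\<Oplus>v\<in>{w}. \<kappa> (R.free_monom w r v) \<otimes> word v)"
    by (rule eval_free_superset) (use r in \<open>auto simp: R.free_monom_def\<close>, simp flip: R.free_monom_def)
  also have "\<dots> = \<kappa> (R.free_monom w r w) \<otimes> word w"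
    using r by (subst A.finsum_insert) (auto simp: R.free_monom_def struct_closed)
  finally show ?thesis by (simp add: R.free_monom_def)
qed

lemma eval_free_mult:
  assumes f: "f \<in> carrier FR" and g: "g \<in> carrier FR"
  shows "eval_free (f \<otimes>\<^bsub>FR\<^esub> g) = eval_free f \<otimes> eval_free g"
proof -
  have step: "g \<in> {g \<in> carrier FR. eval_free (R.free_monom w r \<otimes>\<^bsub>FR\<^esub> g) = eval_free (R.free_monom w r) \<otimes> eval_free g}"
    if g: "g \<in> carrier FR" and r: "r \<in> carrier R" for w r g
  proof (rule R.FA_induct[OF g])
    fix v s assume s: "s \<in> carrier R"
    have "word w \<otimes> (\<kappa> s \<otimes> word v) = \<kappa> s \<otimes> (word w \<otimes> word v)"
      using s struct_central[OF s, of "word w"] by (simp add: struct_closed A.m_assoc[symmetric])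
    then have "\<kappa> r \<otimes> word w \<otimes> (\<kappa> s \<otimes> word v) = \<kappa> (r \<otimes>\<^bsub>R\<^esub> s) \<otimes> word (w @ v)"
      using r s by (simp add: struct_closed struct_mult word_append A.m_assoc)
    then show "R.free_monom v s \<in> {g \<in> carrier FR. eval_free (R.free_monom w r \<otimes>\<^bsub>FR\<^esub> g) = eval_free (R.free_monom w r) \<otimes> eval_free g}"
      using r s by (simp add: R.free_monom_mult eval_free_monom)
  next
    fix f g assume "f \<in> {g \<in> carrier FR. eval_free (R.free_monom w r \<otimes>\<^bsub>FR\<^esub> g) = eval_free (R.free_monom w r) \<otimes> eval_free g}"
      "g \<in> {g \<in> carrier FR. eval_free (R.free_monom w r \<otimes>\<^bsub>FR\<^esub> g) = eval_free (R.free_monom w r) \<otimes> eval_free g}"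
    then show "f \<oplus>\<^bsub>FR\<^esub> g \<in> {g \<in> carrier FR. eval_free (R.free_monom w r \<otimes>\<^bsub>FR\<^esub> g) = eval_free (R.free_monom w r) \<otimes> eval_free g}"
      using r by (simp add: R.FA_distr eval_free_add R.FA_mult_closed R.FA_add_closed eval_free_closed A.r_distr)
  qed
  have "f \<in> {f \<in> carrier FR. eval_free (f \<otimes>\<^bsub>FR\<^esub> g) = eval_free f \<otimes> eval_free g}"
  proof (rule R.FA_induct[OF f])
    fix w r assume "r \<in> carrier R"
    then show "R.free_monom w r \<in> {f \<in> carrier FR. eval_free (f \<otimes>\<^bsub>FR\<^esub> g) = eval_free f \<otimes> eval_free g}"
      using step[OF g] by simp
  next
    fix f f' assume "f \<in> {f \<in> carrier FR. eval_free (f \<otimes>\<^bsub>FR\<^esub> g) = eval_free f \<otimes> eval_free g}"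
      "f' \<in> {f \<in> carrier FR. eval_free (f \<otimes>\<^bsub>FR\<^esub> g) = eval_free f \<otimes> eval_free g}"
    then show "f \<oplus>\<^bsub>FR\<^esub> f' \<in> {f \<in> carrier FR. eval_free (f \<otimes>\<^bsub>FR\<^esub> g) = eval_free f \<otimes> eval_free g}"
      using g by (simp add: R.FA_distr eval_free_add R.FA_mult_closed R.FA_add_closed eval_free_closed A.l_distr)
  qed
  then show ?thesis by simp
qed

lemma eval_free_hom: "eval_free \<in> ring_hom FR Q"
  by (rule ring_hom_memI)
    (simp_all add: eval_free_closed eval_free_add eval_free_mult R.FA_one eval_free_monom struct_one)

lemma eval_free_const: "r \<in> carrier R \<Longrightarrow> eval_free (free_const R r) = \<kappa> r"
  by (simp add: R.free_const_eq eval_free_monom struct_closed)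

lemma eval_free_gen: "eval_free (free_gen R g) = G g"
  by (simp add: R.free_gen_eq eval_free_monom struct_one)

text \<open>The evaluation kills the ideal of the relations, hence factors through the presented
  algebra. One algebra that satisfies the relations and contains \<open>R\<close> thus shows that
  the presented algebra contains \<open>R\<close>.\<close>

lemma presented_struct_inj:
  assumes rels: "rels \<subseteq> carrier FR" "\<And>f. f \<in> rels \<Longrightarrow> eval_free f = \<zero>" and inj: "inj_on \<kappa> (carrier R)"
  shows "inj_on (\<lambda>r. presented_class R rels (free_const R r)) (carrier R)"
proof -
  note FR_ring = R.FA_ring[where 'g='g]
  have ideal: "ideal (genideal FR rels) FR" by (rule ring.genideal_ideal[OF FR_ring rels(1)])
  have "rels \<subseteq> a_kernel FR Q eval_free"
    using rels by (auto simp: a_kernel_def')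
  then have "genideal FR rels \<subseteq> a_kernel FR Q eval_free"
    by (rule ring.genideal_minimal[OF FR_ring ring_hom_kernel_ideal[OF FR_ring A.ring_axioms eval_free_hom]])
  then have ker: "eval_free f = \<zero>" if "f \<in> genideal FR rels" for f
    using that by (auto simp: a_kernel_def')
  show ?thesis
  proof (rule inj_onI)
    fix r s assume rs: "r \<in> carrier R" "s \<in> carrier R"
      "presented_class R rels (free_const R r) = presented_class R rels (free_const R s)"
    have c: "free_const R r \<in> carrier FR" "free_const R s \<in> carrier FR"
      using rs by (simp_all add: R.free_const_eq)
    have "free_const R r \<ominus>\<^bsub>FR\<^esub> free_const R s \<in> genideal FR rels"
      using ring.quotient_eq_iff_same_a_r_cos[OF FR_ring ideal c] rs(3) by (simp add: presented_class_def)
    then have "eval_free (free_const R r \<ominus>\<^bsub>FR\<^esub> free_const R s) = \<zero>" by (rule ker)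
    moreover have "eval_free (free_const R r \<ominus>\<^bsub>FR\<^esub> free_const R s) = \<kappa> r \<ominus> \<kappa> s"
      using ring_hom_minus[OF FR_ring A.ring_axioms eval_free_hom c] rs(1,2) by (simp add: eval_free_const)
    ultimately have "\<kappa> r \<ominus> \<kappa> s = \<zero>" by simp
    then have "\<kappa> r = \<kappa> s" using rs by (simp add: struct_closed)
    then show "r = s" using inj rs by (simp add: inj_on_eq_iff)
  qed
qed

end

section \<open>Endomorphism algebras of periodic function modules\<close>

lemma ring_hom_nat_pow:
  assumes "ring R" "ring S" "h \<in> ring_hom R S" "z \<in> carrier R"
  shows "h (z [^]\<^bsub>R\<^esub> (n::nat)) = h z [^]\<^bsub>S\<^esub> n"
proof -
  interpret R: ring R by fact
  interpret S: ring S by fact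
  show ?thesis
    by (induction n) (use assms(3,4) in \<open>simp_all add: ring_hom_one ring_hom_mult\<close>)
qed

definition End_algebra :: "('r, 'm) ring_scheme \<Rightarrow> ('r, 'v, 'k) module_scheme \<Rightarrow> ('v \<Rightarrow> 'v) ring" where
  "End_algebra R M =
    \<lparr>carrier = module_homs R M M,
     monoid.mult = (\<lambda>f g. \<lambda>v\<in>carrier M. f (g v)), monoid.one = (\<lambda>v\<in>carrier M. v),
     ring.zero = (\<lambda>v\<in>carrier M. \<zero>\<^bsub>M\<^esub>), ring.add = (\<lambda>f g. \<lambda>v\<in>carrier M. f v \<oplus>\<^bsub>M\<^esub> g v)\<rparr>"

lemma End_algebra_simps:
  "carrier (End_algebra R M) = module_homs R M M"
  "f \<otimes>\<^bsub>End_algebra R M\<^esub> g = (\<lambda>v\<in>carrier M. f (g v))"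
  "\<one>\<^bsub>End_algebra R M\<^esub> = (\<lambda>v\<in>carrier M. v)"
  "\<zero>\<^bsub>End_algebra R M\<^esub> = (\<lambda>v\<in>carrier M. \<zero>\<^bsub>M\<^esub>)"
  "f \<oplus>\<^bsub>End_algebra R M\<^esub> g = (\<lambda>v\<in>carrier M. f v \<oplus>\<^bsub>M\<^esub> g v)"
  by (simp_all add: End_algebra_def)

context module
begin

abbreviation EA where "EA \<equiv> End_algebra R M"
abbreviation scalar_end where "scalar_end r \<equiv> \<lambda>v\<in>carrier M. r \<odot>\<^bsub>M\<^esub> v"

lemma homsD:
  assumes "f \<in> module_homs R M M"
  shows "v \<in> carrier M \<Longrightarrow> f v \<in> carrier M"
    "v \<in> carrier M \<Longrightarrow> w \<in> carrier M \<Longrightarrow> f (v \<oplus>\<^bsub>M\<^esub> w) = f v \<oplus>\<^bsub>M\<^esub> f w"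
    "r \<in> carrier R \<Longrightarrow> v \<in> carrier M \<Longrightarrow> f (r \<odot>\<^bsub>M\<^esub> v) = r \<odot>\<^bsub>M\<^esub> f v"
    "restrict f (carrier M) = f"
  using assms by (auto simp: module_homs_def PiE_restrict)

lemma homsI:
  assumes "\<And>v. v \<in> carrier M \<Longrightarrow> f v \<in> carrier M"
    "\<And>v w. v \<in> carrier M \<Longrightarrow> w \<in> carrier M \<Longrightarrow> f (v \<oplus>\<^bsub>M\<^esub> w) = f v \<oplus>\<^bsub>M\<^esub> f w"
    "\<And>r v. r \<in> carrier R \<Longrightarrow> v \<in> carrier M \<Longrightarrow> f (r \<odot>\<^bsub>M\<^esub> v) = r \<odot>\<^bsub>M\<^esub> f v"
  shows "restrict f (carrier M) \<in> module_homs R M M"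
  using assms by (auto simp: module_homs_def)

lemma homs_eqI:
  assumes "f \<in> module_homs R M M" "g \<in> module_homs R M M"
    and "\<And>v. v \<in> carrier M \<Longrightarrow> f v = g v"
  shows "f = g"
  by (rule PiE_ext[where k = "carrier M" and s = "\<lambda>_. carrier M"])
    (use assms in \<open>auto simp: module_homs_def\<close>)

lemma EA_closed:
  assumes f: "f \<in> module_homs R M M" and g: "g \<in> module_homs R M M"
  shows "f \<otimes>\<^bsub>EA\<^esub> g \<in> module_homs R M M" "f \<oplus>\<^bsub>EA\<^esub> g \<in> module_homs R M M"
    "\<one>\<^bsub>EA\<^esub> \<in> module_homs R M M" "\<zero>\<^bsub>EA\<^esub> \<in> module_homs R M M"
  unfolding End_algebra_simps
  by (auto intro!: homsI simp: homsD(1-3)[OF f] homsD(1-3)[OF g] M.a_ac smult_r_distr)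

lemma scalar_end_closed: "r \<in> carrier R \<Longrightarrow> scalar_end r \<in> module_homs R M M"
  by (rule homsI) (auto simp: smult_r_distr smult_assoc1[symmetric] R.m_comm)

lemma EA_abelian_group: "abelian_group EA"
proof (rule abelian_groupI)
  fix f assume "f \<in> carrier EA"
  then have f: "f \<in> module_homs R M M" by (simp add: End_algebra_simps)
  let ?g = "\<lambda>v\<in>carrier M. \<ominus>\<^bsub>M\<^esub> f v"
  have "?g \<in> module_homs R M M"
    by (rule homsI) (auto simp: homsD(1-3)[OF f] M.minus_add smult_r_minus)
  moreover have "?g \<oplus>\<^bsub>EA\<^esub> f = \<zero>\<^bsub>EA\<^esub>"
    by (auto simp: End_algebra_simps fun_eq_iff homsD(1)[OF f] M.l_neg)
  ultimately show "\<exists>g\<in>carrier EA. g \<oplus>\<^bsub>EA\<^esub> f = \<zero>\<^bsub>EA\<^esub>" by (auto simp: End_algebra_simps(1))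
next
  show "\<zero>\<^bsub>EA\<^esub> \<in> carrier EA"
    unfolding End_algebra_simps by (rule homsI) auto
next
  fix f g assume "f \<in> carrier EA" "g \<in> carrier EA"
  then show "f \<oplus>\<^bsub>EA\<^esub> g \<in> carrier EA" by (simp only: End_algebra_simps(1) EA_closed)
next
  fix f assume "f \<in> carrier EA"
  then have f: "f \<in> module_homs R M M" by (simp add: End_algebra_simps)
  show "\<zero>\<^bsub>EA\<^esub> \<oplus>\<^bsub>EA\<^esub> f = f"
    by (rule homs_eqI) (use f EA_closed[OF f f] EA_closed[OF EA_closed(4)[OF f f] f] homsD(1)[OF f] in \<open>auto simp: End_algebra_simps\<close>)
next
  fix f g h assume "f \<in> carrier EA" "g \<in> carrier EA" "h \<in> carrier EA"
  then have c: "f \<in> module_homs R M M" "g \<in> module_homs R M M" "h \<in> module_homs R M M"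
    by (simp_all add: End_algebra_simps)
  show "f \<oplus>\<^bsub>EA\<^esub> g \<oplus>\<^bsub>EA\<^esub> h = f \<oplus>\<^bsub>EA\<^esub> (g \<oplus>\<^bsub>EA\<^esub> h)"
    by (auto simp: End_algebra_simps fun_eq_iff homsD(1)[OF c(1)] homsD(1)[OF c(2)] homsD(1)[OF c(3)] M.a_assoc)
next
  fix f g assume "f \<in> carrier EA" "g \<in> carrier EA"
  then have c: "f \<in> module_homs R M M" "g \<in> module_homs R M M"
    by (simp_all add: End_algebra_simps)
  show "f \<oplus>\<^bsub>EA\<^esub> g = g \<oplus>\<^bsub>EA\<^esub> f"
    by (auto simp: End_algebra_simps fun_eq_iff homsD(1)[OF c(1)] homsD(1)[OF c(2)] M.a_comm)
qed

lemma EA_ring: "ring EA"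
proof (rule ringI[OF EA_abelian_group])
  show "monoid EA"
  proof (rule monoidI)
    fix f g assume "f \<in> carrier EA" "g \<in> carrier EA"
    then show "f \<otimes>\<^bsub>EA\<^esub> g \<in> carrier EA" by (simp only: End_algebra_simps(1) EA_closed)
  next
    show "\<one>\<^bsub>EA\<^esub> \<in> carrier EA" unfolding End_algebra_simps by (rule homsI) auto
  next
    fix f g h assume "f \<in> carrier EA" "g \<in> carrier EA" "h \<in> carrier EA"
    then have "h \<in> module_homs R M M" by (simp add: End_algebra_simps)
    then show "f \<otimes>\<^bsub>EA\<^esub> g \<otimes>\<^bsub>EA\<^esub> h = f \<otimes>\<^bsub>EA\<^esub> (g \<otimes>\<^bsub>EA\<^esub> h)"
      by (auto simp: End_algebra_simps fun_eq_iff homsD(1))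
  next
    fix f assume "f \<in> carrier EA"
    then have f: "f \<in> module_homs R M M" by (simp add: End_algebra_simps)
    have "\<one>\<^bsub>EA\<^esub> \<otimes>\<^bsub>EA\<^esub> f = restrict f (carrier M)" "f \<otimes>\<^bsub>EA\<^esub> \<one>\<^bsub>EA\<^esub> = restrict f (carrier M)"
      by (auto simp: End_algebra_simps fun_eq_iff homsD(1)[OF f])
    then show "\<one>\<^bsub>EA\<^esub> \<otimes>\<^bsub>EA\<^esub> f = f" "f \<otimes>\<^bsub>EA\<^esub> \<one>\<^bsub>EA\<^esub> = f" by (simp_all add: homsD(4)[OF f])
  qed
next
  fix f g h assume "f \<in> carrier EA" "g \<in> carrier EA" "h \<in> carrier EA"
  then have c: "f \<in> module_homs R M M" "g \<in> module_homs R M M" "h \<in> module_homs R M M"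
    by (simp_all add: End_algebra_simps)
  show "(f \<oplus>\<^bsub>EA\<^esub> g) \<otimes>\<^bsub>EA\<^esub> h = f \<otimes>\<^bsub>EA\<^esub> h \<oplus>\<^bsub>EA\<^esub> g \<otimes>\<^bsub>EA\<^esub> h"
    "h \<otimes>\<^bsub>EA\<^esub> (f \<oplus>\<^bsub>EA\<^esub> g) = h \<otimes>\<^bsub>EA\<^esub> f \<oplus>\<^bsub>EA\<^esub> h \<otimes>\<^bsub>EA\<^esub> g"
    by (auto simp: End_algebra_simps fun_eq_iff homsD(1)[OF c(1)] homsD(1)[OF c(2)] homsD(1,2)[OF c(3)])
qed

lemma EA_central: "central_algebra R scalar_end EA"
proof (intro central_algebra.intro assoc_algebra.intro assoc_algebra_axioms.intro R.cring_axioms EA_ring)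
  show "scalar_end \<in> ring_hom R EA"
    by (rule ring_hom_memI)
      (auto simp: End_algebra_simps(1) scalar_end_closed, auto simp: End_algebra_simps fun_eq_iff smult_l_distr smult_assoc1)
next
  fix r f assume r: "r \<in> carrier R" and "f \<in> carrier EA"
  then have f: "f \<in> module_homs R M M" by (simp add: End_algebra_simps)
  show "scalar_end r \<otimes>\<^bsub>EA\<^esub> f = f \<otimes>\<^bsub>EA\<^esub> scalar_end r"
    using r by (auto simp: End_algebra_simps fun_eq_iff homsD(1,3)[OF f])
qed

end

text \<open>Such functions are determined by their values for \<open>m, n < p\<close>, which are
  arbitrary, so this is a free module of rank \<open>p * p\<close>. Building the wrap-around into
  the functions allows operators to be written with index shifts and without case distinctions at
  p.\<close>

definition periodic_module :: "('r, 'm) ring_scheme \<Rightarrow> nat \<Rightarrow> 'r \<Rightarrow> 'r \<Rightarrow> ('r, nat \<Rightarrow> nat \<Rightarrow> 'r) module" where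
  "periodic_module R p a b =
    \<lparr>carrier = {v. \<forall>m n. v m n \<in> carrier R \<and> v (m + p) n = a \<otimes>\<^bsub>R\<^esub> v m n \<and> v m (n + p) = b \<otimes>\<^bsub>R\<^esub> v m n},
     monoid.mult = (\<lambda>v w. v), monoid.one = (\<lambda>m n. \<zero>\<^bsub>R\<^esub>),
     ring.zero = (\<lambda>m n. \<zero>\<^bsub>R\<^esub>), ring.add = (\<lambda>v w m n. v m n \<oplus>\<^bsub>R\<^esub> w m n),
     module.smult = (\<lambda>r v m n. r \<otimes>\<^bsub>R\<^esub> v m n)\<rparr>"

locale periodic_functions = cring R for R :: "('r, 'm) ring_scheme" (structure) +
  fixes p :: nat and a b :: 'r
  assumes p_pos: "0 < p" and a_closed [simp]: "a \<in> carrier R" and b_closed [simp]: "b \<in> carrier R"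
begin

abbreviation V where "V \<equiv> periodic_module R p a b"

lemma V_simps:
  "v \<in> carrier V \<longleftrightarrow> (\<forall>m n. v m n \<in> carrier R \<and> v (m + p) n = a \<otimes> v m n \<and> v m (n + p) = b \<otimes> v m n)"
  "v \<oplus>\<^bsub>V\<^esub> w = (\<lambda>m n. v m n \<oplus> w m n)" "\<zero>\<^bsub>V\<^esub> = (\<lambda>m n. \<zero>)" "r \<odot>\<^bsub>V\<^esub> v = (\<lambda>m n. r \<otimes> v m n)"
  by (simp_all add: periodic_module_def)

lemma V_value: "v \<in> carrier V \<Longrightarrow> v m n \<in> carrier R"
  and V_shift: "v \<in> carrier V \<Longrightarrow> v (m + p) n = a \<otimes> v m n" "v \<in> carrier V \<Longrightarrow> v m (n + p) = b \<otimes> v m n"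
  by (simp_all add: V_simps)

lemma V_add_closed: "v \<in> carrier V \<Longrightarrow> w \<in> carrier V \<Longrightarrow> v \<oplus>\<^bsub>V\<^esub> w \<in> carrier V"
  by (simp add: V_simps r_distr)

lemma V_smult_closed:
  assumes r: "r \<in> carrier R" and v: "v \<in> carrier V"
  shows "r \<odot>\<^bsub>V\<^esub> v \<in> carrier V"
  using r V_value[OF v] by (simp add: V_simps V_shift[OF v] m_lcomm)

lemma V_module: "module R V"
proof (rule moduleI[OF cring_axioms])
  show "abelian_group V"
  proof (rule abelian_groupI)
    fix v assume v: "v \<in> carrier V"
    show "\<exists>w\<in>carrier V. w \<oplus>\<^bsub>V\<^esub> v = \<zero>\<^bsub>V\<^esub>"
      by (rule bexI[of _ "\<lambda>m n. \<ominus> v m n"])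
        (use V_value[OF v] in \<open>simp_all add: V_simps(2,3) l_neg, simp add: V_simps V_shift[OF v] r_minus\<close>)
  next
    fix v w u assume c: "v \<in> carrier V" "w \<in> carrier V" "u \<in> carrier V"
    show "v \<oplus>\<^bsub>V\<^esub> w \<oplus>\<^bsub>V\<^esub> u = v \<oplus>\<^bsub>V\<^esub> (w \<oplus>\<^bsub>V\<^esub> u)"
      using c[THEN V_value] by (simp add: V_simps(2) a_assoc)
  next
    fix v w assume c: "v \<in> carrier V" "w \<in> carrier V"
    show "v \<oplus>\<^bsub>V\<^esub> w = w \<oplus>\<^bsub>V\<^esub> v"
      using c[THEN V_value] by (simp add: V_simps(2) a_comm)
  next
    fix v assume v: "v \<in> carrier V"
    show "\<zero>\<^bsub>V\<^esub> \<oplus>\<^bsub>V\<^esub> v = v" using V_value[OF v] by (simp add: V_simps(2,3))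
  next
    show "\<zero>\<^bsub>V\<^esub> \<in> carrier V" by (simp add: V_simps)
  qed (rule V_add_closed)
next
  fix r s v assume rs: "r \<in> carrier R" "s \<in> carrier R" and v: "v \<in> carrier V"
  show "(r \<oplus> s) \<odot>\<^bsub>V\<^esub> v = r \<odot>\<^bsub>V\<^esub> v \<oplus>\<^bsub>V\<^esub> s \<odot>\<^bsub>V\<^esub> v" "(r \<otimes> s) \<odot>\<^bsub>V\<^esub> v = r \<odot>\<^bsub>V\<^esub> (s \<odot>\<^bsub>V\<^esub> v)"
    using rs V_value[OF v] by (simp_all add: V_simps(2,4) l_distr m_assoc)
next
  fix r v w assume r: "r \<in> carrier R" and v: "v \<in> carrier V" and w: "w \<in> carrier V"
  show "r \<odot>\<^bsub>V\<^esub> (v \<oplus>\<^bsub>V\<^esub> w) = r \<odot>\<^bsub>V\<^esub> v \<oplus>\<^bsub>V\<^esub> r \<odot>\<^bsub>V\<^esub> w"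
    using r V_value[OF v] V_value[OF w] by (simp add: V_simps(2,4) r_distr)
next
  fix v assume v: "v \<in> carrier V"
  show "\<one> \<odot>\<^bsub>V\<^esub> v = v" using V_value[OF v] by (simp add: V_simps(4))
qed (rule V_smult_closed)

sublocale V: module R V by (rule V_module)

abbreviation EV where "EV \<equiv> End_algebra R V"

text \<open>Among the values with \<open>m, n < p\<close> only the one at the origin is nonzero, and
  it is 1; evaluation there recovers a scalar from its action.\<close>

definition delta :: "nat \<Rightarrow> nat \<Rightarrow> 'r" where
  "delta m n = (if p dvd m \<and> p dvd n then a [^] (m div p) \<otimes> b [^] (n div p) else \<zero>)"

lemma delta_V: "delta \<in> carrier V"
  using p_pos by (auto simp: V_simps delta_def m_ac)

lemma scalar_end_inj: "inj_on V.scalar_end (carrier R)"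
proof (rule inj_onI)
  fix r s assume rs: "r \<in> carrier R" "s \<in> carrier R" and "V.scalar_end r = V.scalar_end s"
  then have "V.scalar_end r delta 0 0 = V.scalar_end s delta 0 0" by simp
  then show "r = s" using rs by (simp add: delta_V V_simps(4)) (simp add: delta_def)
qed

lemma EV_pow:
  assumes f: "f \<in> module_homs R V V" and v: "v \<in> carrier V"
  shows "(f [^]\<^bsub>EV\<^esub> (k::nat)) v = (f ^^ k) v \<and> (f ^^ k) v \<in> carrier V"
  using v
proof (induction k arbitrary: v)
  case 0
  then show ?case by (simp add: nat_pow_def End_algebra_simps)
next
  case (Suc k)
  interpret EV: ring EV by (rule V.EA_ring)
  have "f v \<in> carrier V" using V.homsD(1)[OF f] Suc.prems by blast
  then show ?case using Suc.IH[of "f v"] Suc.prems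
    by (simp add: End_algebra_simps(2) funpow_swap1 del: funpow.simps) (simp add: funpow_swap1)
qed

lemma EV_pow_eqI:
  assumes f: "f \<in> module_homs R V V" and r: "r \<in> carrier R"
    and "\<And>v m n. v \<in> carrier V \<Longrightarrow> (f ^^ k) v m n = r \<otimes> v m n"
  shows "f [^]\<^bsub>EV\<^esub> k = V.scalar_end r"
proof (rule V.homs_eqI)
  interpret EV: ring EV by (rule V.EA_ring)
  show "f [^]\<^bsub>EV\<^esub> k \<in> module_homs R V V"
    using EV.nat_pow_closed[of f k] f by (simp add: End_algebra_simps(1))
  fix v assume v: "v \<in> carrier V"
  show "(f [^]\<^bsub>EV\<^esub> k) v = V.scalar_end r v"
    using EV_pow[OF f v, of k] assms(3)[OF v] v by (simp add: V_simps(4) fun_eq_iff)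
qed (rule V.scalar_end_closed[OF r])

end

section \<open>The algebra \<open>(a,b)\<close>\<close>

locale characteristic_p = cring R for R :: "('r, 'm) ring_scheme" (structure) +
  fixes p :: nat and a b :: 'r
  assumes prime: "Factorial_Ring.prime p" and char: "[p] \<cdot> \<one> = \<zero>"
    and a_closed [simp]: "a \<in> carrier R" and b_closed [simp]: "b \<in> carrier R"
begin

lemma qnum_one_base: "qnum R \<one> k = [k] \<cdot> \<one>"
  by (induction k) auto

sublocale qnum_vanishing R \<one> p
  by unfold_locales (auto simp: qnum_one_base char prime)

sublocale periodic_functions R p a b
  by unfold_locales (auto simp: p_pos)

text \<open>At \<open>n = 0\<close> the junk value \<open>v m (0 - 1)\<close> is multiplied by \<open>0\<close>.\<close>

definition x_op where
  "x_op = (\<lambda>v\<in>carrier V. \<lambda>m n. v (Suc m) n \<ominus> qnum R \<one> n \<otimes> v m (n - 1))"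

definition y_op where "y_op = (\<lambda>v\<in>carrier V. \<lambda>m n. v m (Suc n))"

lemma x_op_apply: "v \<in> carrier V \<Longrightarrow> x_op v = (\<lambda>m n. v (Suc m) n \<ominus> qnum R \<one> n \<otimes> v m (n - 1))"
  and y_op_apply: "v \<in> carrier V \<Longrightarrow> y_op v = (\<lambda>m n. v m (Suc n))"
  by (simp_all add: x_op_def y_op_def)

lemma y_op_hom: "y_op \<in> module_homs R V V"
  unfolding y_op_def
proof (rule V.homsI)
  fix v assume v: "v \<in> carrier V"
  show "(\<lambda>m n. v m (Suc n)) \<in> carrier V"
    using V_value[OF v] V_shift[OF v] by (simp add: V_simps(1) flip: add_Suc)
qed (simp_all add: V_simps(2,4))

lemma qnum_shift: "qnum R \<one> (n + p) = qnum R \<one> n"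
  by (simp add: qnum_add qnum_p)

lemma x_op_hom: "x_op \<in> module_homs R V V"
  unfolding x_op_def
proof (rule V.homsI)
  fix v assume v: "v \<in> carrier V"
  note [simp] = V_value[OF v]
  have "v (Suc (m + p)) n \<ominus> qnum R \<one> n \<otimes> v (m + p) (n - 1) = a \<otimes> (v (Suc m) n \<ominus> qnum R \<one> n \<otimes> v m (n - 1))" for m n
    using V_shift(1)[OF v, of "Suc m" n] V_shift(1)[OF v, of m "n - 1"]
    by (simp add: minus_eq r_distr r_minus m_lcomm)
  \<comment> \<open>Periodicity in the second index rests on equal quantum integers at
    \<open>n\<close> and \<open>n + p\<close>. At \<open>n = 0\<close> the value
    \<open>v m (p - 1)\<close> appears, but its coefficient is the quantum integer of p, which is
    zero.\<close>
  moreover have "v (Suc m) (n + p) \<ominus> qnum R \<one> (n + p) \<otimes> v m (n + p - 1) = b \<otimes> (v (Suc m) n \<ominus> qnum R \<one> n \<otimes> v m (n - 1))" for m n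
  proof (cases n)
    case 0
    then show ?thesis using V_shift(2)[OF v, of "Suc m" 0] by (simp add: qnum_p minus_eq)
  next
    case (Suc k)
    then show ?thesis unfolding qnum_shift using V_shift(2)[OF v, of "Suc m" n] V_shift(2)[OF v, of m k]
      by (simp add: minus_eq r_distr r_minus m_lcomm del: qnum.simps)
  qed
  ultimately show "(\<lambda>m n. v (Suc m) n \<ominus> qnum R \<one> n \<otimes> v m (n - 1)) \<in> carrier V"
    by (simp add: V_simps(1))
next
  fix v w assume v: "v \<in> carrier V" and w: "w \<in> carrier V"
  note [simp] = V_value[OF v] V_value[OF w]
  show "(\<lambda>m n. (v \<oplus>\<^bsub>V\<^esub> w) (Suc m) n \<ominus> qnum R \<one> n \<otimes> (v \<oplus>\<^bsub>V\<^esub> w) m (n - 1)) =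
    (\<lambda>m n. v (Suc m) n \<ominus> qnum R \<one> n \<otimes> v m (n - 1)) \<oplus>\<^bsub>V\<^esub> (\<lambda>m n. w (Suc m) n \<ominus> qnum R \<one> n \<otimes> w m (n - 1))"
    by (simp add: V_simps(2) minus_eq r_distr minus_add a_ac)
next
  fix r v assume r: "r \<in> carrier R" and v: "v \<in> carrier V"
  note [simp] = V_value[OF v] r
  show "(\<lambda>m n. (r \<odot>\<^bsub>V\<^esub> v) (Suc m) n \<ominus> qnum R \<one> n \<otimes> (r \<odot>\<^bsub>V\<^esub> v) m (n - 1)) =
    r \<odot>\<^bsub>V\<^esub> (\<lambda>m n. v (Suc m) n \<ominus> qnum R \<one> n \<otimes> v m (n - 1))"
    by (simp add: V_simps(4) minus_eq r_distr r_minus m_lcomm)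
qed

text \<open>In the two orders of composition the correction term carries the coefficients
  \<open>n\<close> and \<open>n + 1\<close>, so the difference is the identity.\<close>

lemma weyl_pair_op: "weyl_pair R V.scalar_end EV \<one> x_op y_op"
proof -
  interpret EV: central_algebra R V.scalar_end EV by (rule V.EA_central)
  have c: "x_op \<in> carrier EV" "y_op \<in> carrier EV" by (simp_all add: End_algebra_simps(1) x_op_hom y_op_hom)
  have "x_op \<otimes>\<^bsub>EV\<^esub> y_op = y_op \<otimes>\<^bsub>EV\<^esub> x_op \<oplus>\<^bsub>EV\<^esub> \<one>\<^bsub>EV\<^esub>"
  proof (rule V.homs_eqI)
    fix v assume v: "v \<in> carrier V"
    note [simp] = V_value[OF v] v
    have cl: "y_op v \<in> carrier V" "x_op v \<in> carrier V"
      using V.homsD(1)[OF y_op_hom v] V.homsD(1)[OF x_op_hom v] by auto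
    have "x_op (y_op v) m n = y_op (x_op v) m n \<oplus> v m n" for m n
    proof -
      have q: "qnum R \<one> n \<in> carrier R" by simp
      have "x_op (y_op v) m n = v (Suc m) (Suc n) \<ominus> qnum R \<one> n \<otimes> v m n"
        unfolding x_op_def using cl by (cases n) (simp_all add: y_op_def)
      moreover have "y_op (x_op v) m n = v (Suc m) (Suc n) \<ominus> qnum R \<one> (Suc n) \<otimes> v m n"
        unfolding y_op_def using cl by (simp add: x_op_def)
      moreover have "qnum R \<one> (Suc n) = qnum R \<one> n \<oplus> \<one>" by simp
      ultimately show ?thesis
        using q by (simp del: qnum.simps add: minus_eq l_distr minus_add a_assoc l_neg)
    qed
    then have "x_op (y_op v) = (\<lambda>m n. y_op (x_op v) m n \<oplus> v m n)" by (intro ext)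
    then show "(x_op \<otimes>\<^bsub>EV\<^esub> y_op) v = (y_op \<otimes>\<^bsub>EV\<^esub> x_op \<oplus>\<^bsub>EV\<^esub> \<one>\<^bsub>EV\<^esub>) v"
      by (simp add: End_algebra_simps V_simps(2))
  qed (use c in \<open>simp_all flip: End_algebra_simps(1)\<close>)
  then show ?thesis
    by unfold_locales (use c in \<open>simp_all add: EV.scale_one\<close>)
qed

lemma y_op_pow: "y_op [^]\<^bsub>EV\<^esub> p = V.scalar_end b"
proof (rule EV_pow_eqI[OF y_op_hom b_closed])
  fix v m n assume v: "v \<in> carrier V"
  have "(y_op ^^ k) v = (\<lambda>m n. v m (n + k))" for k
  proof (induction k)
    case (Suc k)
    have "(y_op ^^ k) v \<in> carrier V" using EV_pow[OF y_op_hom v] by blast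
    then show ?case using Suc by (simp add: y_op_apply)
  qed simp
  then show "(y_op ^^ p) v m n = b \<otimes> v m n" using V_shift(2)[OF v] by simp
qed

text \<open>\<open>x_op\<^sup>p\<close> commutes with \<open>y_op\<close>, so it is determined by the values at \<open>n = 0\<close>, where
  the correction term of \<open>x_op\<close> vanishes.\<close>

lemma x_op_pow: "x_op [^]\<^bsub>EV\<^esub> p = V.scalar_end a"
proof (rule EV_pow_eqI[OF x_op_hom a_closed])
  interpret EV: weyl_pair R V.scalar_end EV \<one> x_op y_op by (rule weyl_pair_op)
  fix v m n assume v: "v \<in> carrier V"
  have axis: "(x_op ^^ k) w m 0 = w (m + k) 0" if w: "w \<in> carrier V" for w k m
  proof (induction k arbitrary: m)
    case (Suc k)
    have c: "(x_op ^^ k) w \<in> carrier V" using EV_pow[OF x_op_hom w] by blast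
    show ?case using c V_value[OF c] V_value[OF w] Suc[of "Suc m"]
      by (simp add: x_op_apply[OF c] minus_eq)
  qed simp
  have "x_op [^]\<^bsub>EV\<^esub> p \<otimes>\<^bsub>EV\<^esub> y_op = y_op \<otimes>\<^bsub>EV\<^esub> x_op [^]\<^bsub>EV\<^esub> p"
    using EV.x_pow_y[of p] by (simp add: qnum_p EV.scale_one EV.scale_zero_left)
  then have comm: "(x_op [^]\<^bsub>EV\<^esub> p) (y_op w) = y_op ((x_op [^]\<^bsub>EV\<^esub> p) w)" if "w \<in> carrier V" for w
    using that by (auto simp: End_algebra_simps(2) fun_eq_iff split: if_splits dest!: spec[of _ w])
  have "(x_op [^]\<^bsub>EV\<^esub> p) w m n = w (m + p) n" if "w \<in> carrier V" for w
    using that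
  proof (induction n arbitrary: w)
    case 0
    then show ?case using EV_pow[OF x_op_hom 0, of p] axis[OF 0, of p m] by simp
  next
    case (Suc n)
    have c: "y_op w \<in> carrier V" "(x_op [^]\<^bsub>EV\<^esub> p) w \<in> carrier V"
      using V.homsD(1)[OF y_op_hom Suc.prems] EV_pow[OF x_op_hom Suc.prems, of p] by auto
    have "(x_op [^]\<^bsub>EV\<^esub> p) w m (Suc n) = y_op ((x_op [^]\<^bsub>EV\<^esub> p) w) m n" using c(2) by (simp add: y_op_def)
    also have "\<dots> = y_op w (m + p) n" unfolding comm[OF Suc.prems, symmetric] by (rule Suc.IH[OF c(1)])
    finally show ?case using Suc.prems by (simp add: y_op_def)
  qed
  then show "(x_op ^^ p) v m n = a \<otimes> v m n"
    using EV_pow[OF x_op_hom v, of p] V_shift(1)[OF v, of m n] v by metis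
qed

text \<open>The presentation supplies the relations and the spanning monomials; the operators on
  \<open>V\<close> show that \<open>R\<close> embeds. Since \<open>q = 1\<close>, the element
  \<open>\<beta>\<close> is 1, which is why the unit is 1.\<close>

lemma ab_weyl_algebra:
  "weyl_algebra R (ab_struct p R a b) (ab_algebra p R a b) \<one> (ab_x p R a b) (ab_y p R a b) p a b \<one>"
proof -
  let ?rels = "ab_relations p R a b" and ?A = "ab_algebra p R a b" and ?\<iota> = "ab_struct p R a b"
  let ?F = "free_algebra R :: (two_gens list \<Rightarrow> 'r) ring"
  let ?X = "free_gen R Gen1 :: two_gens list \<Rightarrow> 'r" and ?Y = "free_gen R Gen2 :: two_gens list \<Rightarrow> 'r"
  let ?c = "presented_class R ?rels"
  have F: "ring ?F" by (rule FA_ring)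
  interpret F: ring ?F by (rule F)
  have gens: "?X \<in> carrier ?F" "?Y \<in> carrier ?F" by (simp_all add: free_gen_eq)
  have const: "r \<in> carrier R \<Longrightarrow> free_const R r \<in> carrier ?F" for r by (simp add: free_const_eq)
  have rels: "?rels = {?X [^]\<^bsub>?F\<^esub> p \<ominus>\<^bsub>?F\<^esub> free_const R a, ?Y [^]\<^bsub>?F\<^esub> p \<ominus>\<^bsub>?F\<^esub> free_const R b,
      (?X \<otimes>\<^bsub>?F\<^esub> ?Y \<ominus>\<^bsub>?F\<^esub> ?Y \<otimes>\<^bsub>?F\<^esub> ?X) \<ominus>\<^bsub>?F\<^esub> \<one>\<^bsub>?F\<^esub>}"
    by (simp add: ab_relations_def Let_def)
  have rels_closed: "?rels \<subseteq> carrier ?F" unfolding rels using gens const by simp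
  have pres: "presentation R ?rels"
    by (intro presentation.intro presentation_axioms.intro cring_axioms rels_closed)
  have \<iota>: "?\<iota> = (\<lambda>r. ?c (free_const R r))" by (simp add: ab_struct_def fun_eq_iff)
  have A: "?A = presented_algebra R ?rels" by (simp add: ab_algebra_def)
  have central: "central_algebra R ?\<iota> ?A" unfolding \<iota> A by (rule presentation.central[OF pres])
  interpret A: central_algebra R ?\<iota> ?A by (rule central)
  have hom: "?c \<in> ring_hom ?F ?A" unfolding A by (rule presentation.class_hom[OF pres])
  have x: "ab_x p R a b = ?c ?X" and y: "ab_y p R a b = ?c ?Y" by (simp_all add: ab_x_def ab_y_def)
  have xy: "?c ?X \<in> carrier ?A" "?c ?Y \<in> carrier ?A"
    using ring_hom_closed[OF hom] gens by auto
  have mem: "?X [^]\<^bsub>?F\<^esub> p \<ominus>\<^bsub>?F\<^esub> free_const R a \<in> ?rels" "?Y [^]\<^bsub>?F\<^esub> p \<ominus>\<^bsub>?F\<^esub> free_const R b \<in> ?rels"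
      "(?X \<otimes>\<^bsub>?F\<^esub> ?Y \<ominus>\<^bsub>?F\<^esub> ?Y \<otimes>\<^bsub>?F\<^esub> ?X) \<ominus>\<^bsub>?F\<^esub> \<one>\<^bsub>?F\<^esub> \<in> ?rels"
    by (simp_all only: rels insert_iff) simp_all
  have "?c (?X [^]\<^bsub>?F\<^esub> p) = ?c (free_const R a)"
    by (rule presentation.class_rel[OF pres _ _ mem(1)]) (simp_all add: gens const)
  moreover have "?c (?Y [^]\<^bsub>?F\<^esub> p) = ?c (free_const R b)"
    by (rule presentation.class_rel[OF pres _ _ mem(2)]) (simp_all add: gens const)
  ultimately have "?c (?X [^]\<^bsub>?F\<^esub> p) = ?\<iota> a" "?c (?Y [^]\<^bsub>?F\<^esub> p) = ?\<iota> b"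
    unfolding \<iota> by simp_all
  then have pow: "?c ?X [^]\<^bsub>?A\<^esub> p = ?\<iota> a" "?c ?Y [^]\<^bsub>?A\<^esub> p = ?\<iota> b"
    using ring_hom_nat_pow[OF F A.ring_axioms hom] gens by simp_all
  have "?c (?X \<otimes>\<^bsub>?F\<^esub> ?Y \<ominus>\<^bsub>?F\<^esub> ?Y \<otimes>\<^bsub>?F\<^esub> ?X) = ?c \<one>\<^bsub>?F\<^esub>"
    by (rule presentation.class_rel[OF pres _ _ mem(3)]) (simp_all add: gens)
  then have "?c ?X \<otimes>\<^bsub>?A\<^esub> ?c ?Y \<ominus>\<^bsub>?A\<^esub> ?c ?Y \<otimes>\<^bsub>?A\<^esub> ?c ?X = \<one>\<^bsub>?A\<^esub>"
    using gens by (simp add: ring_hom_minus[OF F A.ring_axioms hom] ring_hom_mult[OF hom] ring_hom_one[OF hom])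
  then have "?c ?X \<otimes>\<^bsub>?A\<^esub> ?c ?Y = ?c ?Y \<otimes>\<^bsub>?A\<^esub> ?c ?X \<oplus>\<^bsub>?A\<^esub> \<one>\<^bsub>?A\<^esub>"
    using xy by (metis A.m_closed A.minus_closed A.a_comm A.add.inv_solve_right A.minus_eq A.one_closed)
  then have weyl: "weyl_relations R ?\<iota> ?A \<one> (?c ?X) (?c ?Y) p a b"
    by unfold_locales (use xy pow in \<open>simp_all add: A.scale_one\<close>)
  interpret W: weyl_relations R ?\<iota> ?A \<one> "?c ?X" "?c ?Y" p a b by (rule weyl)
  define G where "G g = (case g of Gen1 \<Rightarrow> x_op | Gen2 \<Rightarrow> y_op)" for g
  have G: "G g \<in> carrier EV" for g
    by (cases g) (simp_all add: G_def End_algebra_simps(1) x_op_hom y_op_hom)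
  have ev: "evaluation R V.scalar_end EV G"
    by (intro evaluation.intro evaluation_axioms.intro V.EA_central G)
  note EV = V.EA_ring
  interpret EV: weyl_pair R V.scalar_end EV \<one> x_op y_op by (rule weyl_pair_op)
  let ?e = "evaluation.eval_free R V.scalar_end EV G"
  note e_hom = evaluation.eval_free_hom[OF ev]
  have e_gen: "?e ?X = x_op" "?e ?Y = y_op"
    using evaluation.eval_free_gen[OF ev] by (simp_all add: G_def)
  have inj: "inj_on ?\<iota> (carrier R)"
    unfolding \<iota>
  proof (rule evaluation.presented_struct_inj[OF ev rels_closed _ scalar_end_inj])
    fix f assume "f \<in> ?rels"
    then consider "f = ?X [^]\<^bsub>?F\<^esub> p \<ominus>\<^bsub>?F\<^esub> free_const R a" | "f = ?Y [^]\<^bsub>?F\<^esub> p \<ominus>\<^bsub>?F\<^esub> free_const R b"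
      | "f = (?X \<otimes>\<^bsub>?F\<^esub> ?Y \<ominus>\<^bsub>?F\<^esub> ?Y \<otimes>\<^bsub>?F\<^esub> ?X) \<ominus>\<^bsub>?F\<^esub> \<one>\<^bsub>?F\<^esub>"
      unfolding rels by blast
    then show "?e f = \<zero>\<^bsub>EV\<^esub>"
    proof cases
      case 1
      have "?e f = x_op [^]\<^bsub>EV\<^esub> p \<ominus>\<^bsub>EV\<^esub> V.scalar_end a"
        unfolding 1 using gens const
        by (simp add: ring_hom_minus[OF F EV e_hom] ring_hom_nat_pow[OF F EV e_hom] e_gen evaluation.eval_free_const[OF ev])
      then show ?thesis unfolding x_op_pow using EV.struct_closed[of a] by (simp add: EV.A.r_neg EV.A.minus_eq)
    next
      case 2
      have "?e f = y_op [^]\<^bsub>EV\<^esub> p \<ominus>\<^bsub>EV\<^esub> V.scalar_end b"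
        unfolding 2 using gens const
        by (simp add: ring_hom_minus[OF F EV e_hom] ring_hom_nat_pow[OF F EV e_hom] e_gen evaluation.eval_free_const[OF ev])
      then show ?thesis unfolding y_op_pow using EV.struct_closed[of b] by (simp add: EV.A.r_neg EV.A.minus_eq)
    next
      case 3
      have "?e f = (x_op \<otimes>\<^bsub>EV\<^esub> y_op \<ominus>\<^bsub>EV\<^esub> y_op \<otimes>\<^bsub>EV\<^esub> x_op) \<ominus>\<^bsub>EV\<^esub> \<one>\<^bsub>EV\<^esub>"
        unfolding 3 using gens const
        by (simp add: ring_hom_minus[OF F EV e_hom] ring_hom_mult[OF e_hom] ring_hom_one[OF e_hom] e_gen)
      then show ?thesis
        unfolding EV.weyl by (simp add: EV.scale_one EV.A.minus_eq EV.A.r_neg EV.A.a_ac EV.A.r_neg2)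
    qed
  qed
  have span: "carrier ?A \<subseteq> W.monomial_span"
  proof (rule presentation.PA_generated[OF pres, folded ab_algebra_def])
    show "subring W.monomial_span ?A" by (rule W.monomial_span_subring)
    show "?c (free_const R r) \<in> W.monomial_span" if "r \<in> carrier R" for r
      using W.struct_in_span[OF that] by (simp only: ab_struct_def[symmetric])
    show "?c (free_gen R g) \<in> W.monomial_span" for g
      by (cases g) (simp_all add: W.x_in_span W.y_in_span)
  qed
  show ?thesis
    unfolding x y
    by (intro weyl_algebra.intro weyl_unit.intro weyl weyl_unit_axioms.intro weyl_algebra_axioms.intro inj span)
      (use xy in \<open>simp_all add: A.struct_one A.scale_zero_left minus_eq r_neg\<close>)
qed

end

section \<open>Subrings of a field type\<close>

abbreviation type_ring :: "'f::field set \<Rightarrow> 'f ring" where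
  "type_ring S \<equiv> ring_of_type_algebra\<lparr>carrier := S\<rparr>"

lemma type_ring_simps:
  "carrier (type_ring S) = S" "r \<otimes>\<^bsub>type_ring S\<^esub> s = r * s" "r \<oplus>\<^bsub>type_ring S\<^esub> s = r + s"
  "\<one>\<^bsub>type_ring S\<^esub> = 1" "\<zero>\<^bsub>type_ring S\<^esub> = 0"
  "r \<otimes>\<^bsub>ring_of_type_algebra\<^esub> s = r * s" "r \<oplus>\<^bsub>ring_of_type_algebra\<^esub> s = r + s"
  "\<one>\<^bsub>ring_of_type_algebra\<^esub> = 1" "\<zero>\<^bsub>ring_of_type_algebra\<^esub> = 0"
  by (simp_all add: ring_of_type_algebra_def)

locale type_subring =
  fixes S :: "'f::field set"
  assumes one_in: "1 \<in> S" and diff_in: "\<lbrakk>r \<in> S; s \<in> S\<rbrakk> \<Longrightarrow> r - s \<in> S"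
    and mult_in: "\<lbrakk>r \<in> S; s \<in> S\<rbrakk> \<Longrightarrow> r * s \<in> S"
begin

lemma zero_in: "0 \<in> S" using diff_in[OF one_in one_in] by simp
lemma uminus_in: "r \<in> S \<Longrightarrow> - r \<in> S" using diff_in[OF zero_in] by force
lemma add_in: "r \<in> S \<Longrightarrow> s \<in> S \<Longrightarrow> r + s \<in> S" using diff_in[OF _ uminus_in] by force
lemma pow_in: "r \<in> S \<Longrightarrow> r ^ n \<in> S" by (induction n) (auto intro: one_in mult_in)

lemma type_ring_cring: "cring (type_ring S)"
proof (rule cringI)
  show "abelian_group (type_ring S)"
    by (rule abelian_groupI)
      (auto simp: type_ring_simps zero_in add_in algebra_simps intro!: bexI[of _ "- _"] uminus_in)
  show "comm_monoid (type_ring S)"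
    by (rule comm_monoidI) (auto simp: type_ring_simps one_in mult_in)
qed (simp add: type_ring_simps algebra_simps)

lemma type_ring_uminus: "r \<in> S \<Longrightarrow> \<ominus>\<^bsub>type_ring S\<^esub> r = - r"
  by (rule abelian_group.minus_equality[OF ring.is_abelian_group[OF cring.axioms(1)[OF type_ring_cring]]])
    (auto simp: type_ring_simps uminus_in)

lemma type_ring_minus: "r \<in> S \<Longrightarrow> s \<in> S \<Longrightarrow> r \<ominus>\<^bsub>type_ring S\<^esub> s = r - s"
  by (simp add: a_minus_def type_ring_uminus type_ring_simps)

lemma type_ring_pow: "r [^]\<^bsub>type_ring S\<^esub> (n::nat) = r ^ n"
  by (induction n) (simp_all add: nat_pow_def type_ring_simps mult.commute)

lemma type_ring_qnum: "qnum (type_ring S) q n = (\<Sum>k<n. q ^ k)"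
  by (induction n) (simp_all add: type_ring_simps type_ring_pow)

lemma type_ring_qnum_vanishing:
  assumes "Factorial_Ring.prime p" "q \<in> S" "q ^ p = 1" "q \<noteq> 1"
  shows "qnum_vanishing (type_ring S) q p"
proof (intro qnum_vanishing.intro qnum_vanishing_axioms.intro type_ring_cring)
  have "(q - 1) * (\<Sum>k<p. q ^ k) = 0"
    using assms(3) by (simp add: power_diff_1_eq[symmetric])
  then show "qnum (type_ring S) q p = \<zero>\<^bsub>type_ring S\<^esub>"
    using assms(4) by (simp add: type_ring_qnum type_ring_simps(5))
qed (use assms in \<open>auto simp: type_ring_simps\<close>)

end

section \<open>Symbol algebras\<close>

text \<open>The coefficient of \<open>T\<^sup>j\<close> in \<open>(T - 1) (q T - 1) \<dots> (q\<^sup>n\<^sup>-\<^sup>1 T - 1)\<close>.\<close>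

fun qprod_coeff :: "'f::field \<Rightarrow> nat \<Rightarrow> nat \<Rightarrow> 'f" where
  "qprod_coeff q 0 0 = 1"
| "qprod_coeff q 0 (Suc j) = 0"
| "qprod_coeff q (Suc n) 0 = - qprod_coeff q n 0"
| "qprod_coeff q (Suc n) (Suc j) = q ^ n * qprod_coeff q n j - qprod_coeff q n (Suc j)"

lemma qprod_coeff_0: "qprod_coeff q n 0 = (- 1) ^ n"
  by (induction n) auto

lemma qprod_coeff_eq_0: "n < j \<Longrightarrow> qprod_coeff q n j = 0"
  by (induction q n j rule: qprod_coeff.induct) auto

text \<open>Comparison of coefficients in \<open>(T - 1) f(q T) = (q\<^sup>n T - 1) f(T)\<close>, where \<open>f\<close> is the product.\<close>

lemma qprod_coeff_functional:
  "qprod_coeff q n (Suc j) * (1 - q ^ Suc j) = qprod_coeff q n j * (q ^ n - q ^ j)"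
proof (induction n arbitrary: j)
  case 0
  then show ?case by (cases j) auto
next
  case (Suc n)
  show ?case
  proof (cases j)
    case 0
    have "qprod_coeff q n 1 * (1 - q) = qprod_coeff q n 0 * (q ^ n - 1)" using Suc[of 0] by simp
    then show ?thesis using 0 by (simp add: algebra_simps)
  next
    case (Suc i)
    have 1: "qprod_coeff q n (Suc j) * (1 - q ^ Suc j) = qprod_coeff q n j * (q ^ n - q ^ j)"
      and 2: "qprod_coeff q n j * (1 - q ^ j) = qprod_coeff q n i * (q ^ n - q ^ i)"
      using Suc.IH[of j] Suc.IH[of i] Suc by auto
    have "qprod_coeff q (Suc n) (Suc j) * (1 - q ^ Suc j)
        = q ^ n * qprod_coeff q n j * (1 - q ^ Suc j) - qprod_coeff q n j * (q ^ n - q ^ j)"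
      using 1 by (simp add: algebra_simps)
    also have "\<dots> = q ^ Suc n * (qprod_coeff q n j * (1 - q ^ j)) - qprod_coeff q n j * (q ^ Suc n - q ^ j)"
      by (simp add: algebra_simps)
    also have "\<dots> = qprod_coeff q (Suc n) j * (q ^ Suc n - q ^ j)"
      unfolding 2 using Suc by (simp add: algebra_simps)
    finally show ?thesis .
  qed
qed

text \<open>This is the value of the product at \<open>T = 1\<close>, where the factor
  \<open>T - 1\<close> vanishes.\<close>

lemma qprod_coeff_sum: "(\<Sum>j\<le>Suc n. qprod_coeff q (Suc n) j) = 0"
proof -
  have rec: "(\<Sum>j\<le>Suc n. qprod_coeff q (Suc n) j) = (q ^ n - 1) * (\<Sum>j\<le>n. qprod_coeff q n j)" for n
  proof -
    have "(\<Sum>j\<le>n. qprod_coeff q n j) = (\<Sum>j\<le>Suc n. qprod_coeff q n j)"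
      by (simp add: qprod_coeff_eq_0)
    also have "\<dots> = qprod_coeff q n 0 + (\<Sum>j\<le>n. qprod_coeff q n (Suc j))"
      by (rule sum.atMost_Suc_shift)
    finally have "(\<Sum>j\<le>n. qprod_coeff q n (Suc j)) = (\<Sum>j\<le>n. qprod_coeff q n j) - qprod_coeff q n 0" by simp
    then show ?thesis
      by (simp add: sum.atMost_Suc_shift sum_subtractf sum_distrib_left[symmetric] left_diff_distrib del: sum.atMost_Suc)
  qed
  show ?thesis by (induction n) (subst rec, simp)+
qed

text \<open>For \<open>q^p = 1\<close> the functional equation expresses each coefficient by its
  predecessor times \<open>1 - q^j\<close>, divided by the nonzero \<open>1 - q^(j+1)\<close>. At
  \<open>j = 0\<close> this factor is zero, and the vanishing propagates.\<close>

lemma qprod_coeff_middle: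
  assumes "q ^ p = 1" "\<And>k. 0 < k \<Longrightarrow> k < p \<Longrightarrow> q ^ k \<noteq> 1" "0 < j" "j < p"
  shows "qprod_coeff q p j = 0"
  using assms(3,4)
proof (induction j)
  case (Suc j)
  have "qprod_coeff q p j * (q ^ p - q ^ j) = 0"
    using Suc assms(1) by (cases j) auto
  then have "qprod_coeff q p (Suc j) * (1 - q ^ Suc j) = 0"
    unfolding qprod_coeff_functional .
  then show ?case using assms(2)[of "Suc j"] Suc.prems by auto
qed simp

text \<open>The coefficients sum to zero and only the outer two remain, so this one is minus the
  constant term. The sign \<open>(-1)^(p+1)\<close> in the value of \<open>y^p\<close> originates
  here.\<close>

lemma qprod_coeff_top:
  assumes "q ^ p = 1" "\<And>k. 0 < k \<Longrightarrow> k < p \<Longrightarrow> q ^ k \<noteq> 1" "0 < p"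
  shows "qprod_coeff q p p = - ((- 1) ^ p)"
proof -
  have "(\<Sum>j\<le>p. qprod_coeff q p j) = (\<Sum>j\<in>{0, p}. qprod_coeff q p j)"
    by (rule sum.mono_neutral_right) (auto intro: qprod_coeff_middle[OF assms(1,2)])
  moreover have "(\<Sum>j\<le>p. qprod_coeff q p j) = 0"
    using qprod_coeff_sum[where n = "p - 1" and q = q] assms(3) by simp
  ultimately show ?thesis using assms(3) by (simp add: qprod_coeff_0 eq_neg_iff_add_eq_0 add.commute)
qed

lemma (in type_subring) qprod_coeff_in: "q \<in> S \<Longrightarrow> qprod_coeff q n j \<in> S"
  by (induction q n j rule: qprod_coeff.induct) (auto intro: one_in zero_in diff_in mult_in uminus_in pow_in)

section \<open>From the generators x, \<beta> to the generators x, y over a field\<close>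

locale symbol_pair = type_subring K + central_algebra "type_ring K" \<iota> B
  for K :: "'f::field set" and \<iota> :: "'f \<Rightarrow> 'b" and B :: "('b, 'n) ring_scheme" (structure) +
  fixes x \<beta> :: 'b and q a d :: 'f and p :: nat
  assumes inverse_in: "z \<in> K \<Longrightarrow> inverse z \<in> K"
    and q_in: "q \<in> K" and a_in: "a \<in> K" and d_in: "d \<in> K" and a_nonzero: "a \<noteq> 0"
    and prime: "Factorial_Ring.prime p"
    and q_pow: "q ^ p = 1" and q_primitive: "\<And>k. 0 < k \<Longrightarrow> k < p \<Longrightarrow> q ^ k \<noteq> 1"
    and x_closed [simp]: "x \<in> carrier B" and \<beta>_closed [simp]: "\<beta> \<in> carrier B"
    and x_pow_p: "x [^] p = \<iota> a" and \<beta>_pow_p: "\<beta> [^] p = \<iota> d"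
    and commute: "x \<otimes> \<beta> = \<iota> q \<otimes> (\<beta> \<otimes> x)"
begin

notation scale (infixr "\<bullet>" 72)

lemmas K_scale = scale_simps[unfolded type_ring_simps] scale_add_left[unfolded type_ring_simps]
lemmas K_struct = struct_closed[unfolded type_ring_simps] struct_one[unfolded type_ring_simps]
  struct_add[unfolded type_ring_simps] struct_mult[unfolded type_ring_simps]
lemmas K_in = one_in zero_in mult_in add_in uminus_in pow_in inverse_in diff_in q_in a_in d_in

lemma p_gt_1: "1 < p" using prime by (rule prime_gt_1_nat)
lemma q_ne_1: "q \<noteq> 1" using q_primitive[of 1] p_gt_1 by simp

definition e where "e = inverse (q - 1)"
definition \<alpha> where "\<alpha> = \<iota> e \<otimes> (\<beta> \<ominus> \<one>)"
definition x_inv where "x_inv = \<iota> (inverse a) \<otimes> x [^] (p - 1)"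
definition y where "y = x_inv \<otimes> \<alpha>"
text \<open>The scalar that \<open>y_pow_p\<close> finds for \<open>y [^] p\<close>. For
  \<open>d = 1 + a b' (q - 1)^p\<close> it equals \<open>(-1)^(p+1) b'\<close>.\<close>

definition b where "b = (- 1) ^ Suc p * (d - 1) * e ^ p * inverse a"

lemma e_in: "e \<in> K" and b_in: "b \<in> K"
  by (simp_all add: e_def b_def K_in)

lemma e_mult: "e * (q - 1) = 1" using q_ne_1 by (simp add: e_def)

lemma \<alpha>_eq: "\<alpha> = e \<bullet> \<beta> \<oplus> \<iota> (- e)"
proof -
  have "\<iota> (- e) = \<ominus> \<iota> e" using struct_uminus[of e] e_in by (simp add: type_ring_simps type_ring_uminus)
  then show ?thesis
    using K_struct(1)[OF e_in] by (simp add: \<alpha>_def scale_def A.minus_eq A.r_distr A.r_minus)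
qed

lemma closed [simp]: "\<alpha> \<in> carrier B" "x_inv \<in> carrier B" "y \<in> carrier B"
  by (simp_all add: \<alpha>_def x_inv_def y_def K_struct e_in K_in)

lemma x_inv: "x \<otimes> x_inv = \<one>" "x_inv \<otimes> x = \<one>"
proof -
  have p: "p = Suc (p - 1)" using p_gt_1 by simp
  have 1: "x \<otimes> x [^] (p - 1) = \<iota> a" "x [^] (p - 1) \<otimes> x = \<iota> a"
    using x_pow_p A.nat_pow_Suc2[of x "p - 1"] A.nat_pow_Suc[of x "p - 1"] p by simp_all
  have 2: "\<iota> (inverse a) \<otimes> \<iota> a = \<one>"
    using a_nonzero K_struct(4)[of "inverse a" a] by (simp add: K_in K_struct(2))
  have 3: "\<iota> (inverse a) \<otimes> x = x \<otimes> \<iota> (inverse a)"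
    using struct_central[of "inverse a" x] by (simp add: type_ring_simps K_in)
  have "x \<otimes> x_inv = (x \<otimes> \<iota> (inverse a)) \<otimes> x [^] (p - 1)"
    by (simp add: x_inv_def K_in K_struct A.m_assoc)
  also have "\<dots> = \<iota> (inverse a) \<otimes> (x \<otimes> x [^] (p - 1))"
    unfolding 3[symmetric] by (simp add: K_in K_struct A.m_assoc)
  finally show "x \<otimes> x_inv = \<one>" using 1 2 by simp
  show "x_inv \<otimes> x = \<one>"
    using 1 2 by (simp add: x_inv_def K_in K_struct A.m_assoc)
qed

lemma xy: "x \<otimes> y = \<alpha>"
  by (simp add: y_def A.m_assoc[symmetric] x_inv)

lemma scalar_scale: "r \<in> K \<Longrightarrow> z \<in> carrier B \<Longrightarrow> \<iota> r \<otimes> z = r \<bullet> z" by (simp add: scale_def)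

lemma scale_scalar: "r \<in> K \<Longrightarrow> s \<in> K \<Longrightarrow> r \<bullet> \<iota> s = \<iota> (r * s)" by (simp add: scale_def K_struct)

lemma x_inv_cancel: "z \<in> carrier B \<Longrightarrow> x_inv \<otimes> (x \<otimes> z) = z"
  by (simp add: A.m_assoc[symmetric] x_inv)

text \<open>Conjugation by \<open>x\<close> multiplies \<open>\<beta>\<close> by \<open>q\<close>,
  so \<open>q \<alpha> x\<close> can be rewritten with \<open>x\<close> as its left factor, which
  \<open>x_inv\<close> then removes.\<close>

lemma q_yx: "q \<bullet> (y \<otimes> x) = e \<bullet> \<beta> \<oplus> \<iota> (- (e * q))"
proof -
  have "\<alpha> \<otimes> x = e \<bullet> (\<beta> \<otimes> x) \<oplus> (- e) \<bullet> x"
    by (simp add: \<alpha>_eq A.l_distr K_scale K_struct K_in e_in scalar_scale)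
  then have "q \<bullet> (\<alpha> \<otimes> x) = e \<bullet> (q \<bullet> (\<beta> \<otimes> x)) \<oplus> (- (e * q)) \<bullet> x"
    by (simp add: K_scale K_in e_in mult.commute)
  also have "\<dots> = x \<otimes> (e \<bullet> \<beta> \<oplus> \<iota> (- (e * q)))"
    using commute struct_central[of "- (e * q)" x]
    by (simp add: A.r_distr K_scale K_struct K_in e_in scalar_scale type_ring_simps)
  finally have *: "q \<bullet> (\<alpha> \<otimes> x) = x \<otimes> (e \<bullet> \<beta> \<oplus> \<iota> (- (e * q)))" .
  have "q \<bullet> (y \<otimes> x) = x_inv \<otimes> (q \<bullet> (\<alpha> \<otimes> x))"
    by (simp add: y_def A.m_assoc K_scale K_in)
  then show ?thesis unfolding * by (simp add: x_inv_cancel K_scale K_struct K_in e_in)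
qed

lemma weyl: "x \<otimes> y = q \<bullet> (y \<otimes> x) \<oplus> \<one>"
proof -
  have "- (e * q) + 1 = - e" using e_mult by (simp add: algebra_simps)
  then have "\<iota> (- (e * q)) \<oplus> \<one> = \<iota> (- e)"
    using K_struct(3)[of "- (e * q)" 1] by (simp add: K_in e_in K_struct(2))
  then show ?thesis
    by (simp add: xy \<alpha>_eq q_yx A.a_assoc K_scale K_struct(1) K_in e_in)
qed

lemma \<beta>_eq: "\<one> \<oplus> (q - 1) \<bullet> (x \<otimes> y) = \<beta>"
proof -
  have "(q - 1) \<bullet> \<alpha> = \<beta> \<oplus> \<iota> (- 1)"
    using e_mult by (simp add: \<alpha>_eq K_scale K_struct(1) K_in e_in scale_scalar mult.commute)
  moreover have "\<one> \<oplus> \<iota> (- 1) = \<zero>"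
    using K_struct(3)[of 1 "- 1"] struct_zero by (simp add: K_in K_struct(2) type_ring_simps)
  ultimately show ?thesis
    by (simp add: xy) (metis A.a_lcomm A.one_closed A.r_zero K_in(1,5) K_struct(1) \<beta>_closed)
qed

lemma x_pow_\<beta>: "x [^] n \<otimes> \<beta> = (q ^ n) \<bullet> (\<beta> \<otimes> x [^] (n::nat))"
proof (induction n)
  case 0
  then show ?case by (simp add: K_scale)
next
  case (Suc n)
  have "x [^] Suc n \<otimes> \<beta> = x [^] n \<otimes> (q \<bullet> (\<beta> \<otimes> x))"
    using commute by (simp add: A.m_assoc scalar_scale q_in)
  also have "\<dots> = q \<bullet> ((x [^] n \<otimes> \<beta>) \<otimes> x)"
    by (simp add: K_scale K_in A.m_assoc)
  also have "\<dots> = (q ^ Suc n) \<bullet> (\<beta> \<otimes> x [^] Suc n)"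
    unfolding Suc by (simp add: K_scale K_in A.m_assoc)
  finally show ?case .
qed

text \<open>The product of \<open>\<beta> - 1, q \<beta> - 1, ..., q^(n-1) \<beta> - 1\<close>,
  given in expanded form; \<open>product_Suc\<close> recovers the factors.\<close>

definition product where "product n = (\<Oplus>j\<in>{..n}. qprod_coeff q n j \<bullet> \<beta> [^] j)"

lemma term_closed [simp]: "qprod_coeff q n j \<bullet> \<beta> [^] (k::nat) \<in> carrier B"
  by (simp add: K_scale qprod_coeff_in q_in)

lemma product_closed [simp]: "product n \<in> carrier B"
  unfolding product_def by (intro A.finsum_closed) auto

lemma scale_finsum:
  "r \<in> K \<Longrightarrow> f \<in> I \<rightarrow> carrier B \<Longrightarrow> r \<bullet> (\<Oplus>i\<in>I. f i) = (\<Oplus>i\<in>I. r \<bullet> f i)"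
  unfolding scale_def by (cases "finite I") (simp_all add: A.finsum_rdistr K_struct)

lemma product_Suc: "product (Suc n) = ((q ^ n) \<bullet> \<beta> \<oplus> \<iota> (- 1)) \<otimes> product n"
proof -
  let ?c = "qprod_coeff q"
  have c: "?c n j \<in> K" for n j by (simp add: qprod_coeff_in q_in)
  have "\<beta> \<otimes> product n = (\<Oplus>j\<in>{..n}. ?c n j \<bullet> \<beta> [^] Suc j)"
    unfolding product_def
    by (subst A.finsum_rdistr) (auto simp: K_scale c A.nat_pow_Suc2[symmetric] simp del: A.nat_pow_Suc intro!: A.add.finprod_cong')
  then have 1: "((q ^ n) \<bullet> \<beta>) \<otimes> product n = (\<Oplus>j\<in>{..n}. (q ^ n * ?c n j) \<bullet> \<beta> [^] Suc j)"
    by (simp add: K_scale K_in scale_finsum c Pi_iff del: A.nat_pow_Suc)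
  have "product n = (\<Oplus>j\<in>{..Suc n}. ?c n j \<bullet> \<beta> [^] j)"
    unfolding product_def
    by (subst A.finsum_Suc) (auto simp: qprod_coeff_eq_0 scale_zero_left[unfolded type_ring_simps] K_scale)
  then have "\<iota> (- 1) \<otimes> product n = (\<Oplus>j\<in>{..Suc n}. (- ?c n j) \<bullet> \<beta> [^] j)"
    by (simp add: scalar_scale K_in scale_finsum c K_scale Pi_iff del: A.finsum_Suc A.nat_pow_Suc)
  also have "\<dots> = (\<Oplus>j\<in>{..n}. (- ?c n (Suc j)) \<bullet> \<beta> [^] Suc j) \<oplus> (- ?c n 0) \<bullet> \<one>"
    by (subst A.finsum_Suc2) (auto simp: K_scale K_in c simp del: A.nat_pow_Suc)
  finally have 2: "\<iota> (- 1) \<otimes> product n = (\<Oplus>j\<in>{..n}. (- ?c n (Suc j)) \<bullet> \<beta> [^] Suc j) \<oplus> (- ?c n 0) \<bullet> \<one>" .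
  have "product (Suc n) = (\<Oplus>j\<in>{..n}. ?c (Suc n) (Suc j) \<bullet> \<beta> [^] Suc j) \<oplus> (- ?c n 0) \<bullet> \<one>"
    unfolding product_def by (subst A.finsum_Suc2) (auto simp del: A.nat_pow_Suc qprod_coeff.simps(4))
  also have "(\<Oplus>j\<in>{..n}. ?c (Suc n) (Suc j) \<bullet> \<beta> [^] Suc j)
      = (\<Oplus>j\<in>{..n}. (q ^ n * ?c n j) \<bullet> \<beta> [^] Suc j \<oplus> (- ?c n (Suc j)) \<bullet> \<beta> [^] Suc j)"
    by (intro A.add.finprod_cong')
      (auto simp: scale_add_left[unfolded type_ring_simps, symmetric] K_scale K_in c simp del: A.nat_pow_Suc)
  also have "\<dots> = (\<Oplus>j\<in>{..n}. (q ^ n * ?c n j) \<bullet> \<beta> [^] Suc j) \<oplus> (\<Oplus>j\<in>{..n}. (- ?c n (Suc j)) \<bullet> \<beta> [^] Suc j)"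
    by (intro A.finsum_addf) (auto simp: K_scale K_in c simp del: A.nat_pow_Suc)
  finally have "product (Suc n) = (\<Oplus>j\<in>{..n}. (q ^ n * ?c n j) \<bullet> \<beta> [^] Suc j)
      \<oplus> ((\<Oplus>j\<in>{..n}. (- ?c n (Suc j)) \<bullet> \<beta> [^] Suc j) \<oplus> (- ?c n 0) \<bullet> \<one>)"
    by (simp add: A.a_assoc K_scale K_in c Pi_iff del: A.nat_pow_Suc)
  then show ?thesis
    unfolding 1[symmetric] 2[symmetric] by (simp add: A.l_distr K_scale K_struct K_in)
qed

text \<open>Moving the innermost \<open>x y = \<alpha> = e (\<beta> - 1)\<close> left across
  \<open>x [^] n\<close> replaces \<open>\<beta>\<close> by \<open>q^n \<beta>\<close>, which
  contributes the next factor of the product.\<close>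

lemma x_pow_y_pow: "x [^] n \<otimes> y [^] n = (e ^ n) \<bullet> product n"
proof (induction n)
  case 0
  then show ?case by (simp add: product_def K_scale)
next
  case (Suc n)
  have "x [^] n \<otimes> \<alpha> = (e * q ^ n) \<bullet> (\<beta> \<otimes> x [^] n) \<oplus> (- e) \<bullet> x [^] n"
    using struct_central[of "- e" "x [^] n"]
    by (simp add: \<alpha>_eq A.r_distr K_scale K_struct(1) K_in e_in x_pow_\<beta> type_ring_simps scale_def[of "- e"])
  also have "\<dots> = e \<bullet> (((q ^ n) \<bullet> \<beta> \<oplus> \<iota> (- 1)) \<otimes> x [^] n)"
    by (simp add: A.l_distr K_scale K_struct(1) K_in e_in scalar_scale)
  finally have *: "x [^] n \<otimes> \<alpha> = e \<bullet> (((q ^ n) \<bullet> \<beta> \<oplus> \<iota> (- 1)) \<otimes> x [^] n)" .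
  have "x [^] Suc n \<otimes> y [^] Suc n = x [^] n \<otimes> (x \<otimes> y) \<otimes> y [^] n"
    using A.nat_pow_Suc2[of y n] by (simp add: A.m_assoc)
  also have "\<dots> = e \<bullet> (((q ^ n) \<bullet> \<beta> \<oplus> \<iota> (- 1)) \<otimes> (x [^] n \<otimes> y [^] n))"
    unfolding xy * by (simp add: K_scale K_struct(1) K_in e_in A.m_assoc)
  also have "\<dots> = (e ^ Suc n) \<bullet> product (Suc n)"
    unfolding Suc product_Suc by (simp add: K_scale K_struct(1) K_in e_in)
  finally show ?case .
qed

lemma y_pow_p: "y [^] p = \<iota> b"
proof -
  let ?s = "(- 1 :: 'f) ^ p"
  have s: "?s \<in> K" by (simp add: K_in)
  have middle: "qprod_coeff q p j = 0" if "j \<le> p" "j \<noteq> 0" "j \<noteq> p" for j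
    using qprod_coeff_middle[OF q_pow q_primitive, of j] that by simp
  \<comment> \<open>Only the outer two coefficients survive and \<open>\<beta> [^] p\<close> is the
    scalar \<open>d\<close>, so \<open>x [^] p \<otimes> y [^] p\<close> is a scalar and the
    invertible \<open>a\<close> can be cancelled.\<close>
  have "product p = (\<Oplus>j\<in>{0, p}. qprod_coeff q p j \<bullet> \<beta> [^] j)"
    unfolding product_def
    by (rule A.add.finprod_mono_neutral_cong_right)
      (auto simp: K_scale scale_zero_left[unfolded type_ring_simps] middle)
  also have "\<dots> = ?s \<bullet> \<one> \<oplus> (- ?s) \<bullet> \<iota> d"
    using p_gt_1 by (subst A.finsum_insert)
      (auto simp: qprod_coeff_0 qprod_coeff_top[OF q_pow q_primitive] \<beta>_pow_p K_scale K_struct s K_in)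
  also have "\<dots> = \<iota> (?s + - ?s * d)"
    using K_struct(3)[of ?s "- ?s * d"] K_struct(4)[of "- ?s" d] by (simp add: K_in s scale_def K_struct(1,2))
  finally have "x [^] p \<otimes> y [^] p = \<iota> (e ^ p * (?s + - ?s * d))"
    by (simp add: x_pow_y_pow scale_scalar K_in e_in s)
  then have "\<iota> (inverse a) \<otimes> (\<iota> a \<otimes> y [^] p) = \<iota> (inverse a) \<otimes> \<iota> (e ^ p * (?s + - ?s * d))"
    by (simp add: x_pow_p)
  moreover have "\<iota> (inverse a) \<otimes> \<iota> a = \<one>"
    using a_nonzero K_struct(4)[of "inverse a" a] by (simp add: K_in K_struct(2))
  then have "\<iota> (inverse a) \<otimes> (\<iota> a \<otimes> y [^] p) = y [^] p"
    by (simp add: A.m_assoc[symmetric] K_struct(1) K_in)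
  moreover have "\<iota> (inverse a) \<otimes> \<iota> (e ^ p * (?s + - ?s * d)) = \<iota> b"
    by (subst K_struct(4)[symmetric]) (auto simp: K_in e_in s b_def algebra_simps)
  ultimately show ?thesis by simp
qed

end

section \<open>The order spanned by the monomials over the smaller base ring\<close>

locale symbol_order = symbol_pair K \<iota> B x \<beta> q a d p
  for K :: "'f::field set" and \<iota> :: "'f \<Rightarrow> 'b" and B :: "('b, 'n) ring_scheme" (structure)
    and x \<beta> q a d p +
  fixes S :: "'f set"
  assumes S_subring: "type_subring S" and S_subset: "S \<subseteq> K"
    and S_elements: "q \<in> S" "a \<in> S" "b \<in> S" "d \<in> S" "inverse d \<in> S"
    and d_nonzero: "d \<noteq> 0" and struct_inj: "inj_on \<iota> K"
begin

interpretation S: type_subring S by (rule S_subring)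

abbreviation mono_term :: "(nat \<Rightarrow> nat \<Rightarrow> 'f) \<Rightarrow> nat \<times> nat \<Rightarrow> 'b" where
  "mono_term c \<equiv> \<lambda>(i, j). \<iota> (c i j) \<otimes> (x [^] i \<otimes> y [^] j)"

definition order where
  "order = {finsum B (mono_term c) ({..<p} \<times> {..<p})
    | c :: nat \<Rightarrow> nat \<Rightarrow> 'f. \<forall>i j. c i j \<in> S}"

lemma S_central: "central_algebra (type_ring S) \<iota> B"
proof (intro central_algebra.intro assoc_algebra.intro assoc_algebra_axioms.intro S.type_ring_cring A.ring_axioms)
  show "\<iota> \<in> ring_hom (type_ring S) B"
    by (rule ring_hom_memI) (use S_subset in \<open>auto simp: type_ring_simps K_struct subset_iff\<close>)
  show "\<iota> r \<otimes> z = z \<otimes> \<iota> r" if "r \<in> carrier (type_ring S)" "z \<in> carrier B" for r z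
    using struct_central[of r z] that S_subset by (auto simp: type_ring_simps)
qed

lemma S_vanishing: "qnum_vanishing (type_ring S) q p"
  by (rule S.type_ring_qnum_vanishing[OF prime S_elements(1) q_pow q_ne_1])

lemma S_relations: "weyl_relations (type_ring S) \<iota> B q x y p a b"
  by (intro weyl_relations.intro weyl_pair.intro weyl_pair_axioms.intro weyl_relations_axioms.intro
      S_central S_vanishing)
    (use S_elements weyl x_pow_p y_pow_p in
      \<open>simp_all add: type_ring_simps scale_def central_algebra.scale_def[OF S_central]\<close>)

interpretation M: weyl_relations "type_ring S" \<iota> B q x y p a b by (rule S_relations)

lemma term_S_closed: "r \<in> S \<Longrightarrow> \<iota> r \<otimes> (x [^] (i::nat) \<otimes> y [^] (j::nat)) \<in> carrier B"
  using M.struct_closed[of r] by (simp add: type_ring_simps)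

text \<open>Turns the sums over all index pairs into the inductive span, which is already known to
  be closed under multiplication.\<close>

lemma order_eq: "order = M.monomial_span"
proof
  have "finsum B (mono_term c) I \<in> M.monomial_span"
    if c: "\<forall>i j. c i j \<in> S" and "finite I" and "I \<subseteq> {..<p} \<times> {..<p}" for c :: "nat \<Rightarrow> nat \<Rightarrow> 'f" and I
    using that(2,3)
  proof (induction I rule: finite_induct)
    case empty
    then show ?case using subringE(2)[OF M.monomial_span_subring] by simp
  next
    case (insert k I)
    obtain i j where k: "k = (i, j)" by (cases k)
    have "\<iota> (c i j) \<otimes> (x [^] i \<otimes> y [^] j) \<in> M.monomial_span"
      using M.monomial_span.monomial[of "c i j" i j] c insert.prems k by (simp add: type_ring_simps M.scale_def)
    then have "\<iota> (c i j) \<otimes> (x [^] i \<otimes> y [^] j) \<oplus> finsum B (mono_term c) I \<in> M.monomial_span"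
      using insert by (intro M.monomial_span.add) auto
    then show ?case
      using insert.hyps c term_S_closed k by (subst A.finsum_insert) (auto simp: Pi_iff)
  qed
  then show "order \<subseteq> M.monomial_span" unfolding order_def by fastforce
next
  show "M.monomial_span \<subseteq> order"
  proof
    fix z assume "z \<in> M.monomial_span"
    then show "z \<in> order"
    proof (induction rule: M.monomial_span.induct)
      case (monomial r i j)
      define c where "c k l = (if k = i \<and> l = j then r else 0)" for k l
      have c: "\<forall>k l. c k l \<in> S" using monomial by (simp add: c_def S.zero_in type_ring_simps)
      have "finsum B (mono_term c) ({..<p} \<times> {..<p})
          = finsum B (mono_term c) {(i, j)}"
        by (rule A.add.finprod_mono_neutral_cong_right)
          (use monomial M.struct_zero c term_S_closed in \<open>auto simp: c_def type_ring_simps split: if_splits\<close>)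
      also have "\<dots> = r \<bullet> (x [^] i \<otimes> y [^] j)"
        using monomial term_S_closed[of r i j] by (subst A.finsum_insert) (auto simp: c_def type_ring_simps scale_def)
      finally have eq: "finsum B (mono_term c) ({..<p} \<times> {..<p}) = r \<bullet> (x [^] i \<otimes> y [^] j)" .
      show ?case unfolding eq[symmetric] order_def using c by blast
    next
      case (add u v)
      then obtain c c' where c: "\<forall>i j. c i j \<in> S" "\<forall>i j. c' i j \<in> S"
        and uv: "u = finsum B (mono_term c) ({..<p} \<times> {..<p})"
          "v = finsum B (mono_term c') ({..<p} \<times> {..<p})"
        unfolding order_def by auto
      have "\<iota> (c i j + c' i j) \<otimes> (x [^] i \<otimes> y [^] j)
          = \<iota> (c i j) \<otimes> (x [^] i \<otimes> y [^] j) \<oplus> \<iota> (c' i j) \<otimes> (x [^] i \<otimes> y [^] j)" for i j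
        using M.struct_add[of "c i j" "c' i j"] M.struct_closed[of "c i j"] M.struct_closed[of "c' i j"] c
        by (simp add: type_ring_simps A.l_distr)
      then have "mono_term (\<lambda>i j. c i j + c' i j) = (\<lambda>k. mono_term c k \<oplus> mono_term c' k)"
        by (simp add: fun_eq_iff split_paired_all)
      moreover have "finsum B (\<lambda>k. mono_term c k \<oplus> mono_term c' k) ({..<p} \<times> {..<p}) = u \<oplus> v"
        unfolding uv by (rule A.finsum_addf) (use c term_S_closed in auto)
      ultimately have "finsum B (mono_term (\<lambda>i j. c i j + c' i j)) ({..<p} \<times> {..<p}) = u \<oplus> v" by simp
      moreover have "\<forall>i j. c i j + c' i j \<in> S" using c S.add_in by blast
      ultimately show ?case
        unfolding order_def by (intro CollectI exI[of _ "\<lambda>i j. c i j + c' i j"] conjI) simp_all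
    qed
  qed
qed

lemma order_subring: "subring order B"
  unfolding order_eq by (rule M.monomial_span_subring)

abbreviation A where "A \<equiv> B\<lparr>carrier := order\<rparr>"

lemma order_central: "central_algebra (type_ring S) \<iota> A"
proof (intro central_algebra.intro assoc_algebra.intro assoc_algebra_axioms.intro S.type_ring_cring)
  show "ring A" by (rule A.subring_is_ring[OF order_subring])
  show "\<iota> \<in> ring_hom (type_ring S) A"
    by (rule ring_hom_memI)
      (use M.struct_in_span M.struct_add M.struct_mult M.struct_one in \<open>simp_all add: order_eq\<close>)
  show "\<iota> r \<otimes>\<^bsub>A\<^esub> z = z \<otimes>\<^bsub>A\<^esub> \<iota> r" if "r \<in> carrier (type_ring S)" "z \<in> carrier A" for r z
    using M.struct_central[of r z] that subringE(1)[OF order_subring] by auto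
qed

lemma order_pow: "z [^]\<^bsub>A\<^esub> (n::nat) = z [^] n"
  by (rule A.nat_pow_consistent[symmetric])

lemma order_scale: "central_algebra.scale \<iota> A r z = r \<bullet> z"
  by (simp add: central_algebra.scale_def[OF order_central] scale_def)

lemma order_weyl_relations: "weyl_relations (type_ring S) \<iota> A q x y p a b"
proof -
  have "x \<in> order" "y \<in> order" by (simp_all add: order_eq M.x_in_span M.y_in_span)
  then show ?thesis
    by (intro weyl_relations.intro weyl_pair.intro weyl_pair_axioms.intro weyl_relations_axioms.intro
        order_central S_vanishing)
      (use S_elements weyl x_pow_p y_pow_p in \<open>simp_all add: type_ring_simps order_pow order_scale\<close>)
qed

lemma order_weyl_algebra: "weyl_algebra (type_ring S) \<iota> A q x y p a b d"
proof (intro weyl_algebra.intro weyl_unit.intro order_weyl_relations weyl_unit_axioms.intro weyl_algebra_axioms.intro)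
  show "d \<in> Units (type_ring S)"
    using S_elements(4,5) d_nonzero by (auto simp: Units_def type_ring_simps intro!: bexI[of _ "inverse d"])
  show "(\<one>\<^bsub>A\<^esub> \<oplus>\<^bsub>A\<^esub> central_algebra.scale \<iota> A (q \<ominus>\<^bsub>type_ring S\<^esub> \<one>\<^bsub>type_ring S\<^esub>) (x \<otimes>\<^bsub>A\<^esub> y)) [^]\<^bsub>A\<^esub> p = \<iota> d"
    using \<beta>_eq \<beta>_pow_p S.type_ring_minus[OF S_elements(1) S.one_in]
    by (simp add: order_pow order_scale type_ring_simps)
  show "inj_on \<iota> (carrier (type_ring S))"
    using inj_on_subset[OF struct_inj S_subset] by (simp add: type_ring_simps)
  \<comment> \<open>The two spans are formed in \<open>B\<close> and in the order; powers and
    scalings agree there, so an induction carries one into the other.\<close>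
  show "carrier A \<subseteq> weyl_relations.monomial_span (type_ring S) \<iota> A x y p"
  proof
    fix z assume "z \<in> carrier A"
    then have "z \<in> M.monomial_span" by (simp add: order_eq)
    then show "z \<in> weyl_relations.monomial_span (type_ring S) \<iota> A x y p"
    proof (induction rule: M.monomial_span.induct)
      case (monomial r i j)
      then show ?case
        using weyl_relations.monomial_span.monomial[OF order_weyl_relations, of r i j]
        by (simp add: order_pow order_scale scale_def M.scale_def)
    next
      case (add u v)
      then show ?case
        using weyl_relations.monomial_span.add[OF order_weyl_relations, of u v] by simp
    qed
  qed
qed

end

section \<open>Operators that satisfy the symbol relations\<close>

context periodic_functions
begin

definition shift_op where "shift_op = (\<lambda>v\<in>carrier V. \<lambda>m n. v (Suc m) n)"
text \<open>This is the action of \<open>\<beta>\<close>, while \<open>x\<close> acts by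
  \<open>shift_op\<close>. Shifting the first index after twisting raises the weight
  \<open>q^m\<close> by one factor \<open>q\<close>, which is the relation
  \<open>x \<beta> = q \<beta> x\<close>.\<close>

definition twist_op where "twist_op q = (\<lambda>v\<in>carrier V. \<lambda>m n. q [^] (m::nat) \<otimes> v m (Suc n))"

lemma shift_op_apply: "v \<in> carrier V \<Longrightarrow> shift_op v = (\<lambda>m n. v (Suc m) n)"
  and twist_op_apply: "v \<in> carrier V \<Longrightarrow> twist_op q v = (\<lambda>m n. q [^] m \<otimes> v m (Suc n))"
  by (simp_all add: shift_op_def twist_op_def)

lemma shift_op_hom: "shift_op \<in> module_homs R V V"
  unfolding shift_op_def
proof (rule V.homsI)
  fix v assume v: "v \<in> carrier V"
  show "(\<lambda>m n. v (Suc m) n) \<in> carrier V"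
    using V_value[OF v] V_shift[OF v] by (simp add: V_simps(1) flip: add_Suc)
qed (simp_all add: V_simps(2,4))

lemma twist_op_hom:
  assumes q: "q \<in> carrier R" "q [^] p = \<one>"
  shows "twist_op q \<in> module_homs R V V"
  unfolding twist_op_def
proof (rule V.homsI)
  fix v assume v: "v \<in> carrier V"
  have "q [^] (m + p) = q [^] m" for m :: nat using q by (simp add: nat_pow_mult[symmetric])
  then show "(\<lambda>m n. q [^] m \<otimes> v m (Suc n)) \<in> carrier V"
    using V_value[OF v] V_shift[OF v] q by (simp add: V_simps(1) m_lcomm flip: add_Suc)
next
  fix v w assume v: "v \<in> carrier V" and w: "w \<in> carrier V"
  show "(\<lambda>m n. q [^] m \<otimes> (v \<oplus>\<^bsub>V\<^esub> w) m (Suc n)) = (\<lambda>m n. q [^] m \<otimes> v m (Suc n)) \<oplus>\<^bsub>V\<^esub> (\<lambda>m n. q [^] m \<otimes> w m (Suc n))"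
    using q V_value[OF v] V_value[OF w] by (simp add: V_simps(2) r_distr)
next
  fix r v assume r: "r \<in> carrier R" and v: "v \<in> carrier V"
  show "(\<lambda>m n. q [^] m \<otimes> (r \<odot>\<^bsub>V\<^esub> v) m (Suc n)) = r \<odot>\<^bsub>V\<^esub> (\<lambda>m n. q [^] m \<otimes> v m (Suc n))"
    using q r V_value[OF v] by (simp add: V_simps(4) m_lcomm)
qed

lemma shift_op_pow: "shift_op [^]\<^bsub>EV\<^esub> p = V.scalar_end a"
proof (rule EV_pow_eqI[OF shift_op_hom a_closed])
  fix v m n assume v: "v \<in> carrier V"
  have "(shift_op ^^ k) v = (\<lambda>m n. v (m + k) n)" for k
  proof (induction k)
    case (Suc k)
    have "(shift_op ^^ k) v \<in> carrier V" using EV_pow[OF shift_op_hom v] by blast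
    then show ?case using Suc by (simp add: shift_op_apply)
  qed simp
  then show "(shift_op ^^ p) v m n = a \<otimes> v m n" using V_shift(1)[OF v] by simp
qed

lemma twist_op_pow:
  assumes q: "q \<in> carrier R" "q [^] p = \<one>"
  shows "twist_op q [^]\<^bsub>EV\<^esub> p = V.scalar_end b"
proof (rule EV_pow_eqI[OF twist_op_hom[OF q] b_closed])
  fix v and m n :: nat assume v: "v \<in> carrier V"
  have "(twist_op q ^^ k) v = (\<lambda>(m::nat) n. (q [^] m) [^] k \<otimes> v m (n + k))" for k
  proof (induction k)
    case 0
    then show ?case using V_value[OF v] by simp
  next
    case (Suc k)
    have "(twist_op q ^^ k) v \<in> carrier V" using EV_pow[OF twist_op_hom[OF q] v] by blast
    then show ?case using Suc q V_value[OF v] by (simp add: twist_op_apply m_ac)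
  qed
  moreover have "(q [^] m) [^] p = \<one>"
    using q nat_pow_pow[OF q(1), of m p] nat_pow_pow[OF q(1), of p m] by (simp only: mult.commute[of m p]) simp
  ultimately show "(twist_op q ^^ p) v m n = b \<otimes> v m n" using V_shift(2)[OF v] V_value[OF v] by simp
qed

lemma shift_twist:
  assumes q: "q \<in> carrier R" "q [^] p = \<one>"
  shows "shift_op \<otimes>\<^bsub>EV\<^esub> twist_op q = V.scalar_end q \<otimes>\<^bsub>EV\<^esub> twist_op q \<otimes>\<^bsub>EV\<^esub> shift_op"
proof (rule V.homs_eqI)
  note h = shift_op_hom twist_op_hom[OF q]
  note s = V.scalar_end_closed[OF q(1)]
  show "shift_op \<otimes>\<^bsub>EV\<^esub> twist_op q \<in> module_homs R V V"
    "V.scalar_end q \<otimes>\<^bsub>EV\<^esub> twist_op q \<otimes>\<^bsub>EV\<^esub> shift_op \<in> module_homs R V V"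
    by (intro V.EA_closed h s)+
  fix v assume v: "v \<in> carrier V"
  have c: "shift_op v \<in> carrier V" "twist_op q v \<in> carrier V" "twist_op q (shift_op v) \<in> carrier V"
    using V.homsD(1)[OF h(1)] V.homsD(1)[OF h(2)] v by auto
  have "shift_op (twist_op q v) = q \<odot>\<^bsub>V\<^esub> twist_op q (shift_op v)"
    unfolding shift_op_apply[OF c(2)] twist_op_apply[OF c(1)]
    unfolding twist_op_apply[OF v] shift_op_apply[OF v] V_simps(4)
    using q V_value[OF v] by (simp add: m_ac)
  then show "(shift_op \<otimes>\<^bsub>EV\<^esub> twist_op q) v = (V.scalar_end q \<otimes>\<^bsub>EV\<^esub> twist_op q \<otimes>\<^bsub>EV\<^esub> shift_op) v"
    using v c by (simp add: End_algebra_simps)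
qed

lemma symbol_presentation:
  fixes q :: 'r
  assumes q: "q \<in> carrier R" "q [^] p = \<one>"
  defines "gX \<equiv> free_gen R Gen1 :: two_gens list \<Rightarrow> 'r" and "gY \<equiv> free_gen R Gen2"
  defines "Fr \<equiv> free_algebra R"
  defines "rels \<equiv> {gX [^]\<^bsub>Fr\<^esub> p \<ominus>\<^bsub>Fr\<^esub> free_const R a, gY [^]\<^bsub>Fr\<^esub> p \<ominus>\<^bsub>Fr\<^esub> free_const R b,
      gX \<otimes>\<^bsub>Fr\<^esub> gY \<ominus>\<^bsub>Fr\<^esub> free_const R q \<otimes>\<^bsub>Fr\<^esub> gY \<otimes>\<^bsub>Fr\<^esub> gX}"
  defines "PB \<equiv> presented_algebra R rels" and "cls \<equiv> presented_class R rels"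
  shows "central_algebra R (\<lambda>r. cls (free_const R r)) PB"
    and "cls gX \<in> carrier PB" "cls gY \<in> carrier PB"
    and "cls gX [^]\<^bsub>PB\<^esub> p = cls (free_const R a)" "cls gY [^]\<^bsub>PB\<^esub> p = cls (free_const R b)"
    and "cls gX \<otimes>\<^bsub>PB\<^esub> cls gY = cls (free_const R q) \<otimes>\<^bsub>PB\<^esub> (cls gY \<otimes>\<^bsub>PB\<^esub> cls gX)"
    and "inj_on (\<lambda>r. cls (free_const R r)) (carrier R)"
proof -
  have F: "ring Fr" unfolding Fr_def by (rule FA_ring)
  interpret F: ring Fr by (rule F)
  have gens: "gX \<in> carrier Fr" "gY \<in> carrier Fr" by (simp_all add: free_gen_eq gX_def gY_def Fr_def)
  have const: "r \<in> carrier R \<Longrightarrow> free_const R r \<in> carrier Fr" for r by (simp add: free_const_eq Fr_def)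
  have rels_closed: "rels \<subseteq> carrier Fr" unfolding rels_def using gens const q by simp
  have pres: "presentation R rels"
    by (intro presentation.intro presentation_axioms.intro cring_axioms rels_closed[unfolded Fr_def])
  show central: "central_algebra R (\<lambda>r. cls (free_const R r)) PB"
    unfolding PB_def cls_def by (rule presentation.central[OF pres])
  have B: "ring PB" unfolding PB_def by (rule presentation.PA_ring[OF pres])
  interpret B: ring PB by (rule B)
  have hom: "cls \<in> ring_hom Fr PB" unfolding PB_def cls_def Fr_def by (rule presentation.class_hom[OF pres])
  show xy: "cls gX \<in> carrier PB" "cls gY \<in> carrier PB"
    using ring_hom_closed[OF hom] gens by auto
  have rel: "cls f = cls g" if "f \<in> carrier Fr" "g \<in> carrier Fr" "f \<ominus>\<^bsub>Fr\<^esub> g \<in> rels" for f g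
    using presentation.class_rel[OF pres] that unfolding cls_def Fr_def by blast
  have "cls (gX [^]\<^bsub>Fr\<^esub> p) = cls (free_const R a)" "cls (gY [^]\<^bsub>Fr\<^esub> p) = cls (free_const R b)"
    by (rule rel; simp add: gens const rels_def)+
  then show "cls gX [^]\<^bsub>PB\<^esub> p = cls (free_const R a)" "cls gY [^]\<^bsub>PB\<^esub> p = cls (free_const R b)"
    using ring_hom_nat_pow[OF F B hom] gens by simp_all
  have "cls (gX \<otimes>\<^bsub>Fr\<^esub> gY) = cls (free_const R q \<otimes>\<^bsub>Fr\<^esub> gY \<otimes>\<^bsub>Fr\<^esub> gX)"
    by (rule rel) (simp_all add: gens const q rels_def)
  then show "cls gX \<otimes>\<^bsub>PB\<^esub> cls gY = cls (free_const R q) \<otimes>\<^bsub>PB\<^esub> (cls gY \<otimes>\<^bsub>PB\<^esub> cls gX)"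
    using gens const[OF q(1)] ring_hom_closed[OF hom const[OF q(1)]] xy
    by (simp add: ring_hom_mult[OF hom] B.m_assoc)
  define G where "G g = (case g of Gen1 \<Rightarrow> shift_op | Gen2 \<Rightarrow> twist_op q)" for g
  have G: "G g \<in> carrier EV" for g
    by (cases g) (simp_all add: G_def End_algebra_simps(1) shift_op_hom twist_op_hom[OF q])
  have ev: "evaluation R V.scalar_end EV G"
    by (intro evaluation.intro evaluation_axioms.intro V.EA_central G)
  note EV = V.EA_ring
  interpret EV: ring EV by (rule EV)
  let ?e = "evaluation.eval_free R V.scalar_end EV G"
  note e_hom = evaluation.eval_free_hom[OF ev, folded Fr_def]
  have e_gen: "?e gX = shift_op" "?e gY = twist_op q"
    using evaluation.eval_free_gen[OF ev] by (simp_all add: G_def gX_def gY_def)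
  have e_const: "r \<in> carrier R \<Longrightarrow> ?e (free_const R r) = V.scalar_end r" for r
    by (rule evaluation.eval_free_const[OF ev])
  have cl: "shift_op \<in> carrier EV" "twist_op q \<in> carrier EV" "r \<in> carrier R \<Longrightarrow> V.scalar_end r \<in> carrier EV" for r
    by (simp_all add: End_algebra_simps(1) shift_op_hom twist_op_hom[OF q] V.scalar_end_closed)
  show "inj_on (\<lambda>r. cls (free_const R r)) (carrier R)"
    unfolding cls_def
  proof (rule evaluation.presented_struct_inj[OF ev rels_closed[unfolded Fr_def] _ scalar_end_inj])
    fix f assume "f \<in> rels"
    then consider "f = gX [^]\<^bsub>Fr\<^esub> p \<ominus>\<^bsub>Fr\<^esub> free_const R a" | "f = gY [^]\<^bsub>Fr\<^esub> p \<ominus>\<^bsub>Fr\<^esub> free_const R b"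
      | "f = gX \<otimes>\<^bsub>Fr\<^esub> gY \<ominus>\<^bsub>Fr\<^esub> free_const R q \<otimes>\<^bsub>Fr\<^esub> gY \<otimes>\<^bsub>Fr\<^esub> gX"
      unfolding rels_def by blast
    then show "?e f = \<zero>\<^bsub>EV\<^esub>"
    proof cases
      case 1
      have "?e f = shift_op [^]\<^bsub>EV\<^esub> p \<ominus>\<^bsub>EV\<^esub> V.scalar_end a"
        unfolding 1 using gens const
        by (simp add: ring_hom_minus[OF F EV e_hom] ring_hom_nat_pow[OF F EV e_hom] e_gen e_const)
      then show ?thesis unfolding shift_op_pow using cl(3)[of a] by (simp add: EV.r_neg EV.minus_eq)
    next
      case 2
      have "?e f = twist_op q [^]\<^bsub>EV\<^esub> p \<ominus>\<^bsub>EV\<^esub> V.scalar_end b"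
        unfolding 2 using gens const
        by (simp add: ring_hom_minus[OF F EV e_hom] ring_hom_nat_pow[OF F EV e_hom] e_gen e_const)
      then show ?thesis unfolding twist_op_pow[OF q] using cl(3)[of b] by (simp add: EV.r_neg EV.minus_eq)
    next
      case 3
      have "?e f = shift_op \<otimes>\<^bsub>EV\<^esub> twist_op q \<ominus>\<^bsub>EV\<^esub> V.scalar_end q \<otimes>\<^bsub>EV\<^esub> twist_op q \<otimes>\<^bsub>EV\<^esub> shift_op"
        unfolding 3 using gens const[OF q(1)]
        by (simp add: ring_hom_minus[OF F EV e_hom] ring_hom_mult[OF e_hom] e_gen e_const q)
      then show ?thesis
        unfolding shift_twist[OF q] using cl(1,2) cl(3)[OF q(1)] by (simp add: EV.minus_eq EV.r_neg)
    qed
  qed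
qed

end

section \<open>The base ring of \<open>(a,b)\<^sub>\<rho>\<close> and its field of fractions\<close>

lemma cyclotomic_subring: "type_subring (cyclotomic_integers \<rho>)"
proof
  let ?e = "map_poly (of_int :: int \<Rightarrow> complex)"
  have diff: "?e (p - q) = ?e p - ?e q" for p q
    by (rule poly_eqI) (simp add: coeff_map_poly)
  have mult: "?e (p * q) = ?e p * ?e q" for p q
    by (rule poly_eqI) (simp add: coeff_map_poly coeff_mult)
  have "(1 :: complex) = Polynomial.poly (?e 1) \<rho>" by simp
  then show "1 \<in> cyclotomic_integers \<rho>" unfolding cyclotomic_integers_def by (rule range_eqI)
  show "r - s \<in> cyclotomic_integers \<rho>" "r * s \<in> cyclotomic_integers \<rho>"
    if "r \<in> cyclotomic_integers \<rho>" "s \<in> cyclotomic_integers \<rho>" for r s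
  proof -
    obtain f g where "r = Polynomial.poly (?e f) \<rho>" "s = Polynomial.poly (?e g) \<rho>"
      using \<open>r \<in> _\<close> \<open>s \<in> _\<close> unfolding cyclotomic_integers_def by auto
    then have "r - s = Polynomial.poly (?e (f - g)) \<rho>" "r * s = Polynomial.poly (?e (f * g)) \<rho>"
      by (simp_all add: diff mult)
    then show "r - s \<in> cyclotomic_integers \<rho>" "r * s \<in> cyclotomic_integers \<rho>"
      unfolding cyclotomic_integers_def by blast+
  qed
qed

lemma root_cyclotomic: "\<rho> \<in> cyclotomic_integers \<rho>"
proof -
  have "\<rho> = Polynomial.poly (map_poly of_int [:0, 1:]) \<rho>" by (simp add: map_poly_pCons)
  then show ?thesis unfolding cyclotomic_integers_def by (rule range_eqI)
qed

lemma (in type_subring) sum_in: "(\<And>i. i \<in> I \<Longrightarrow> f i \<in> S) \<Longrightarrow> sum f I \<in> S"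
  by (induction I rule: infinite_finite_induct) (auto simp: zero_in add_in)

lemma rho_polys_closed:
  "1 \<in> rho_polys \<rho>" "P \<in> rho_polys \<rho> \<Longrightarrow> Q \<in> rho_polys \<rho> \<Longrightarrow> P - Q \<in> rho_polys \<rho>"
  "P \<in> rho_polys \<rho> \<Longrightarrow> Q \<in> rho_polys \<rho> \<Longrightarrow> P + Q \<in> rho_polys \<rho>"
  "P \<in> rho_polys \<rho> \<Longrightarrow> Q \<in> rho_polys \<rho> \<Longrightarrow> P * Q \<in> rho_polys \<rho>"
  "c \<in> cyclotomic_integers \<rho> \<Longrightarrow> [:[:c:]:] \<in> rho_polys \<rho>"
  "[:[:0, 1:]:] \<in> rho_polys \<rho>" "[:0, 1:] \<in> rho_polys \<rho>"
proof -
  interpret O: type_subring "cyclotomic_integers \<rho>" by (rule cyclotomic_subring)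
  show "1 \<in> rho_polys \<rho>" by (simp add: rho_polys_def O.one_in O.zero_in)
  show "P - Q \<in> rho_polys \<rho>" "P + Q \<in> rho_polys \<rho>" if "P \<in> rho_polys \<rho>" "Q \<in> rho_polys \<rho>"
    using that by (simp_all add: rho_polys_def O.diff_in O.add_in)
  show "P * Q \<in> rho_polys \<rho>" if "P \<in> rho_polys \<rho>" "Q \<in> rho_polys \<rho>"
    using that by (simp add: rho_polys_def coeff_mult coeff_sum O.sum_in O.mult_in)
  show "[:[:c:]:] \<in> rho_polys \<rho>" if "c \<in> cyclotomic_integers \<rho>"
    using that by (simp add: rho_polys_def coeff_pCons O.zero_in split: nat.split)
  show "[:[:0, 1:]:] \<in> rho_polys \<rho>" "[:0, 1:] \<in> rho_polys \<rho>"
    by (simp_all add: rho_polys_def coeff_pCons O.zero_in O.one_in split: nat.split)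
qed

lemma rho_polys_pow: "P \<in> rho_polys \<rho> \<Longrightarrow> P ^ n \<in> rho_polys \<rho>"
  by (induction n) (simp_all add: rho_polys_closed)

lemma to_fract_pow: "to_fract (P ^ n) = to_fract P ^ n"
  by (induction n) simp_all

lemma scalar_simps:
  "scalar (c * c') = scalar c * scalar c'" "scalar (c - c') = scalar c - scalar c'" "scalar 1 = 1"
  "scalar c = scalar c' \<longleftrightarrow> c = c'" "scalar c = 0 \<longleftrightarrow> c = 0" "scalar (c ^ n) = scalar c ^ n"
proof -
  show mult: "scalar (c * c') = scalar c * scalar c'" for c c'
    by (simp add: scalar_def flip: to_fract_mult)
  show one: "scalar 1 = 1" by (simp add: scalar_def one_pCons[symmetric])
  show "scalar (c - c') = scalar c - scalar c'" by (simp add: scalar_def flip: to_fract_diff)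
  show "scalar c = scalar c' \<longleftrightarrow> c = c'" "scalar c = 0 \<longleftrightarrow> c = 0" by (simp_all add: scalar_def)
  show "scalar (c ^ n) = scalar c ^ n" by (induction n) (simp_all add: mult one)
qed

lemma rho_denom_poly:
  obtains D where "rho_denom p \<rho> = to_fract D" "D \<in> rho_polys \<rho>" "D \<noteq> 0"
proof
  let ?D = "1 + [:[:0, 1:]:] * [:0, 1:] * [:[:\<rho> - 1:]:] ^ p :: complex poly poly"
  interpret O: type_subring "cyclotomic_integers \<rho>" by (rule cyclotomic_subring)
  show "rho_denom p \<rho> = to_fract ?D"
    by (simp only: rho_denom_def var_a_def var_b_def scalar_def to_fract_add to_fract_mult to_fract_pow to_fract_1)
  show "?D \<in> rho_polys \<rho>"
    by (intro rho_polys_closed rho_polys_pow O.diff_in O.one_in root_cyclotomic)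
  \<comment> \<open>Setting the outer variable, which is \<open>b\<close>, to 0 leaves 1.\<close>
  have "Polynomial.poly ?D 0 = 1" by simp
  then show "?D \<noteq> 0" by (metis poly_0 zero_neq_one)
qed

lemma rho_denom_nonzero: "rho_denom p \<rho> \<noteq> 0"
  by (rule rho_denom_poly[of p \<rho>]) simp

lemma rho_base_poly: "P \<in> rho_polys \<rho> \<Longrightarrow> to_fract P \<in> rho_base_set p \<rho>"
  unfolding rho_base_set_def by (intro CollectI exI[of _ P] exI[of _ 0]) simp

lemma rho_base_subring: "type_subring (rho_base_set p \<rho>)"
proof
  show "1 \<in> rho_base_set p \<rho>" using rho_base_poly[OF rho_polys_closed(1)] by simp
  obtain D where D: "rho_denom p \<rho> = to_fract D" "D \<in> rho_polys \<rho>" "D \<noteq> 0" by (rule rho_denom_poly)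
  fix r s assume "r \<in> rho_base_set p \<rho>" "s \<in> rho_base_set p \<rho>"
  then obtain P Q k l where P: "P \<in> rho_polys \<rho>" "r = to_fract P / rho_denom p \<rho> ^ k"
    and Q: "Q \<in> rho_polys \<rho>" "s = to_fract Q / rho_denom p \<rho> ^ l"
    unfolding rho_base_set_def by blast
  have "r - s = to_fract (P * D ^ l - Q * D ^ k) / rho_denom p \<rho> ^ (k + l)"
    using rho_denom_nonzero[of p \<rho>] unfolding P(2) Q(2)
    by (simp add: to_fract_pow D(1)[symmetric] field_simps power_add)
  moreover have "r * s = to_fract (P * Q) / rho_denom p \<rho> ^ (k + l)"
    unfolding P(2) Q(2) by (simp add: power_add)
  moreover have "P * D ^ l - Q * D ^ k \<in> rho_polys \<rho>" "P * Q \<in> rho_polys \<rho>"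
    by (intro rho_polys_closed rho_polys_pow P(1) Q(1) D(2))+
  ultimately show "r - s \<in> rho_base_set p \<rho>" "r * s \<in> rho_base_set p \<rho>"
    unfolding rho_base_set_def by blast+
qed

definition rho_field_set :: "nat \<Rightarrow> complex \<Rightarrow> cfun2 set" where
  "rho_field_set p \<rho> = {u / v | u v. u \<in> rho_base_set p \<rho> \<and> v \<in> rho_base_set p \<rho> \<and> v \<noteq> 0}"

lemma rho_base_subset: "rho_base_set p \<rho> \<subseteq> rho_field_set p \<rho>"
proof
  interpret R: type_subring "rho_base_set p \<rho>" by (rule rho_base_subring)
  fix r assume "r \<in> rho_base_set p \<rho>"
  then show "r \<in> rho_field_set p \<rho>"
    unfolding rho_field_set_def by (intro CollectI exI[of _ r] exI[of _ 1]) (simp add: R.one_in)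
qed

lemma rho_field_subring: "type_subring (rho_field_set p \<rho>)"
proof
  interpret R: type_subring "rho_base_set p \<rho>" by (rule rho_base_subring)
  show "1 \<in> rho_field_set p \<rho>" using rho_base_subset R.one_in by blast
  fix r s assume "r \<in> rho_field_set p \<rho>" "s \<in> rho_field_set p \<rho>"
  then obtain u v u' v' where r: "r = u / v" "u \<in> rho_base_set p \<rho>" "v \<in> rho_base_set p \<rho>" "v \<noteq> 0"
    and s: "s = u' / v'" "u' \<in> rho_base_set p \<rho>" "v' \<in> rho_base_set p \<rho>" "v' \<noteq> 0"
    unfolding rho_field_set_def by blast
  have "r - s = (u * v' - u' * v) / (v * v')" "r * s = (u * u') / (v * v')"
    unfolding r(1) s(1) using r(4) s(4) by (simp_all add: field_simps)
  moreover have "v * v' \<noteq> 0" using r(4) s(4) by simp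
  moreover have "u * v' - u' * v \<in> rho_base_set p \<rho>" "u * u' \<in> rho_base_set p \<rho>" "v * v' \<in> rho_base_set p \<rho>"
    by (intro R.mult_in R.diff_in r(2,3) s(2,3))+
  ultimately show "r - s \<in> rho_field_set p \<rho>" "r * s \<in> rho_field_set p \<rho>"
    unfolding rho_field_set_def by blast+
qed

lemma rho_field_inverse: "z \<in> rho_field_set p \<rho> \<Longrightarrow> inverse z \<in> rho_field_set p \<rho>"
proof -
  assume z: "z \<in> rho_field_set p \<rho>"
  interpret F: type_subring "rho_field_set p \<rho>" by (rule rho_field_subring)
  obtain u v where uv: "z = u / v" "u \<in> rho_base_set p \<rho>" "v \<in> rho_base_set p \<rho>" "v \<noteq> 0"
    using z unfolding rho_field_set_def by blast
  show ?thesis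
  proof (cases "u = 0")
    case True
    then show ?thesis using uv F.zero_in by simp
  next
    case False
    then have "inverse z = v / u" using uv by simp
    then show ?thesis using uv False unfolding rho_field_set_def by blast
  qed
qed

lemma rho_base_elements:
  "scalar \<rho> \<in> rho_base_set p \<rho>" "var_a \<in> rho_base_set p \<rho>" "var_b \<in> rho_base_set p \<rho>"
  "rho_denom p \<rho> \<in> rho_base_set p \<rho>" "inverse (rho_denom p \<rho>) \<in> rho_base_set p \<rho>"
proof -
  show "scalar \<rho> \<in> rho_base_set p \<rho>" "var_a \<in> rho_base_set p \<rho>" "var_b \<in> rho_base_set p \<rho>"
    unfolding scalar_def var_a_def var_b_def by (intro rho_base_poly rho_polys_closed root_cyclotomic)+
  show "rho_denom p \<rho> \<in> rho_base_set p \<rho>" by (rule rho_denom_poly[of p \<rho>]) (simp add: rho_base_poly)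
  have "inverse (rho_denom p \<rho>) = to_fract 1 / rho_denom p \<rho> ^ 1" by (simp add: inverse_eq_divide)
  then show "inverse (rho_denom p \<rho>) \<in> rho_base_set p \<rho>"
    unfolding rho_base_set_def using rho_polys_closed(1) by blast
qed

lemma rho_ring_eq: "rho_base p \<rho> = type_ring (rho_base_set p \<rho>)" "rho_field p \<rho> = type_ring (rho_field_set p \<rho>)"
  by (simp_all add: rho_base_def rho_field_def rho_field_set_def)

lemma var_a_nonzero: "var_a \<noteq> 0" by (simp add: var_a_def)

section \<open>The instance over the cyclotomic base ring\<close>

locale primitive_root =
  fixes p :: nat and \<rho> :: complex
  assumes prime: "Factorial_Ring.prime p" and primitive: "primitive_root_of_unity p \<rho>"
begin

lemma scalar_root: "scalar \<rho> ^ p = 1" "0 < k \<Longrightarrow> k < p \<Longrightarrow> scalar \<rho> ^ k \<noteq> 1" "\<rho> \<noteq> 1"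
proof -
  have p: "\<rho> ^ p = 1" "0 < k \<Longrightarrow> k < p \<Longrightarrow> \<rho> ^ k \<noteq> 1" for k
    using primitive by (auto simp: primitive_root_of_unity_def)
  show "scalar \<rho> ^ p = 1" using p(1) by (simp add: scalar_simps(3) flip: scalar_simps(6))
  show "0 < k \<Longrightarrow> k < p \<Longrightarrow> scalar \<rho> ^ k \<noteq> 1"
    using p(2)[of k] scalar_simps(4)[of "\<rho> ^ k" 1] by (simp add: scalar_simps(3,6))
  show "\<rho> \<noteq> 1" using p(2)[of 1] prime_gt_1_nat[OF prime] by simp
qed

lemma symbol_pair_rho:
  "symbol_pair (rho_field_set p \<rho>) (symbol_struct p \<rho>) (symbol_algebra p \<rho>) (symbol_x p \<rho>) (symbol_beta p \<rho>)
     (scalar \<rho>) var_a (rho_denom p \<rho>) p" (is ?pair)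
  and symbol_struct_inj: "inj_on (symbol_struct p \<rho>) (rho_field_set p \<rho>)" (is ?inj)
proof -
  interpret F: type_subring "rho_field_set p \<rho>" by (rule rho_field_subring)
  have elems: "scalar \<rho> \<in> rho_field_set p \<rho>" "var_a \<in> rho_field_set p \<rho>" "rho_denom p \<rho> \<in> rho_field_set p \<rho>"
    using rho_base_elements[where p = p and \<rho> = \<rho>] rho_base_subset[of p \<rho>] by auto
  have P: "periodic_functions (rho_field p \<rho>) p var_a (rho_denom p \<rho>)"
    unfolding rho_ring_eq
    by (intro periodic_functions.intro periodic_functions_axioms.intro F.type_ring_cring)
      (use elems prime_gt_0_nat[OF prime] in \<open>simp_all add: type_ring_simps\<close>)
  have q: "scalar \<rho> \<in> carrier (rho_field p \<rho>)" "scalar \<rho> [^]\<^bsub>rho_field p \<rho>\<^esub> p = \<one>\<^bsub>rho_field p \<rho>\<^esub>"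
    unfolding rho_ring_eq F.type_ring_pow by (simp_all add: elems type_ring_simps scalar_root)
  note rels = symbol_relations_def[of p \<rho>, unfolded Let_def, symmetric]
  note pres = periodic_functions.symbol_presentation[OF P q, unfolded rels]
  have struct: "(\<lambda>r. presented_class (rho_field p \<rho>) (symbol_relations p \<rho>) (free_const (rho_field p \<rho>) r)) = symbol_struct p \<rho>"
    by (simp add: symbol_struct_def fun_eq_iff)
  note pres' = pres[folded symbol_algebra_def symbol_x_def symbol_beta_def symbol_struct_def, unfolded struct]
  show ?pair
  proof (intro symbol_pair.intro symbol_pair_axioms.intro F.type_subring_axioms)
    show "central_algebra (type_ring (rho_field_set p \<rho>)) (symbol_struct p \<rho>) (symbol_algebra p \<rho>)"
      using pres'(1) by (simp only: rho_ring_eq)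
  qed (use pres'(2-6) elems prime scalar_root var_a_nonzero rho_field_inverse in simp_all)
  show ?inj
    using pres'(7) by (simp add: rho_ring_eq type_ring_simps)
qed

lemma ab_rho_weyl_algebra:
  "weyl_algebra (rho_base p \<rho>) (symbol_struct p \<rho>) (ab_rho_algebra p \<rho>) (scalar \<rho>) (symbol_x p \<rho>) (symbol_y p \<rho>)
     p var_a ((- 1) ^ Suc p * var_b) (rho_denom p \<rho>)"
proof -
  interpret B: symbol_pair "rho_field_set p \<rho>" "symbol_struct p \<rho>" "symbol_algebra p \<rho>" "symbol_x p \<rho>" "symbol_beta p \<rho>"
     "scalar \<rho>" var_a "rho_denom p \<rho>" p
    by (rule symbol_pair_rho)
  interpret R: type_subring "rho_base_set p \<rho>" by (rule rho_base_subring)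
  have q1: "scalar \<rho> - 1 = scalar (\<rho> - 1)" by (simp add: scalar_simps(2,3))
  have nz: "scalar (\<rho> - 1) \<noteq> 0" using scalar_root(3) by (simp add: scalar_simps(5))
  \<comment> \<open>Since \<open>rho_denom p \<rho>\<close> minus 1 is
    \<open>a b (\<rho> - 1)^p\<close>, the factor \<open>e^p\<close> and the inverse of
    \<open>a\<close> cancel, and only the sign remains in front of \<open>b\<close>.\<close>
  have b: "B.b = (- 1) ^ Suc p * var_b"
    using nz var_a_nonzero unfolding B.b_def B.e_def q1 unfolding rho_denom_def by (simp add: field_simps)
  have order: "symbol_order (rho_field_set p \<rho>) (symbol_struct p \<rho>) (symbol_algebra p \<rho>) (symbol_x p \<rho>) (symbol_beta p \<rho>)
     (scalar \<rho>) var_a (rho_denom p \<rho>) p (rho_base_set p \<rho>)"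
  proof (intro symbol_order.intro symbol_order_axioms.intro symbol_pair_rho rho_base_subring rho_base_subset
      rho_base_elements rho_denom_nonzero symbol_struct_inj)
    show "B.b \<in> rho_base_set p \<rho>"
      unfolding b by (intro R.mult_in R.pow_in R.uminus_in R.one_in rho_base_elements)
  qed
  have alpha: "symbol_alpha p \<rho> = B.\<alpha>"
    by (simp add: symbol_alpha_def Let_def B.\<alpha>_def B.e_def q1 inverse_eq_divide)
  have "inv\<^bsub>symbol_algebra p \<rho>\<^esub> (symbol_x p \<rho>) = B.x_inv"
    by (rule B.A.inv_char) (simp_all add: B.x_inv)
  then have y: "symbol_y p \<rho> = B.y"
    by (simp add: symbol_y_def Let_def alpha B.y_def)
  have "ab_rho_algebra p \<rho> = (symbol_algebra p \<rho>)\<lparr>carrier := symbol_order.order (symbol_struct p \<rho>) (symbol_algebra p \<rho>) (symbol_x p \<rho>) (symbol_beta p \<rho>) (scalar \<rho>) var_a p (rho_base_set p \<rho>)\<rparr>"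
    unfolding symbol_order.order_def[OF order] ab_rho_algebra_def Let_def y ..
  then show ?thesis
    using symbol_order.order_weyl_algebra[OF order] unfolding b rho_ring_eq y by simp
qed

end

theorem lemma9p9:
  fixes p :: nat
    and R :: "('r, 'm) ring_scheme" and a b :: 'r
    and \<rho> :: complex
  assumes p: "Factorial_Ring.prime p"
  shows
    "(cring R \<and> [p] \<cdot>\<^bsub>R\<^esub> \<one>\<^bsub>R\<^esub> = \<zero>\<^bsub>R\<^esub> \<and> a \<in> carrier R \<and> b \<in> carrier R \<longrightarrow>
       (let A = ab_algebra p R a b; \<iota> = ab_struct p R a b;
            u = ab_x p R a b \<otimes>\<^bsub>A\<^esub> ab_y p R a b
        in (\<exists>\<sigma>. \<sigma> u = u \<oplus>\<^bsub>A\<^esub> \<one>\<^bsub>A\<^esub> \<and> almost_cyclic R \<iota> A (adjoin R \<iota> A u) \<sigma> p) \<and>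
           azumaya R \<iota> A)) \<and>
     (primitive_root_of_unity p \<rho> \<longrightarrow>
       (let R\<^sub>\<rho> = rho_base p \<rho>; A = ab_rho_algebra p \<rho>; \<iota> = symbol_struct p \<rho>;
            u = symbol_x p \<rho> \<otimes>\<^bsub>A\<^esub> symbol_y p \<rho>
        in (\<exists>\<sigma>. \<sigma> u = \<iota> (scalar \<rho>) \<otimes>\<^bsub>A\<^esub> u \<oplus>\<^bsub>A\<^esub> \<one>\<^bsub>A\<^esub> \<and>
                almost_cyclic R\<^sub>\<rho> \<iota> A (adjoin R\<^sub>\<rho> \<iota> A u) \<sigma> p) \<and>
           azumaya R\<^sub>\<rho> \<iota> A))"
proof (intro conjI impI)
  assume "cring R \<and> [p] \<cdot>\<^bsub>R\<^esub> \<one>\<^bsub>R\<^esub> = \<zero>\<^bsub>R\<^esub> \<and> a \<in> carrier R \<and> b \<in> carrier R"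
  then have "characteristic_p R p a b"
    using p by (simp add: characteristic_p_def characteristic_p_axioms_def)
  note weyl_alg = characteristic_p.ab_weyl_algebra[OF this]
  let ?A = "ab_algebra p R a b" and ?\<iota> = "ab_struct p R a b"
  let ?u = "ab_x p R a b \<otimes>\<^bsub>?A\<^esub> ab_y p R a b"
  interpret weyl_algebra R ?\<iota> ?A "\<one>\<^bsub>R\<^esub>" "ab_x p R a b" "ab_y p R a b" p a b "\<one>\<^bsub>R\<^esub>" by (rule weyl_alg)
  \<comment> \<open>At \<open>q = 1\<close> the general formula \<open>q u + 1\<close> for the image
    of \<open>u\<close> becomes \<open>u + 1\<close>.\<close>
  have "?\<iota> \<one>\<^bsub>R\<^esub> \<otimes>\<^bsub>?A\<^esub> ?u = ?u" by (simp add: struct_one)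
  then show "let A = ab_algebra p R a b; \<iota> = ab_struct p R a b;
            u = ab_x p R a b \<otimes>\<^bsub>A\<^esub> ab_y p R a b
        in (\<exists>\<sigma>. \<sigma> u = u \<oplus>\<^bsub>A\<^esub> \<one>\<^bsub>A\<^esub> \<and> almost_cyclic R \<iota> A (adjoin R \<iota> A u) \<sigma> p) \<and>
           azumaya R \<iota> A"
    unfolding Let_def using weyl_algebra_almost_cyclic[OF weyl_alg] azumaya by simp
next
  assume "primitive_root_of_unity p \<rho>"
  then have "primitive_root p \<rho>" using p by (simp add: primitive_root_def)
  note weyl_alg = primitive_root.ab_rho_weyl_algebra[OF this]
  interpret weyl_algebra "rho_base p \<rho>" "symbol_struct p \<rho>" "ab_rho_algebra p \<rho>" "scalar \<rho>" "symbol_x p \<rho>" "symbol_y p \<rho>"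
     p var_a "(- 1) ^ Suc p * var_b" "rho_denom p \<rho>" by (rule weyl_alg)
  show "let R\<^sub>\<rho> = rho_base p \<rho>; A = ab_rho_algebra p \<rho>; \<iota> = symbol_struct p \<rho>;
            u = symbol_x p \<rho> \<otimes>\<^bsub>A\<^esub> symbol_y p \<rho>
        in (\<exists>\<sigma>. \<sigma> u = \<iota> (scalar \<rho>) \<otimes>\<^bsub>A\<^esub> u \<oplus>\<^bsub>A\<^esub> \<one>\<^bsub>A\<^esub> \<and>
                almost_cyclic R\<^sub>\<rho> \<iota> A (adjoin R\<^sub>\<rho> \<iota> A u) \<sigma> p) \<and>
           azumaya R\<^sub>\<rho> \<iota> A"
    unfolding Let_def using weyl_algebra_almost_cyclic[OF weyl_alg] azumaya by blast
qed

end
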